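(* Let $0<\alpha<\beta$ with $\alpha,\beta\notin\mathbb{Z}$, and let $f$ be analytic inside a closed contour strictly containing $[\alpha,\beta]$. Let $\chi$ be an odd primitive Dirichlet character modulo $q$, and let $\nu\in\mathbb{C}$ with $0<\Re(\nu)<\frac12$. Then \begin{align*} & \frac{ q^{1-\frac{\nu}{2}} } {\tau(\chi )} \sum_{\alpha<j <\beta} \frac{\bar{\sigma}_{-\nu, \chi }(j)}{j} f(j) = \frac{ q^{1-\frac{\nu}{2}}}{\tau(\chi)} L(1-\nu,\chi) \int_\alpha^\beta \frac{f(t) }{t^{\nu+1}} \,dt-2\pi i \sum_{n=1}^{\infty}\sigma_{-\nu, \bar{\chi }}(n)\, n^{\nu/2} \int_{\alpha} ^{ \beta }f(t) t^{-\frac{\nu}{2}-1} \\ & \times \left\{ \left( \frac{2}{\pi} K_{\nu}\left(4\pi \sqrt{\tfrac{nt}{q}} \right) - Y_{\nu}\left(4\pi \sqrt{\tfrac{nt}{q}} \right) \right) \sin \left(\frac{\pi \nu}{2}\right) + J_{\nu}\left(4\pi \sqrt{\tfrac{nt}{q}} \right) \cos \left(\frac{\pi \nu}{2}\right) \right\} dt, \end{align*} where the sum on the left is over integers $j$.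
   Context: For a Dirichlet character $\chi$ and $z\in\mathbb{C}$: $\sigma_{z,\chi}(n)=\sum_{d\mid n}d^z\chi(d)$ and $\bar{\sigma}_{z,\chi}(n)=\sum_{d\mid n}d^z\chi(n/d)$. $\tau(\chi)=\sum_{h=1}^q\chi(h)e^{2\pi i h/q}$ is the Gauss sum, $L(s,\chi)$ the Dirichlet $L$-function. $J_\nu$, $Y_\nu$ are the Bessel functions of the first and second kind and $K_\nu$ the modified Bessel function of the second kind. *)

theory Defs
  imports "HOL-Analysis.Analysis" "HOL-Number_Theory.Number_Theory"
begin

definition dirichlet_char :: "nat \<Rightarrow> (nat \<Rightarrow> complex) \<Rightarrow> bool" where
  "dirichlet_char q chi \<longleftrightarrow> q > 0 \<and> (\<forall>n. chi (n + q) = chi n) \<and>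
     (\<forall>m n. chi (m * n) = chi m * chi n) \<and> chi 1 = 1 \<and>
     (\<forall>n. chi n \<noteq> 0 \<longleftrightarrow> coprime n q)"

text \<open>Primitive: not induced by a character of any proper divisor modulus.\<close>
definition primitive_dirichlet_char :: "nat \<Rightarrow> (nat \<Rightarrow> complex) \<Rightarrow> bool" where
  "primitive_dirichlet_char q chi \<longleftrightarrow> dirichlet_char q chi \<and>
     (\<forall>d. d dvd q \<and> d < q \<longrightarrow> (\<exists>a. [a = 1] (mod d) \<and> coprime a q \<and> chi a \<noteq> 1))"

text \<open>Odd: chi(-1) = -1, i.e. chi(q-1) = -1.\<close>
definition odd_char :: "nat \<Rightarrow> (nat \<Rightarrow> complex) \<Rightarrow> bool" where
  "odd_char q chi \<longleftrightarrow> chi (q - 1) = -1"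

definition gauss_sum :: "nat \<Rightarrow> (nat \<Rightarrow> complex) \<Rightarrow> complex" where
  "gauss_sum q chi = (\<Sum>h=1..q. chi h * exp (2 * of_real pi * \<i> * of_nat h / of_nat q))"

text \<open>Dirichlet L-function, as the (conditionally convergent for nonprincipal chi,
  Re s > 0) Dirichlet series.\<close>
definition dirichlet_L :: "(nat \<Rightarrow> complex) \<Rightarrow> complex \<Rightarrow> complex" where
  "dirichlet_L chi s = (\<Sum>n. chi (Suc n) / of_nat (Suc n) powr s)"

definition sigma_char :: "complex \<Rightarrow> (nat \<Rightarrow> complex) \<Rightarrow> nat \<Rightarrow> complex" where
  "sigma_char z chi n = (\<Sum>d | d dvd n. of_nat d powr z * chi d)"

definition sigma_bar_char :: "complex \<Rightarrow> (nat \<Rightarrow> complex) \<Rightarrow> nat \<Rightarrow> complex" where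
  "sigma_bar_char z chi n = (\<Sum>d | d dvd n. of_nat d powr z * chi (n div d))"

definition bessel_J :: "complex \<Rightarrow> real \<Rightarrow> complex" where
  "bessel_J \<nu> x = (\<Sum>k. (-1) ^ k * rGamma (of_nat k + \<nu> + 1) / of_nat (fact k)
       * of_real (x / 2) powr \<nu> * of_real (x / 2) ^ (2 * k))"

definition bessel_I :: "complex \<Rightarrow> real \<Rightarrow> complex" where
  "bessel_I \<nu> x = (\<Sum>k. rGamma (of_nat k + \<nu> + 1) / of_nat (fact k)
       * of_real (x / 2) powr \<nu> * of_real (x / 2) ^ (2 * k))"

definition bessel_Y_aux :: "complex \<Rightarrow> real \<Rightarrow> complex" where
  "bessel_Y_aux \<nu> x = (bessel_J \<nu> x * cos (\<nu> * pi) - bessel_J (-\<nu>) x) / sin (\<nu> * pi)"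

definition bessel_K_aux :: "complex \<Rightarrow> real \<Rightarrow> complex" where
  "bessel_K_aux \<nu> x = of_real pi / 2 * (bessel_I (-\<nu>) x - bessel_I \<nu> x) / sin (\<nu> * pi)"

definition bessel_Y :: "complex \<Rightarrow> real \<Rightarrow> complex" where
  "bessel_Y \<nu> x = (if \<nu> \<in> \<int> then Lim (at \<nu>) (\<lambda>\<mu>. bessel_Y_aux \<mu> x) else bessel_Y_aux \<nu> x)"

definition bessel_K :: "complex \<Rightarrow> real \<Rightarrow> complex" where
  "bessel_K \<nu> x = (if \<nu> \<in> \<int> then Lim (at \<nu>) (\<lambda>\<mu>. bessel_K_aux \<mu> x) else bessel_K_aux \<nu> x)"

end

theory Submission
  imports Defs "HOL-Complex_Analysis.Complex_Analysis" "HOL-Probability.Probability" "HOL-Real_Asymp.Real_Asymp"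
begin

text \<open>For a smooth test function \<open>\<phi>\<close> supported in \<open>(0, \<infinity>)\<close>, the sum of \<open>\<phi>(d m) m\<^sup>\<nu> \<chi>(m)\<close> over
  \<open>d, m\<close> is transformed by Poisson summation in \<open>d\<close> and by twisted Poisson summation in \<open>m\<close>; the
  resulting kernel \<open>\<integral> w\<^bsup>\<nu>-1\<^esup> exp (-a w - c / w) dw\<close> is identified with a combination of Bessel
  functions through a Wronskian argument. This gives the formula for smooth test functions, with an
  absolutely convergent dual series.

  To pass to the indicator of \<open>[\<alpha>, \<beta>]\<close>, put \<open>s = sqrt t\<close> and cut off with the window
  \<open>(Si (\<Lambda> (s - s1)) - Si (\<Lambda> (s - s2))) / \<pi>\<close>, whose frequencies are at most \<open>\<Lambda>\<close>. By the asymptotic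
  expansion of the kernel, the \<open>n\<close>-th dual term oscillates with frequency \<open>x = 4 \<pi> sqrt (n / q)\<close> in \<open>s\<close>,
  so windowing leaves it essentially unchanged if \<open>x \<le> \<Lambda>\<close> and essentially kills it otherwise, up
  to an error \<open>O(x\<^bsup>-1/2\<^esup> max(x, \<Lambda>)\<^bsup>-1\<^esup> (1 + |x - \<Lambda>|)\<^bsup>-2\<^esup>)\<close>. Since the divisor sums over
  blocks \<open>j \<le> x < j + 1\<close> are \<open>O(j)\<close>, these errors add up to \<open>O(\<Lambda>\<^bsup>Re \<nu> - 1/2\<^esup>)\<close>, which tends to 0
  exactly because \<open>Re \<nu> < 1/2\<close>. With \<open>\<Lambda>\<close> equal to the frequency of the \<open>N\<close>-th term, the windowed
  dual series therefore approximates the \<open>N\<close>-th partial sum of the sharp one.\<close>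

text \<open>The sharp cut-off is the main obstacle. Integrating the \<open>n\<close>-th dual term
  over a sharp interval gains only one power of its frequency \<open>x\<close>, so that block sums
  are merely O(j powr (Re nu - 1/2)) and sizes alone give no convergence; it comes from comparison
  with the windowed series, whose sum is known. The kernel is expanded to two terms for the same
  reason: the remainder x powr (- 5/2) leaves blocks O(j powr (Re nu - 3/2)), summable exactly
  because Re nu < 1/2, while a one-term expansion would fail. The variable s = sqrt t makes the
  phase of the kernel linear. For smooth test functions the obstacle is that a Poisson mode x powr
  (nu - 1) * P0 (k / x) decays too slowly at infinity to be summed or integrated. A factor exp (-
  eps x) is inserted, and second derivatives are bounded uniformly in eps; this yields the majorant
  k powr (Re nu - 2) / l^2 of the dual terms before the kernel is known. Seven derivatives of the
  test function are used: the second derivative of a mode carries at worst x powr (-5) at 0, and x^2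
  must remain.\<close>

lemma tannery:
 fixes a :: "nat => 'b => 'a :: {real_normed_algebra, banach}"
 assumes "!!k. ((%n. a k n) \<longlongrightarrow> b k) F" "!!k n. norm (a k n) <= M k" "summable M" "F ~= bot"
 shows "((%n. suminf (%k. a k n)) \<longlongrightarrow> suminf b) F"
 using tannerys_theorem[of a b F M] assms by (auto intro!: always_eventually)

lemma summable_inverse_Suc_squares: "summable (%n. 1 / (real (Suc n))^2)"
 using inverse_squares_sums by (simp add: sums_iff add.commute)

section \<open>The second periodic Bernoulli polynomial as a cosine series\<close>

text \<open>This is pi^2 times the periodic Bernoulli polynomial of degree two, the kernel that two
  integrations by parts leave in Euler-Maclaurin summation. Its absolute convergence allows termwise
  expansion under integrals.\<close>

definition cos_series :: "real => real" where
 "cos_series x = (\<Sum>n. cos (2 * pi * real (Suc n) * x) / (real (Suc n))^2)"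

lemma summable_cos_series: "summable (%n. cos (2 * pi * real (Suc n) * x) / (real (Suc n))^2)"
 by (rule summable_comparison_test'[OF summable_inverse_Suc_squares, of 0])
  (auto simp: divide_simps)

lemma continuous_on_cos_series: "continuous_on UNIV cos_series"
proof -
 have "uniform_limit UNIV (%N x. \<Sum>n<N. cos (2 * pi * real (Suc n) * x) / (real (Suc n))^2)
     (%x. \<Sum>n. cos (2 * pi * real (Suc n) * x) / (real (Suc n))^2) sequentially"
  by (rule Weierstrass_m_test[OF _ summable_inverse_Suc_squares]) (auto simp: divide_simps)
 hence "uniform_limit UNIV (%N x. \<Sum>n<N. cos (2 * pi * real (Suc n) * x) / (real (Suc n))^2)
     cos_series sequentially"
  by (simp add: cos_series_def[abs_def])
 thus ?thesis
  by (rule uniform_limit_theorem[rotated]) (auto intro!: always_eventually continuous_intros)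
qed

lemma cos_series_0: "cos_series 0 = pi^2 / 6"
 using inverse_squares_sums by (simp add: cos_series_def sums_iff add.commute)

lemma abs_cos_series_le: "\<bar>cos_series x\<bar> <= pi^2 / 6"
proof -
 have s: "summable (%n. \<bar>cos (2 * pi * real (Suc n) * x) / (real (Suc n))^2\<bar>)"
  by (rule summable_comparison_test'[OF summable_inverse_Suc_squares, of 0])
   (auto simp: divide_simps)
 have "\<bar>cos_series x\<bar> <= (\<Sum>n. \<bar>cos (2 * pi * real (Suc n) * x) / (real (Suc n))^2\<bar>)"
  unfolding cos_series_def using s by (rule summable_rabs)
 also have "... <= (\<Sum>n. 1 / (real (Suc n))^2)"
  by (rule suminf_le[OF _ s summable_inverse_Suc_squares]) (auto simp: divide_simps)
 also have "... = pi^2 / 6"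
  using inverse_squares_sums by (simp add: sums_iff add.commute)
 finally show ?thesis .
qed

lemma cos_series_periodic: "cos_series (x + of_int m) = cos_series x"
proof -
 have "cos (2 * pi * real (Suc n) * (x + of_int m)) = cos (2 * pi * real (Suc n) * x)" for n
 proof -
  have "2 * pi * real (Suc n) * (x + of_int m)
    = 2 * pi * real (Suc n) * x + 2 * pi * of_int (int (Suc n) * m)"
   by (simp add: algebra_simps)
  thus ?thesis
   by (simp add: cos_add sin_int_2pin cos_int_2pin del: of_int_mult)
 qed
 thus ?thesis by (simp add: cos_series_def)
qed

text \<open>The half-angle factorisation has modulus 2 sin (pi y) and argument pi y - pi / 2, and
  that argument already lies in the principal range.\<close>

lemma Im_Ln_one_minus_unit:
 assumes "0 < y" "y < 1"
 shows "Im (Ln (1 - exp (2 * of_real pi * \<i> * of_real y))) = pi * (y - 1/2)"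
proof -
 define t where "t = pi * y"
 have t: "0 < t" "t < pi" using assms by (auto simp: t_def)
 have sp: "sin t > 0" using t by (rule sin_gt_zero)
 have "1 - exp (2 * of_real pi * \<i> * of_real y) = 1 - cis (2 * t)"
  by (simp add: cis_conv_exp t_def mult_ac)
 also have "... = rcis (2 * sin t) (t - pi/2)"
  by (simp add: complex_eq_iff rcis_def cos_diff sin_diff cos_double_sin sin_double power2_eq_square)
 finally have eq: "1 - exp (2 * of_real pi * \<i> * of_real y) = rcis (2 * sin t) (t - pi/2)" .
 have "Arg (rcis (2 * sin t) (t - pi/2)) = t - pi/2"
  by (rule Arg_unique'[of "2 * sin t"]) (use t sp in auto)
 moreover have "rcis (2 * sin t) (t - pi/2) ~= 0" using sp by simp
 ultimately show ?thesis
  unfolding eq by (simp add: Arg_eq_Im_Ln t_def algebra_simps)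
qed

lemma Im_Ln_one_minus_bound:
 assumes "norm z < 1"
 shows "\<bar>Im (Ln (1 - z))\<bar> <= pi"
proof -
 have "z ~= 1" using assms by auto
 thus ?thesis using mpi_less_Im_Ln[of "1 - z"] Im_Ln_le_pi[of "1 - z"] by auto
qed

text \<open>The differentiated series converges only conditionally, so the differentiation is done
  for the dilogarithm \<open>Li\<close> on circles of radius r < 1, where the derivative along the
  circle is - 2 pi i Ln (1 - z). Then r tends to 1: the imaginary part of Ln is bounded by pi, so
  the integrals converge dominatedly, and the series themselves converge by \<open>tannery\<close>.
  Positive \<open>a\<close> avoids the singular point z = 1.\<close>

lemma cos_series_eq_aux:
 assumes "0 < a" "a <= 1/2" "b = 1/2"
 shows "cos_series b - cos_series a = - pi\<^sup>2 * (a - 1/2)^2"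
proof -
 define c where "c = (%n. if n = 0 then 0 else 1 / (of_nat n)^2 :: complex)"
 define Li where "Li = (%z. \<Sum>n. c n * z ^ n)"
 have nc: "norm (c n) = (if n = 0 then 0 else 1 / (real n)^2)" for n
  by (simp add: c_def norm_divide norm_power)
 have sumc: "summable (%n. norm (c n))"
  by (subst summable_Suc_iff[symmetric])
   (use summable_inverse_Suc_squares in \<open>simp add: nc\<close>)
 have dLi: "(Li has_field_derivative (\<Sum>n. diffs c n * z ^ n)) (at z)" if "norm z < 1" for z
  unfolding Li_def
  by (rule termdiffs_strong[where K = 1]) (use that sumc summable_norm_cancel in auto)
 have dLi': "z * (\<Sum>n. diffs c n * z ^ n) = - Ln (1 - z)" if "norm z < 1" for z
 proof -
  have "(%n. - ((-(-z))^n) / of_nat n) sums ln (1 + - z)"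
   using that by (intro Ln_series') auto
  hence "(%n. - (z ^ n) / of_nat n) sums ln (1 - z)" by simp
  hence "(%n. - (z ^ Suc n) / of_nat (Suc n)) sums ln (1 - z)"
   by (subst sums_Suc_iff) simp
  hence 1: "(%n. (z ^ Suc n) / of_nat (Suc n)) sums - ln (1 - z)"
   using sums_minus by fastforce
  have "(%n. z * (diffs c n * z ^ n)) = (%n. (z ^ Suc n) / of_nat (Suc n))"
   by (simp add: diffs_def c_def power2_eq_square field_simps fun_eq_iff del: of_nat_Suc)
  moreover have "summable (%n. diffs c n * z ^ n)"
   by (rule termdiff_converges[where K = 1])
    (use that in \<open>auto intro!: summable_norm_cancel[OF summable_comparison_test'[OF sumc, of 0]]
     simp: norm_mult norm_power intro!: mult_left_le power_le_one\<close>)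
  ultimately show ?thesis
   using 1 by (simp add: suminf_mult[symmetric] sums_iff)
 qed
 define e where "e = (%y::real. exp (2 * of_real pi * \<i> * of_real y))"
 have ne: "norm (e y) = 1" for y by (simp add: e_def)
 have Li_Re: "Re (Li (of_real r * e y)) = (\<Sum>n. r ^ Suc n * (cos (2 * pi * real (Suc n) * y) / (real (Suc n))^2))"
  if "0 <= r" "r <= 1" for r y
 proof -
  have sm: "summable (%n. c n * (of_real r * e y) ^ n)"
   by (rule summable_norm_cancel[OF summable_comparison_test'[OF sumc, of 0]])
    (use that in \<open>auto simp: norm_mult norm_power ne intro!: mult_left_le power_le_one\<close>)
  have "Re (Li (of_real r * e y)) = (\<Sum>n. Re (c n * (of_real r * e y) ^ n))"
   unfolding Li_def by (rule Re_suminf[OF sm])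
  also have "... = (\<Sum>n. Re (c (Suc n) * (of_real r * e y) ^ Suc n))"
   using suminf_split_head[OF summable_Re[OF sm]] by (simp add: c_def del: power_Suc)
  also have "... = (\<Sum>n. r ^ Suc n * (cos (2 * pi * real (Suc n) * y) / (real (Suc n))^2))"
  proof (intro suminf_cong)
   fix n
   have "e y ^ Suc n = cis (2 * pi * real (Suc n) * y)"
    by (simp add: e_def exp_of_nat_mult[symmetric] cis_conv_exp mult_ac del: power_Suc of_nat_Suc)
   hence "c (Suc n) * (of_real r * e y) ^ Suc n =
       of_real (r ^ Suc n / (real (Suc n))^2) * cis (2 * pi * real (Suc n) * y)"
    by (simp add: c_def power_mult_distrib del: power_Suc of_nat_Suc)
   thus "Re (c (Suc n) * (of_real r * e y) ^ Suc n) =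
      r ^ Suc n * (cos (2 * pi * real (Suc n) * y) / (real (Suc n))^2)"
    by (simp del: power_Suc of_nat_Suc)
  qed
  finally show ?thesis .
 qed
 define \<rho> where "\<rho> = (%n::nat. 1 - 1 / real (Suc n))"
 have rho: "0 <= \<rho> n" "\<rho> n < 1" for n by (auto simp: \<rho>_def)
 have rlim: "\<rho> \<longlonglongrightarrow> 1"
  unfolding \<rho>_def using tendsto_diff[OF tendsto_const[of 1] LIMSEQ_inverse_real_of_nat]
  by (simp add: divide_inverse)
 have Hint: "((%y. 2 * pi * Im (Ln (1 - of_real r * e y))) has_integral
     Re (Li (of_real r * e b)) - Re (Li (of_real r * e a))) {a..b}" if "0 <= r" "r < 1" for r
 proof (rule fundamental_theorem_of_calculus)
  show "a <= b" using assms by simp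
  fix y assume "y \<in> {a..b}"
  have n1: "norm (of_real r * e y) < 1" using that by (simp add: norm_mult ne)
  have de: "((%y. of_real r * e y) has_vector_derivative (2 * of_real pi * \<i>) * (of_real r * e y)) (at y within {a..b})"
   unfolding e_def by (auto intro!: derivative_eq_intros has_vector_derivative_real_field simp: algebra_simps)
  have "((Li \<circ> (%y. of_real r * e y)) has_vector_derivative
      ((2 * of_real pi * \<i>) * (of_real r * e y)) * (\<Sum>n. diffs c n * (of_real r * e y) ^ n)) (at y within {a..b})"
   by (rule field_vector_diff_chain_within[OF de]) (rule has_field_derivative_at_within[OF dLi[OF n1]])
  moreover have "((2 * of_real pi * \<i>) * (of_real r * e y)) * (\<Sum>n. diffs c n * (of_real r * e y) ^ n)
   = - (2 * of_real pi * \<i>) * Ln (1 - of_real r * e y)"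
   using dLi'[OF n1] by (simp add: mult.assoc)
  ultimately have "((%y. Li (of_real r * e y)) has_vector_derivative
      - (2 * of_real pi * \<i>) * Ln (1 - of_real r * e y)) (at y within {a..b})"
   by (simp only: o_def)
  hence "((%y. Re (Li (of_real r * e y))) has_vector_derivative
      Re (- (2 * of_real pi * \<i>) * Ln (1 - of_real r * e y))) (at y within {a..b})"
   by (rule bounded_linear.has_vector_derivative[OF bounded_linear_Re])
  thus "((%y. Re (Li (of_real r * e y))) has_vector_derivative
      2 * pi * Im (Ln (1 - of_real r * e y))) (at y within {a..b})"
   by simp
 qed
 have "(%n. integral {a..b} (%y. 2 * pi * Im (Ln (1 - of_real (\<rho> n) * e y))))
     \<longlonglongrightarrow> integral {a..b} (%y. 2 * pi * (pi * (y - 1/2)))"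
 proof (rule dominated_convergence(2))
  show "(%y. 2 * pi * Im (Ln (1 - of_real (\<rho> n) * e y))) integrable_on {a..b}" for n
   using Hint[OF rho] by (auto simp: integrable_on_def)
  show "(%y. 2 * pi * pi) integrable_on {a..b}" by (intro integrable_continuous_real continuous_intros)
  show "norm (2 * pi * Im (Ln (1 - of_real (\<rho> n) * e y))) <= 2 * pi * pi" for n y
   using Im_Ln_one_minus_bound[of "of_real (\<rho> n) * e y"] rho[of n]
   by (simp add: norm_mult ne abs_mult)
  show "(%n. 2 * pi * Im (Ln (1 - of_real (\<rho> n) * e y))) \<longlonglongrightarrow> 2 * pi * (pi * (y - 1/2))"
   if y: "y \<in> {a..b}" for y
  proof -
   have y01: "0 < y" "y < 1" using y assms by auto
   \<comment> \<open>Away from z = 1 the limit point is off the cut of Ln, so that Ln passes to the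
     limit; its value there is \<open>Im_Ln_one_minus_unit\<close>.\<close>
   have "1 - e y \<notin> \<real>\<^sub>\<le>\<^sub>0"
   proof
    assume "1 - e y \<in> \<real>\<^sub>\<le>\<^sub>0"
    hence r: "Re (1 - e y) <= 0" "Im (1 - e y) = 0" by (auto simp: complex_nonpos_Reals_iff)
    have "Re (1 - e y) = 1 - cos (2 * pi * y)"
     by (simp add: e_def Re_exp)
    hence "cos (2 * (pi * y)) = 1" using r(1) cos_le_one[of "2 * (pi * y)"] by (simp add: mult.assoc)
    hence "sin (pi * y) = 0" by (simp add: cos_double_sin)
    moreover have "sin (pi * y) > 0" using y01 by (intro sin_gt_zero) auto
    ultimately show False by simp
   qed
   hence "(%n. Ln (1 - of_real (\<rho> n) * e y)) \<longlonglongrightarrow> Ln (1 - of_real 1 * e y)"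
    by (intro tendsto_intros tendsto_Ln rlim) auto
   hence "(%n. 2 * pi * Im (Ln (1 - of_real (\<rho> n) * e y))) \<longlonglongrightarrow> 2 * pi * Im (Ln (1 - of_real 1 * e y))"
    by (intro tendsto_mult tendsto_const tendsto_Im)
   thus ?thesis using Im_Ln_one_minus_unit[OF y01] by (simp add: e_def)
  qed
 qed
 moreover have "integral {a..b} (%y. 2 * pi * Im (Ln (1 - of_real (\<rho> n) * e y)))
  = Re (Li (of_real (\<rho> n) * e b)) - Re (Li (of_real (\<rho> n) * e a))" for n
  using Hint[OF rho] by (rule integral_unique)
 moreover have "(%n. Re (Li (of_real (\<rho> n) * e y))) \<longlonglongrightarrow> cos_series y" for y
 proof -
  have "((%n. \<Sum>k. \<rho> n ^ Suc k * (cos (2 * pi * real (Suc k) * y) / (real (Suc k))^2))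
    \<longlongrightarrow> (\<Sum>k. 1 ^ Suc k * (cos (2 * pi * real (Suc k) * y) / (real (Suc k))^2))) sequentially"
  proof (rule tannery[where M = "%k. 1 / (real (Suc k))^2"])
   show "((%n. \<rho> n ^ Suc k * (cos (2 * pi * real (Suc k) * y) / (real (Suc k))^2))
    \<longlongrightarrow> 1 ^ Suc k * (cos (2 * pi * real (Suc k) * y) / (real (Suc k))^2)) sequentially" for k
    by (intro tendsto_intros rlim)
   have "\<bar>\<rho> n ^ Suc k * (cos (2 * pi * real (Suc k) * y) / (real (Suc k))^2)\<bar> <= 1 / (real (Suc k))^2" for k n
   proof -
    have "\<bar>\<rho> n ^ Suc k\<bar> <= 1" using rho[of n] by (simp add: power_le_one del: power_Suc)
    moreover have "\<bar>cos (2 * pi * real (Suc k) * y) / (real (Suc k))^2\<bar> <= 1 / (real (Suc k))^2"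
     by (auto simp: divide_simps)
    ultimately show ?thesis
     unfolding abs_mult using mult_mono[of "\<bar>\<rho> n ^ Suc k\<bar>" 1] by force
   qed
   thus "norm (\<rho> n ^ Suc k * (cos (2 * pi * real (Suc k) * y) / (real (Suc k))^2)) <= 1 / (real (Suc k))^2" for k n
    unfolding real_norm_def .
  qed (use summable_inverse_Suc_squares in auto)
  thus ?thesis using rho by (simp add: Li_Re less_imp_le cos_series_def)
 qed
 ultimately have "cos_series b - cos_series a = integral {a..b} (%y. 2 * pi * (pi * (y - 1/2)))"
  by (intro LIMSEQ_unique[OF _ \<open>(%n. integral {a..b} _) \<longlonglongrightarrow> _\<close>]) (auto intro!: tendsto_intros)
 also have "... = pi^2 * (b - 1/2)^2 - pi\<^sup>2 * (a - 1/2)^2"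
  by (intro integral_unique fundamental_theorem_of_calculus)
   (use assms in \<open>auto intro!: derivative_eq_intros
     simp flip: has_real_derivative_iff_has_vector_derivative simp: power2_eq_square algebra_simps\<close>)
 finally show ?thesis unfolding assms(3) by simp
qed

text \<open>The differences in \<open>cos_series_eq_aux\<close> fix the function up to a constant,
  which Euler's value pi^2 / 6 at 0 determines when the left endpoint tends to 0. The half beyond
  1/2 follows from evenness and period one.\<close>

lemma cos_series_eq:
 assumes "0 <= x" "x <= 1"
 shows "cos_series x = pi^2 * (x^2 - x + 1/6)"
proof -
 have lim: "((%a. cos_series (1/2) - cos_series a) \<longlongrightarrow> cos_series (1/2) - cos_series 0) (at_right 0)"
 proof -
  have "isCont cos_series 0"
   using continuous_on_cos_series by (simp add: continuous_on_eq_continuous_at)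
  hence "(cos_series \<longlongrightarrow> cos_series 0) (at_right 0)"
   unfolding isCont_def by (rule tendsto_within_subset) simp
  thus ?thesis by (intro tendsto_diff tendsto_const)
 qed
 have "((%a. - pi\<^sup>2 * (a - 1/2)^2) \<longlongrightarrow> - pi\<^sup>2 * (0 - 1/2)^2) (at_right 0)"
  by (intro tendsto_intros)
 moreover have "\<forall>\<^sub>F a in at_right 0. - pi\<^sup>2 * (a - 1/2)^2 = cos_series (1/2) - cos_series a"
  unfolding eventually_at_right_field
 proof (intro exI[of _ "1/2"] conjI allI impI)
  fix y :: real assume "0 < y" "y < 1/2"
  thus "- pi\<^sup>2 * (y - 1/2)^2 = cos_series (1/2) - cos_series y"
   by (intro cos_series_eq_aux[symmetric]) auto
 qed auto
 ultimately have "((%a. cos_series (1/2) - cos_series a) \<longlongrightarrow> - pi\<^sup>2 * (0 - 1/2)^2) (at_right 0)"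
  by (rule Lim_transform_eventually)
 with lim have "cos_series (1/2) - cos_series 0 = - pi\<^sup>2 * (0 - 1/2)^2"
  by (intro tendsto_unique[of "at_right (0::real)"]) (auto simp: trivial_limit_at_right_real)
 hence h: "cos_series (1/2) = - pi\<^sup>2 / 12"
  by (simp add: cos_series_0 power2_eq_square field_simps)
 have main: "cos_series y = pi^2 * (y^2 - y + 1/6)" if "0 <= y" "y <= 1/2" for y
 proof (cases "y = 0")
  case True thus ?thesis by (simp add: cos_series_0)
 next
  case False
  thus ?thesis using cos_series_eq_aux[of y "1/2"] that h
   by (simp add: power2_eq_square field_simps)
 qed
 show ?thesis
 proof (cases "x <= 1/2")
  case True thus ?thesis using main assms by simp
 next
  case False
  have "cos_series x = cos_series (- x)" by (simp add: cos_series_def)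
  also have "... = cos_series (1 - x)" using cos_series_periodic[of "-x" 1] by simp
  also have "... = pi^2 * ((1-x)^2 - (1-x) + 1/6)" using False assms by (intro main) auto
  finally show ?thesis by (simp add: power2_eq_square algebra_simps)
 qed
qed

section \<open>Odd primitive characters and their Gauss sums\<close>

definition unit_exp :: "nat => nat => complex" where
 "unit_exp q n = exp (2 * of_real pi * \<i> * of_nat n / of_nat q)"

lemma unit_exp_add: "unit_exp q (m + n) = unit_exp q m * unit_exp q n"
 by (simp add: unit_exp_def exp_add[symmetric] add_divide_distrib[symmetric] algebra_simps)

lemma unit_exp_mult: "unit_exp q (m * n) = unit_exp q m ^ n"
 by (induction n) (auto simp: unit_exp_add unit_exp_def[of q 0])

lemma unit_exp_self: "q > 0 ==> unit_exp q q = 1"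
 by (simp add: unit_exp_def)

lemma unit_exp_cong:
 assumes "q > 0" "[m = n] (mod q)"
 shows "unit_exp q m = unit_exp q n"
proof -
 have *: "unit_exp q k = unit_exp q (k mod q)" for k
 proof -
  have "unit_exp q k = unit_exp q (q * (k div q) + k mod q)" by simp
  also have "... = unit_exp q (k mod q)"
   by (simp only: unit_exp_add unit_exp_mult unit_exp_self[OF assms(1)]) simp
  finally show ?thesis .
 qed
 show ?thesis using *[of m] *[of n] assms(2) by (simp add: cong_def)
qed

lemma unit_exp_eq_1_iff:
 assumes "q > 0"
 shows "unit_exp q n = 1 \<longleftrightarrow> q dvd n"
 unfolding unit_exp_def using complex_root_unity_eq_1[of q n] assms
 by (simp add: mult_ac)

lemma sum_unit_exp:
 assumes "q > 0"
 shows "(\<Sum>l<q. unit_exp q (m * l)) = (if q dvd m then of_nat q else 0)"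
proof (cases "q dvd m")
 case True
 hence "unit_exp q m = 1" using unit_exp_eq_1_iff[OF assms] by simp
 thus ?thesis using True by (simp add: unit_exp_mult)
next
 case False
 hence "unit_exp q m ~= 1" using unit_exp_eq_1_iff[OF assms] by simp
 moreover have "unit_exp q m ^ q = 1"
  using unit_exp_mult[of q m q] unit_exp_eq_1_iff[OF assms, of "m * q"] by simp
 ultimately show ?thesis using False by (simp add: unit_exp_mult sum_gp_strict)
qed

lemma dirichlet_char_cong:
 assumes "dirichlet_char q chi" "[m = n] (mod q)"
 shows "chi m = chi n"
proof -
 have per: "chi (k + q) = chi k" for k using assms(1) by (simp add: dirichlet_char_def)
 have "chi (k + j * q) = chi k" for k j
 proof (induction j)
  case (Suc j)
  have "chi (k + Suc j * q) = chi ((k + j * q) + q)" by (simp add: algebra_simps)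
  thus ?case using Suc per by simp
 qed auto
 from this[of "k mod q" "k div q" for k] have "chi k = chi (k mod q)" for k by simp
 thus ?thesis using assms(2) by (metis cong_def)
qed

text \<open>By Euler's theorem the value at a unit is a root of unity of order dividing
  \<open>totient q\<close>.\<close>

lemma norm_dirichlet_char:
 assumes "dirichlet_char q chi"
 shows "norm (chi n) = (if coprime n q then 1 else 0)"
proof (cases "coprime n q")
 case True
 have mult: "chi (a * b) = chi a * chi b" and one: "chi 1 = 1" for a b
  using assms by (auto simp: dirichlet_char_def)
 have "chi (n ^ k) = chi n ^ k" for k
  by (induction k) (use one in \<open>auto simp: mult\<close>)
 moreover have "chi (n ^ totient q) = chi 1"
  using dirichlet_char_cong[OF assms] euler_theorem[OF True] by blast
 ultimately have "chi n ^ totient q = 1" using one by simp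
 hence "norm (chi n) ^ totient q = 1" by (metis norm_one norm_power)
 moreover have "totient q > 0" using assms by (simp add: dirichlet_char_def)
 ultimately have "norm (chi n) = 1"
  using power_eq_iff_eq_base[of "totient q" "norm (chi n)" 1] by simp
 thus ?thesis using True by simp
next
 case False thus ?thesis using assms by (auto simp: dirichlet_char_def)
qed

lemma norm_dirichlet_char_le: "dirichlet_char q chi ==> norm (chi n) <= 1"
 by (simp add: norm_dirichlet_char)

lemma cnj_dirichlet_char_mult:
 assumes "dirichlet_char q chi" "coprime n q"
 shows "cnj (chi n) * chi n = 1"
 using norm_dirichlet_char[OF assms(1), of n] assms(2)
 by (metis complex_norm_square mult.commute of_real_1 power_one)

text \<open>Multiplication by a unit permutes the residues, and \<open>F\<close> sees only the
  class.\<close>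

lemma sum_residues_mult:
 fixes F :: "nat => complex"
 assumes "q > 0" "coprime a q" "!!m n. [m = n] (mod q) ==> F m = F n"
 shows "(\<Sum>h<q. F (a * h)) = (\<Sum>h<q. F h)"
proof -
 have inj: "inj_on (%h. (a * h) mod q) {..<q}"
 proof (rule inj_onI)
  fix x y assume xy: "x \<in> {..<q}" "y \<in> {..<q}" "a * x mod q = a * y mod q"
  hence "[a * x = a * y] (mod q)" by (simp add: cong_def)
  hence "[x = y] (mod q)" using assms(2) cong_mult_lcancel_nat by blast
  thus "x = y" using xy by (simp add: cong_def)
 qed
 have "(%h. (a * h) mod q) ` {..<q} = {..<q}"
  by (rule endo_inj_surj[OF _ _ inj]) (use assms in auto)
 hence "bij_betw (%h. (a * h) mod q) {..<q} {..<q}" using inj by (simp add: bij_betw_def)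
 hence "(\<Sum>h<q. F ((a * h) mod q)) = (\<Sum>h<q. F h)" by (rule sum.reindex_bij_betw)
 moreover have "F ((a * h) mod q) = F (a * h)" for h by (rule assms(3)) (simp add: cong_def)
 ultimately show ?thesis by simp
qed

lemma sum_shift_residues:
 fixes F :: "nat => complex"
 assumes "q > 0" "F q = F 0"
 shows "(\<Sum>h=1..q. F h) = (\<Sum>h<q. F h)"
proof -
 have "{..<q} = insert 0 {1..<q}" "{1..q} = insert q {1..<q}" using assms by auto
 thus ?thesis using assms by simp
qed

locale odd_primitive_char =
 fixes q :: nat and chi :: "nat => complex"
 assumes prim: "primitive_dirichlet_char q chi" and odd: "odd_char q chi"
begin

lemma char: "dirichlet_char q chi"
 using prim by (simp add: primitive_dirichlet_char_def)

lemma q_pos: "q > 0" using char by (simp add: dirichlet_char_def)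

lemma chi_mult: "chi (m * n) = chi m * chi n"
 using char by (simp add: dirichlet_char_def)

lemma chi_1: "chi 1 = 1" using char by (simp add: dirichlet_char_def)

lemmas chi_cong = dirichlet_char_cong[OF char]

lemma q_gt_1: "q > 1"
proof (rule ccontr)
 assume "\<not> q > 1"
 hence "q = 1" using q_pos by simp
 hence "chi 0 = -1" using odd by (simp add: odd_char_def)
 moreover have "chi 0 = chi 1" by (rule chi_cong) (simp add: \<open>q = 1\<close> cong_def)
 ultimately show False using chi_1 by simp
qed

lemma chi_0: "chi 0 = 0"
 using norm_dirichlet_char[OF char, of 0] q_gt_1 by auto

text \<open>Characters live on the natural numbers here, so \<open>q - 1\<close> stands in for the
  residue -1.\<close>

lemma chi_neg: "chi ((q - 1) * n) = - chi n"
 using odd by (simp add: chi_mult odd_char_def)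

lemma gauss_sum_eq: "gauss_sum q chi = (\<Sum>h<q. chi h * unit_exp q h)"
proof -
 have "chi q = chi 0" by (rule chi_cong) (simp add: cong_def)
 thus ?thesis
  unfolding gauss_sum_def unit_exp_def[symmetric]
  by (intro sum_shift_residues) (auto simp: q_pos chi_0)
qed

text \<open>For \<open>l\<close> coprime to \<open>q\<close> the substitution h -> l h suffices. For
  the other \<open>l\<close> the right side is 0, and the vanishing of the left side is what
  primitivity provides.\<close>

lemma twisted_gauss_sum:
 "(\<Sum>h<q. chi h * unit_exp q (h * l)) = cnj (chi l) * gauss_sum q chi"
proof (cases "coprime l q")
 case True
 define F where "F = (%h. chi h * unit_exp q h)"
 have F: "F m = F n" if "[m = n] (mod q)" for m n
  unfolding F_def using chi_cong[OF that] unit_exp_cong[OF q_pos that] by simp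
 have "(\<Sum>h<q. chi h * unit_exp q (h * l)) = (\<Sum>h<q. cnj (chi l) * F (l * h))"
 proof (intro sum.cong refl)
  fix h
  have "cnj (chi l) * F (l * h) = (cnj (chi l) * chi l) * (chi h * unit_exp q (h * l))"
   by (simp add: F_def chi_mult mult_ac)
  thus "chi h * unit_exp q (h * l) = cnj (chi l) * F (l * h)"
   using cnj_dirichlet_char_mult[OF char True] by simp
 qed
 also have "... = cnj (chi l) * (\<Sum>h<q. F (l * h))" by (simp add: sum_distrib_left)
 also have "(\<Sum>h<q. F (l * h)) = (\<Sum>h<q. F h)"
  by (rule sum_residues_mult[OF q_pos True F])
 finally show ?thesis by (simp add: gauss_sum_eq F_def)
next
 case False
 define g where "g = gcd l q"
 define d where "d = q div g"
 have g: "g dvd q" "g dvd l" by (simp_all add: g_def)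
 have "g ~= 1" using False unfolding g_def coprime_iff_gcd_eq_1 .
 moreover have "g > 0" using q_pos by (simp add: g_def)
 ultimately have "g > 1" by simp
 have qdg: "q = d * g" using g by (simp add: d_def)
 have "d > 0" using qdg q_pos by (cases d) auto
 have "d dvd q" using qdg by simp
 have "d < q" using qdg \<open>g > 1\<close> \<open>d > 0\<close> by simp
 with \<open>d dvd q\<close> obtain a where a: "[a = 1] (mod d)" "coprime a q" "chi a ~= 1"
  using prim unfolding primitive_dirichlet_char_def by blast
 \<comment> \<open>Since \<open>a\<close> is 1 modulo q / gcd l q, replacing h by a * h leaves
   unit_exp q (h * l) unchanged while it multiplies \<open>chi h\<close> by \<open>chi a\<close>. As
   \<open>chi a\<close> is not 1, the sum must be 0.\<close>
 have al: "[a * l = l] (mod q)"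
 proof -
  have "int d dvd int a - 1" using a(1) by (simp add: cong_iff_dvd_diff flip: cong_int_iff)
  moreover have "int g dvd int l" using g(2) by (simp add: int_dvd_int_iff)
  ultimately have "int d * int g dvd (int a - 1) * int l" by (rule mult_dvd_mono)
  hence "int q dvd int (a * l) - int l" using qdg by (simp add: algebra_simps)
  thus ?thesis by (simp add: cong_iff_dvd_diff flip: cong_int_iff)
 qed
 define F where "F = (%h. chi h * unit_exp q (h * l))"
 have F: "F m = F n" if "[m = n] (mod q)" for m n
 proof -
  have "[m * l = n * l] (mod q)" using that by (rule cong_scalar_right)
  thus ?thesis unfolding F_def using chi_cong[OF that] unit_exp_cong[OF q_pos] by metis
 qed
 have "F (a * h) = chi a * F h" for h
 proof -
  have "[a * h * l = h * l] (mod q)"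
   using cong_scalar_left[OF al, of h] by (simp add: mult_ac)
  hence "unit_exp q (a * h * l) = unit_exp q (h * l)" by (rule unit_exp_cong[OF q_pos])
  thus ?thesis by (simp add: F_def chi_mult)
 qed
 hence "chi a * (\<Sum>h<q. F h) = (\<Sum>h<q. F (a * h))" by (simp add: sum_distrib_left)
 also have "... = (\<Sum>h<q. F h)" by (rule sum_residues_mult[OF q_pos a(2) F])
 finally have "(\<Sum>h<q. F h) = 0" using a(3) by (metis mult_cancel_right1)
 moreover have "chi l = 0" using False norm_dirichlet_char[OF char, of l] by simp
 ultimately show ?thesis by (simp add: F_def)
qed

lemma sum_chi: "(\<Sum>h<q. chi h) = 0"
 using twisted_gauss_sum[of 0] by (simp add: chi_0 unit_exp_def)

text \<open>Were it zero, the discrete Fourier transform of \<open>chi\<close> would vanish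
  identically by \<open>twisted_gauss_sum\<close>. Fourier inversion at the residue 1, with
  \<open>q - 1\<close> in the role of the frequency -1, would then give q = 0.\<close>

lemma gauss_sum_nonzero: "gauss_sum q chi ~= 0"
proof
 assume 0: "gauss_sum q chi = 0"
 have "0 = (\<Sum>l<q. unit_exp q ((q - 1) * l) * (\<Sum>h<q. chi h * unit_exp q (h * l)))"
  by (simp add: twisted_gauss_sum 0)
 also have "... = (\<Sum>l<q. \<Sum>h<q. chi h * unit_exp q ((h + (q - 1)) * l))"
  unfolding sum_distrib_left
  by (intro sum.cong refl) (simp only: unit_exp_add distrib_right distrib_left mult_ac)
 also have "... = (\<Sum>h<q. chi h * (\<Sum>l<q. unit_exp q ((h + (q - 1)) * l)))"
  by (subst sum.swap) (simp add: sum_distrib_left)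
 also have "... = (\<Sum>h<q. if h = 1 then of_nat q else 0)"
 proof (intro sum.cong refl)
  fix h assume h: "h \<in> {..<q}"
  have "q dvd h + (q - 1) \<longleftrightarrow> h = 1"
  proof
   assume "q dvd h + (q - 1)"
   then obtain k where k: "h + (q - 1) = q * k" by (auto elim: dvdE)
   have "k > 0" using k q_gt_1 by (cases k) auto
   moreover have "k < 2"
   proof (rule ccontr)
    assume "\<not> k < 2"
    hence "q * 2 <= q * k" by (intro mult_le_mono) auto
    moreover have "h + (q - 1) < q * 2" using h by auto
    ultimately show False using k by linarith
   qed
   ultimately have "k = 1" by simp
   thus "h = 1" using k q_gt_1 by simp
  qed (use q_gt_1 in auto)
  thus "chi h * (\<Sum>l<q. unit_exp q ((h + (q - 1)) * l)) = (if h = 1 then of_nat q else 0)"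
   unfolding sum_unit_exp[OF q_pos] using chi_1 by auto
 qed
 also have "... = of_nat q" using q_gt_1 by simp
 finally show False using q_pos by simp
qed

text \<open>The cosine splits into exponentials, which produce the Gauss sums twisted by l and by
  -l. These have opposite signs because the character is odd, so cosines of \<open>x - h\<close>
  collapse to a sine of \<open>x\<close>. Here the sine enters the dual side.\<close>

lemma sum_chi_cos:
 "(\<Sum>h<q. chi h * of_real (cos (2 * pi * real l * ((x - real h) / real q)))) =
  - \<i> * cnj (chi l) * gauss_sum q chi * of_real (sin (2 * pi * real l * x / real q))"
proof -
 define e where "e = exp (\<i> * of_real (2 * pi * real l * x / real q))"
 have e_inv: "exp (- (\<i> * of_real (2 * pi * real l * x / real q))) = inverse e"
  by (simp add: e_def exp_minus)
 have ue: "unit_exp q ((q - 1) * (h * l)) = inverse (unit_exp q (h * l))" for h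
 proof -
  have "unit_exp q ((q - 1) * (h * l)) * unit_exp q (h * l) = unit_exp q (q * (h * l))"
   using q_pos by (simp add: unit_exp_add[symmetric] algebra_simps)
  also have "... = 1" by (simp add: unit_exp_eq_1_iff[OF q_pos])
  finally show ?thesis by (metis inverse_unique mult.commute)
 qed
 have c: "of_real (cos (2 * pi * real l * ((x - real h) / real q)))
    = (e * unit_exp q ((q - 1) * (h * l)) + inverse e * unit_exp q (h * l)) / 2" for h
 proof -
  define \<theta> where "\<theta> = 2 * pi * real l * ((x - real h) / real q)"
  have 1: "exp (\<i> * of_real \<theta>) = e * inverse (unit_exp q (h * l))"
   unfolding e_def unit_exp_def \<theta>_def exp_minus[symmetric] exp_add[symmetric]
   using q_pos by (intro arg_cong[of _ _ exp]) (simp add: field_simps)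
  have "of_real (cos \<theta>) = (exp (\<i> * of_real \<theta>) + inverse (exp (\<i> * of_real \<theta>))) / 2"
   by (simp add: cos_exp_eq exp_minus flip: cos_of_real)
  thus ?thesis unfolding 1 ue \<theta>_def[symmetric] by (simp add: field_simps)
 qed
 have s1: "(\<Sum>h<q. chi h * unit_exp q ((q - 1) * (h * l))) = - cnj (chi l) * gauss_sum q chi"
  using twisted_gauss_sum[of "(q - 1) * l"] unfolding chi_neg by (simp add: mult.left_commute)
 have "(\<Sum>h<q. chi h * of_real (cos (2 * pi * real l * ((x - real h) / real q))))
   = (e * (\<Sum>h<q. chi h * unit_exp q ((q - 1) * (h * l))) + inverse e * (\<Sum>h<q. chi h * unit_exp q (h * l))) / 2"
  unfolding c by (simp add: sum_distrib_left sum.distrib[symmetric] sum_divide_distrib algebra_simps)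
 also have "... = - cnj (chi l) * gauss_sum q chi * ((e - inverse e) / 2)"
  unfolding s1 twisted_gauss_sum by (simp add: field_simps)
 also have "(e - inverse e) / 2 = \<i> * of_real (sin (2 * pi * real l * x / real q))"
  unfolding e_def exp_minus[symmetric] by (simp add: sin_exp_eq field_simps flip: sin_of_real)
 finally show ?thesis by simp
qed

end

section \<open>Euler-Maclaurin summation and Poisson summation twisted by a character\<close>

lemma integrable_inverse_1_plus_square': "integrable lborel (%x::real. C / (1 + x^2))"
proof -
 have "integrable lborel (%x::real. inverse (1 + x^2))"
  using integrable_inverse_1_plus_square by (simp add: set_integrable_def)
 from integrable_mult_right[OF this, of C] show ?thesis by (simp add: divide_inverse)
qed

lemma integrable_quadratic_decay:
 fixes g :: "real => complex"
 assumes "g \<in> borel_measurable lborel" "!!x. norm (g x) <= C / (1 + x^2)"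
 shows "integrable lborel g"
 by (rule Bochner_Integration.integrable_bound[OF integrable_inverse_1_plus_square'[of C] assms(1)])
  (auto intro!: AE_I2 order_trans[OF assms(2)] divide_right_mono)

lemma tendsto_0_quadratic_decay:
 fixes g :: "real => complex"
 assumes "!!x. norm (g x) <= C / (1 + x^2)" "q > 0"
 shows "(%N. g (h + q * real N)) \<longlonglongrightarrow> 0"
proof (rule Lim_null_comparison)
 show "\<forall>\<^sub>F N in sequentially. norm (g (h + q * real N)) <= C / (1 + (h + q * real N)^2)"
  using assms by (intro always_eventually) auto
 have "filterlim (%N. h + q * real N) at_top sequentially"
  by (intro filterlim_tendsto_add_at_top[OF tendsto_const] filterlim_tendsto_pos_mult_at_top[OF tendsto_const assms(2)]
    filterlim_real_sequentially)
 hence "filterlim (%N. 1 + (h + q * real N)^2) at_top sequentially"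
  by (intro filterlim_tendsto_add_at_top[OF tendsto_const filterlim_pow_at_top]) auto
 thus "(%N. C / (1 + (h + q * real N)^2)) \<longlonglongrightarrow> 0"
  by (intro tendsto_divide_0[OF tendsto_const] filterlim_at_top_imp_at_infinity)
qed

lemma vector_derivative_measurable:
 fixes g :: "real => complex"
 assumes "!!x. (g has_vector_derivative g' x) (at x)"
 shows "continuous_on UNIV g" "g \<in> borel_measurable borel"
proof -
 show "continuous_on UNIV g"
  unfolding continuous_on_eq_continuous_at[OF open_UNIV]
  using has_vector_derivative_continuous[OF assms] by blast
 thus "g \<in> borel_measurable borel" by (rule borel_measurable_continuous_onI)
qed

text \<open>Two derivatives with integrable majorants are what two integrations by parts against the
  Bernoulli kernel consume. Vanishing on the nonpositive half line removes every lower boundary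
  term, so that half-line sums have no correction at 0.\<close>

locale quadratic_decay_C2 =
 fixes g g1 g2 :: "real => complex" and C :: real
 assumes d0: "!!x. (g has_vector_derivative g1 x) (at x)"
  and d1: "!!x. (g1 has_vector_derivative g2 x) (at x)"
  and c2: "continuous_on UNIV g2"
  and b0: "!!x. norm (g x) <= C / (1 + x^2)"
  and b1: "!!x. norm (g1 x) <= C / (1 + x^2)"
  and b2: "!!x. norm (g2 x) <= C / (1 + x^2)"
  and z0: "!!x. x <= 0 ==> g x = 0"
  and z1: "!!x. x <= 0 ==> g1 x = 0"
  and z2: "!!x. x <= 0 ==> g2 x = 0"
begin

lemmas c0 = vector_derivative_measurable[OF d0]
lemmas c1 = vector_derivative_measurable[OF d1]

lemma m2 [measurable]: "g2 \<in> borel_measurable borel"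
 using c2 by (rule borel_measurable_continuous_onI)

lemmas [measurable] = c0(2) c1(2)

lemma integrable_g: "integrable lborel g" and integrable_g2: "integrable lborel g2"
 by (auto intro!: integrable_quadratic_decay b0 b2)

lemma integrable_g2_bounded:
 assumes [measurable]: "u \<in> borel_measurable borel" and "!!x. \<bar>u x\<bar> <= B"
 shows "integrable lborel (%x. g2 x * of_real (u x))"
proof (rule integrable_quadratic_decay)
 fix x
 have "norm (g2 x * of_real (u x)) <= (C / (1 + x^2)) * B"
  unfolding norm_mult using b2[of x] assms(2)[of x] by (intro mult_mono) (auto intro: order_trans[OF norm_ge_zero])
 thus "norm (g2 x * of_real (u x)) <= (C * B) / (1 + x^2)" by simp
qed measurable

text \<open>Two integrations by parts against the Bernoulli polynomial scaled to one period. That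
  polynomial is 1/6 at both ends and its derivative is -1 and 1 there, whence the factors q^2 / 12
  and q / 2.\<close>

lemma interval_identity:
 fixes h q :: real and m :: int
 assumes q: "q > 0"
 defines "A \<equiv> h + q * of_int m"
 shows "((%x. of_real (q^2 / (2 * pi^2)) * (g2 x * of_real (cos_series ((x - h) / q))) - g x) has_integral
  (of_real (q^2 / 12) * (g1 (A + q) - g1 A) - of_real (q / 2) * (g A + g (A + q)))) {A..A + q}"
proof -
 define H where "H = (%x. of_real (q^2 / 2 * (((x - A) / q)^2 - (x - A) / q + 1/6)) * g1 x
   - of_real (q / 2 * (2 * ((x - A) / q) - 1)) * g x)"
 have "((%x. of_real (q^2 / 2 * (((x - A) / q)^2 - (x - A) / q + 1/6)) * g2 x - g x) has_integral (H (A + q) - H A)) {A..A + q}"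
 proof (rule fundamental_theorem_of_calculus)
  fix x assume "x \<in> {A..A+q}"
  have 1: "((%x. of_real (q^2 / 2 * (((x - A) / q)^2 - (x - A) / q + 1/6))) has_vector_derivative
    complex_of_real (q / 2 * (2 * ((x - A) / q) - 1))) (at x within {A..A+q})"
   by (rule has_vector_derivative_of_real)
    (use q in \<open>auto intro!: derivative_eq_intros simp flip: has_real_derivative_iff_has_vector_derivative
      simp: field_simps power2_eq_square\<close>)
  have 2: "((%x. of_real (q / 2 * (2 * ((x - A) / q) - 1))) has_vector_derivative complex_of_real 1) (at x within {A..A+q})"
   by (rule has_vector_derivative_of_real)
    (use q in \<open>auto intro!: derivative_eq_intros simp flip: has_real_derivative_iff_has_vector_derivative
      simp: field_simps power2_eq_square\<close>)
  show "(H has_vector_derivative of_real (q^2 / 2 * (((x - A) / q)^2 - (x - A) / q + 1/6)) * g2 x - g x) (at x within {A..A + q})"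
   unfolding H_def
   by (rule has_vector_derivative_eq_rhs[OF has_vector_derivative_diff[OF
     has_vector_derivative_mult[OF 1 has_vector_derivative_at_within[OF d1]]
     has_vector_derivative_mult[OF 2 has_vector_derivative_at_within[OF d0]]]]) simp
 qed (use q in auto)
 also have "H (A + q) - H A = of_real (q^2 / 12) * (g1 (A + q) - g1 A) - of_real (q / 2) * (g A + g (A + q))"
  using q by (simp add: H_def algebra_simps)
 finally show ?thesis
 proof (rule has_integral_eq[rotated])
  fix x assume x: "x \<in> {A..A+q}"
  have "(x - h) / q = (x - A) / q + of_int m" using q by (simp add: A_def field_simps)
  hence "cos_series ((x - h) / q) = cos_series ((x - A) / q)" by (simp only: cos_series_periodic)
  also have "... = pi^2 * (((x - A) / q)^2 - (x - A) / q + 1/6)"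
   using x q by (intro cos_series_eq) (auto simp: field_simps)
  finally have "q^2 / (2 * pi^2) * cos_series ((x - h) / q) = q^2 / 2 * (((x - A) / q)^2 - (x - A) / q + 1/6)"
   by simp
  thus "of_real (q^2 / 2 * (((x - A) / q)^2 - (x - A) / q + 1/6)) * g2 x - g x =
   of_real (q^2 / (2 * pi^2)) * (g2 x * of_real (cos_series ((x - h) / q))) - g x"
   by (metis (no_types, lifting) mult.assoc mult.commute of_real_mult)
 qed
qed

text \<open>The identities for consecutive periods are added: the terms in \<open>g1\<close>
  telescope and the halves of the values at common nodes add up. The condition h <= q puts the start
  h - q of the first period where \<open>g\<close> and \<open>g1\<close> vanish, so \<open>h\<close>
  is the first node that counts.\<close>

theorem euler_maclaurin_half_line:
 assumes h: "0 < h" "h <= q"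
 shows "(%j. g (h + q * real j)) sums
  (((\<integral>x. g x \<partial>lborel) - of_real (q^2 / (2 * pi^2)) * (\<integral>x. g2 x * of_real (cos_series ((x - h) / q)) \<partial>lborel)) / of_real q)"
proof -
 have q: "q > 0" using h by simp
 define \<psi> where "\<psi> = (%x. of_real (q^2 / (2 * pi^2)) * (g2 x * of_real (cos_series ((x - h) / q))) - g x)"
 have mc [measurable]: "cos_series \<in> borel_measurable borel"
  using continuous_on_cos_series by (rule borel_measurable_continuous_onI)
 have int1: "integrable lborel (%x. g2 x * of_real (cos_series ((x - h) / q)))"
  by (rule integrable_g2_bounded[OF _ abs_cos_series_le]) measurable
 have int: "integrable lborel \<psi>"
  unfolding \<psi>_def by (intro Bochner_Integration.integrable_diff integrable_mult_right int1 integrable_g)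
 have fin: "(\<psi> has_integral (of_real (q^2 / 12) * g1 (h + q * real N) - of_real q * (\<Sum>j<N. g (h + q * real j))
    - of_real (q / 2) * g (h + q * real N))) {h - q..h + q * real N}" for N
 proof (induction N)
  case 0
  from interval_identity[OF q, of h "-1"] show ?case
   using h by (simp add: \<psi>_def z0 z1)
 next
  case (Suc N)
  have i: "(\<psi> has_integral
   (of_real (q^2 / 12) * (g1 (h + q * real N + q) - g1 (h + q * real N))
    - of_real (q / 2) * (g (h + q * real N) + g (h + q * real N + q)))) {h + q * real N..h + q * real N + q}"
   using interval_identity[OF q, of h "int N"] by (simp add: \<psi>_def)
  have "h - q <= h + q * real N" using q by (simp add: order_trans[of _ 0])
  from has_integral_combine[OF this _ Suc i] q
  have "(\<psi> has_integral (of_real (q^2 / 12) * g1 (h + q * real N) - of_real q * (\<Sum>j<N. g (h + q * real j))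
    - of_real (q / 2) * g (h + q * real N)) +
     (of_real (q^2 / 12) * (g1 (h + q * real N + q) - g1 (h + q * real N))
    - of_real (q / 2) * (g (h + q * real N) + g (h + q * real N + q)))) {h - q..h + q * real N + q}" by simp
  moreover have "h + q * real N + q = h + q * real (Suc N)" by (simp add: algebra_simps)
  moreover have "(of_real (q^2 / 12) * g1 (h + q * real N) - of_real q * (\<Sum>j<N. g (h + q * real j))
    - of_real (q / 2) * g (h + q * real N)) +
     (of_real (q^2 / 12) * (g1 (h + q * real (Suc N)) - g1 (h + q * real N))
    - of_real (q / 2) * (g (h + q * real N) + g (h + q * real (Suc N))))
   = of_real (q^2 / 12) * g1 (h + q * real (Suc N)) - of_real q * (\<Sum>j<Suc N. g (h + q * real j))
    - of_real (q / 2) * g (h + q * real (Suc N))"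
   by (simp add: algebra_simps del: of_nat_Suc)
  ultimately show ?case by (simp only:)
 qed
 have lim1: "(%N. \<integral>x. indicator {h - q..h + q * real N} x *\<^sub>R \<psi> x \<partial>lborel) \<longlonglongrightarrow> (\<integral>x. \<psi> x \<partial>lborel)"
 proof (rule integral_dominated_convergence[where w = "%x. norm (\<psi> x)"])
  have "(%N. indicator {h - q..h + q * real N} x *\<^sub>R \<psi> x) \<longlonglongrightarrow> \<psi> x" for x
  proof (cases "x < h - q")
   case True
   hence "\<psi> x = 0" using h by (simp add: \<psi>_def z0 z2)
   thus ?thesis by simp
  next
   case False
   obtain N0 :: nat where "real N0 > (x - h) / q" using reals_Archimedean2 by blast
   have "\<forall>\<^sub>F N in sequentially. indicator {h - q..h + q * real N} x *\<^sub>R \<psi> x = \<psi> x"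
    using eventually_ge_at_top[of N0]
   proof eventually_elim
    case (elim N)
    hence "(x - h) / q < real N" using \<open>real N0 > _\<close> by (meson of_nat_le_iff order_less_le_trans)
    hence "x < h + q * real N" using q by (simp add: field_simps)
    thus ?case using False by (auto simp: indicator_def)
   qed
   thus ?thesis by (rule tendsto_eventually)
  qed
  thus "AE x in lborel. (%N. indicator {h - q..h + q * real N} x *\<^sub>R \<psi> x) \<longlonglongrightarrow> \<psi> x" by simp
  show "\<psi> \<in> borel_measurable lborel" unfolding \<psi>_def by measurable
  show "(%x. indicator {h - q..h + q * real N} x *\<^sub>R \<psi> x) \<in> borel_measurable lborel" for N
   unfolding \<psi>_def by measurable
  show "integrable lborel (%x. norm (\<psi> x))" using int by simp
 qed (auto simp: indicator_def)
 have eq: "(\<integral>x. indicator {h - q..h + q * real N} x *\<^sub>R \<psi> x \<partial>lborel) =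
  of_real (q^2 / 12) * g1 (h + q * real N) - of_real q * (\<Sum>j<N. g (h + q * real j)) - of_real (q / 2) * g (h + q * real N)" for N
 proof -
  have "set_integrable lborel {h - q..h + q * real N} \<psi>"
   unfolding set_integrable_def by (rule integrable_mult_indicator) (use int in auto)
  from set_borel_integral_eq_integral(2)[OF this] integral_unique[OF fin] show ?thesis
   by (simp add: set_lebesgue_integral_def)
 qed
 have "(%N. of_real (q^2 / 12) * g1 (h + q * real N) - of_real (q / 2) * g (h + q * real N)
   - (\<integral>x. indicator {h - q..h + q * real N} x *\<^sub>R \<psi> x \<partial>lborel)) \<longlonglongrightarrow>
   of_real (q^2 / 12) * 0 - of_real (q / 2) * 0 - (\<integral>x. \<psi> x \<partial>lborel)"
  by (intro tendsto_diff tendsto_mult tendsto_const lim1 tendsto_0_quadratic_decay[OF b0 q] tendsto_0_quadratic_decay[OF b1 q])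
 hence "(%N. of_real q * (\<Sum>j<N. g (h + q * real j))) \<longlonglongrightarrow> - (\<integral>x. \<psi> x \<partial>lborel)"
  by (simp add: eq algebra_simps)
 from tendsto_mult[OF tendsto_const[of "inverse (of_real q)"] this]
 have "(%N. (\<Sum>j<N. g (h + q * real j))) \<longlonglongrightarrow> inverse (of_real q) * - (\<integral>x. \<psi> x \<partial>lborel)"
  using q by (simp add: mult.assoc[symmetric])
 moreover have "(\<integral>x. \<psi> x \<partial>lborel) = of_real (q^2 / (2 * pi^2)) * (\<integral>x. g2 x * of_real (cos_series ((x - h) / q)) \<partial>lborel) - (\<integral>x. g x \<partial>lborel)"
  unfolding \<psi>_def by (subst Bochner_Integration.integral_diff) (use int1 integrable_g in auto)
 ultimately show ?thesis
  unfolding sums_def by (simp only: minus_diff_eq divide_inverse mult.commute)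
qed

lemma g2_cos_series_sums:
 "(%l. (\<integral>x. g2 x * of_real (cos (2 * pi * real (Suc l) * ((x - h) / q))) \<partial>lborel) / (of_nat (Suc l))^2) sums
  (\<integral>x. g2 x * of_real (cos_series ((x - h) / q)) \<partial>lborel)"
proof -
 let ?f = "%l x. g2 x * of_real (cos (2 * pi * real (Suc l) * ((x - h) / q)) / (real (Suc l))^2)"
 have n: "norm (?f l x) <= norm (g2 x) * (1 / (real (Suc l))^2)" for l x
  unfolding norm_mult norm_of_real by (intro mult_left_mono) (auto simp: divide_simps)
 have sm: "summable (%l. norm (g2 x) * (1 / (real (Suc l))^2))" for x
  by (intro summable_mult summable_inverse_Suc_squares)
 have int: "integrable lborel (?f l)" for l
  by (rule integrable_g2_bounded[where B = "1 / (real (Suc l))^2"]) (auto simp: divide_simps)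
 have "(%l. integral\<^sup>L lborel (?f l)) sums (\<integral>x. (\<Sum>l. ?f l x) \<partial>lborel)"
 proof (rule sums_integral[OF int])
  show "AE x in lborel. summable (%l. norm (?f l x))"
   by (intro AE_I2 summable_comparison_test'[OF sm, of 0]) (use n in auto)
  show "summable (%l. \<integral>x. norm (?f l x) \<partial>lborel)"
  proof (rule summable_comparison_test')
   show "summable (%l. (\<integral>x. norm (g2 x) \<partial>lborel) * (1 / (real (Suc l))^2))"
    by (intro summable_mult summable_inverse_Suc_squares)
   fix l
   have "(\<integral>x. norm (?f l x) \<partial>lborel) <= (\<integral>x. norm (g2 x) * (1 / (real (Suc l))^2) \<partial>lborel)"
    by (intro integral_mono n integrable_norm int integrable_mult_left integrable_g2)
   thus "norm (\<integral>x. norm (?f l x) \<partial>lborel) <= (\<integral>x. norm (g2 x) \<partial>lborel) * (1 / (real (Suc l))^2)"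
    by simp
  qed
 qed
 moreover have "(\<Sum>l. ?f l x) = g2 x * of_real (cos_series ((x - h) / q))" for x
  unfolding cos_series_def
  unfolding suminf_of_real[OF summable_cos_series]
  by (rule suminf_mult[OF summable_of_real[OF summable_cos_series]])
 moreover have "integral\<^sup>L lborel (?f l) = (\<integral>x. g2 x * of_real (cos (2 * pi * real (Suc l) * ((x - h) / q))) \<partial>lborel) / (of_nat (Suc l))^2" for l
  by (subst integral_divide_zero[symmetric]) (simp del: of_nat_Suc)
 ultimately show ?thesis by (simp only:)
qed

end

context odd_primitive_char
begin

text \<open>The sum is split into residue classes and \<open>euler_maclaurin_half_line\<close> is
  applied to each. The main terms cancel by \<open>sum_chi\<close>, and \<open>sum_chi_cos\<close>
  evaluates the combination of dual frequencies. The result is left in terms of \<open>g2\<close>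
  with weights 1 / l^2: it then converges absolutely, and bounds on second derivatives apply to it
  directly.\<close>

theorem twisted_poisson:
 assumes "quadratic_decay_C2 g g1 g2 C"
 shows "(%m. chi m * g (real m)) sums
  (\<i> * gauss_sum q chi * of_nat q / (2 * of_real pi ^ 2) *
   (\<Sum>l. cnj (chi (Suc l)) / (of_nat (Suc l))^2 *
    (\<integral>x. g2 x * of_real (sin (2 * pi * real (Suc l) * x / real q)) \<partial>lborel)))"
proof -
 interpret quadratic_decay_C2 g g1 g2 C by fact
 define J where "J = (%h. \<integral>x. g2 x * of_real (cos_series ((x - real h) / real q)) \<partial>lborel)"
 define I where "I = (%l. \<integral>x. g2 x * of_real (sin (2 * pi * real (Suc l) * x / real q)) \<partial>lborel)"
 define c where "c = complex_of_real ((real q)^2 / (2 * pi^2))"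
 have s1: "(%j. chi h * g (real h + real q * real j)) sums (chi h * (((\<integral>x. g x \<partial>lborel) - c * J h) / of_nat q))" if "h < q" for h
 proof (cases "h = 0")
  case True thus ?thesis by (simp add: chi_0)
 next
  case False
  show ?thesis using sums_mult[OF euler_maclaurin_half_line[of "real h" "real q"], of "chi h"] that False
   by (simp add: J_def c_def)
 qed
 have s2: "(%j. \<Sum>h<q. chi h * g (real h + real q * real j)) sums (\<Sum>h<q. chi h * (((\<integral>x. g x \<partial>lborel) - c * J h) / of_nat q))"
  by (rule sums_sum) (use s1 in auto)
 have e2: "(\<Sum>h<q. chi h * (((\<integral>x. g x \<partial>lborel) - c * J h) / of_nat q)) = - c / of_nat q * (\<Sum>h<q. chi h * J h)"
 proof -
  have "(\<Sum>h<q. chi h * (((\<integral>x. g x \<partial>lborel) - c * J h) / of_nat q)) =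
   (\<Sum>h<q. chi h) * ((\<integral>x. g x \<partial>lborel) / of_nat q) - c / of_nat q * (\<Sum>h<q. chi h * J h)"
   by (simp add: right_diff_distrib diff_divide_distrib sum_subtractf sum_distrib_left sum_distrib_right
     sum_divide_distrib mult_ac)
  thus ?thesis by (simp add: sum_chi)
 qed
 have "(%l. \<Sum>h<q. chi h * ((\<integral>x. g2 x * of_real (cos (2 * pi * real (Suc l) * ((x - real h) / real q))) \<partial>lborel) / (of_nat (Suc l))^2))
  sums (\<Sum>h<q. chi h * J h)"
  unfolding J_def by (intro sums_sum sums_mult g2_cos_series_sums)
 moreover have "(\<Sum>h<q. chi h * ((\<integral>x. g2 x * of_real (cos (2 * pi * real (Suc l) * ((x - real h) / real q))) \<partial>lborel) / (of_nat (Suc l))^2))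
  = - \<i> * gauss_sum q chi * (cnj (chi (Suc l)) / (of_nat (Suc l))^2 * I l)" for l
 proof -
  have int: "integrable lborel (%x. g2 x * of_real (cos (2 * pi * real (Suc l) * ((x - real h) / real q))))" for h
   by (rule integrable_g2_bounded[where B = 1]) auto
  have "(\<Sum>h<q. chi h * (\<integral>x. g2 x * of_real (cos (2 * pi * real (Suc l) * ((x - real h) / real q))) \<partial>lborel))
   = (\<Sum>h<q. (\<integral>x. chi h * (g2 x * of_real (cos (2 * pi * real (Suc l) * ((x - real h) / real q)))) \<partial>lborel))"
   by simp
  also have "... = (\<integral>x. (\<Sum>h<q. chi h * (g2 x * of_real (cos (2 * pi * real (Suc l) * ((x - real h) / real q))))) \<partial>lborel)"
   by (rule Bochner_Integration.integral_sum[symmetric]) (intro integrable_mult_right int)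
  also have "... = (\<integral>x. (- \<i> * cnj (chi (Suc l)) * gauss_sum q chi) * (g2 x * of_real (sin (2 * pi * real (Suc l) * x / real q))) \<partial>lborel)"
  proof (intro Bochner_Integration.integral_cong refl)
   fix x
   have "(\<Sum>h<q. chi h * (g2 x * of_real (cos (2 * pi * real (Suc l) * ((x - real h) / real q)))))
    = g2 x * (\<Sum>h<q. chi h * of_real (cos (2 * pi * real (Suc l) * ((x - real h) / real q))))"
    by (simp only: sum_distrib_left mult.left_commute)
   also have "... = g2 x * (- \<i> * cnj (chi (Suc l)) * gauss_sum q chi * of_real (sin (2 * pi * real (Suc l) * x / real q)))"
    by (simp only: sum_chi_cos)
   finally show "(\<Sum>h<q. chi h * (g2 x * of_real (cos (2 * pi * real (Suc l) * ((x - real h) / real q)))))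
    = (- \<i> * cnj (chi (Suc l)) * gauss_sum q chi) * (g2 x * of_real (sin (2 * pi * real (Suc l) * x / real q)))"
    by (simp only: mult_ac)
  qed
  also have "... = (- \<i> * cnj (chi (Suc l)) * gauss_sum q chi) * I l"
   unfolding I_def by (rule integral_mult_right_zero)
  finally have "(\<Sum>h<q. chi h * (\<integral>x. g2 x * of_real (cos (2 * pi * real (Suc l) * ((x - real h) / real q))) \<partial>lborel)) / (of_nat (Suc l))^2
    = (- \<i> * cnj (chi (Suc l)) * gauss_sum q chi) * I l / (of_nat (Suc l))^2" by (rule arg_cong)
  thus ?thesis by (simp add: sum_divide_distrib del: of_nat_Suc)
 qed
 ultimately have "(%l. - \<i> * gauss_sum q chi * (cnj (chi (Suc l)) / (of_nat (Suc l))^2 * I l)) sums (\<Sum>h<q. chi h * J h)"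
  by (simp only:)
 hence "(%l. - \<i> * gauss_sum q chi * (cnj (chi (Suc l)) / (of_nat (Suc l))^2 * I l)) sums
  (- \<i> * gauss_sum q chi * (inverse (- \<i> * gauss_sum q chi) * (\<Sum>h<q. chi h * J h)))"
  using gauss_sum_nonzero
  by (subst (2) mult.assoc[symmetric], subst right_inverse) (simp_all del: of_nat_Suc)
 hence "(%l. cnj (chi (Suc l)) / (of_nat (Suc l))^2 * I l) sums (inverse (- \<i> * gauss_sum q chi) * (\<Sum>h<q. chi h * J h))"
  using gauss_sum_nonzero by (subst (asm) sums_mult_iff) auto
 hence "(\<Sum>l. cnj (chi (Suc l)) / (of_nat (Suc l))^2 * I l) = inverse (- \<i> * gauss_sum q chi) * (\<Sum>h<q. chi h * J h)"
  by (rule sums_unique[symmetric])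
 hence s3: "(\<Sum>h<q. chi h * J h) = - \<i> * gauss_sum q chi * (\<Sum>l. cnj (chi (Suc l)) / (of_nat (Suc l))^2 * I l)"
 proof -
  have "X = K * U" if "U = inverse K * X" "K ~= 0" for U K X :: complex using that by simp
  from this[OF \<open>(\<Sum>l. _ l) = _\<close>] show ?thesis using gauss_sum_nonzero by simp
 qed
 have sm: "summable (%m. chi m * g (real m))"
 proof (rule summable_comparison_test')
  show "summable (%m. \<bar>C\<bar> * (1 / (real m)^2))"
   using inverse_power_summable[of 2, where ?'a = real] by (intro summable_mult) (simp add: inverse_eq_divide)
  fix m :: nat assume "m >= 1"
  have "norm (chi m * g (real m)) <= 1 * (C / (1 + (real m)^2))"
   unfolding norm_mult by (intro mult_mono norm_dirichlet_char_le[OF char] b0) auto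
  also have "... <= \<bar>C\<bar> * (1 / (real m)^2)"
   using \<open>m >= 1\<close> by (simp, intro frac_le) auto
  finally show "norm (chi m * g (real m)) <= \<bar>C\<bar> * (1 / (real m)^2)" .
 qed
 have "(%j. \<Sum>m\<in>{j*q..<j*q+q}. chi m * g (real m)) sums (\<Sum>m. chi m * g (real m))"
  by (rule sums_group[OF summable_sums[OF sm] q_pos])
 moreover have "(\<Sum>m\<in>{j*q..<j*q+q}. chi m * g (real m)) = (\<Sum>h<q. chi h * g (real h + real q * real j))" for j
 proof -
  have "(\<Sum>m\<in>{j*q..<j*q+q}. chi m * g (real m)) = (\<Sum>h<q. chi (h + j*q) * g (real (h + j*q)))"
   using sum.shift_bounds_nat_ivl[of "%m. chi m * g (real m)" 0 "j*q" q]
   by (simp add: atLeast0LessThan add.commute)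
  also have "... = (\<Sum>h<q. chi h * g (real h + real q * real j))"
  proof (intro sum.cong refl)
   fix h
   have "chi (h + j * q) = chi h" by (rule chi_cong) (simp add: cong_def)
   thus "chi (h + j*q) * g (real (h + j*q)) = chi h * g (real h + real q * real j)"
    by (simp add: mult.commute)
  qed
  finally show ?thesis .
 qed
 ultimately have "(\<Sum>m. chi m * g (real m)) = - c / of_nat q * (\<Sum>h<q. chi h * J h)"
  using s2 e2 sums_unique2 by (metis (no_types, lifting) sums_cong)
 also have "... = \<i> * gauss_sum q chi * of_nat q / (2 * of_real pi ^ 2) *
   (\<Sum>l. cnj (chi (Suc l)) / (of_nat (Suc l))^2 * I l)"
  unfolding s3 c_def using q_pos by (simp add: power2_eq_square)
 finally show ?thesis using sm by (simp add: sums_iff I_def)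
qed

end

section \<open>The integrals of w powr (nu - 1) * exp (- a w - c / w) in closed form\<close>

lemma has_field_derivative_lborel_integral:
 fixes f f' :: "complex => real => complex"
 assumes e: "e > 0"
  and der: "!!z x. z \<in> ball z0 e ==> ((%z. f z x) has_field_derivative f' z x) (at z)"
  and bnd: "!!z x. z \<in> ball z0 e ==> norm (f' z x) <= w x"
  and w: "integrable lborel w"
  and int: "!!z. z \<in> ball z0 e ==> integrable lborel (f z)"
  and m: "f' z0 \<in> borel_measurable lborel"
 shows "((%z. \<integral>x. f z x \<partial>lborel) has_field_derivative (\<integral>x. f' z0 x \<partial>lborel)) (at z0)"
proof -
 have z0: "z0 \<in> ball z0 e" using e by simp
 have "((%z. ((\<integral>x. f z x \<partial>lborel) - (\<integral>x. f z0 x \<partial>lborel)) / (z - z0)) \<longlongrightarrow> (\<integral>x. f' z0 x \<partial>lborel)) (at z0 within ball z0 e)"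
  unfolding tendsto_at_iff_sequentially
 proof (intro allI impI)
  fix X :: "nat => complex"
  assume X: "\<forall>i. X i \<in> ball z0 e - {z0}" "X \<longlonglongrightarrow> z0"
  have "(%i. \<integral>x. (f (X i) x - f z0 x) / (X i - z0) \<partial>lborel) \<longlonglongrightarrow> (\<integral>x. f' z0 x \<partial>lborel)"
  proof (rule integral_dominated_convergence[OF m _ w])
   fix i
   show "(%x. (f (X i) x - f z0 x) / (X i - z0)) \<in> borel_measurable lborel"
    using int[of "X i"] int[OF z0] X(1) by (intro borel_measurable_divide borel_measurable_diff) auto
   have "norm ((f (X i) x - f z0 x) / (X i - z0)) <= w x" for x
   proof -
    have "norm (f (X i) x - f z0 x) <= w x * norm (X i - z0)"
     by (rule field_differentiable_bound[of "ball z0 e" "%z. f z x" "%z. f' z x"])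
      (use X(1) z0 in \<open>auto intro!: has_field_derivative_at_within der bnd\<close>)
    moreover have "norm (X i - z0) > 0" using X(1) by auto
    ultimately show ?thesis by (simp add: norm_divide divide_simps)
   qed
   thus "AE x in lborel. norm ((f (X i) x - f z0 x) / (X i - z0)) <= w x" by simp
  next
   have "(%i. (f (X i) x - f z0 x) / (X i - z0)) \<longlonglongrightarrow> f' z0 x" for x
   proof -
    have "((%z. (f z x - f z0 x) / (z - z0)) \<longlongrightarrow> f' z0 x) (at z0)"
     using der[OF z0] by (simp add: has_field_derivative_iff)
    thus ?thesis
     unfolding tendsto_at_iff_sequentially using X by (auto simp: o_def)
   qed
   thus "AE x in lborel. (%i. (f (X i) x - f z0 x) / (X i - z0)) \<longlonglongrightarrow> f' z0 x" by simp
  qed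
  moreover have "(\<integral>x. (f (X i) x - f z0 x) / (X i - z0) \<partial>lborel) = ((\<integral>x. f (X i) x \<partial>lborel) - (\<integral>x. f z0 x \<partial>lborel)) / (X i - z0)" for i
   using int[of "X i"] int[OF z0] X(1) by (simp add: Bochner_Integration.integral_diff)
  ultimately show "((%z. ((\<integral>x. f z x \<partial>lborel) - (\<integral>x. f z0 x \<partial>lborel)) / (z - z0)) \<circ> X) \<longlonglongrightarrow> (\<integral>x. f' z0 x \<partial>lborel)"
   by (simp only: o_def)
 qed
 hence "((%z. ((\<integral>x. f z x \<partial>lborel) - (\<integral>x. f z0 x \<partial>lborel)) / (z - z0)) \<longlongrightarrow> (\<integral>x. f' z0 x \<partial>lborel)) (at z0)"
  using e by (simp add: at_within_open[OF _ open_ball])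
 thus ?thesis by (simp add: has_field_derivative_iff)
qed

text \<open>\<open>bessel_kern s a c x\<close> is \<open>x powr (s - 1) * exp (- a x - c / x)\<close> on the positive half line.\<close>

definition bessel_kern :: "complex => complex => complex => real => complex" where
 "bessel_kern s a c x = (if x > 0 then exp ((s - 1) * of_real (ln x) - a * of_real x - c / of_real x) else 0)"

definition bessel_int :: "complex => complex => complex => complex" where
 "bessel_int s a c = (\<integral>x. bessel_kern s a c x \<partial>lborel)"

definition gamma_kern :: "real => real => real => real" where
 "gamma_kern \<sigma> \<alpha> x = (if x > 0 then exp ((\<sigma> - 1) * ln x - \<alpha> * x) else 0)"

lemma measurable_bessel_kern [measurable]: "bessel_kern s a c \<in> borel_measurable borel"
 unfolding bessel_kern_def by measurable

lemma measurable_gamma_kern [measurable]: "gamma_kern \<sigma> \<alpha> \<in> borel_measurable borel"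
 unfolding gamma_kern_def by measurable

lemma gamma_kern_nonneg: "gamma_kern \<sigma> \<alpha> x >= 0"
 by (simp add: gamma_kern_def)

lemma integrable_lborel_iff_lebesgue:
 fixes f :: "real => 'a :: {banach, second_countable_topology}"
 assumes [measurable]: "f \<in> borel_measurable borel"
 shows "integrable lborel f \<longleftrightarrow> integrable lebesgue f"
 using integrable_completion[of f lborel] by simp

lemma integrable_gamma_kern:
 assumes "\<sigma> > 0" "\<alpha> > 0"
 shows "integrable lborel (gamma_kern \<sigma> \<alpha>)"
proof -
 have "(%t. complex_of_real t powr (of_real \<sigma> - 1) / of_real (exp (\<alpha> * t))) absolutely_integrable_on {0<..}"
  using assms by (intro absolutely_integrable_Gamma_integral) auto
 hence "integrable lebesgue (%t. norm (indicat_real {0<..} t *\<^sub>R (complex_of_real t powr (of_real \<sigma> - 1) / of_real (exp (\<alpha> * t)))))"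
  unfolding set_integrable_def by (rule integrable_norm)
 also have "(%t. norm (indicat_real {0<..} t *\<^sub>R (complex_of_real t powr (of_real \<sigma> - 1) / of_real (exp (\<alpha> * t))))) = gamma_kern \<sigma> \<alpha>"
  by (auto simp: fun_eq_iff gamma_kern_def indicator_def norm_divide norm_powr_real_powr powr_def exp_diff)
 finally show ?thesis by (subst integrable_lborel_iff_lebesgue) auto
qed

lemma norm_bessel_kern:
 "norm (bessel_kern s a c x) = (if x > 0 then exp ((Re s - 1) * ln x - Re a * x - Re c / x) else 0)"
 by (simp add: bessel_kern_def)

lemma norm_bessel_kern_le:
 assumes "Re a >= \<alpha>" "Re c >= 0"
 shows "norm (bessel_kern s a c x) <= gamma_kern (Re s) \<alpha> x"
proof (cases "x > 0")
 case True
 have "\<alpha> * x <= Re a * x" "0 <= Re c / x" using assms True by (auto intro: mult_right_mono)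
 hence "(Re s - 1) * ln x - Re a * x - Re c / x <= (Re s - 1) * ln x - \<alpha> * x" by linarith
 hence "exp ((Re s - 1) * ln x - Re a * x - Re c / x) <= exp ((Re s - 1) * ln x - \<alpha> * x)"
  by (simp only: exp_le_cancel_iff)
 thus ?thesis using True by (simp only: norm_bessel_kern gamma_kern_def if_True)
qed (simp add: norm_bessel_kern gamma_kern_def)

lemma exp_ge_power_div_fact:
 fixes y :: real
 assumes "y >= 0"
 shows "y ^ N / fact N <= exp y"
proof -
 have "(%n. y ^ n / fact n) sums exp y" using exp_converges[of y] by (simp add: divide_inverse mult.commute)
 hence "(\<Sum>n\<in>{N}. y ^ n / fact n) <= exp y"
  using assms sum_le_suminf[of "%n. y ^ n / fact n" "{N}"] by (auto simp: sums_iff)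
 thus ?thesis by simp
qed

text \<open>Near 0 the factor exp (- c / x) is smaller than any power of x; trading it for
  \<open>N\<close> powers makes the kernel integrable whatever the exponent \<open>s\<close>
  is.\<close>

lemma norm_bessel_kern_le':
 assumes "Re a >= \<alpha>" "Re c >= \<gamma>" "\<gamma> > 0"
 shows "norm (bessel_kern s a c x) <= fact N / \<gamma> ^ N * gamma_kern (Re s + real N) \<alpha> x"
proof (cases "x > 0")
 case True
 have "(\<gamma> / x) ^ N / fact N <= exp (\<gamma> / x)"
  using assms True by (intro exp_ge_power_div_fact) auto
 hence "exp (- (\<gamma> / x)) <= fact N / (\<gamma> / x) ^ N"
  using assms True by (simp add: exp_minus field_simps)
 also have "... = fact N / \<gamma> ^ N * exp (real N * ln x)"
  using True by (simp add: power_divide exp_of_nat_mult)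
 finally have e: "exp (- (\<gamma> / x)) <= fact N / \<gamma> ^ N * exp (real N * ln x)" .
 have "norm (bessel_kern s a c x) = exp ((Re s - 1) * ln x - Re a * x - Re c / x)"
  using True by (simp add: norm_bessel_kern)
 also have "... <= exp ((Re s - 1) * ln x - \<alpha> * x - \<gamma> / x)"
  using assms True by (auto intro!: diff_mono mult_right_mono divide_right_mono)
 also have "... = exp ((Re s - 1) * ln x - \<alpha> * x) * exp (- (\<gamma> / x))"
  by (simp add: exp_add[symmetric])
 also have "... <= exp ((Re s - 1) * ln x - \<alpha> * x) * (fact N / \<gamma> ^ N * exp (real N * ln x))"
  by (intro mult_left_mono e) auto
 also have "... = fact N / \<gamma> ^ N * gamma_kern (Re s + real N) \<alpha> x"
  using True by (simp add: gamma_kern_def exp_add[symmetric] exp_diff algebra_simps)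
 finally show ?thesis .
qed (simp add: norm_bessel_kern gamma_kern_def)

lemma integrable_bessel_kern:
 assumes "Re a > 0" "Re c >= 0" "Re s > 0 \<or> Re c > 0"
 shows "integrable lborel (bessel_kern s a c)"
proof (cases "Re c > 0")
 case True
 obtain N :: nat where N: "real N > - Re s" using reals_Archimedean2 by blast
 show ?thesis
  by (rule Bochner_Integration.integrable_bound[OF integrable_mult_right[OF integrable_gamma_kern[of "Re s + real N" "Re a"], of "fact N / Re c ^ N"]])
   (use N assms True norm_bessel_kern_le'[of "Re a" a "Re c" c s _ N] in \<open>auto simp: abs_mult gamma_kern_nonneg\<close>)
next
 case False
 hence "Re s > 0" using assms by simp
 show ?thesis
  by (rule Bochner_Integration.integrable_bound[OF integrable_gamma_kern[of "Re s" "Re a"]])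
   (use assms \<open>Re s > 0\<close> norm_bessel_kern_le[of "Re a" a c s] in \<open>auto simp: gamma_kern_nonneg\<close>)
qed

lemma bessel_kern_deriv_c:
 "((%c. bessel_kern s a c x) has_field_derivative - bessel_kern (s - 1) a c x) (at c)"
proof (cases "x > 0")
 case True
 have "- bessel_kern (s - 1) a c x = - (1 / of_real x) * exp ((s - 1) * of_real (ln x) - a * of_real x - c / of_real x)"
 proof -
  have "exp ((s - 1 - 1) * of_real (ln x) - a * of_real x - c / of_real x) =
     exp ((s - 1) * of_real (ln x) - a * of_real x - c / of_real x) / exp (of_real (ln x))"
   by (simp add: exp_diff[symmetric] algebra_simps)
  also have "exp (of_real (ln x)) = complex_of_real x" using True by (simp add: exp_of_real)
  finally show ?thesis using True by (simp add: bessel_kern_def)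
 qed
 thus ?thesis using True unfolding bessel_kern_def
  by (auto intro!: derivative_eq_intros)
qed (simp add: bessel_kern_def)

lemma bessel_kern_Suc:
 "bessel_kern (s + 1) a c x = of_real x * bessel_kern s a c x"
proof (cases "x > 0")
 case True
 have "exp ((s + 1 - 1) * of_real (ln x) - a * of_real x - c / of_real x) =
    exp ((s - 1) * of_real (ln x) - a * of_real x - c / of_real x) * exp (of_real (ln x))"
  by (simp add: exp_add[symmetric] algebra_simps)
 also have "exp (of_real (ln x)) = complex_of_real x" using True by (simp add: exp_of_real)
 finally show ?thesis using True by (simp add: bessel_kern_def)
qed (simp add: bessel_kern_def)

lemma bessel_kern_deriv_a:
 "((%a. bessel_kern s a c x) has_field_derivative - bessel_kern (s + 1) a c x) (at a)"
 unfolding bessel_kern_Suc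
 by (cases "x > 0") (auto intro!: derivative_eq_intros simp: bessel_kern_def[abs_def])

text \<open>On a disc of radius Re c / 2 the real part keeps a fixed positive lower bound, so a
  single Gamma kernel dominates the derivatives on the whole disc.\<close>

lemma bessel_int_deriv_c:
 assumes "Re a > 0" "Re c > 0"
 shows "((%c. bessel_int s a c) has_field_derivative - bessel_int (s - 1) a c) (at c)"
proof -
 obtain N :: nat where N: "real N > - Re (s - 1)" using reals_Archimedean2 by blast
 have Re_pos: "Re z >= Re c / 2" if "z \<in> ball c (Re c / 2)" for z
  using that abs_Re_le_cmod[of "c - z"] by (auto simp: dist_norm)
 have "((%c. \<integral>x. bessel_kern s a c x \<partial>lborel) has_field_derivative (\<integral>x. - bessel_kern (s - 1) a c x \<partial>lborel)) (at c)"
 proof (rule has_field_derivative_lborel_integral[where e = "Re c / 2" and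
    w = "%x. fact N / (Re c / 2) ^ N * gamma_kern (Re (s - 1) + real N) (Re a) x"])
  fix z x assume z: "z \<in> ball c (Re c / 2)"
  show "((%c. bessel_kern s a c x) has_field_derivative - bessel_kern (s - 1) a z x) (at z)"
   by (rule bessel_kern_deriv_c)
  show "norm (- bessel_kern (s - 1) a z x) <= fact N / (Re c / 2) ^ N * gamma_kern (Re (s - 1) + real N) (Re a) x"
   unfolding norm_minus_cancel using Re_pos[OF z] assms by (intro norm_bessel_kern_le') auto
 next
  fix z assume z: "z \<in> ball c (Re c / 2)"
  show "integrable lborel (bessel_kern s a z)"
   using Re_pos[OF z] assms by (intro integrable_bessel_kern) auto
 next
  show "integrable lborel (%x. fact N / (Re c / 2) ^ N * gamma_kern (Re (s - 1) + real N) (Re a) x)"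
   using N assms by (intro integrable_mult_right integrable_gamma_kern) auto
 qed (use assms in auto)
 thus ?thesis by (simp add: bessel_int_def)
qed

lemma bessel_int_deriv_a:
 assumes "Re a > 0" "Re c > 0"
 shows "((%a. bessel_int s a c) has_field_derivative - bessel_int (s + 1) a c) (at a)"
proof -
 obtain N :: nat where N: "real N > - Re (s + 1)" using reals_Archimedean2 by blast
 have Re_pos: "Re z >= Re a / 2" if "z \<in> ball a (Re a / 2)" for z
  using that abs_Re_le_cmod[of "a - z"] by (auto simp: dist_norm)
 have "((%a. \<integral>x. bessel_kern s a c x \<partial>lborel) has_field_derivative (\<integral>x. - bessel_kern (s + 1) a c x \<partial>lborel)) (at a)"
 proof (rule has_field_derivative_lborel_integral[where e = "Re a / 2" and
    w = "%x. fact N / (Re c) ^ N * gamma_kern (Re (s + 1) + real N) (Re a / 2) x"])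
  fix z x assume z: "z \<in> ball a (Re a / 2)"
  show "((%a. bessel_kern s a c x) has_field_derivative - bessel_kern (s + 1) z c x) (at z)"
   by (rule bessel_kern_deriv_a)
  show "norm (- bessel_kern (s + 1) z c x) <= fact N / (Re c) ^ N * gamma_kern (Re (s + 1) + real N) (Re a / 2) x"
   unfolding norm_minus_cancel using Re_pos[OF z] assms by (intro norm_bessel_kern_le') auto
 next
  fix z assume z: "z \<in> ball a (Re a / 2)"
  show "integrable lborel (bessel_kern s z c)"
   using Re_pos[OF z] assms by (intro integrable_bessel_kern) auto
 next
  show "integrable lborel (%x. fact N / (Re c) ^ N * gamma_kern (Re (s + 1) + real N) (Re a / 2) x)"
   using N assms by (intro integrable_mult_right integrable_gamma_kern) auto
 qed (use assms in auto)
 thus ?thesis by (simp add: bessel_int_def)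
qed

text \<open>The left side is the integral of the derivative of x powr s * exp (- a x - c / x), which
  tends to 0 at both ends of the half line.\<close>

lemma bessel_int_recurrence:
 assumes "Re a > 0" "Re c > 0"
 shows "s * bessel_int s a c - a * bessel_int (s + 1) a c + c * bessel_int (s - 1) a c = 0"
proof -
 define f where "f = (%x. s * bessel_kern s a c x - a * bessel_kern (s + 1) a c x + c * bessel_kern (s - 1) a c x)"
 have int: "integrable lborel (bessel_kern z a c)" for z
  using assms by (intro integrable_bessel_kern) auto
 have intf: "integrable lborel f" unfolding f_def
  by (intro Bochner_Integration.integrable_add Bochner_Integration.integrable_diff integrable_mult_right int)
 have f0: "f x = 0" if "x <= 0" for x using that by (simp add: f_def bessel_kern_def)
 define F where "F = (%x. bessel_kern (s + 1) a c x)"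
 have dF: "(F has_vector_derivative f x) (at x)" if "x > 0" for x
 proof -
  have 1: "((%x. exp (s * of_real (ln x) - a * of_real x - c / of_real x)) has_vector_derivative
    (s / of_real x - a + c / (of_real x)^2) * exp (s * of_real (ln x) - a * of_real x - c / of_real x)) (at x)"
  proof -
   have l: "((%x. complex_of_real (ln x)) has_vector_derivative of_real (1 / x)) (at x)"
    using that by (intro has_vector_derivative_of_real) (auto intro!: derivative_eq_intros simp flip: has_real_derivative_iff_has_vector_derivative)
   have i: "((%x. complex_of_real (1 / x)) has_vector_derivative of_real (- 1 / x^2)) (at x)"
    using that by (intro has_vector_derivative_of_real) (auto intro!: derivative_eq_intros simp flip: has_real_derivative_iff_has_vector_derivative simp: power2_eq_square)
   have j: "((%x. complex_of_real x) has_vector_derivative of_real 1) (at x)"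
    by (intro has_vector_derivative_of_real) (auto intro!: derivative_eq_intros)
   have "((%x. s * of_real (ln x) - a * of_real x - c * of_real (1 / x)) has_vector_derivative
     (s * of_real (1 / x) - a * of_real 1 - c * of_real (- 1 / x^2))) (at x)"
    by (intro has_vector_derivative_diff has_vector_derivative_mult_right l i j)
   from field_vector_diff_chain_at[OF this DERIV_exp] show ?thesis
    by (simp add: o_def)
  qed
  have k: "bessel_kern (s + 1) a c x = exp (s * of_real (ln x) - a * of_real x - c / of_real x)" if "x > 0" for x
   using that by (simp add: bessel_kern_def)
  have 2: "(F has_vector_derivative (s / of_real x - a + c / (of_real x)^2) * exp (s * of_real (ln x) - a * of_real x - c / of_real x)) (at x)"
   by (rule has_vector_derivative_transform_within_open[OF 1, of "{0<..}"]) (use that in \<open>auto simp: F_def k\<close>)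
  have e1: "bessel_kern (s + 1) a c x = of_real x * bessel_kern s a c x" by (rule bessel_kern_Suc)
  have e2: "bessel_kern s a c x = of_real x * bessel_kern (s - 1) a c x" using bessel_kern_Suc[of "s - 1"] by simp
  have "(s / of_real x - a + c / (of_real x)^2) * exp (s * of_real (ln x) - a * of_real x - c / of_real x) = f x"
   unfolding k[OF that, symmetric] f_def e1 e2 using that by (simp add: field_simps power2_eq_square)
  thus ?thesis using 2 by simp
 qed
 have "(LBINT x=0..\<infinity>. f x) = 0 - 0"
 proof (rule interval_integral_FTC_integrable)
  show "(F has_vector_derivative f x) (at x)" if "(0::ereal) < ereal x" "ereal x < \<infinity>" for x
   using that by (intro dF) auto
  show "isCont f x" if "(0::ereal) < ereal x" "ereal x < \<infinity>" for x
  proof -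
   have "continuous_on {0<..} f"
   proof (rule continuous_on_eq)
    let ?k = "%s x. exp ((s - 1) * complex_of_real (ln x) - a * of_real x - c / of_real x)"
    show "continuous_on {0<..} (%x. s * ?k s x - a * ?k (s + 1) x + c * ?k (s - 1) x)"
     by (intro continuous_intros) auto
   qed (auto simp: f_def bessel_kern_def)
   thus ?thesis using that by (simp add: continuous_on_eq_continuous_at)
  qed
  show "set_integrable lborel (einterval 0 \<infinity>) f"
   unfolding set_integrable_def by (rule integrable_mult_indicator) (use intf in auto)
  have bound: "norm (F x) <= fact N / (Re c) ^ N * gamma_kern (Re (s + 1) + real N) (Re a) x" for x N
   unfolding F_def using assms by (intro norm_bessel_kern_le') auto
  show "((F \<circ> real_of_ereal) \<longlongrightarrow> 0) (at_right 0)"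
  proof -
   obtain N :: nat where N: "real N > 1 - Re s" using reals_Archimedean2 by blast
   have "(F \<longlongrightarrow> 0) (at_right 0)"
   proof (rule Lim_null_comparison)
    show "\<forall>\<^sub>F x in at_right 0. norm (F x) <= fact N / (Re c) ^ N * x"
     unfolding eventually_at_right_field
    proof (intro exI[of _ 1] conjI allI impI)
     fix x :: real assume x: "0 < x" "x < 1"
     have "gamma_kern (Re (s + 1) + real N) (Re a) x <= exp (ln x)"
     proof -
      have "ln x < 0" using x by simp
      hence "(Re s + real N) * ln x <= 1 * ln x" using N by (intro mult_right_mono_neg) auto
      moreover have "Re a * x >= 0" using x assms by simp
      ultimately have "(Re s + real N) * ln x - Re a * x <= ln x" by linarith
      hence "exp ((Re s + real N) * ln x - Re a * x) <= exp (ln x)" by (simp only: exp_le_cancel_iff)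
      moreover have "Re (s + 1) + real N - 1 = Re s + real N" by simp
      ultimately show ?thesis using x by (simp only: gamma_kern_def if_True)
     qed
     hence g: "gamma_kern (Re (s + 1) + real N) (Re a) x <= x" using x by simp
     have "norm (F x) <= fact N / (Re c) ^ N * gamma_kern (Re (s + 1) + real N) (Re a) x" by (rule bound)
     also have "... <= fact N / (Re c) ^ N * x" using g assms by (intro mult_left_mono) auto
     finally show "norm (F x) <= fact N / (Re c) ^ N * x" .
    qed auto
    show "((%x. fact N / (Re c) ^ N * x) \<longlongrightarrow> 0) (at_right 0)"
     by (rule tendsto_mult_right_zero) (rule tendsto_ident_at)
   qed
   thus ?thesis by (simp add: ereal_tendsto_simps zero_ereal_def)
  qed
  show "((F \<circ> real_of_ereal) \<longlongrightarrow> 0) (at_left \<infinity>)"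
  proof -
   have "(F \<longlongrightarrow> 0) at_top"
   proof (rule Lim_null_comparison)
    show "\<forall>\<^sub>F x in at_top. norm (F x) <= exp (Re s * ln x - Re a * x)"
     using eventually_gt_at_top[of 0]
    proof eventually_elim
     case (elim x)
     thus ?case using bound[of x 0] by (simp add: gamma_kern_def)
    qed
    show "((%x. exp (Re s * ln x - Re a * x)) \<longlongrightarrow> 0) at_top"
     using assms by real_asymp
   qed
   thus ?thesis by (simp add: ereal_tendsto_simps)
  qed
 qed auto
 hence "0 = (LBINT x:{0<..}. f x)" by (simp add: interval_integral_to_infinity_eq zero_ereal_def)
 also have "... = (\<integral>x. f x \<partial>lborel)"
  unfolding set_lebesgue_integral_def by (intro Bochner_Integration.integral_cong) (auto simp: indicator_def f0)
 also have "... = s * bessel_int s a c - a * bessel_int (s + 1) a c + c * bessel_int (s - 1) a c"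
  unfolding f_def bessel_int_def using int by simp
 finally show ?thesis by simp
qed

text \<open>The Bessel-Clifford function, the entire factor of the Bessel functions: times (x / 2)
  powr mu it gives I at the argument (x / 2)^2 and J at - (x / 2)^2. All questions of branches stay
  in that power.\<close>

definition bessel_E :: "complex => complex => complex" where
 "bessel_E mu z = (\<Sum>k. rGamma (of_nat k + mu + 1) / of_nat (fact k) * z ^ k)"

lemma bessel_E_coeff_rec:
 "rGamma (of_nat k + mu + 1) / of_nat (fact k) =
  (of_nat (Suc k) * (of_nat (Suc k) + mu)) * (rGamma (of_nat (Suc k) + mu + 1) / of_nat (fact (Suc k)) :: complex)"
proof -
 have "(of_nat k + mu + 1) * rGamma (of_nat k + mu + 1 + 1) = rGamma (of_nat k + mu + 1)"
  by (rule rGamma_plus1)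
 hence "rGamma (of_nat k + mu + 1) = (of_nat (Suc k) + mu) * rGamma (of_nat (Suc k) + mu + 1)"
  by (simp add: algebra_simps)
 moreover have "(of_nat (fact (Suc k)) :: complex) = of_nat (Suc k) * of_nat (fact k)"
  by (simp only: fact_Suc of_nat_mult of_nat_id)
 ultimately show ?thesis by (simp add: divide_simps del: of_nat_Suc of_nat_fact fact_Suc)
qed

lemma summable_bessel_E:
 "summable (%k. norm (rGamma (of_nat k + mu + 1) / of_nat (fact k) * z ^ k :: complex))"
proof -
 define c where "c = (%k. rGamma (of_nat k + mu + 1) / of_nat (fact k) :: complex)"
 obtain N :: nat where N: "real N > norm mu + 1 + 2 * norm z" using reals_Archimedean2 by blast
 show ?thesis
 proof (rule summable_ratio_test[of "1/2" N])
  fix k assume k: "k >= N"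
  have c: "c k = (of_nat (Suc k) * (of_nat (Suc k) + mu)) * c (Suc k)"
   unfolding c_def by (rule bessel_E_coeff_rec)
  have "norm (of_nat (Suc k) + mu) >= real (Suc k) - norm mu"
   using norm_triangle_ineq2[of "of_nat (Suc k)" "- mu"] by (simp del: of_nat_Suc)
  moreover have Nk: "real N <= real (Suc k)" using k by simp
  ultimately have 1: "norm (of_nat (Suc k) + mu) >= 1" using N norm_ge_zero[of z] by linarith
  have 2: "real (Suc k) >= 2 * norm z" using N Nk norm_ge_zero[of mu] by linarith
  have "norm (c k * z ^ k) = real (Suc k) * norm (of_nat (Suc k) + mu) * norm (c (Suc k)) * norm z ^ k"
   unfolding c by (simp add: norm_mult norm_power del: of_nat_Suc)
  also have "... >= (2 * norm z) * 1 * norm (c (Suc k)) * norm z ^ k"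
   using 1 2 by (intro mult_right_mono mult_mono) auto
  finally have "2 * norm (c (Suc k) * z ^ Suc k) <= norm (c k * z ^ k)"
   by (simp add: norm_mult norm_power mult_ac)
  thus "norm (norm (rGamma (of_nat (Suc k) + mu + 1) / of_nat (fact (Suc k)) * z ^ Suc k))
   <= 1/2 * norm (norm (rGamma (of_nat k + mu + 1) / of_nat (fact k) * z ^ k))"
   unfolding c_def by simp
 qed auto
qed

lemma bessel_E_diffs:
 "diffs (%k. rGamma (of_nat k + mu + 1) / of_nat (fact k)) = (%k. rGamma (of_nat k + (mu + 1) + 1) / of_nat (fact k) :: complex)"
proof
 fix k
 have f: "(of_nat (fact (Suc k)) :: complex) = of_nat (Suc k) * of_nat (fact k)"
  by (simp only: fact_Suc of_nat_mult of_nat_id)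
 have g: "of_nat (Suc k) + mu + 1 = of_nat k + (mu + 1) + 1" by simp
 have n0: "(of_nat (Suc k) :: complex) ~= 0" by (rule of_nat_neq_0)
 show "diffs (%k. rGamma (of_nat k + mu + 1) / of_nat (fact k)) k = rGamma (of_nat k + (mu + 1) + 1) / of_nat (fact k)"
  unfolding diffs_def f g using n0 by (simp del: of_nat_Suc of_nat_fact)
qed

lemma bessel_E_deriv: "(bessel_E mu has_field_derivative bessel_E (mu + 1) z) (at z)"
proof -
 have "((%z. \<Sum>k. rGamma (of_nat k + mu + 1) / of_nat (fact k) * z ^ k) has_field_derivative
  (\<Sum>k. diffs (%k. rGamma (of_nat k + mu + 1) / of_nat (fact k)) k * z ^ k)) (at z)"
  by (rule termdiffs_strong_converges_everywhere) (rule summable_norm_cancel[OF summable_bessel_E])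
 thus ?thesis unfolding bessel_E_diffs by (simp add: bessel_E_def[abs_def])
qed

lemma continuous_bessel_E: "isCont (bessel_E mu) z"
 using bessel_E_deriv by (rule DERIV_isCont)

lemma holomorphic_bessel_E: "bessel_E mu holomorphic_on A"
 using bessel_E_deriv by (meson DERIV_subset UNIV_I holomorphic_on_open holomorphic_on_subset open_UNIV subset_UNIV)

lemma bessel_E_0: "bessel_E mu 0 = rGamma (mu + 1)"
 unfolding bessel_E_def by (subst suminf_finite[of "{0}"]) auto

text \<open>Coefficientwise this is the functional equation of \<open>rGamma\<close>. Together with
  \<open>bessel_E_deriv\<close> it says that \<open>bessel_E mu\<close> solves z u'' + (mu + 1) u' =
  u.\<close>

lemma bessel_E_rec: "bessel_E (mu - 1) z = mu * bessel_E mu z + z * bessel_E (mu + 1) z"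
proof -
 define c where "c = (%k. rGamma (of_nat k + mu + 1) / of_nat (fact k) :: complex)"
 have s: "summable (%k. c k * z ^ k)" unfolding c_def by (rule summable_norm_cancel[OF summable_bessel_E])
 have sd: "(%k. diffs c k * z ^ k) sums bessel_E (mu + 1) z"
  unfolding c_def bessel_E_diffs bessel_E_def by (rule summable_sums[OF summable_norm_cancel[OF summable_bessel_E]])
 have "(%k. of_nat (Suc k) * c (Suc k) * z ^ Suc k) sums (z * bessel_E (mu + 1) z)"
  using sums_mult[OF sd, of z] by (simp add: diffs_def mult_ac)
 hence "(%k. of_nat k * c k * z ^ k) sums (z * bessel_E (mu + 1) z)"
  by (subst (asm) sums_Suc_iff) simp
 from sums_add[OF sums_mult[OF summable_sums[OF s], of mu] this]
 have "(%k. mu * (c k * z ^ k) + of_nat k * c k * z ^ k) sums (mu * bessel_E mu z + z * bessel_E (mu + 1) z)"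
  by (simp add: bessel_E_def c_def)
 moreover have "mu * (c k * z ^ k) + of_nat k * c k * z ^ k = rGamma (of_nat k + (mu - 1) + 1) / of_nat (fact k) * z ^ k" for k
 proof -
  have "(of_nat k + mu) * rGamma (of_nat k + mu + 1) = rGamma (of_nat k + mu)" by (rule rGamma_plus1)
  hence "rGamma (of_nat k + (mu - 1) + 1) = (of_nat k + mu) * rGamma (of_nat k + mu + 1)" by simp
  thus ?thesis by (simp only: c_def) (simp add: field_simps)
 qed
 ultimately show ?thesis unfolding bessel_E_def[of "mu - 1"] by (simp add: sums_iff)
qed

lemma bessel_E_powr_deriv:
 assumes "Re z > 0"
 shows "((%z. z powr mu * bessel_E mu z) has_field_derivative z powr (mu - 1) * bessel_E (mu - 1) z) (at z)"
proof -
 have z: "z \<notin> \<real>\<^sub>\<le>\<^sub>0" "z ~= 0" using assms by (auto simp: complex_nonpos_Reals_iff)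
 have p: "z powr mu = z * z powr (mu - 1)" using z by (simp add: powr_diff)
 have "((%z. z powr mu * bessel_E mu z) has_field_derivative
  (mu * z powr (mu - 1)) * bessel_E mu z + bessel_E (mu + 1) z * z powr mu) (at z)"
  by (rule DERIV_mult[OF has_field_derivative_powr[OF z(1)] bessel_E_deriv])
 thus ?thesis unfolding bessel_E_rec by (simp add: p algebra_simps)
qed

lemma bessel_int_tendsto:
 assumes "Re s > 0" "Re a > 0" "X \<longlonglongrightarrow> c0" "!!i. Re (X i) >= 0"
 shows "(%i. bessel_int s a (X i)) \<longlonglongrightarrow> bessel_int s a c0"
 unfolding bessel_int_def
proof (rule integral_dominated_convergence[where w = "gamma_kern (Re s) (Re a)"])
 show "integrable lborel (gamma_kern (Re s) (Re a))" by (rule integrable_gamma_kern) fact+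
 show "AE x in lborel. norm (bessel_kern s a (X i) x) <= gamma_kern (Re s) (Re a) x" for i
  using assms by (intro AE_I2 norm_bessel_kern_le) auto
 have "(%i. bessel_kern s a (X i) x) \<longlonglongrightarrow> bessel_kern s a c0 x" for x
  by (cases "x > 0") (auto simp: bessel_kern_def intro!: tendsto_intros assms)
 thus "AE x in lborel. (%i. bessel_kern s a (X i) x) \<longlonglongrightarrow> bessel_kern s a c0 x" by simp
qed auto

lemma bessel_int_eq_integral:
 assumes "Re a > 0" "Re c >= 0" "Re s > 0 \<or> Re c > 0"
 shows "bessel_kern s a c absolutely_integrable_on {0<..}" "bessel_int s a c = integral {0<..} (bessel_kern s a c)"
proof -
 have i: "integrable lborel (bessel_kern s a c)" by (rule integrable_bessel_kern) fact+
 have e: "(%x. indicat_real {0<..} x *\<^sub>R bessel_kern s a c x) = bessel_kern s a c"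
  by (auto simp: fun_eq_iff indicator_def bessel_kern_def)
 show "bessel_kern s a c absolutely_integrable_on {0<..}"
  unfolding set_integrable_def e using i by (subst (asm) integrable_lborel_iff_lebesgue) auto
 have "(bessel_kern s a c has_integral bessel_int s a c) UNIV"
  unfolding bessel_int_def by (rule has_integral_integral_lborel[OF i])
 hence "((%x. if x \<in> {0<..} then bessel_kern s a c x else 0) has_integral bessel_int s a c) UNIV"
  by (rule has_integral_eq[rotated]) (auto simp: bessel_kern_def)
 hence "(bessel_kern s a c has_integral bessel_int s a c) {0<..}" by (simp only: has_integral_restrict_UNIV)
 thus "bessel_int s a c = integral {0<..} (bessel_kern s a c)" by (simp add: integral_unique)
qed

lemma bessel_int_0: "Re s > 0 ==> bessel_int s 1 0 = Gamma s"
proof -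
 assume s: "Re s > 0"
 have "((%t. of_real t powr (s - 1) / of_real (exp t)) has_integral Gamma s) {0<..}"
  by (rule Gamma_integral_complex'[OF s])
 hence "(bessel_kern s 1 0 has_integral Gamma s) {0<..}"
  by (rule has_integral_eq[rotated]) (auto simp: bessel_kern_def powr_def exp_diff exp_of_real Ln_of_real)
 thus ?thesis using s by (subst bessel_int_eq_integral(2)) (auto intro: integral_unique)
qed

text \<open>The substitution x / u exchanges the two terms of the exponent. It converts a negative
  exponent, for which the limit at c = 0 is inaccessible, into a positive one.\<close>

lemma bessel_int_reflect:
 assumes x: "x > 0"
 shows "bessel_int s 1 (of_real x) = of_real x powr s * bessel_int (- s) 1 (of_real x)"
proof -
 have img: "(%u. x / u) ` {0<..} = {0<..}"
 proof (intro equalityI subsetI)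
  fix y :: real assume "y \<in> {0<..}"
  thus "y \<in> (%u. x / u) ` {0<..}" using x by (intro image_eqI[of _ _ "x / y"]) auto
 qed (use x in auto)
 have eq: "\<bar>- x / u^2\<bar> *\<^sub>R bessel_kern s 1 (of_real x) (x / u) = of_real x powr s * bessel_kern (- s) 1 (of_real x) u" if "u > 0" for u
 proof -
  have "complex_of_real (x / u^2) = exp (of_real (ln x) - 2 * of_real (ln u))"
   using x that by (simp add: exp_diff exp_double exp_of_real)
  hence "\<bar>- x / u^2\<bar> *\<^sub>R bessel_kern s 1 (of_real x) (x / u) =
   exp (of_real (ln x) - 2 * of_real (ln u)) * exp ((s - 1) * of_real (ln x - ln u) - of_real x / of_real u - of_real u)"
   using x that by (simp add: scaleR_conv_of_real bessel_kern_def ln_div)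
  also have "... = exp (s * of_real (ln x)) * exp ((- s - 1) * of_real (ln u) - of_real u - of_real x / of_real u)"
   by (simp add: exp_add[symmetric] algebra_simps)
  finally show ?thesis using x that by (simp add: powr_def Ln_of_real bessel_kern_def)
 qed
 have d: "((%u. x / u) has_field_derivative (- x / u^2)) (at u within {0<..})" if "u \<in> {0<..}" for u
  using that by (auto intro!: derivative_eq_intros simp: power2_eq_square)
 have inj: "inj_on (%u. x / u) {0<..}" using x by (auto simp: inj_on_def)
 have ai: "bessel_kern s 1 (of_real x) absolutely_integrable_on {0<..}"
  using x by (intro bessel_int_eq_integral(1)) auto
 have "(%u. \<bar>- x / u^2\<bar> *\<^sub>R bessel_kern s 1 (of_real x) (x / u)) absolutely_integrable_on {0<..} \<and>
    integral {0<..} (%u. \<bar>- x / u^2\<bar> *\<^sub>R bessel_kern s 1 (of_real x) (x / u)) = integral {0<..} (bessel_kern s 1 (of_real x))"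
  using has_absolute_integral_change_of_variables_real[OF _ d inj, of "bessel_kern s 1 (of_real x)"
    "integral {0<..} (bessel_kern s 1 (of_real x))"] ai
  unfolding img by auto
 hence "integral {0<..} (bessel_kern s 1 (of_real x)) = integral {0<..} (%u. \<bar>- x / u^2\<bar> *\<^sub>R bessel_kern s 1 (of_real x) (x / u))"
  by simp
 also have "... = integral {0<..} (%u. of_real x powr s * bessel_kern (- s) 1 (of_real x) u)"
  by (rule integral_cong) (use eq in auto)
 also have "... = of_real x powr s * integral {0<..} (bessel_kern (- s) 1 (of_real x))"
  by simp
 finally show ?thesis using x by (simp add: bessel_int_eq_integral(2))
qed

lemma bessel_int_scale:
 assumes a: "a > 0" and c: "Re c > 0"
 shows "bessel_int s 1 (of_real a * c) = of_real a powr s * bessel_int s (of_real a) c"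
proof -
 have eq: "bessel_kern s 1 (of_real a * c) (a * x) = of_real a powr (s - 1) * bessel_kern s (of_real a) c x" for x
  using a by (auto simp: bessel_kern_def zero_less_mult_iff ln_mult powr_def Ln_of_real exp_add[symmetric] algebra_simps)
 have "bessel_int s 1 (of_real a * c) = \<bar>a\<bar> *\<^sub>R (\<integral>x. bessel_kern s 1 (of_real a * c) (0 + a * x) \<partial>lborel)"
  unfolding bessel_int_def using a by (intro lborel_integral_real_affine) auto
 also have "... = of_real a * (of_real a powr (s - 1) * bessel_int s (of_real a) c)"
  using a by (simp add: eq bessel_int_def scaleR_conv_of_real)
 also have "of_real a * (of_real a powr (s - 1) * bessel_int s (of_real a) c) = of_real a powr s * bessel_int s (of_real a) c"
  using a by (simp add: powr_diff)
 finally show ?thesis .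
qed

text \<open>The equation z u'' + (1 - nu) u' = u is written as a first-order system with the
  quasi-derivative uh = z powr (1 - nu) * u'. In this form the Wronskian is constant without an
  integrating factor, and its value can be read off along the points 1 / Suc n.\<close>

lemma bracket_constant:
 fixes u uh v vh :: "complex => complex"
 assumes u: "!!z. Re z > 0 ==> (u has_field_derivative z powr (nu - 1) * uh z) (at z)"
  and uh: "!!z. Re z > 0 ==> (uh has_field_derivative z powr (- nu) * u z) (at z)"
  and v: "!!z. Re z > 0 ==> (v has_field_derivative z powr (nu - 1) * vh z) (at z)"
  and vh: "!!z. Re z > 0 ==> (vh has_field_derivative z powr (- nu) * v z) (at z)"
  and lim: "(%n. u (of_real (1 / real (Suc n))) * vh (of_real (1 / real (Suc n)))
        - uh (of_real (1 / real (Suc n))) * v (of_real (1 / real (Suc n)))) \<longlonglongrightarrow> k"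
  and z: "Re z > 0"
 shows "u z * vh z - uh z * v z = k"
proof -
 have "\<exists>c. \<forall>z\<in>{z. Re z > 0}. u z * vh z - uh z * v z = c"
 proof (rule has_field_derivative_zero_constant)
  show "convex {z. Re z > 0}" by (rule convex_halfspace_Re_gt)
  fix z assume "z \<in> {z. Re z > 0}"
  hence z: "Re z > 0" by simp
  have "((%z. u z * vh z - uh z * v z) has_field_derivative
   ((z powr (nu - 1) * uh z) * vh z + (z powr (- nu) * v z) * u z) -
   ((z powr (- nu) * u z) * v z + (z powr (nu - 1) * vh z) * uh z)) (at z)"
   by (intro DERIV_diff DERIV_mult u uh v vh z)
  hence "((%z. u z * vh z - uh z * v z) has_field_derivative 0) (at z)"
   by (simp add: mult_ac)
  thus "((%z. u z * vh z - uh z * v z) has_field_derivative 0) (at z within {z. Re z > 0})"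
   by (rule has_field_derivative_at_within)
 qed
 then obtain c where c: "!!z. Re z > 0 ==> u z * vh z - uh z * v z = c" by auto
 have "(%n. u (of_real (1 / real (Suc n))) * vh (of_real (1 / real (Suc n)))
        - uh (of_real (1 / real (Suc n))) * v (of_real (1 / real (Suc n)))) = (%n. c)"
  by (intro ext c) simp
 hence "c = k" using lim LIMSEQ_unique tendsto_const by metis
 thus ?thesis using c z by simp
qed

text \<open>Three solutions of one second-order equation are compared: the integral \<open>F\<close>
  and the two power series solutions \<open>f1\<close>, \<open>f2\<close> at 0. \<open>F\<close> is
  a combination of the other two whose coefficients are quotients of Wronskians, and all three
  Wronskians follow from the limits at 0.\<close>

theorem bessel_int_one:
 assumes nu: "0 < Re nu" "Re nu < 1" and z: "Re z > 0"
 shows "bessel_int nu 1 z * (rGamma (1 - nu) * rGamma nu) = bessel_E (- nu) z - z powr nu * bessel_E nu z"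
proof -
 define F where "F = (%z. bessel_int nu 1 z)"
 define Fh where "Fh = (%z. - (z powr (1 - nu)) * bessel_int (nu - 1) 1 z)"
 define f1 where "f1 = bessel_E (- nu)"
 define f1h where "f1h = (%z. z powr (1 - nu) * bessel_E (1 - nu) z)"
 define f2 where "f2 = (%z. z powr nu * bessel_E nu z)"
 define f2h where "f2h = bessel_E (nu - 1)"
 have nz: "z ~= 0" "z \<notin> \<real>\<^sub>\<le>\<^sub>0" if "Re z > 0" for z using that by (auto simp: complex_nonpos_Reals_iff)
 have pp: "z powr (nu - 1) * z powr (1 - nu) = 1" "z powr (- nu) * z powr nu = 1" if "Re z > 0" for z
  using nz[OF that] by (simp_all add: powr_add[symmetric])
 have dF: "(F has_field_derivative z powr (nu - 1) * Fh z) (at z)" if "Re z > 0" for z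
 proof -
  have "z powr (nu - 1) * Fh z = - (z powr (nu - 1) * z powr (1 - nu)) * bessel_int (nu - 1) 1 z"
   by (simp add: Fh_def)
  hence "z powr (nu - 1) * Fh z = - bessel_int (nu - 1) 1 z" by (simp only: pp[OF that]) simp
  thus ?thesis unfolding F_def using bessel_int_deriv_c[of 1 z nu] that by simp
 qed
 have dFh: "(Fh has_field_derivative z powr (- nu) * F z) (at z)" if "Re z > 0" for z
 proof -
  have "((%z. z powr (1 - nu) * bessel_int (nu - 1) 1 z) has_field_derivative
   ((1 - nu) * z powr (1 - nu - 1)) * bessel_int (nu - 1) 1 z + (- bessel_int (nu - 1 - 1) 1 z) * z powr (1 - nu)) (at z)"
   using that by (intro DERIV_mult has_field_derivative_powr[OF nz(2)[OF that]] bessel_int_deriv_c) auto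
  from DERIV_minus[OF this]
  have "(Fh has_field_derivative - (((1 - nu) * z powr (1 - nu - 1)) * bessel_int (nu - 1) 1 z + (- bessel_int (nu - 1 - 1) 1 z) * z powr (1 - nu))) (at z)"
   by (simp add: Fh_def[abs_def])
  moreover have p: "z powr (1 - nu) = z * z powr (- nu)" using nz[OF that] by (simp add: powr_diff powr_minus field_simps)
  have "- (((1 - nu) * z powr (1 - nu - 1)) * A + (- B) * z powr (1 - nu)) = z powr (- nu) * ((nu - 1) * A + z * B)" for A B
   unfolding p by (simp add: algebra_simps)
  moreover have "(nu - 1) * bessel_int (nu - 1) 1 z - bessel_int nu 1 z + z * bessel_int (nu - 1 - 1) 1 z = 0"
   using bessel_int_recurrence[of 1 z "nu - 1"] that by simp
  hence "F z = (nu - 1) * bessel_int (nu - 1) 1 z + z * bessel_int (nu - 1 - 1) 1 z"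
   unfolding F_def by (simp add: algebra_simps)
  ultimately show ?thesis by (simp only:)
 qed
 have d1: "(f1 has_field_derivative z powr (nu - 1) * f1h z) (at z)" if "Re z > 0" for z
 proof -
  have "z powr (nu - 1) * f1h z = bessel_E (1 - nu) z"
   unfolding f1h_def mult.assoc[symmetric] pp[OF that] by simp
  thus ?thesis unfolding f1_def using bessel_E_deriv[of "- nu" z] by simp
 qed
 have d1h: "(f1h has_field_derivative z powr (- nu) * f1 z) (at z)" if "Re z > 0" for z
  unfolding f1h_def f1_def using bessel_E_powr_deriv[OF that, of "1 - nu"] by simp
 have d2: "(f2 has_field_derivative z powr (nu - 1) * f2h z) (at z)" if "Re z > 0" for z
  unfolding f2h_def f2_def using bessel_E_powr_deriv[OF that, of nu] by simp
 have d2h: "(f2h has_field_derivative z powr (- nu) * f2 z) (at z)" if "Re z > 0" for z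
 proof -
  have "z powr (- nu) * f2 z = bessel_E nu z"
   unfolding f2_def mult.assoc[symmetric] pp[OF that] by simp
  thus ?thesis unfolding f2h_def using bessel_E_deriv[of "nu - 1" z] by simp
 qed
 define X where "X = (%n::nat. complex_of_real (1 / real (Suc n)))"
 have X0: "X \<longlonglongrightarrow> 0"
 proof -
  have "(%n. 1 / real (Suc n)) \<longlonglongrightarrow> 0"
   using LIMSEQ_inverse_real_of_nat by (simp add: inverse_eq_divide del: of_nat_Suc)
  hence "X \<longlonglongrightarrow> of_real 0" unfolding X_def by (rule tendsto_of_real)
  thus ?thesis by simp
 qed
 have Xpos: "Re (X n) >= 0" for n by (simp add: X_def)
 have LE: "(%n. bessel_E mu (X n)) \<longlonglongrightarrow> rGamma (mu + 1)" for mu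
  using isCont_tendsto_compose[OF continuous_bessel_E X0] by (simp add: bessel_E_0)
 have Lp: "(%n. X n powr s) \<longlonglongrightarrow> 0" if "Re s > 0" for s
 proof (rule tendsto_norm_zero_cancel)
  have "norm (X n powr s) = (1 / real (Suc n)) powr Re s" for n
   unfolding X_def by (subst norm_powr_real_powr) auto
  moreover have "(%n. (1 / real (Suc n)) powr Re s) \<longlonglongrightarrow> 0"
   using that by real_asymp
  ultimately show "(%n. norm (X n powr s)) \<longlonglongrightarrow> 0" by simp
 qed
 have LF: "(%n. F (X n)) \<longlonglongrightarrow> Gamma nu"
  unfolding F_def using bessel_int_tendsto[of nu 1 X 0] nu X0 Xpos by (simp add: bessel_int_0)
 \<comment> \<open>With exponent nu - 1 the integral itself has no usable limit at 0. Reflection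
   replaces that exponent by 1 - nu, and the powers of z cancel.\<close>
 have LFh: "(%n. Fh (X n)) \<longlonglongrightarrow> - Gamma (1 - nu)"
 proof -
  have "Fh (X n) = - bessel_int (1 - nu) 1 (X n)" for n
  proof -
   have "bessel_int (nu - 1) 1 (X n) = X n powr (nu - 1) * bessel_int (1 - nu) 1 (X n)"
    unfolding X_def using bessel_int_reflect[of "1 / real (Suc n)" "nu - 1"] by simp
   moreover have "X n powr (1 - nu) * X n powr (nu - 1) = 1"
    using pp(1)[of "X n"] by (simp add: X_def mult.commute)
   ultimately show ?thesis by (simp add: Fh_def mult.assoc[symmetric])
  qed
  thus ?thesis using bessel_int_tendsto[of "1 - nu" 1 X 0] nu X0 Xpos by (auto simp: bessel_int_0 intro!: tendsto_minus)
 qed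
 have L1: "(%n. f1 (X n)) \<longlonglongrightarrow> rGamma (1 - nu)" unfolding f1_def using LE[of "- nu"] by simp
 have L1h: "(%n. f1h (X n)) \<longlonglongrightarrow> 0" unfolding f1h_def
  using tendsto_mult[OF Lp[of "1 - nu"] LE[of "1 - nu"]] nu by simp
 have L2: "(%n. f2 (X n)) \<longlonglongrightarrow> 0" unfolding f2_def
  using tendsto_mult[OF Lp[of nu] LE[of nu]] nu by simp
 have L2h: "(%n. f2h (X n)) \<longlonglongrightarrow> rGamma nu" unfolding f2h_def using LE[of "nu - 1"] by simp
 have G: "Gamma s * rGamma s = 1" if "Re s > 0" for s :: complex
 proof -
  have "s \<notin> \<int>\<^sub>\<le>\<^sub>0" using that by (auto elim!: nonpos_Ints_cases)
  thus ?thesis by (simp add: rGamma_inverse_Gamma Gamma_eq_zero_iff)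
 qed
 have B1: "F z * f2h z - Fh z * f2 z = 1"
  by (rule bracket_constant[OF dF dFh d2 d2h _ z])
   (use tendsto_diff[OF tendsto_mult[OF LF L2h] tendsto_mult[OF LFh L2]] G[OF nu(1)] in \<open>simp_all add: X_def del: of_nat_Suc\<close>)
 have B2: "F z * f1h z - Fh z * f1 z = 1"
  by (rule bracket_constant[OF dF dFh d1 d1h _ z])
   (use tendsto_diff[OF tendsto_mult[OF LF L1h] tendsto_mult[OF LFh L1]] G[of "1 - nu"] nu in \<open>simp_all add: X_def del: of_nat_Suc\<close>)
 have B3: "f1 z * f2h z - f1h z * f2 z = rGamma (1 - nu) * rGamma nu"
  by (rule bracket_constant[OF d1 d1h d2 d2h _ z])
   (use tendsto_diff[OF tendsto_mult[OF L1 L2h] tendsto_mult[OF L1h L2]] in \<open>simp_all add: X_def del: of_nat_Suc\<close>)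
 \<comment> \<open>The three-term relation between 2 x 2 minors solves for \<open>F\<close>
   directly.\<close>
 have "F z * (f1 z * f2h z - f1h z * f2 z) = f1 z * (F z * f2h z - Fh z * f2 z) - f2 z * (F z * f1h z - Fh z * f1 z)"
  by (simp add: algebra_simps)
 hence "F z * (rGamma (1 - nu) * rGamma nu) = f1 z - f2 z" unfolding B1 B2 B3 by simp
 thus ?thesis by (simp add: F_def f1_def f2_def)
qed

text \<open>Scaling reduces real a > 0 to a = 1, and analytic continuation from the positive axis
  reaches Re a > 0. The boundary Re c = 0, where the oscillating integrals live, is approached
  through c + 1 / Suc n: the integrals converge dominatedly because Re nu > 0, and c stays off the
  branch cut.\<close>

theorem bessel_int_eq:
 assumes nu: "0 < Re nu" "Re nu < 1" and a: "Re a > 0" and c: "Re c >= 0" "c ~= 0"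
 shows "bessel_int nu a c * (rGamma (1 - nu) * rGamma nu) =
     a powr (- nu) * bessel_E (- nu) (a * c) - c powr nu * bessel_E nu (a * c)"
proof -
 define kap where "kap = rGamma (1 - nu) * rGamma nu"
 have real_case: "bessel_int nu (of_real x) c * kap =
     of_real x powr (- nu) * bessel_E (- nu) (of_real x * c) - c powr nu * bessel_E nu (of_real x * c)"
  if x: "x > 0" and c: "Re c > 0" for x c
 proof -
  have x1: "of_real x powr (- nu) * of_real x powr nu = (1 :: complex)" using x by (simp add: powr_add[symmetric])
  have xc: "(of_real x * c) powr nu = of_real x powr nu * c powr nu"
   using x c by (subst powr_times_real_left) auto
  have "bessel_int nu (of_real x) c * kap = (of_real x powr (- nu) * of_real x powr nu) * bessel_int nu (of_real x) c * kap"
   unfolding x1 by simp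
  also have "... = of_real x powr (- nu) * (bessel_int nu 1 (of_real x * c) * kap)"
   unfolding bessel_int_scale[OF x c] by simp
  also have "bessel_int nu 1 (of_real x * c) * kap = bessel_E (- nu) (of_real x * c) - (of_real x powr nu * c powr nu) * bessel_E nu (of_real x * c)"
   unfolding kap_def xc[symmetric] using x c by (intro bessel_int_one nu) auto
  also have "of_real x powr (- nu) * ... = of_real x powr (- nu) * bessel_E (- nu) (of_real x * c) -
   (of_real x powr (- nu) * of_real x powr nu) * c powr nu * bessel_E nu (of_real x * c)"
   by (simp add: algebra_simps)
  finally show ?thesis unfolding x1 by simp
 qed
 have pos_case: "bessel_int nu a c * kap = a powr (- nu) * bessel_E (- nu) (a * c) - c powr nu * bessel_E nu (a * c)"
  if c: "Re c > 0" for c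
 proof -
  define D where "D = (%a. bessel_int nu a c * kap - (a powr (- nu) * bessel_E (- nu) (a * c) - c powr nu * bessel_E nu (a * c)))"
  have "D a = 0"
  proof (rule analytic_continuation[where f = D and S = "{z. Re z > 0}" and U = "of_real ` {0<..}" and \<xi> = 1])
   have "(%a. bessel_int nu a c) holomorphic_on {z. Re z > 0}"
    using bessel_int_deriv_a[OF _ c]
    by (auto simp: holomorphic_on_open[OF open_halfspace_Re_gt])
   moreover have "(%a. bessel_E mu (a * c)) holomorphic_on {z. Re z > 0}" for mu
    using holomorphic_on_compose[of "%a. a * c" "{z. Re z > 0}" "bessel_E mu"] holomorphic_bessel_E
    by (simp add: o_def holomorphic_intros)
   ultimately show "D holomorphic_on {z. Re z > 0}"
    unfolding D_def by (intro holomorphic_intros) (auto simp: complex_nonpos_Reals_iff)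
   show "connected {z. Re z > 0}" by (rule convex_connected[OF convex_halfspace_Re_gt])
   show "(1::complex) islimpt of_real ` {0<..}"
    unfolding islimpt_sequential
   proof (intro exI[of _ "%n. of_real (1 + 1 / real (Suc n))"] conjI allI)
    have "(%n. 1 + 1 / real (Suc n)) \<longlonglongrightarrow> 1 + 0"
     using LIMSEQ_inverse_real_of_nat by (intro tendsto_add) (auto simp: inverse_eq_divide simp del: of_nat_Suc)
    hence "(%n. complex_of_real (1 + 1 / real (Suc n))) \<longlonglongrightarrow> of_real (1 + 0)" by (rule tendsto_of_real)
    thus "(%n. complex_of_real (1 + 1 / real (Suc n))) \<longlonglongrightarrow> 1" by simp
    fix n
    have "1 + 1 / real (Suc n) ~= 1" "1 + 1 / real (Suc n) > 0" by (auto simp del: of_nat_Suc intro: add_pos_nonneg)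
    thus "complex_of_real (1 + 1 / real (Suc n)) \<in> of_real ` {0<..} - {1}"
     by (metis Diff_iff greaterThan_iff image_eqI of_real_eq_1_iff singletonD)
   qed
   show "D z = 0" if "z \<in> of_real ` {0<..}" for z
    using that real_case[OF _ c] by (auto simp: D_def)
  qed (use a in \<open>auto simp: open_halfspace_Re_gt\<close>)
  thus ?thesis by (simp add: D_def)
 qed
 define X where "X = (%n::nat. c + of_real (1 / real (Suc n)))"
 have X0: "X \<longlonglongrightarrow> c"
 proof -
  have "(%n. 1 / real (Suc n)) \<longlonglongrightarrow> 0"
   using LIMSEQ_inverse_real_of_nat by (simp add: inverse_eq_divide del: of_nat_Suc)
  hence "X \<longlonglongrightarrow> c + of_real 0" unfolding X_def by (intro tendsto_add tendsto_of_real tendsto_const)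
  thus ?thesis by simp
 qed
 have Xpos: "Re (X n) > 0" for n using c by (simp add: X_def add_nonneg_pos)
 have cn: "c \<notin> \<real>\<^sub>\<le>\<^sub>0"
 proof
  assume "c \<in> \<real>\<^sub>\<le>\<^sub>0"
  hence "Re c = 0" "Im c = 0" using c by (auto simp: complex_nonpos_Reals_iff)
  thus False using c by (simp add: complex_eq_iff)
 qed
 have E: "(%n. bessel_E mu (a * X n)) \<longlonglongrightarrow> bessel_E mu (a * c)" for mu
  by (rule isCont_tendsto_compose[OF continuous_bessel_E]) (intro tendsto_intros X0)
 have "(%n. bessel_int nu a (X n) * kap) \<longlonglongrightarrow> bessel_int nu a c * kap"
  using Xpos by (intro tendsto_mult bessel_int_tendsto nu a X0 tendsto_const) (auto intro: less_imp_le)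
 moreover have "(%n. a powr (- nu) * bessel_E (- nu) (a * X n) - X n powr nu * bessel_E nu (a * X n)) \<longlonglongrightarrow>
  a powr (- nu) * bessel_E (- nu) (a * c) - c powr nu * bessel_E nu (a * c)"
  by (intro tendsto_diff tendsto_mult tendsto_const E tendsto_powr_complex X0 cn)
 ultimately show ?thesis
  unfolding pos_case[OF Xpos] kap_def[symmetric] using LIMSEQ_unique by blast
qed

section \<open>C^k functions on the line and decay of their Fourier transforms\<close>

text \<open>Only finitely many derivatives are ever used. The recursion peels off one derivative at
  a time, so that closure properties become inductions over the order with the function kept
  arbitrary.\<close>

fun ck_on :: "nat => real set => (real => complex) => bool" where
 "ck_on 0 S f \<longleftrightarrow> continuous_on S f"
| "ck_on (Suc k) S f \<longleftrightarrow> (\<forall>x\<in>S. f differentiable (at x)) \<and> ck_on k S (%x. vector_derivative f (at x))"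

lemma ck_on_cong:
 assumes "open S" "!!x. x \<in> S ==> f x = g x" "ck_on k S f"
 shows "ck_on k S g"
 using assms(2,3)
proof (induction k arbitrary: f g)
 case 0 thus ?case by (simp cong: continuous_on_cong)
next
 case (Suc k)
 have d: "(g has_vector_derivative vector_derivative f (at x)) (at x)" if "x \<in> S" for x
 proof (rule has_vector_derivative_transform_within_open[OF _ assms(1) that])
  show "(f has_vector_derivative vector_derivative f (at x)) (at x)"
   using Suc.prems that vector_derivative_works[of f "at x"] by auto
 qed (use Suc.prems in auto)
 have "ck_on k S (%x. vector_derivative g (at x))"
 proof (rule Suc.IH)
  show "ck_on k S (%x. vector_derivative f (at x))" using Suc.prems by simp
 qed (use vector_derivative_at[OF d] in auto)
 thus ?case using d by (auto intro: differentiableI_vector)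
qed

lemma ck_on_SucI:
 assumes "open S" "!!x. x \<in> S ==> (f has_vector_derivative f' x) (at x)" "ck_on k S f'"
 shows "ck_on (Suc k) S f"
proof -
 have "ck_on k S (%x. vector_derivative f (at x))"
  by (rule ck_on_cong[OF assms(1) _ assms(3)]) (use vector_derivative_at[OF assms(2)] in auto)
 thus ?thesis using assms(2) by (auto intro: differentiableI_vector)
qed

lemma ck_on_SucD:
 assumes "ck_on (Suc k) S f"
 shows "\<exists>f'. (\<forall>x\<in>S. (f has_vector_derivative f' x) (at x)) \<and> ck_on k S f'"
 using assms vector_derivative_works[of f]
 by (intro exI[of _ "%x. vector_derivative f (at x)"]) auto

lemma ck_on_continuous: "open S ==> ck_on k S f ==> continuous_on S f"
 by (cases k) (auto intro!: continuous_at_imp_continuous_on differentiable_imp_continuous_within)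

lemma ck_on_Suc_imp: "open S ==> ck_on (Suc k) S f ==> ck_on k S f"
proof (induction k arbitrary: f)
 case 0 thus ?case using ck_on_continuous[of S "Suc 0" f] by simp
next
 case (Suc k) thus ?case by simp
qed

lemma ck_on_le: "open S ==> j <= k ==> ck_on k S f ==> ck_on j S f"
proof (induction k)
 case (Suc k)
 thus ?case using ck_on_Suc_imp[of S k f] by (cases "j = Suc k") auto
qed simp

lemma ck_on_subset: "T \<subseteq> S ==> ck_on k S f ==> ck_on k T f"
 by (induction k arbitrary: f) (auto intro: continuous_on_subset)

lemma ck_on_Un: "open S ==> open T ==> ck_on k S f ==> ck_on k T f ==> ck_on k (S \<union> T) f"
 by (induction k arbitrary: f) (auto intro: continuous_on_open_Un)

lemma ck_on_const [intro]: "ck_on k S (%x. c)"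
 by (induction k arbitrary: c) auto

lemma ck_on_add:
 assumes "open S" "ck_on k S f" "ck_on k S g"
 shows "ck_on k S (%x. f x + g x)"
 using assms(2,3)
proof (induction k arbitrary: f g)
 case 0 thus ?case by (auto intro: continuous_on_add)
next
 case (Suc k)
 obtain f' where f: "!!x. x \<in> S ==> (f has_vector_derivative f' x) (at x)" "ck_on k S f'" using ck_on_SucD[OF Suc.prems(1)] by blast
 obtain g' where g: "!!x. x \<in> S ==> (g has_vector_derivative g' x) (at x)" "ck_on k S g'" using ck_on_SucD[OF Suc.prems(2)] by blast
 show ?case
  by (rule ck_on_SucI[OF assms(1) has_vector_derivative_add[OF f(1) g(1)] Suc.IH[OF f(2) g(2)]])
qed

lemma ck_on_mult:
 assumes "open S" "ck_on k S f" "ck_on k S g"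
 shows "ck_on k S (%x. f x * g x)"
 using assms(2,3)
proof (induction k arbitrary: f g)
 case 0 thus ?case by (auto intro: continuous_on_mult)
next
 case (Suc k)
 obtain f' where f: "!!x. x \<in> S ==> (f has_vector_derivative f' x) (at x)" "ck_on k S f'" using ck_on_SucD[OF Suc.prems(1)] by blast
 obtain g' where g: "!!x. x \<in> S ==> (g has_vector_derivative g' x) (at x)" "ck_on k S g'" using ck_on_SucD[OF Suc.prems(2)] by blast
 have fg: "ck_on k S f" "ck_on k S g" using Suc.prems ck_on_Suc_imp[OF assms(1)] by auto
 show ?case
  by (rule ck_on_SucI[OF assms(1) has_vector_derivative_mult[OF f(1) g(1)]])
   (auto intro!: ck_on_add[OF assms(1)] Suc.IH f g fg)
qed

lemma ck_on_holomorphic: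
 assumes "open U" "F holomorphic_on U" "open S" "of_real ` S \<subseteq> U"
 shows "ck_on k S (%x. F (of_real x))"
 using assms(2)
proof (induction k arbitrary: F)
 case 0
 have "continuous_on (of_real ` S) F"
  by (rule continuous_on_subset[OF holomorphic_on_imp_continuous_on[OF 0] assms(4)])
 moreover have "continuous_on S complex_of_real" by (intro continuous_intros)
 ultimately show ?case by (auto intro: continuous_on_compose2)
next
 case (Suc k)
 show ?case
 proof (rule ck_on_SucI[OF assms(3)])
  fix x assume "x \<in> S"
  hence "(F has_field_derivative deriv F (of_real x)) (at (of_real x))"
   using assms Suc.prems by (intro holomorphic_derivI[of F U]) auto
  thus "((%x. F (of_real x)) has_vector_derivative deriv F (of_real x)) (at x)"
   by (rule has_vector_derivative_real_field)
 qed (use Suc holomorphic_deriv[OF Suc.prems assms(1)] in auto)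
qed

text \<open>Smoothness is demanded of the inner derivative \<open>h'\<close> rather than of
  \<open>h\<close>, since the chain rule only ever multiplies by it and the induction can keep this
  hypothesis.\<close>

lemma ck_on_compose:
 fixes h h' :: "real => real"
 assumes "open S" "open T" "h ` S \<subseteq> T" "ck_on k T f"
  and h: "!!x. x \<in> S ==> (h has_real_derivative h' x) (at x)" "ck_on k S (%x. of_real (h' x))"
 shows "ck_on k S (%x. f (h x))"
 using assms(4) h(2)
proof (induction k arbitrary: f)
 case 0
 have "continuous_on S h" using h(1) assms(1)
  by (intro continuous_at_imp_continuous_on) (auto intro: DERIV_isCont)
 thus ?case using 0 assms(3) by (auto intro: continuous_on_compose2)
next
 case (Suc k)
 obtain f' where f: "!!x. x \<in> T ==> (f has_vector_derivative f' x) (at x)" "ck_on k T f'" using ck_on_SucD[OF Suc.prems(1)] by blast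
 have hk: "ck_on k S (%x. of_real (h' x))" using Suc.prems(2) ck_on_Suc_imp[OF assms(1)] by blast
 show ?case
 proof (rule ck_on_SucI[OF assms(1)])
  fix x assume x: "x \<in> S"
  have "((f \<circ> h) has_vector_derivative h' x *\<^sub>R f' (h x)) (at x)"
   by (rule vector_diff_chain_at) (use h(1)[OF x] f(1) assms(3) x in \<open>auto simp: has_real_derivative_iff_has_vector_derivative\<close>)
  thus "((%x. f (h x)) has_vector_derivative of_real (h' x) * f' (h x)) (at x)"
   by (simp add: o_def scaleR_conv_of_real)
 next
  show "ck_on k S (%x. of_real (h' x) * f' (h x))"
   by (intro ck_on_mult assms(1) hk Suc.IH f(2))
 qed
qed

lemma ck_on_extend_zero:
 assumes "open S" "ck_on k S f" "closed K" "K \<subseteq> S" "!!x. x \<notin> K ==> f x = 0"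
 shows "ck_on k UNIV f"
proof -
 have "ck_on k (- K) f"
  by (rule ck_on_cong[of _ "%x. 0"]) (use assms in \<open>auto simp: open_Compl\<close>)
 hence "ck_on k (S \<union> - K) f" using assms by (intro ck_on_Un) (auto simp: open_Compl)
 moreover have "S \<union> - K = UNIV" using assms(4) by auto
 ultimately show ?thesis by simp
qed

lemma has_real_derivative_max_power:
 "((%x. max 0 x ^ Suc (Suc k)) has_real_derivative real (Suc (Suc k)) * max 0 x ^ Suc k) (at x)"
proof (cases "x = 0")
 case True
 have "((%h. (max 0 h ^ Suc (Suc k)) / h) \<longlongrightarrow> 0) (at (0::real))"
 proof (rule Lim_null_comparison)
  show "\<forall>\<^sub>F h in at 0. norm (max 0 h ^ Suc (Suc k) / h) <= max 0 h ^ Suc k"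
   unfolding eventually_at by (intro exI[of _ 1]) (auto simp: max_def)
  have "((%h::real. max 0 h ^ Suc k) \<longlongrightarrow> max 0 0 ^ Suc k) (at 0)" by (intro tendsto_intros)
  thus "((%h::real. max 0 h ^ Suc k) \<longlongrightarrow> 0) (at 0)" by simp
 qed
 thus ?thesis using True by (simp add: has_field_derivative_iff)
next
 case False
 show ?thesis
 proof (cases "x > 0")
  case True
  have "((%x. x ^ Suc (Suc k)) has_real_derivative real (Suc (Suc k)) * x ^ Suc k) (at x)"
   by (auto intro!: derivative_eq_intros simp del: power_Suc of_nat_Suc) (simp add: power_Suc)?
  hence "((%x. max 0 x ^ Suc (Suc k)) has_real_derivative real (Suc (Suc k)) * x ^ Suc k) (at x)"
   by (rule has_field_derivative_transform_within_open[of _ _ _ "{0<..}"]) (use True in \<open>auto simp: max_def\<close>)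
  thus ?thesis using True by (simp add: max_def)
 next
  case neg: False
  have "((%x. 0) has_real_derivative 0) (at x)" by simp
  hence "((%x. max 0 x ^ Suc (Suc k)) has_real_derivative 0) (at x)"
   by (rule has_field_derivative_transform_within_open[of _ _ _ "{..<0}"]) (use neg False in \<open>auto simp: max_def\<close>)
  thus ?thesis using neg False by (simp add: max_def)
 qed
qed

text \<open>Truncated powers are the raw material of the cut-off functions.\<close>

lemma ck_on_max_power: "ck_on k UNIV (%x. of_real (max 0 x ^ Suc k))"
proof (induction k)
 case 0 show ?case by (auto intro!: continuous_intros)
next
 case (Suc k)
 show ?case
 proof (rule ck_on_SucI[where f' = "%x. of_real (real (Suc (Suc k))) * of_real (max 0 x ^ Suc k)"])
  fix x :: real
  note has_real_derivative_max_power[of k x]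
  hence "((%x. of_real (max 0 x ^ Suc (Suc k))) has_vector_derivative complex_of_real (real (Suc (Suc k)) * max 0 x ^ Suc k)) (at x)"
   by (intro has_vector_derivative_of_real) (simp add: has_real_derivative_iff_has_vector_derivative)
  thus "((%x. of_real (max 0 x ^ Suc (Suc k))) has_vector_derivative of_real (real (Suc (Suc k))) * complex_of_real (max 0 x ^ Suc k)) (at x)"
   by (simp only: of_real_mult)
 qed (rule open_UNIV, rule ck_on_mult[OF open_UNIV ck_on_const Suc])
qed

definition vanishes_off :: "real => real => (real => complex) => bool" where
 "vanishes_off a b f \<longleftrightarrow> (\<forall>x. x <= a \<or> x >= b --> f x = 0)"

lemma vanishes_off_mult: "vanishes_off a b f ==> vanishes_off a b (%x. g x * f x)"
 by (simp add: vanishes_off_def)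

lemma vanishes_off_deriv:
 assumes "vanishes_off a b f" "!!x. (f has_vector_derivative f' x) (at x)" "continuous_on UNIV f'"
 shows "vanishes_off a b f'"
 unfolding vanishes_off_def
proof (intro allI impI)
 have z: "f' x = 0" if "x < a \<or> x > b" for x
 proof -
  have "((%x. 0) has_vector_derivative 0) (at x)" by simp
  hence "(f has_vector_derivative 0) (at x)"
   by (rule has_vector_derivative_transform_within_open[of _ _ _ "{..<a} \<union> {b<..}"])
    (use assms(1) that in \<open>auto simp: vanishes_off_def\<close>)
  thus ?thesis using assms(2) vector_derivative_unique_at by blast
 qed
 have "closed {x. f' x = 0}"
  using continuous_closed_vimage[of "{0}" f'] assms(3)
  by (simp add: vimage_def continuous_on_eq_continuous_at)
 fix x assume "x <= a \<or> x >= b"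
 hence "x \<in> closure {..<a} \<or> x \<in> closure {b<..}" by auto
 moreover have "closure {..<a} \<subseteq> {x. f' x = 0}"
  by (rule closure_minimal[OF _ \<open>closed {x. f' x = 0}\<close>]) (use z in auto)
 moreover have "closure {b<..} \<subseteq> {x. f' x = 0}"
  by (rule closure_minimal[OF _ \<open>closed {x. f' x = 0}\<close>]) (use z in auto)
 ultimately show "f' x = 0" by blast
qed

lemma integrable_vanishes_off:
 assumes "continuous_on UNIV f" "vanishes_off a b f"
 shows "integrable lborel f"
proof -
 have "integrable lborel (%x. indicator {a..b} x *\<^sub>R f x)"
  using borel_integrable_atLeastAtMost'[OF continuous_on_subset[OF assms(1)]] by (simp add: set_integrable_def)
 also have "(%x. indicator {a..b} x *\<^sub>R f x) = f"
  using assms(2) by (auto simp: fun_eq_iff indicator_def vanishes_off_def)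
 finally show ?thesis .
qed

lemma integral_deriv_vanishes_off:
 assumes "vanishes_off a b f" "!!x. (f has_vector_derivative f' x) (at x)" "continuous_on UNIV f'"
 shows "(\<integral>x. f' x \<partial>lborel) = 0"
proof (cases "a <= b")
 case True
 have v: "vanishes_off a b f'" by (rule vanishes_off_deriv[OF assms])
 have "(\<integral>x. indicator {a..b} x *\<^sub>R f' x \<partial>lborel) = f b - f a"
  by (rule integral_FTC_Icc[OF True]) (use assms in \<open>auto intro: has_vector_derivative_at_within continuous_on_subset\<close>)
 also have "(%x. indicator {a..b} x *\<^sub>R f' x) = f'"
  using v by (auto simp: fun_eq_iff indicator_def vanishes_off_def)
 finally show ?thesis using assms(1) by (simp add: vanishes_off_def)
next
 case False
 have "vanishes_off a b f'" by (rule vanishes_off_deriv[OF assms])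
 hence "f' x = 0" for x using False by (cases "x <= a") (auto simp: vanishes_off_def)
 hence "f' = (%x. 0)" by auto
 thus ?thesis by simp
qed

text \<open>The frequency is complex because the transform of a continuous function with bounded
  support is entire, with a complex derivative that is again such a transform.\<close>

definition fourier :: "(real => complex) => complex => complex" where
 "fourier f z = (\<integral>t. f t * exp (\<i> * z * of_real t) \<partial>lborel)"

lemma fourier_of_deriv:
 assumes "vanishes_off a b f" "!!x. (f has_vector_derivative f' x) (at x)" "continuous_on UNIV f'"
 shows "fourier f' (of_real y) = - (\<i> * of_real y * fourier f (of_real y))"
proof -
 have c: "continuous_on UNIV f" using vector_derivative_measurable(1)[OF assms(2)] .
 have v': "vanishes_off a b f'" by (rule vanishes_off_deriv[OF assms])
 have "(\<integral>t. f' t * exp (\<i> * of_real y * of_real t) + f t * (\<i> * of_real y * exp (\<i> * of_real y * of_real t)) \<partial>lborel) = 0"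
 proof (rule integral_deriv_vanishes_off[of a b "%t. f t * exp (\<i> * of_real y * of_real t)"])
  show "vanishes_off a b (%t. f t * exp (\<i> * of_real y * of_real t))"
   using assms(1) by (simp add: vanishes_off_def)
  have ex: "((%t. exp (\<i> * of_real y * of_real t)) has_vector_derivative \<i> * of_real y * exp (\<i> * of_real y * of_real t)) (at t)" for t
   by (rule has_vector_derivative_real_field) (auto intro!: derivative_eq_intros)
  show "((%t. f t * exp (\<i> * of_real y * of_real t)) has_vector_derivative
   f' t * exp (\<i> * of_real y * of_real t) + f t * (\<i> * of_real y * exp (\<i> * of_real y * of_real t))) (at t)" for t
   using has_vector_derivative_mult[OF assms(2) ex, of t] by (simp add: add.commute)
  show "continuous_on UNIV (%t. f' t * exp (\<i> * of_real y * of_real t) + f t * (\<i> * of_real y * exp (\<i> * of_real y * of_real t)))"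
   by (intro continuous_intros c assms(3))
 qed
 moreover have "integrable lborel (%t. f' t * exp (\<i> * of_real y * of_real t))"
  by (rule integrable_vanishes_off[of _ a b]) (use v' assms(3) in \<open>auto simp: vanishes_off_def intro!: continuous_intros\<close>)
 moreover have "integrable lborel (%t. f t * (\<i> * of_real y * exp (\<i> * of_real y * of_real t)))"
  by (rule integrable_vanishes_off[of _ a b]) (use assms(1) c in \<open>auto simp: vanishes_off_def intro!: continuous_intros\<close>)
 ultimately have "fourier f' (of_real y) + (\<integral>t. (\<i> * of_real y) * (f t * exp (\<i> * of_real y * of_real t)) \<partial>lborel) = 0"
  unfolding fourier_def by (simp add: mult_ac)
 thus ?thesis
  unfolding fourier_def integral_mult_right_zero by (simp add: add_eq_0_iff)
qed

text \<open>Each integration by parts trades one derivative of \<open>f\<close> for one factor of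
  the frequency.\<close>

lemma fourier_decay:
 assumes "ck_on k UNIV f" "vanishes_off a b f"
 shows "\<exists>C\<ge>0. \<forall>y::real. \<bar>y\<bar> ^ k * norm (fourier f (of_real y)) <= C"
 using assms
proof (induction k arbitrary: f)
 case 0
 have c: "continuous_on UNIV f" using 0 by simp
 have "norm (fourier f (of_real y)) <= (\<integral>t. norm (f t) \<partial>lborel)" for y :: real
  unfolding fourier_def
  by (rule order_trans[OF integral_norm_bound]) (simp add: norm_mult)
 thus ?case by (intro exI[of _ "\<integral>t. norm (f t) \<partial>lborel"]) auto
next
 case (Suc k)
 obtain f' where f: "!!x. (f has_vector_derivative f' x) (at x)" "ck_on k UNIV f'" using ck_on_SucD[OF Suc.prems(1)] by blast
 have c': "continuous_on UNIV f'" using f(2) ck_on_continuous by blast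
 have c: "continuous_on UNIV f" using Suc.prems(1) ck_on_continuous by blast
 have v': "vanishes_off a b f'" by (rule vanishes_off_deriv[OF Suc.prems(2) f(1) c'])
 obtain C where C: "C >= 0" "!!y. \<bar>y\<bar> ^ k * norm (fourier f' (of_real y)) <= C" using Suc.IH[OF f(2) v'] by blast
 have "norm (of_real y * fourier f (of_real y)) = norm (fourier f' (of_real y))" for y :: real
  unfolding fourier_of_deriv[OF Suc.prems(2) f(1) c'] by (simp add: norm_mult)
 hence eq: "\<bar>y\<bar> * norm (fourier f (of_real y)) = norm (fourier f' (of_real y))" for y :: real
  by (simp add: norm_mult)
 have "\<bar>y\<bar> ^ Suc k * norm (fourier f (of_real y)) <= C" for y :: real
  using C(2)[of y] by (simp add: eq[symmetric] mult_ac)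
 thus ?case using C(1) by blast
qed

lemma fourier_deriv:
 assumes "continuous_on UNIV f" "vanishes_off a b f"
 shows "(fourier f has_field_derivative fourier (%t. \<i> * of_real t * f t) z) (at z)"
proof -
 define R where "R = max \<bar>a\<bar> \<bar>b\<bar>"
 have R: "\<bar>t\<bar> <= R" if "f t ~= 0" for t
  using that assms(2) unfolding vanishes_off_def R_def by (cases "t <= a"; cases "t >= b") auto
 have "((%z. \<integral>t. f t * exp (\<i> * z * of_real t) \<partial>lborel) has_field_derivative
     (\<integral>t. \<i> * of_real t * f t * exp (\<i> * z * of_real t) \<partial>lborel)) (at z)"
 proof (rule has_field_derivative_lborel_integral[where e = 1 and w = "%t. R * exp ((norm z + 1) * R) * norm (f t)"])
  fix w t assume w: "w \<in> ball z 1"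
  show "((%z. f t * exp (\<i> * z * of_real t)) has_field_derivative \<i> * of_real t * f t * exp (\<i> * w * of_real t)) (at w)"
   by (auto intro!: derivative_eq_intros)
  show "norm (\<i> * of_real t * f t * exp (\<i> * w * of_real t)) <= R * exp ((norm z + 1) * R) * norm (f t)"
  proof (cases "f t = 0")
   case False
   have "norm w <= norm z + 1" using w norm_triangle_ineq2[of w z] by (auto simp: dist_norm norm_minus_commute)
   hence "norm (\<i> * w * of_real t) <= (norm z + 1) * R"
    using R[OF False] unfolding norm_mult by (simp add: mult_mono)
   hence "norm (exp (\<i> * w * of_real t)) <= exp ((norm z + 1) * R)"
    by (meson exp_le_cancel_iff norm_exp order_trans)
   hence "\<bar>t\<bar> * norm (exp (\<i> * w * of_real t)) <= R * exp ((norm z + 1) * R)"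
    using R[OF False] by (intro mult_mono) auto
   from mult_right_mono[OF this norm_ge_zero[of "f t"]] show ?thesis by (simp add: norm_mult mult_ac)
  qed (simp add: R_def)
 next
  show "integrable lborel (%t. R * exp ((norm z + 1) * R) * norm (f t))"
   by (intro integrable_mult_right integrable_norm integrable_vanishes_off[OF assms])
  show "integrable lborel (%t. f t * exp (\<i> * w * of_real t))" for w
   by (rule integrable_vanishes_off[of _ a b]) (use assms in \<open>auto simp: vanishes_off_def intro!: continuous_intros\<close>)
  have "continuous_on UNIV (%t. \<i> * of_real t * f t * exp (\<i> * z * of_real t))"
   by (intro continuous_intros assms)
  thus "(%t. \<i> * of_real t * f t * exp (\<i> * z * of_real t)) \<in> borel_measurable lborel"
   by (simp add: borel_measurable_continuous_onI)
 qed auto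
 thus ?thesis by (simp add: fourier_def[abs_def])
qed

section \<open>Poisson modes regularised by an exponential factor\<close>

text \<open>The bound x^2 near 0 makes the zero extensions differentiable there with derivative 0,
  and 1 / x^2 gives the decay at infinity. The factor 2 comes from min (x^2) (1 / x^2) <= 2 / (1 +
  x^2).\<close>

lemma quadratic_decay_C2_glue:
 fixes G0 G1 G2 :: "real => complex"
 assumes d0: "!!x. x > 0 ==> (G0 has_vector_derivative G1 x) (at x)"
  and d1: "!!x. x > 0 ==> (G1 has_vector_derivative G2 x) (at x)"
  and c2: "continuous_on {0<..} G2"
  and b: "!!x. x > 0 ==> norm (G0 x) <= C * min (x^2) (1 / x^2)"
   "!!x. x > 0 ==> norm (G1 x) <= C * min (x^2) (1 / x^2)"
   "!!x. x > 0 ==> norm (G2 x) <= C * min (x^2) (1 / x^2)"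
 shows "quadratic_decay_C2 (%x. if x > 0 then G0 x else 0) (%x. if x > 0 then G1 x else 0)
      (%x. if x > 0 then G2 x else 0) (2 * C)"
proof -
 have "norm (G0 1) <= C" using b(1)[of 1] by simp
 hence C: "C >= 0" using norm_ge_zero order_trans by blast
 have deriv: "((%x. if x > 0 then G x else 0) has_vector_derivative (if x > 0 then G' x else 0)) (at x)"
  if d: "!!x. x > 0 ==> (G has_vector_derivative G' x) (at x)" and bd: "!!x. x > 0 ==> norm (G x) <= C * min (x^2) (1 / x^2)"
  for G G' :: "real => complex" and x
 proof -
  consider "x > 0" | "x = 0" | "x < 0" by linarith
  thus ?thesis
  proof cases
   case 1
   hence "((%x. if x > 0 then G x else 0) has_vector_derivative G' x) (at x)"
    by (intro has_vector_derivative_transform_within_open[OF d[OF 1], of "{0<..}"]) auto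
   thus ?thesis using 1 by simp
  next
   case 3
   have "((%x. 0::complex) has_vector_derivative 0) (at x)" by simp
   hence "((%x. if x > 0 then G x else 0) has_vector_derivative 0) (at x)"
    by (rule has_vector_derivative_transform_within_open[of _ _ _ "{..<0}"]) (use 3 in auto)
   thus ?thesis using 3 by simp
  next
   case 2
   have "((%x. if x > 0 then G x else 0) has_derivative (%x. 0)) (at (0::real))"
   proof (rule has_derivativeI_sandwich[of 1 _ _ _ _ "%h. C * \<bar>h\<bar>"])
    fix h :: real assume "h ~= 0"
    show "norm ((if 0 < h then G h else 0) - (if 0 < (0::real) then G 0 else 0) - 0) / norm (h - 0) <= C * \<bar>h\<bar>"
    proof (cases "h > 0")
     case True
     have "norm (G h) <= C * h^2" using bd[OF True] mult_left_mono[OF min.cobounded1[of "h^2" "1 / h^2"] C] by linarith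
     thus ?thesis using True by (simp add: divide_simps power2_eq_square mult_ac)
    qed (use C in \<open>auto simp: mult_nonneg_nonpos\<close>)
   next
    have "((%h. C * \<bar>h\<bar>) \<longlongrightarrow> C * \<bar>0\<bar>) (at (0::real))" by (intro tendsto_intros)
    thus "((%h. C * \<bar>h\<bar>) \<longlongrightarrow> 0) (at (0::real))" by simp
   qed auto
   hence "((%x. if x > 0 then G x else 0) has_vector_derivative 0) (at 0)"
    by (simp add: has_vector_derivative_def)
   thus ?thesis using 2 by simp
  qed
 qed
 have bound: "norm (if x > 0 then G x else 0) <= 2 * C / (1 + x^2)"
  if bd: "!!x. x > 0 ==> norm (G x) <= C * min (x^2) (1 / x^2)" for G :: "real => complex" and x
 proof (cases "x > 0")
  case True
  have "min (x^2) (1 / x^2) <= 2 / (1 + x^2)"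
  proof (cases "x <= 1")
   case x1: True
   have "x^2 <= 1" using x1 True by (simp add: power_le_one)
   hence "x^2 * (1 + x^2) <= 1 * (1 + 1)" by (intro mult_mono) auto
   hence "x^2 <= 2 / (1 + x^2)" by (simp add: pos_le_divide_eq add_pos_nonneg)
   thus ?thesis by linarith
  next
   case False
   hence "x^2 >= 1" by (simp add: one_le_power)
   hence "1 / x^2 <= 2 / (1 + x^2)" using True by (simp add: divide_simps add_pos_nonneg)
   thus ?thesis by linarith
  qed
  from mult_left_mono[OF this C] bd[OF True] have "norm (G x) <= C * (2 / (1 + x^2))" by linarith
  thus ?thesis using True by (simp add: mult.commute)
 qed (use C in auto)
 have cont: "continuous_on UNIV (%x. if x > 0 then G2 x else 0)"
  unfolding continuous_on_eq_continuous_at[OF open_UNIV]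
 proof
  fix x :: real
  consider "x > 0" | "x = 0" | "x < 0" by linarith
  thus "isCont (%x. if x > 0 then G2 x else 0) x"
  proof cases
   case 1
   have "isCont G2 x" using c2 1 by (simp add: continuous_on_eq_continuous_at)
   moreover have "\<forall>\<^sub>F y in nhds x. (if y > 0 then G2 y else 0) = G2 y"
    using eventually_nhds_in_open[of "{0<..}" x] 1 by (auto elim!: eventually_mono)
   ultimately show ?thesis by (subst isCont_cong) auto
  next
   case 3
   have "\<forall>\<^sub>F y in nhds x. (if y > 0 then G2 y else 0) = 0"
    using eventually_nhds_in_open[of "{..<0}" x] 3 by (auto elim!: eventually_mono)
   thus ?thesis by (subst isCont_cong) auto
  next
   case 2
   have "((%x. if x > 0 then G2 x else 0) \<longlongrightarrow> 0) (at 0)"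
   proof (rule Lim_null_comparison)
    have "norm (if x > 0 then G2 x else 0) <= C * x^2" for x
     using b(3)[of x] mult_left_mono[OF min.cobounded1[of "x^2" "1 / x^2"] C] C by auto
    thus "\<forall>\<^sub>F x in at 0. norm (if x > 0 then G2 x else 0) <= C * x^2" by simp
    have "((%x. C * x^2) \<longlongrightarrow> C * 0^2) (at (0::real))" by (intro tendsto_intros)
    thus "((%x. C * x^2) \<longlongrightarrow> 0) (at (0::real))" by simp
   qed
   thus ?thesis using 2 by (simp add: isCont_def)
  qed
 qed
 show ?thesis
  by unfold_locales (use deriv[OF d0 b(1)] deriv[OF d1 b(2)] cont bound[OF b(1)] bound[OF b(2)] bound[OF b(3)] in auto)
qed

text \<open>For \<open>a\<close> = nu - 1 and \<open>P\<close> = \<open>P0\<close> this is the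
  \<open>k\<close>-th Poisson mode in d, as a function of m extended to real x and damped. Exponent
  and profile are left general because differentiation stays within this family.\<close>

definition tau :: "real => real => complex => (real => complex) => real => complex" where
 "tau k eps a P x = of_real x powr a * P (k / x) * of_real (exp (- eps * x))"

lemma tau_deriv:
 assumes x: "x > 0" and P: "!!y. (P has_vector_derivative P' y) (at y)"
 shows "(tau k eps a P has_vector_derivative
  (a * tau k eps (a - 1) P x - of_real k * tau k eps (a - 2) P' x - of_real eps * tau k eps a P x)) (at x)"
proof -
 have 1: "((%x. complex_of_real x powr a) has_vector_derivative a * of_real x powr (a - 1)) (at x)"
  by (rule has_vector_derivative_real_field) (use x in \<open>auto intro!: has_field_derivative_powr simp: complex_nonpos_Reals_iff\<close>)
 have "((%x. k / x) has_vector_derivative (- k / x^2)) (at x)"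
  using x by (auto intro!: derivative_eq_intros simp: power2_eq_square simp flip: has_real_derivative_iff_has_vector_derivative)
 from vector_diff_chain_at[OF this P] have 2: "((%x. P (k / x)) has_vector_derivative (- of_real k / (of_real x)^2) * P' (k / x)) (at x)"
  by (simp add: o_def scaleR_conv_of_real)
 have 3: "((%x. complex_of_real (exp (- eps * x))) has_vector_derivative of_real (- eps * exp (- eps * x))) (at x)"
  by (rule has_vector_derivative_of_real) (auto intro!: derivative_eq_intros simp flip: has_real_derivative_iff_has_vector_derivative)
 have p2: "complex_of_real x powr (a - 2) = of_real x powr a / (of_real x)^2"
  using x by (simp add: powr_diff)
 show ?thesis
  unfolding tau_def
  by (rule has_vector_derivative_eq_rhs[OF has_vector_derivative_mult[OF has_vector_derivative_mult[OF 1 2] 3]])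
   (simp add: p2 field_simps)
qed

lemma tau_continuous:
 assumes "continuous_on UNIV P"
 shows "continuous_on {0<..} (tau k eps a P)"
 unfolding tau_def
 by (intro continuous_intros continuous_on_compose2[OF assms]) (auto simp: complex_nonpos_Reals_iff)

lemma norm_tau: "x > 0 ==> norm (tau k eps a P x) = x powr Re a * norm (P (k / x)) * exp (- eps * x)"
 by (simp add: tau_def norm_mult norm_powr_real_powr)

lemma power_exp_neg_le:
 fixes y :: real
 assumes "y >= 0"
 shows "y ^ j * exp (- y) <= fact j"
proof -
 have "y ^ j <= fact j * exp y" using exp_ge_power_div_fact[OF assms, of j] by (simp add: field_simps)
 hence "y ^ j * exp (- y) <= fact j * exp y * exp (- y)" by (intro mult_right_mono) auto
 also have "fact j * exp y * exp (- y) = fact j" by (simp add: mult.assoc exp_minus_inverse)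
 finally show ?thesis .
qed

text \<open>Seven powers of decay of \<open>P\<close> become x^7 near 0, which outweighs x powr (-5)
  and leaves x^2. Beyond 1 the exponential provides 1 / x^2, at a price depending on eps; this is
  good enough for admitting a single mode to Poisson summation.\<close>

lemma tau_bound:
 assumes x: "x > 0" and k: "k >= 1" and e: "eps > 0" and a: "-5 <= Re a" "Re a <= 0"
  and P: "!!y. y > 0 ==> norm (P y) <= B" "!!y. y > 0 ==> norm (P y) <= B / y ^ 7"
 shows "norm (tau k eps a P x) <= B * (1 + 2 / eps\<^sup>2) * min (x^2) (1 / x^2)"
proof -
 have B: "B >= 0" using P(1)[of 1] norm_ge_zero[of "P 1"] by linarith
 have kx: "k / x > 0" using x k by simp
 show ?thesis
 proof (cases "x <= 1")
  case True
  have "norm (P (k / x)) <= B / (k / x) ^ 7" by (rule P(2)[OF kx])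
  also have "... = B * x ^ 7 / k ^ 7" by (simp add: power_divide)
  also have "... <= B * x ^ 7 / 1" using B x k by (intro divide_left_mono) (auto simp: one_le_power)
  also have "... = B * x ^ 7" by simp
  finally have p: "norm (P (k / x)) <= B * x ^ 7" .
  have xp: "x powr Re a * x ^ 7 = x powr (Re a + 7)"
   using x by (simp add: powr_add)
  have "x powr (Re a + 7) <= x powr 2" using x True a by (intro powr_mono') auto
  hence xp2: "x powr Re a * x ^ 7 <= x^2" using x unfolding xp by simp
  have "norm (tau k eps a P x) <= x powr Re a * (B * x ^ 7) * 1"
   unfolding norm_tau[OF x] using p x e B by (intro mult_mono) auto
  also have "... = B * (x powr Re a * x ^ 7)" by simp
  also have "... <= B * x^2" using xp2 B by (intro mult_left_mono)
  also have "... <= B * (1 + 2 / eps\<^sup>2) * x^2" using B by (intro mult_right_mono) (auto simp: mult_le_cancel_left1)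
  also have "x^2 = min (x^2) (1 / x^2)"
  proof -
   have "x^2 <= 1" using True x by (simp add: power_le_one)
   hence "x^2 * x^2 <= 1 * 1" by (intro mult_mono) auto
   hence "x^2 <= 1 / x^2" using x by (simp add: pos_le_divide_eq)
   thus ?thesis by simp
  qed
  finally show ?thesis .
 next
  case False
  have "x powr Re a <= x powr 0" using False a by (intro powr_mono) auto
  hence xa: "x powr Re a <= 1" using x by simp
  have "(eps * x) ^ 2 * exp (- (eps * x)) <= fact 2" using x e by (intro power_exp_neg_le) auto
  hence "eps\<^sup>2 * x^2 * exp (- eps * x) <= 2" by (simp add: power_mult_distrib)
  hence ex: "exp (- eps * x) <= 2 / eps\<^sup>2 * (1 / x^2)" using x e by (simp add: field_simps)
  have "norm (tau k eps a P x) <= 1 * B * (2 / eps\<^sup>2 * (1 / x^2))"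
   unfolding norm_tau[OF x] using xa P(1)[OF kx] ex B by (intro mult_mono) auto
  also have "... <= B * (1 + 2 / eps\<^sup>2) * (1 / x^2)" using B by (simp add: mult_left_mono divide_right_mono algebra_simps)
  also have "1 / x^2 = min (x^2) (1 / x^2)"
  proof -
   have "x^2 >= 1" using False by (simp add: one_le_power)
   hence "x^2 * x^2 >= 1 * 1" by (intro mult_mono) auto
   hence "1 / x^2 <= x^2" using x by (simp add: pos_divide_le_eq)
   thus ?thesis by simp
  qed
  finally show ?thesis .
 qed
qed

text \<open>The condition on \<open>a\<close> says that k^i eps^j x powr a has the size of x powr (r
  - 3) * (k / x)^i * (eps x)^j. The exponential absorbs the powers of eps x, so eps disappears from
  the bound, and the rest depends on x / k up to the factor k powr (r - 3). Integration over x will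
  give k powr (r - 2), which is summable because r < 1.\<close>

lemma tau_uniform_bound:
 assumes x: "x > 0" and k: "k > 0" and e: "eps > 0" and r: "0 < r" "r < 1"
  and a: "Re a = r - 3 - real i + real j" and ij: "i <= 2" "j <= 2"
  and P: "!!y. y > 0 ==> norm (P y) <= B" "!!y. y > 0 ==> norm (P y) <= B / y ^ 7"
 shows "norm (of_real (k ^ i * eps ^ j) * tau k eps a P x) <= 4 * B * k powr (r - 3) / (1 + (x / k)^2)"
proof -
 have B: "B >= 0" using P(1)[of 1] norm_ge_zero[of "P 1"] by linarith
 define w where "w = x / k"
 have w: "w > 0" "k / x = 1 / w" "x = k * w" using x k by (auto simp: w_def)
 have xpow: "x powr Re a = k powr (r - 3) * w powr (r - 3) * x ^ j / x ^ i"
 proof -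
  have "x powr Re a = x powr (r - 3) * x powr real j / x powr real i"
   unfolding a by (simp add: powr_add powr_diff)
  also have "x powr (r - 3) = k powr (r - 3) * w powr (r - 3)" unfolding w(3) using k w by (simp add: powr_mult)
  finally show ?thesis using x by (simp add: powr_realpow)
 qed
 have "norm (of_real (k ^ i * eps ^ j) * tau k eps a P x) =
   k powr (r - 3) * (w powr (r - 3) * (k / x) ^ i * norm (P (1 / w))) * ((eps * x) ^ j * exp (- (eps * x)))"
  unfolding norm_mult norm_tau[OF x] xpow w(2)[symmetric] using k e x
  by (simp add: power_divide power_mult_distrib abs_mult norm_mult norm_power)
 also have "... <= k powr (r - 3) * (w powr (r - 3) * (k / x) ^ i * norm (P (1 / w))) * 2"
 proof (intro mult_left_mono)
  have "(eps * x) ^ j * exp (- (eps * x)) <= fact j" using e x by (intro power_exp_neg_le) auto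
  also have "(fact j :: real) <= fact 2" by (rule fact_mono) fact
  finally show "(eps * x) ^ j * exp (- (eps * x)) <= 2" by simp
 qed (use w k x in auto)
 also have "w powr (r - 3) * (k / x) ^ i * norm (P (1 / w)) <= B * (2 / (1 + w^2))"
 proof (cases "w <= 1")
  case True
  have "norm (P (1 / w)) <= B * w ^ 7" using P(2)[of "1 / w"] w by (simp add: power_divide)
  hence "w powr (r - 3) * (k / x) ^ i * norm (P (1 / w)) <= w powr (r - 3) * (k / x) ^ i * (B * w ^ 7)"
   using w k x by (intro mult_left_mono) auto
  also have "... = B * (w powr (r - 3) * w ^ 7 / w ^ i)" using w by (simp add: power_divide)
  also have "w powr (r - 3) * w ^ 7 / w ^ i = w powr (r - 3) * w powr 7 / w powr real i"
   using w by (simp add: powr_realpow)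
  also have "... = w powr (r - 3 + 7 - real i)" by (simp only: powr_add powr_diff)
  also have "... <= w powr 0" using w True r ij by (intro powr_mono') auto
  also have "... <= 2 / (1 + w^2)" using w True power_le_one[of w 2] by (simp add: pos_le_divide_eq add_pos_nonneg)
  finally show ?thesis using B by (simp add: mult_left_mono)
 next
  case False
  have "w powr (r - 3) <= w powr (-2)" using False r by (intro powr_mono) auto
  also have "... = 1 / w^2" using w by (simp add: powr_minus divide_inverse powr_numeral)
  also have "... <= 2 / (1 + w^2)" using w False one_le_power[of w 2] by (simp add: divide_simps add_pos_nonneg)
  finally have 1: "w powr (r - 3) <= 2 / (1 + w^2)" .
  have "(k / x) ^ i <= 1" using w False by (intro power_le_one) (auto simp: divide_le_eq)
  hence "w powr (r - 3) * (k / x) ^ i * norm (P (1 / w)) <= (2 / (1 + w^2)) * 1 * B"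
   using 1 P(1)[of "1 / w"] w x k by (intro mult_mono) auto
  thus ?thesis by (simp add: mult_ac)
 qed
 hence "k powr (r - 3) * (w powr (r - 3) * (k / x) ^ i * norm (P (1 / w))) * 2 <= k powr (r - 3) * (B * (2 / (1 + w^2))) * 2"
  by (intro mult_right_mono mult_left_mono) auto
 finally show ?thesis by (simp add: w_def mult_ac)
qed

text \<open>Seven derivatives give the cosine transform the decay of order 7 on which
  \<open>tau_bound\<close> relies.\<close>

locale smooth_bump =
 fixes phi :: "real => complex" and lo hi :: real
 assumes ck: "ck_on 7 UNIV phi" and van: "vanishes_off lo hi phi" and lo: "0 < lo"
begin

lemma cont: "continuous_on UNIV phi" using ck_on_continuous[OF open_UNIV ck] .

lemma ck_t: "ck_on 7 UNIV f ==> ck_on 7 UNIV (%t. \<i> * of_real t * f t)"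
 by (rule ck_on_mult[OF open_UNIV ck_on_holomorphic[of UNIV "%z. \<i> * z"]]) (auto intro!: holomorphic_intros)

definition phi1 where "phi1 t = \<i> * of_real t * phi t"
definition phi2 where "phi2 t = \<i> * of_real t * phi1 t"

lemma ck1: "ck_on 7 UNIV phi1" and ck2: "ck_on 7 UNIV phi2"
 unfolding phi1_def[abs_def] phi2_def[abs_def] using ck by (auto intro!: ck_t)

lemma van1: "vanishes_off lo hi phi1" and van2: "vanishes_off lo hi phi2"
 using van by (auto simp: vanishes_off_def phi1_def phi2_def)

text \<open>\<open>P0\<close> is the cosine transform of \<open>phi\<close> at frequency 2 pi y;
  \<open>P1\<close> and \<open>P2\<close> are its first two derivatives. They come from the test
  functions \<open>phi1\<close> and \<open>phi2\<close>, which are as smooth as \<open>phi\<close>,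
  so all three profiles decay equally fast.\<close>

definition P0 where "P0 y = (fourier phi (of_real (2 * pi * y)) + fourier phi (of_real (- 2 * pi * y))) / 2"
definition P1 where "P1 y = of_real pi * (fourier phi1 (of_real (2 * pi * y)) - fourier phi1 (of_real (- 2 * pi * y)))"
definition P2 where "P2 y = 2 * of_real pi ^ 2 * (fourier phi2 (of_real (2 * pi * y)) + fourier phi2 (of_real (- 2 * pi * y)))"

lemma fourier_chain:
 assumes "continuous_on UNIV f" "vanishes_off a b f"
 shows "((%y. fourier f (of_real (c * y))) has_vector_derivative of_real c * fourier (%t. \<i> * of_real t * f t) (of_real (c * y))) (at y)"
proof -
 have "((%y. complex_of_real (c * y)) has_vector_derivative of_real c) (at y)"
  by (rule has_vector_derivative_of_real) (auto intro!: derivative_eq_intros simp flip: has_real_derivative_iff_has_vector_derivative)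
 from field_vector_diff_chain_at[OF this fourier_deriv[OF assms]] show ?thesis by (simp add: o_def)
qed

lemma P0_deriv: "(P0 has_vector_derivative P1 y) (at y)"
 unfolding P0_def[abs_def] P1_def phi1_def[abs_def]
 by (rule has_vector_derivative_eq_rhs[OF has_vector_derivative_divide[OF has_vector_derivative_add[OF
    fourier_chain[OF cont van] fourier_chain[OF cont van]]]]) (simp add: field_simps)

lemma P1_deriv: "(P1 has_vector_derivative P2 y) (at y)"
 unfolding P1_def[abs_def] P2_def phi2_def[abs_def]
 by (rule has_vector_derivative_eq_rhs[OF has_vector_derivative_mult_right[OF has_vector_derivative_diff[OF
    fourier_chain[OF ck_on_continuous[OF open_UNIV ck1] van1] fourier_chain[OF ck_on_continuous[OF open_UNIV ck1] van1]]]])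
  (simp add: algebra_simps power2_eq_square)

lemma cont_P: "continuous_on UNIV P0" "continuous_on UNIV P1" "continuous_on UNIV P2"
proof -
 show "continuous_on UNIV P0" "continuous_on UNIV P1"
  using vector_derivative_measurable(1)[OF P0_deriv] vector_derivative_measurable(1)[OF P1_deriv] by auto
 have c: "continuous_on UNIV (%y. fourier phi2 (of_real (c * y)))" for c
  using vector_derivative_measurable(1)[OF fourier_chain[OF ck_on_continuous[OF open_UNIV ck2] van2]] .
 show "continuous_on UNIV P2" unfolding P2_def[abs_def]
  by (intro continuous_on_mult continuous_on_add continuous_on_const c)
qed

lemma fourier_bound:
 assumes "ck_on 7 UNIV f" "vanishes_off a b f"
 shows "\<exists>B\<ge>0. \<forall>y. norm (fourier f (of_real y)) <= B \<and> (\<bar>y\<bar> * 1 > 0 --> norm (fourier f (of_real y)) <= B / \<bar>y\<bar> ^ 7)"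
proof -
 have "ck_on 0 UNIV f" using ck_on_le[OF open_UNIV _ assms(1)] by blast
 from fourier_decay[OF this assms(2)] obtain C0 where C0: "C0 >= 0" "!!y. norm (fourier f (of_real y)) <= C0" by auto
 from fourier_decay[OF assms] obtain C7 where C7: "C7 >= 0" "!!y. \<bar>y\<bar> ^ 7 * norm (fourier f (of_real y)) <= C7" by auto
 have "norm (fourier f (of_real y)) <= (C0 + C7) / \<bar>y\<bar> ^ 7" if "\<bar>y\<bar> > 0" for y
 proof -
  have "norm (fourier f (of_real y)) <= C7 / \<bar>y\<bar> ^ 7" using C7(2)[of y] that by (simp add: pos_le_divide_eq mult.commute)
  also have "... <= (C0 + C7) / \<bar>y\<bar> ^ 7" using C0 by (intro divide_right_mono) auto
  finally show ?thesis .
 qed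
 moreover have "norm (fourier f (of_real y)) <= C0 + C7" for y using C0(2)[of y] C7(1) by linarith
 ultimately show ?thesis using C0(1) C7(1) by (intro exI[of _ "C0 + C7"]) auto
qed

lemma two_pi_bound:
 assumes "B >= 0" "y > 0" "!!y. norm (fourier f (of_real y)) <= B \<and> (\<bar>y\<bar> * 1 > 0 --> norm (fourier f (of_real y)) <= B / \<bar>y\<bar> ^ 7)"
 shows "norm (fourier f (of_real (2 * pi * y))) <= B / y ^ 7" "norm (fourier f (of_real (- 2 * pi * y))) <= B / y ^ 7"
proof -
 have "2 * pi * y >= 1 * y" using assms(2) pi_gt3 by (intro mult_right_mono) auto
 hence "y ^ 7 <= (2 * pi * y) ^ 7" using assms(2) by (intro power_mono) auto
 hence le: "B / (2 * pi * y) ^ 7 <= B / y ^ 7" using assms by (intro divide_left_mono) auto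
 show "norm (fourier f (of_real (2 * pi * y))) <= B / y ^ 7"
  using assms(3)[of "2 * pi * y"] assms(2) le by (auto simp: abs_mult)
 show "norm (fourier f (of_real (- 2 * pi * y))) <= B / y ^ 7"
  using assms(3)[of "- 2 * pi * y"] assms(2) le by (auto simp: abs_mult)
qed

lemma P_bounds: "\<exists>B\<ge>0. \<forall>P\<in>{P0, P1, P2}. \<forall>y>0. norm (P y) <= B \<and> norm (P y) <= B / y ^ 7"
proof -
 obtain A0 where A0: "A0 >= 0" "!!y. norm (fourier phi (of_real y)) <= A0 \<and> (\<bar>y\<bar> * 1 > 0 --> norm (fourier phi (of_real y)) <= A0 / \<bar>y\<bar> ^ 7)"
  using fourier_bound[OF ck van] by blast
 obtain A1 where A1: "A1 >= 0" "!!y. norm (fourier phi1 (of_real y)) <= A1 \<and> (\<bar>y\<bar> * 1 > 0 --> norm (fourier phi1 (of_real y)) <= A1 / \<bar>y\<bar> ^ 7)"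
  using fourier_bound[OF ck1 van1] by blast
 obtain A2 where A2: "A2 >= 0" "!!y. norm (fourier phi2 (of_real y)) <= A2 \<and> (\<bar>y\<bar> * 1 > 0 --> norm (fourier phi2 (of_real y)) <= A2 / \<bar>y\<bar> ^ 7)"
  using fourier_bound[OF ck2 van2] by blast
 have pm: "norm (u + v) <= 2 * X" "norm (u - v) <= 2 * X" if "norm u <= X" "norm v <= X" for u v :: complex and X
  using norm_triangle_ineq[of u v] norm_triangle_ineq4[of u v] that by auto
 define B where "B = A0 + 2 * pi * A1 + 4 * pi^2 * A2"
 have 0: "norm (P0 y) <= X" if "norm (fourier phi (of_real (2 * pi * y))) <= X" "norm (fourier phi (of_real (- 2 * pi * y))) <= X" for y X
  using pm(1)[OF that] by (simp add: P0_def norm_divide)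
 have 1: "norm (P1 y) <= 2 * pi * X" if "norm (fourier phi1 (of_real (2 * pi * y))) <= X" "norm (fourier phi1 (of_real (- 2 * pi * y))) <= X" for y X
  using mult_left_mono[OF pm(2)[OF that], of pi] by (simp add: P1_def norm_mult)
 have 2: "norm (P2 y) <= 4 * pi^2 * X" if "norm (fourier phi2 (of_real (2 * pi * y))) <= X" "norm (fourier phi2 (of_real (- 2 * pi * y))) <= X" for y X
  using mult_left_mono[OF pm(1)[OF that], of "2 * pi^2"] by (simp add: P2_def norm_mult norm_power)
 have B: "A0 <= B" "2 * pi * A1 <= B" "4 * pi^2 * A2 <= B" using A0 A1 A2 by (auto simp: B_def)
 have "norm (P y) <= B \<and> norm (P y) <= B / y ^ 7" if "P \<in> {P0, P1, P2}" "y > 0" for P y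
 proof -
  have 00: "norm (P0 y) <= A0" "norm (P0 y) <= A0 / y ^ 7"
   using 0[OF A0(2)[THEN conjunct1] A0(2)[THEN conjunct1]] 0[OF two_pi_bound[OF A0(1) that(2) A0(2)]] by auto
  have 11: "norm (P1 y) <= 2 * pi * A1" "norm (P1 y) <= 2 * pi * (A1 / y ^ 7)"
   using 1[OF A1(2)[THEN conjunct1] A1(2)[THEN conjunct1]] 1[OF two_pi_bound[OF A1(1) that(2) A1(2)]] by auto
  have 22: "norm (P2 y) <= 4 * pi^2 * A2" "norm (P2 y) <= 4 * pi^2 * (A2 / y ^ 7)"
   using 2[OF A2(2)[THEN conjunct1] A2(2)[THEN conjunct1]] 2[OF two_pi_bound[OF A2(1) that(2) A2(2)]] by auto
  have D: "A0 / y ^ 7 <= B / y ^ 7" "(2 * pi * A1) / y ^ 7 <= B / y ^ 7" "(4 * pi^2 * A2) / y ^ 7 <= B / y ^ 7"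
   using B that(2) by (auto intro!: divide_right_mono)
  show ?thesis
  proof (intro conjI)
   show "norm (P y) <= B" using that(1) 00(1) 11(1) 22(1) B by auto
   show "norm (P y) <= B / y ^ 7" using that(1) 00(2) 11(2) 22(2) D by auto
  qed
 qed
 moreover have "B >= 0" using B(1) A0(1) by linarith
 ultimately show ?thesis by blast
qed

lemma P0_eq: "P0 y = (\<integral>t. phi t * of_real (cos (2 * pi * y * t)) \<partial>lborel)"
proof -
 have int: "integrable lborel (%t. phi t * exp (\<i> * of_real z * of_real t))" for z :: real
  by (rule integrable_vanishes_off[of _ lo hi]) (use van cont in \<open>auto simp: vanishes_off_def intro!: continuous_intros\<close>)
 have "P0 y = (\<integral>t. (phi t * exp (\<i> * of_real (2 * pi * y) * of_real t) + phi t * exp (\<i> * of_real (- 2 * pi * y) * of_real t)) / 2 \<partial>lborel)"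
  unfolding P0_def fourier_def using int by (simp add: Bochner_Integration.integral_add del: of_real_mult of_real_minus)
 also have "... = (\<integral>t. phi t * of_real (cos (2 * pi * y * t)) \<partial>lborel)"
  by (intro Bochner_Integration.integral_cong refl) (simp add: cos_exp_eq algebra_simps flip: cos_of_real)
 finally show ?thesis .
qed

text \<open>\<open>Q0\<close> is the damped mode; \<open>Q1\<close> and \<open>Q2\<close> are its
  derivatives as expanded by \<open>tau_deriv\<close>.\<close>

definition Q0 where "Q0 nu k eps = tau k eps (nu - 1) P0"
definition Q1 where "Q1 nu k eps x = (nu - 1) * tau k eps (nu - 2) P0 x - of_real k * tau k eps (nu - 3) P1 x - of_real eps * tau k eps (nu - 1) P0 x"
definition Q2 where "Q2 nu k eps x =
 (nu - 1) * ((nu - 2) * tau k eps (nu - 3) P0 x - of_real k * tau k eps (nu - 4) P1 x - of_real eps * tau k eps (nu - 2) P0 x)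
 - of_real k * ((nu - 3) * tau k eps (nu - 4) P1 x - of_real k * tau k eps (nu - 5) P2 x - of_real eps * tau k eps (nu - 3) P1 x)
 - of_real eps * ((nu - 1) * tau k eps (nu - 2) P0 x - of_real k * tau k eps (nu - 3) P1 x - of_real eps * tau k eps (nu - 1) P0 x)"

lemma Q0_deriv: "x > 0 ==> (Q0 nu k eps has_vector_derivative Q1 nu k eps x) (at x)"
 unfolding Q0_def Q1_def using tau_deriv[OF _ P0_deriv, of x k eps "nu - 1"] by (simp add: algebra_simps)

lemma Q1_deriv:
 assumes x: "x > 0"
 shows "(Q1 nu k eps has_vector_derivative Q2 nu k eps x) (at x)"
proof -
 have a: "nu - 2 - 1 = nu - 3" "nu - 2 - 2 = nu - 4" "nu - 3 - 1 = nu - 4" "nu - 3 - 2 = nu - 5" "nu - 1 - 1 = nu - 2" "nu - 1 - 2 = nu - 3"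
  by simp_all
 show ?thesis
  unfolding Q1_def[abs_def] Q2_def
  using tau_deriv[OF x P0_deriv, of k eps "nu - 2"] tau_deriv[OF x P1_deriv, of k eps "nu - 3"] tau_deriv[OF x P0_deriv, of k eps "nu - 1"]
  unfolding a by (intro has_vector_derivative_diff has_vector_derivative_mult_right)
qed

lemma Q2_continuous: "continuous_on {0<..} (Q2 nu k eps)"
 unfolding Q2_def[abs_def] by (intro continuous_intros tau_continuous cont_P)

lemma Q_decay:
 assumes nu: "0 < Re nu" "Re nu < 1" and k: "k >= 1" and e: "eps > 0"
 shows "\<exists>C. quadratic_decay_C2 (%x. if x > 0 then Q0 nu k eps x else 0) (%x. if x > 0 then Q1 nu k eps x else 0)
      (%x. if x > 0 then Q2 nu k eps x else 0) C"
proof -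
 obtain B where B: "B >= 0" "!!P y. P \<in> {P0, P1, P2} ==> y > 0 ==> norm (P y) <= B" "!!P y. P \<in> {P0, P1, P2} ==> y > 0 ==> norm (P y) <= B / y ^ 7"
  using P_bounds by blast
 define D where "D = B * (1 + 2 / eps\<^sup>2)"
 have D: "D >= 0" using B e by (simp add: D_def)
 define M where "M = (%x::real. D * min (x^2) (1 / x^2))"
 have M: "M x >= 0" for x using D by (auto simp: M_def)
 have t: "norm (c * tau k eps a P x) <= norm c * M x" if "x > 0" "-5 <= Re a" "Re a <= 0" "P \<in> {P0, P1, P2}" for x a c P
  unfolding norm_mult M_def D_def using that B k e by (intro mult_left_mono tau_bound) auto
 have t1: "norm (tau k eps a P x) <= M x" if "x > 0" "-5 <= Re a" "Re a <= 0" "P \<in> {P0, P1, P2}" for x a P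
  using t[OF that, of 1] by simp
 have tri: "norm (u - v - w) <= U + V + W" if "norm u <= U" "norm v <= V" "norm w <= W" for u v w :: complex and U V W
  using norm_triangle_ineq4[of "u - v" w] norm_triangle_ineq4[of u v] that by linarith
 define c1 where "c1 = norm (nu - 1) + norm (complex_of_real k) + norm (complex_of_real eps)"
 define c2 where "c2 = norm (nu - 1) * (norm (nu - 2) + norm (complex_of_real k) + norm (complex_of_real eps))
   + norm (complex_of_real k) * (norm (nu - 3) + norm (complex_of_real k) + norm (complex_of_real eps))
   + norm (complex_of_real eps) * (norm (nu - 1) + norm (complex_of_real k) + norm (complex_of_real eps))"
 have b0: "norm (Q0 nu k eps x) <= M x" if "x > 0" for x
  unfolding Q0_def using that nu by (intro t1) auto
 have b1: "norm (Q1 nu k eps x) <= c1 * M x" if "x > 0" for x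
  unfolding Q1_def c1_def distrib_right using that nu by (intro tri t) auto
 have b2: "norm (Q2 nu k eps x) <= c2 * M x" if "x > 0" for x
 proof -
  have n: "norm (c * u) <= norm c * U" if "norm u <= U" for c u :: complex and U
   using that by (simp add: norm_mult mult_left_mono)
  show ?thesis
   unfolding Q2_def c2_def distrib_right mult.assoc using that nu by (intro tri n t) auto
 qed
 have c: "c1 >= 0" "c2 >= 0" by (auto simp: c1_def c2_def)
 define C where "C = (1 + c1 + c2) * D"
 have le: "M x <= C * min (x^2) (1 / x^2)" "c1 * M x <= C * min (x^2) (1 / x^2)" "c2 * M x <= C * min (x^2) (1 / x^2)" for x
 proof -
  have eq: "C * min (x^2) (1 / x^2) = M x + c1 * M x + c2 * M x" by (simp add: C_def M_def algebra_simps)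
  have "c1 * M x >= 0" "c2 * M x >= 0" using c M by auto
  thus "M x <= C * min (x^2) (1 / x^2)" "c1 * M x <= C * min (x^2) (1 / x^2)" "c2 * M x <= C * min (x^2) (1 / x^2)"
   unfolding eq using M[of x] by linarith+
 qed
 show ?thesis
  using quadratic_decay_C2_glue[OF Q0_deriv Q1_deriv Q2_continuous order_trans[OF b0 le(1)] order_trans[OF b1 le(2)] order_trans[OF b2 le(3)]]
  by blast
qed

text \<open>The nine terms of \<open>Q2\<close> fall into six groups according to the monomial k^i
  eps^j in front, and each group satisfies the exponent condition of
  \<open>tau_uniform_bound\<close>.\<close>

lemma Q2_uniform:
 assumes nu: "0 < Re nu" "Re nu < 1"
 shows "\<exists>C\<ge>0. \<forall>k>0. \<forall>eps>0. \<forall>x>0. norm (Q2 nu k eps x) <= C * k powr (Re nu - 3) / (1 + (x / k)^2)"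
proof -
 obtain B where B: "B >= 0" "!!P y. P \<in> {P0, P1, P2} ==> y > 0 ==> norm (P y) <= B" "!!P y. P \<in> {P0, P1, P2} ==> y > 0 ==> norm (P y) <= B / y ^ 7"
  using P_bounds by blast
 define c where "c = norm ((nu - 1) * (nu - 2)) + norm (2 * (nu - 1)) + norm (2 * nu - 4) + 4"
 show ?thesis
 proof (intro exI[of _ "c * (4 * B)"] conjI allI impI)
  show "c * (4 * B) >= 0" using B by (simp add: c_def)
  fix k eps x :: real assume pos: "k > 0" "eps > 0" "x > 0"
  define M where "M = 4 * B * k powr (Re nu - 3) / (1 + (x / k)^2)"
  have M: "M >= 0" using B by (simp add: M_def)
  have t: "norm (of_real (k ^ i * eps ^ j) * tau k eps (nu - s) P x) <= M" if "s = 3 + of_nat i - of_nat j" "i <= 2" "j <= 2" "P \<in> {P0, P1, P2}" for i j s P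
   unfolding M_def using that pos nu B(2,3)[OF that(4)] by (intro tau_uniform_bound) auto
  have n: "norm (c * u) <= norm c * M" if "norm u <= M" for c u :: complex
   using that by (simp add: norm_mult mult_left_mono)
  define u1 where "u1 = of_real (k ^ 0 * eps ^ 0) * tau k eps (nu - 3) P0 x"
  define u2 where "u2 = of_real (k ^ 1 * eps ^ 0) * tau k eps (nu - 4) P1 x"
  define u3 where "u3 = of_real (k ^ 0 * eps ^ 1) * tau k eps (nu - 2) P0 x"
  define u4 where "u4 = of_real (k ^ 2 * eps ^ 0) * tau k eps (nu - 5) P2 x"
  define u5 where "u5 = of_real (k ^ 1 * eps ^ 1) * tau k eps (nu - 3) P1 x"
  define u6 where "u6 = of_real (k ^ 0 * eps ^ 2) * tau k eps (nu - 1) P0 x"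
  have u: "norm u1 <= M" "norm u2 <= M" "norm u3 <= M" "norm u4 <= M" "norm u5 <= M" "norm u6 <= M"
   unfolding u1_def u2_def u3_def u4_def u5_def u6_def by (rule t; simp)+
  have "Q2 nu k eps x = (nu - 1) * (nu - 2) * u1 - (2 * (nu - 1)) * u3 - (2 * nu - 4) * u2 + u4 + 2 * u5 + u6"
   unfolding Q2_def u1_def u2_def u3_def u4_def u5_def u6_def by (simp add: algebra_simps power2_eq_square)
  also have "norm ... <= norm ((nu - 1) * (nu - 2)) * M + norm (2 * (nu - 1)) * M + norm (2 * nu - 4) * M + M + norm (2::complex) * M + M"
   by (intro order_trans[OF norm_triangle_ineq] order_trans[OF norm_triangle_ineq4] add_mono n u)
  also have "... = c * M" by (simp add: c_def algebra_simps)
  finally show "norm (Q2 nu k eps x) <= c * (4 * B) * k powr (Re nu - 3) / (1 + (x / k)^2)"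
   by (simp add: M_def mult_ac)
 qed
qed

end

context quadratic_decay_C2
begin

text \<open>Two integrations by parts, with no boundary term at 0 since \<open>g\<close> and
  \<open>g1\<close> vanish there. The factor b^2 will cancel the weights 1 / l^2 of
  \<open>twisted_poisson\<close>.\<close>

lemma integral_g2_sin:
 "(\<integral>x. g2 x * of_real (sin (b * x)) \<partial>lborel) = - (of_real b)\<^sup>2 * (\<integral>x. g x * of_real (sin (b * x)) \<partial>lborel)"
proof -
 define F where "F = (%x. g1 x * of_real (sin (b * x)) - of_real b * (g x * of_real (cos (b * x))))"
 define f where "f = (%x. g2 x * of_real (sin (b * x)) + (of_real b)^2 * (g x * of_real (sin (b * x))))"
 have i2: "integrable lborel (%x. g2 x * of_real (sin (b * x)))"
  by (rule integrable_g2_bounded[where B = 1]) auto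
 have i0: "integrable lborel (%x. g x * of_real (sin (b * x)))"
 proof (rule integrable_quadratic_decay)
  fix x
  have "norm (g x * of_real (sin (b * x))) <= norm (g x) * 1" unfolding norm_mult by (intro mult_left_mono) auto
  thus "norm (g x * of_real (sin (b * x))) <= C / (1 + x^2)" using b0[of x] by linarith
 qed measurable
 have dF: "(F has_vector_derivative f x) (at x)" for x
 proof -
  have s: "((%x. complex_of_real (sin (b * x))) has_vector_derivative of_real (b * cos (b * x))) (at x)"
   by (rule has_vector_derivative_of_real) (auto intro!: derivative_eq_intros simp flip: has_real_derivative_iff_has_vector_derivative)
  have c: "((%x. complex_of_real (cos (b * x))) has_vector_derivative of_real (- b * sin (b * x))) (at x)"
   by (rule has_vector_derivative_of_real) (auto intro!: derivative_eq_intros simp flip: has_real_derivative_iff_has_vector_derivative)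
  show ?thesis unfolding F_def
   by (rule has_vector_derivative_eq_rhs[OF has_vector_derivative_diff[OF has_vector_derivative_mult[OF d1 s]
      has_vector_derivative_mult_right[OF has_vector_derivative_mult[OF d0 c]]]])
    (simp add: f_def algebra_simps power2_eq_square)
 qed
 have cf: "continuous_on UNIV f" unfolding f_def by (intro continuous_intros c2 c0)
 have intf: "integrable lborel f" unfolding f_def by (intro Bochner_Integration.integrable_add integrable_mult_right i2 i0)
 have "(%N. \<integral>x. indicator {0..real N} x *\<^sub>R f x \<partial>lborel) \<longlonglongrightarrow> (\<integral>x. f x \<partial>lborel)"
 proof (rule integral_dominated_convergence[where w = "%x. norm (f x)"])
  have "(%N. indicator {0..real N} x *\<^sub>R f x) \<longlonglongrightarrow> f x" for x
  proof (cases "x < 0")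
   case True
   hence "f x = 0" by (simp add: f_def z0 z2)
   thus ?thesis by simp
  next
   case False
   obtain N0 :: nat where "real N0 > x" using reals_Archimedean2 by blast
   have "\<forall>\<^sub>F N in sequentially. indicator {0..real N} x *\<^sub>R f x = f x"
    using eventually_ge_at_top[of N0]
   proof eventually_elim
    case (elim N)
    hence "x < real N" using \<open>real N0 > x\<close> by (meson of_nat_le_iff order_less_le_trans)
    thus ?case using False by (auto simp: indicator_def)
   qed
   thus ?thesis by (rule tendsto_eventually)
  qed
  thus "AE x in lborel. (%N. indicator {0..real N} x *\<^sub>R f x) \<longlonglongrightarrow> f x" by simp
  show m: "f \<in> borel_measurable lborel" using cf by (simp add: borel_measurable_continuous_onI)
  show "(%x. indicator {0..real N} x *\<^sub>R f x) \<in> borel_measurable lborel" for N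
   by (intro borel_measurable_scaleR m) auto
  show "integrable lborel (%x. norm (f x))" using intf by simp
 qed (auto simp: indicator_def)
 moreover have "(\<integral>x. indicator {0..real N} x *\<^sub>R f x \<partial>lborel) = F (real N) - F 0" for N
  by (rule integral_FTC_Icc) (use dF cf in \<open>auto intro: has_vector_derivative_at_within continuous_on_subset\<close>)
 moreover have "(%N. F (real N) - F 0) \<longlonglongrightarrow> 0 - F 0"
 proof (intro tendsto_diff tendsto_const)
  have gN: "(%N. g (real N)) \<longlonglongrightarrow> 0" "(%N. g1 (real N)) \<longlonglongrightarrow> 0"
   using tendsto_0_quadratic_decay[OF b0, of 1 0] tendsto_0_quadratic_decay[OF b1, of 1 0] by auto
  have lim: "(%N. u (real N) * of_real (v (real N))) \<longlonglongrightarrow> 0" if "(%N. u (real N)) \<longlonglongrightarrow> 0" "!!x. \<bar>v x\<bar> <= 1" for u :: "real => complex" and v :: "real => real"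
  proof (rule Lim_null_comparison)
   show "\<forall>\<^sub>F N in sequentially. norm (u (real N) * of_real (v (real N))) <= norm (u (real N))"
    using that(2) by (intro always_eventually) (auto simp: norm_mult mult_left_le)
   show "(%N. norm (u (real N))) \<longlonglongrightarrow> 0" using tendsto_norm[OF that(1)] by simp
  qed
  have "(%N. F (real N)) \<longlonglongrightarrow> 0 - of_real b * 0"
   unfolding F_def by (intro tendsto_diff tendsto_mult_left lim gN) auto
  thus "(%N. F (real N)) \<longlonglongrightarrow> 0" by simp
 qed
 ultimately have "(\<integral>x. f x \<partial>lborel) = 0 - F 0" using LIMSEQ_unique by simp
 hence "(\<integral>x. f x \<partial>lborel) = 0" by (simp add: F_def z0 z1)
 moreover have "(\<integral>x. f x \<partial>lborel) = (\<integral>x. g2 x * of_real (sin (b * x)) \<partial>lborel) + (of_real b)^2 * (\<integral>x. g x * of_real (sin (b * x)) \<partial>lborel)"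
  unfolding f_def using i2 i0 by (subst Bochner_Integration.integral_add) auto
 ultimately show ?thesis by (simp add: add_eq_0_iff)
qed

end

lemma integral_rescaled_quadratic:
 assumes "k > 0"
 shows "integrable lborel (%x::real. 1 / (1 + (x / k)^2))"
  "(\<integral>x. 1 / (1 + (x / k)^2) \<partial>lborel) = k * (\<integral>x. 1 / (1 + (x::real)^2) \<partial>lborel)"
proof -
 have "(\<integral>x. 1 / (1 + (x::real)^2) \<partial>lborel) = \<bar>1 / k\<bar> *\<^sub>R (\<integral>x. 1 / (1 + (0 + 1 / k * x)^2) \<partial>lborel)"
  using assms by (intro lborel_integral_real_affine) auto
 thus "(\<integral>x. 1 / (1 + (x / k)^2) \<partial>lborel) = k * (\<integral>x. 1 / (1 + (x::real)^2) \<partial>lborel)"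
  using assms by simp
 show "integrable lborel (%x::real. 1 / (1 + (x / k)^2))"
  using lborel_integrable_real_affine[OF integrable_inverse_1_plus_square'[of 1], of "1 / k" 0] assms by simp
qed

text \<open>The half-line integral of x powr (nu - 1) * exp (- eps x) * cos (c / x) * sin (b x),
  with both trigonometric factors resolved into exponentials so that every piece is a
  \<open>bessel_int\<close>. The cosine stems from Poisson summation in d, the sine from the twisted
  one in m.\<close>

definition osc_int :: "complex => real => real => real => complex" where
 "osc_int nu eps b c = (bessel_int nu (of_real eps - \<i> * of_real b) (- \<i> * of_real c) + bessel_int nu (of_real eps - \<i> * of_real b) (\<i> * of_real c)
   - bessel_int nu (of_real eps + \<i> * of_real b) (- \<i> * of_real c) - bessel_int nu (of_real eps + \<i> * of_real b) (\<i> * of_real c)) / (4 * \<i>)"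

definition osc_kern :: "complex => real => real => real => real => complex" where
 "osc_kern nu eps b c x = (bessel_kern nu (of_real eps - \<i> * of_real b) (- \<i> * of_real c) x + bessel_kern nu (of_real eps - \<i> * of_real b) (\<i> * of_real c) x
   - bessel_kern nu (of_real eps + \<i> * of_real b) (- \<i> * of_real c) x - bessel_kern nu (of_real eps + \<i> * of_real b) (\<i> * of_real c) x) / (4 * \<i>)"

lemma osc_kern_eq:
 assumes "x > 0"
 shows "osc_kern nu eps b c x = of_real x powr (nu - 1) * of_real (exp (- eps * x)) * of_real (cos (c / x)) * of_real (sin (b * x))"
proof -
 define A where "A = exp (\<i> * of_real (b * x))"
 define D where "D = exp (\<i> * of_real (c / x))"
 define W where "W = exp ((nu - 1) * of_real (ln x) - of_real (eps * x))"
 have e: "exp (- (\<i> * of_real (b * x))) = inverse A" "exp (- (\<i> * of_real (c / x))) = inverse D"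
  by (simp_all add: A_def D_def exp_minus)
 have 1: "bessel_kern nu (of_real eps - \<i> * of_real b) (- \<i> * of_real c) x = W * A * D"
  using assms unfolding bessel_kern_def W_def A_def D_def exp_add[symmetric] by (simp add: algebra_simps)
 have 2: "bessel_kern nu (of_real eps - \<i> * of_real b) (\<i> * of_real c) x = W * A * inverse D"
  using assms unfolding bessel_kern_def W_def A_def e[symmetric] exp_add[symmetric] by (simp add: algebra_simps)
 have 3: "bessel_kern nu (of_real eps + \<i> * of_real b) (- \<i> * of_real c) x = W * inverse A * D"
  using assms unfolding bessel_kern_def W_def D_def e[symmetric] exp_add[symmetric] by (simp add: algebra_simps)
 have 4: "bessel_kern nu (of_real eps + \<i> * of_real b) (\<i> * of_real c) x = W * inverse A * inverse D"
  using assms unfolding bessel_kern_def W_def e[symmetric] exp_add[symmetric] by (simp add: algebra_simps)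
 have c: "of_real (cos (c / x)) = (D + inverse D) / 2" unfolding D_def e(2)[symmetric, unfolded D_def]
  by (simp add: cos_exp_eq exp_minus flip: cos_of_real)
 have s: "of_real (sin (b * x)) = (A - inverse A) / (2 * \<i>)" unfolding A_def
  by (simp add: sin_exp_eq exp_minus flip: sin_of_real)
 have w: "of_real x powr (nu - 1) * of_real (exp (- eps * x)) = W"
  using assms by (simp add: W_def powr_def Ln_of_real exp_diff exp_minus exp_of_real[symmetric] divide_inverse)
 have r: "W * A * D + W * A * D' - W * A' * D - W * A' * D' = W * (D + D') * (A - A')" for A' D'
  by (simp add: algebra_simps)
 show ?thesis unfolding osc_kern_def 1 2 3 4 w c s r by simp
qed

lemma osc_kern_nonpos: "x <= 0 ==> osc_kern nu eps b c x = 0"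
 by (simp add: osc_kern_def bessel_kern_def)

lemma norm_osc_kern_le:
 "norm (osc_kern nu eps b c x) <= gamma_kern (Re nu) eps x"
proof -
 have k: "norm (bessel_kern nu a d x) <= gamma_kern (Re nu) eps x" if "Re a = eps" "Re d = 0" for a d
  using that by (intro norm_bessel_kern_le) auto
 have tri: "norm (u + v - w - z) <= 4 * G" if "norm u <= G" "norm v <= G" "norm w <= G" "norm z <= G" for u v w z :: complex and G
  using norm_triangle_ineq4[of "u + v - w" z] norm_triangle_ineq4[of "u + v" w] norm_triangle_ineq[of u v] that by linarith
 have "norm (osc_kern nu eps b c x) * 4 <= 4 * gamma_kern (Re nu) eps x"
  unfolding osc_kern_def norm_divide by (simp add: norm_mult) (intro tri k, auto)
 thus ?thesis by simp
qed

lemma integral_osc_kern: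
 assumes "0 < Re nu" "eps > 0"
 shows "(\<integral>x. osc_kern nu eps b c x \<partial>lborel) = osc_int nu eps b c"
proof -
 have i: "integrable lborel (bessel_kern nu a d)" if "Re a = eps" "Re d = 0" for a d
  using that assms by (intro integrable_bessel_kern) auto
 show ?thesis unfolding osc_kern_def osc_int_def bessel_int_def by (simp add: i)
qed

context smooth_bump
begin

text \<open>The cosine transform is inserted for \<open>P0\<close> and the integrals are exchanged;
  eps > 0 makes the double integral absolutely convergent, dominated by a Gamma kernel times norm
  (phi t).\<close>

lemma Q0_sin_integral:
 assumes nu: "0 < Re nu" and e: "eps > 0"
 shows "(\<integral>x. (if x > 0 then Q0 nu k eps x else 0) * of_real (sin (b * x)) \<partial>lborel) = (\<integral>t. phi t * osc_int nu eps b (2 * pi * k * t) \<partial>lborel)"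
proof -
 have mphi[measurable]: "phi \<in> borel_measurable borel" using cont by (rule borel_measurable_continuous_onI)
 have iphi: "integrable lborel phi" by (rule integrable_vanishes_off[OF cont van])
 define H where "H = (%x t. phi t * osc_kern nu eps b (2 * pi * k * t) x)"
 have mH[measurable]: "case_prod H \<in> borel_measurable (borel \<Otimes>\<^sub>M borel)"
  unfolding H_def osc_kern_def bessel_kern_def by measurable
 have bH: "norm (H x t) <= gamma_kern (Re nu) eps x * norm (phi t)" for x t
  unfolding H_def norm_mult by (subst mult.commute) (intro mult_right_mono norm_osc_kern_le norm_ge_zero)
 have iH: "integrable (lborel \<Otimes>\<^sub>M lborel) (case_prod H)"
 proof (rule lborel_pair.Fubini_integrable)
  show "case_prod H \<in> borel_measurable (lborel \<Otimes>\<^sub>M lborel)" using mH by simp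
  have i2: "integrable lborel (%t. H x t)" for x
  proof (rule Bochner_Integration.integrable_bound)
   show "integrable lborel (%t. gamma_kern (Re nu) eps x * norm (phi t))" using iphi by (intro integrable_mult_right integrable_norm)
   show "(%t. H x t) \<in> borel_measurable lborel" by simp
   show "AE t in lborel. norm (H x t) <= norm (gamma_kern (Re nu) eps x * norm (phi t))"
    using bH by (intro AE_I2) (auto simp: gamma_kern_nonneg)
  qed
  thus "AE x in lborel. integrable lborel (%t. case_prod H (x, t))" by simp
  show "integrable lborel (%x. \<integral>t. norm (case_prod H (x, t)) \<partial>lborel)"
  proof (rule Bochner_Integration.integrable_bound)
   show "integrable lborel (%x. gamma_kern (Re nu) eps x * (\<integral>t. norm (phi t) \<partial>lborel))"
    using nu e by (intro integrable_mult_left integrable_gamma_kern)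
   show "(%x. \<integral>t. norm (case_prod H (x, t)) \<partial>lborel) \<in> borel_measurable lborel" by measurable
   have "(\<integral>t. norm (H x t) \<partial>lborel) <= gamma_kern (Re nu) eps x * (\<integral>t. norm (phi t) \<partial>lborel)" for x
   proof -
    have "(\<integral>t. norm (H x t) \<partial>lborel) <= (\<integral>t. gamma_kern (Re nu) eps x * norm (phi t) \<partial>lborel)"
     using iphi by (intro integral_mono integrable_norm i2 integrable_mult_right bH)
    thus ?thesis by simp
   qed
   moreover have "(\<integral>t. norm (H x t) \<partial>lborel) >= 0" for x by simp
   ultimately show "AE x in lborel. norm (\<integral>t. norm (case_prod H (x, t)) \<partial>lborel) <= norm (gamma_kern (Re nu) eps x * (\<integral>t. norm (phi t) \<partial>lborel))"
    by (intro AE_I2) (auto simp: abs_of_nonneg gamma_kern_nonneg)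
  qed
 qed
 have "(\<integral>t. (\<integral>x. H x t \<partial>lborel) \<partial>lborel) = (\<integral>x. (\<integral>t. H x t \<partial>lborel) \<partial>lborel)"
  by (rule lborel_pair.Fubini_integral[OF iH])
 moreover have "(\<integral>x. H x t \<partial>lborel) = phi t * osc_int nu eps b (2 * pi * k * t)" for t
  unfolding H_def using nu e by (simp add: integral_osc_kern)
 moreover have "(\<integral>t. H x t \<partial>lborel) = (if x > 0 then Q0 nu k eps x else 0) * of_real (sin (b * x))" for x
 proof (cases "x > 0")
  case True
  have "(\<integral>t. H x t \<partial>lborel) = (\<integral>t. (of_real x powr (nu - 1) * of_real (exp (- eps * x)) * of_real (sin (b * x))) * (phi t * of_real (cos (2 * pi * (k / x) * t))) \<partial>lborel)"
   unfolding H_def osc_kern_eq[OF True] by (intro Bochner_Integration.integral_cong refl) (simp add: mult_ac)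
  also have "... = of_real x powr (nu - 1) * of_real (exp (- eps * x)) * of_real (sin (b * x)) * P0 (k / x)"
   unfolding P0_eq by (rule integral_mult_right_zero)
  finally show ?thesis using True by (simp add: Q0_def tau_def mult_ac)
 next
  case False
  thus ?thesis by (simp add: H_def osc_kern_nonpos)
 qed
 ultimately show ?thesis by simp
qed

end

text \<open>The outcome of inserting \<open>bessel_int_eq\<close> into \<open>osc_int\<close>,
  multiplied by sin (pi nu) / pi. For b, c > 0 it continues to make sense, and is continuous, at eps
  = 0, where the integral has lost its absolute convergence.\<close>

definition osc_form :: "complex => real => real => real => complex" where
 "osc_form nu eps b c =
  ((of_real eps - \<i> * of_real b) powr (- nu) * (bessel_E (- nu) ((of_real eps - \<i> * of_real b) * (- \<i> * of_real c)) + bessel_E (- nu) ((of_real eps - \<i> * of_real b) * (\<i> * of_real c)))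
  - (of_real eps + \<i> * of_real b) powr (- nu) * (bessel_E (- nu) ((of_real eps + \<i> * of_real b) * (- \<i> * of_real c)) + bessel_E (- nu) ((of_real eps + \<i> * of_real b) * (\<i> * of_real c)))
  - ((- \<i> * of_real c) powr nu * (bessel_E nu ((of_real eps - \<i> * of_real b) * (- \<i> * of_real c)) - bessel_E nu ((of_real eps + \<i> * of_real b) * (- \<i> * of_real c)))
    + (\<i> * of_real c) powr nu * (bessel_E nu ((of_real eps - \<i> * of_real b) * (\<i> * of_real c)) - bessel_E nu ((of_real eps + \<i> * of_real b) * (\<i> * of_real c)))))
  / (4 * \<i>)"

text \<open>The limit of \<open>osc_int\<close> as eps tends to 0, in closed form.\<close>

definition voronoi_X :: "complex => real => real => complex" where
 "voronoi_X nu b c = of_real pi / (4 * cos (of_real pi * nu / 2)) *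
  (of_real b powr (- nu) * (bessel_E (- nu) (of_real (b * c)) + bessel_E (- nu) (- of_real (b * c)))
   - of_real c powr nu * (bessel_E nu (of_real (b * c)) - bessel_E nu (- of_real (b * c))))"

lemma rGamma_reflect_nz:
 assumes "0 < Re nu" "Re nu < 1"
 shows "rGamma (1 - nu) * rGamma nu = sin (of_real pi * nu) / of_real pi" "sin (of_real pi * nu) ~= 0" "cos (of_real pi * nu / 2) ~= 0"
proof -
 show "rGamma (1 - nu) * rGamma nu = sin (of_real pi * nu) / of_real pi"
  using rGamma_reflection_complex[of nu] by (simp add: mult.commute)
 have "rGamma (1 - nu) ~= 0" "rGamma nu ~= 0"
  using assms by (auto simp: rGamma_eq_zero_iff elim!: nonpos_Ints_cases dest: arg_cong[of _ _ Re])
 thus s: "sin (of_real pi * nu) ~= 0"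
  using \<open>rGamma (1 - nu) * rGamma nu = _\<close> by auto
 have "sin (of_real pi * nu) = 2 * sin (of_real pi * nu / 2) * cos (of_real pi * nu / 2)"
  using sin_double[of "of_real pi * nu / 2"] by simp
 thus "cos (of_real pi * nu / 2) ~= 0" using s by auto
qed

lemma osc_int_eq_form:
 assumes "0 < Re nu" "Re nu < 1" "eps > 0" "c > 0"
 shows "osc_int nu eps b c * (sin (of_real pi * nu) / of_real pi) = osc_form nu eps b c"
proof -
 have e: "bessel_int nu a d * (sin (of_real pi * nu) / of_real pi) =
     a powr (- nu) * bessel_E (- nu) (a * d) - d powr nu * bessel_E nu (a * d)" if "Re a = eps" "Re d = 0" "d ~= 0" for a d
  using bessel_int_eq[of nu a d] assms that rGamma_reflect_nz(1)[OF assms(1,2)] by simp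
 have "osc_int nu eps b c * (sin (of_real pi * nu) / of_real pi) =
  (bessel_int nu (of_real eps - \<i> * of_real b) (- \<i> * of_real c) * (sin (of_real pi * nu) / of_real pi)
   + bessel_int nu (of_real eps - \<i> * of_real b) (\<i> * of_real c) * (sin (of_real pi * nu) / of_real pi)
   - bessel_int nu (of_real eps + \<i> * of_real b) (- \<i> * of_real c) * (sin (of_real pi * nu) / of_real pi)
   - bessel_int nu (of_real eps + \<i> * of_real b) (\<i> * of_real c) * (sin (of_real pi * nu) / of_real pi)) / (4 * \<i>)"
  unfolding osc_int_def by (simp only: times_divide_eq_left left_diff_distrib distrib_right)
 also have "... = osc_form nu eps b c"
 proof -
  have g: "(A * E1 - D1 * F1) + (A * E2 - D2 * F2) - (A' * E3 - D1 * F3) - (A' * E4 - D2 * F4)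
    = A * (E1 + E2) - A' * (E3 + E4) - (D1 * (F1 - F3) + D2 * (F2 - F4))" for A A' D1 D2 E1 E2 E3 E4 F1 F2 F3 F4 :: complex
   by (simp add: algebra_simps)
  have e1: "bessel_int nu (of_real eps - \<i> * of_real b) (- \<i> * of_real c) * (sin (of_real pi * nu) / of_real pi) =
    (of_real eps - \<i> * of_real b) powr (- nu) * bessel_E (- nu) ((of_real eps - \<i> * of_real b) * (- \<i> * of_real c))
    - (- \<i> * of_real c) powr nu * bessel_E nu ((of_real eps - \<i> * of_real b) * (- \<i> * of_real c))"
   by (rule e) (use assms in auto)
  have e2: "bessel_int nu (of_real eps - \<i> * of_real b) (\<i> * of_real c) * (sin (of_real pi * nu) / of_real pi) =
    (of_real eps - \<i> * of_real b) powr (- nu) * bessel_E (- nu) ((of_real eps - \<i> * of_real b) * (\<i> * of_real c))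
    - (\<i> * of_real c) powr nu * bessel_E nu ((of_real eps - \<i> * of_real b) * (\<i> * of_real c))"
   by (rule e) (use assms in auto)
  have e3: "bessel_int nu (of_real eps + \<i> * of_real b) (- \<i> * of_real c) * (sin (of_real pi * nu) / of_real pi) =
    (of_real eps + \<i> * of_real b) powr (- nu) * bessel_E (- nu) ((of_real eps + \<i> * of_real b) * (- \<i> * of_real c))
    - (- \<i> * of_real c) powr nu * bessel_E nu ((of_real eps + \<i> * of_real b) * (- \<i> * of_real c))"
   by (rule e) (use assms in auto)
  have e4: "bessel_int nu (of_real eps + \<i> * of_real b) (\<i> * of_real c) * (sin (of_real pi * nu) / of_real pi) =
    (of_real eps + \<i> * of_real b) powr (- nu) * bessel_E (- nu) ((of_real eps + \<i> * of_real b) * (\<i> * of_real c))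
    - (\<i> * of_real c) powr nu * bessel_E nu ((of_real eps + \<i> * of_real b) * (\<i> * of_real c))"
   by (rule e) (use assms in auto)
  show ?thesis unfolding osc_form_def by (simp only: e1 e2 e3 e4 g)
 qed
 finally show ?thesis .
qed

text \<open>The principal branches at +- i b and +- i c contribute the phases exp (+- i pi nu / 2).
  Their difference factors out as sin (pi nu / 2), and the double angle formula turns this into sin
  (pi nu) divided by 2 cos (pi nu / 2).\<close>

lemma osc_form_0:
 assumes "b > 0" "c > 0" "0 < Re nu" "Re nu < 1"
 shows "osc_form nu 0 b c = sin (of_real pi * nu) / of_real pi * voronoi_X nu b c"
proof -
 define E where "E = exp (\<i> * of_real pi * nu / 2)"
 have E: "E ~= 0" "exp (- (\<i> * of_real pi * nu / 2)) = inverse E" by (auto simp: E_def exp_minus)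
 have L1: "Ln (- (\<i> * of_real x)) = of_real (ln x) - \<i> * of_real pi / 2" if "x > 0" for x
  using that Ln_times_of_real[of x "- \<i>"] by (simp add: mult.commute Ln_of_real)
 have L2: "Ln (\<i> * of_real x) = of_real (ln x) + \<i> * of_real pi / 2" if "x > 0" for x
  using that Ln_times_of_real[of x "\<i>"] by (simp add: mult.commute Ln_of_real)
 have p1: "(- (\<i> * of_real x)) powr s = of_real x powr s * exp (- (\<i> * of_real pi * s / 2))" if "x > 0" for x s
  using that by (simp add: powr_def L1 Ln_of_real exp_add[symmetric] algebra_simps)
 have p2: "(\<i> * of_real x) powr s = of_real x powr s * exp (\<i> * of_real pi * s / 2)" if "x > 0" for x s
  using that by (simp add: powr_def L2 Ln_of_real exp_add[symmetric] algebra_simps)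
 have pb: "(- (\<i> * of_real b)) powr (- nu) = of_real b powr (- nu) * E" "(\<i> * of_real b) powr (- nu) = of_real b powr (- nu) * inverse E"
  using p1[of b "- nu"] p2[of b "- nu"] assms by (simp_all add: E_def exp_minus[symmetric])
 have pc: "(- (\<i> * of_real c)) powr nu = of_real c powr nu * inverse E" "(\<i> * of_real c) powr nu = of_real c powr nu * E"
  using p1[of c nu] p2[of c nu] assms by (simp_all add: E_def exp_minus[symmetric])
 have sn: "sin (of_real pi * nu / 2) = (E - inverse E) / (2 * \<i>)"
  by (simp add: sin_exp_eq E_def exp_minus mult_ac)
 have s2: "sin (of_real pi * nu) = 2 * sin (of_real pi * nu / 2) * cos (of_real pi * nu / 2)"
  using sin_double[of "of_real pi * nu / 2"] by simp
 have m: "(- (\<i> * of_real b)) * (- (\<i> * of_real c)) = - of_real (b * c)" "(- (\<i> * of_real b)) * (\<i> * of_real c) = of_real (b * c)"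
  "(\<i> * of_real b) * (- (\<i> * of_real c)) = of_real (b * c)" "(\<i> * of_real b) * (\<i> * of_real c) = - of_real (b * c)"
  by (simp_all add: algebra_simps)
 define u v w z where "u = bessel_E (- nu) (of_real (b * c))" and "v = bessel_E (- nu) (- of_real (b * c))"
  and "w = bessel_E nu (of_real (b * c))" and "z = bessel_E nu (- of_real (b * c))"
 define B C where "B = complex_of_real b powr (- nu)" and "C = complex_of_real c powr nu"
 have "osc_form nu 0 b c = (B * E * (v + u) - B * inverse E * (u + v) - (C * inverse E * (z - w) + C * E * (w - z))) / (4 * \<i>)"
  unfolding osc_form_def by (simp add: pb pc m u_def v_def w_def z_def B_def C_def del: of_real_mult)
 also have "B * E * (v + u) - B * E' * (u + v) - (C * E' * (z - w) + C * E * (w - z)) = (E - E') * (B * (u + v) - C * (w - z))" for E'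
  by (simp add: algebra_simps)
 also have "(E - inverse E) * (B * (u + v) - C * (w - z)) / (4 * \<i>) = ((E - inverse E) / (2 * \<i>)) / 2 * (B * (u + v) - C * (w - z))"
  by simp
 also have "... = sin (of_real pi * nu) / of_real pi * voronoi_X nu b c"
  unfolding sn[symmetric] s2 voronoi_X_def using rGamma_reflect_nz(3)[OF assms(3,4)]
  by (simp add: u_def v_def w_def z_def B_def C_def)
 finally show ?thesis .
qed

lemma continuous_on_bessel_E [continuous_intros]:
 assumes "continuous_on A f"
 shows "continuous_on A (%x. bessel_E mu (f x))"
proof -
 have "continuous_on UNIV (bessel_E mu)" by (simp add: continuous_on_eq_continuous_at continuous_bessel_E)
 from continuous_on_compose2[OF this assms] show ?thesis by simp
qed

lemma continuous_on_powr_const: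
 fixes f :: "'a :: topological_space => complex"
 assumes "continuous_on A f" "!!x. x \<in> A ==> f x \<notin> \<real>\<^sub>\<le>\<^sub>0"
 shows "continuous_on A (%x. f x powr s)"
proof (rule continuous_on_eq)
 show "continuous_on A (%x. exp (s * Ln (f x)))"
  by (intro continuous_on_exp continuous_on_mult continuous_on_const continuous_on_Ln' assms)
 show "exp (s * Ln (f x)) = f x powr s" if "x \<in> A" for x
  using assms(2)[OF that] by (auto simp: powr_def)
qed

lemma osc_form_continuous:
 assumes "b > 0" "c1 > 0"
 shows "continuous_on ({0..1} \<times> {c1..c2}) (%(eps, c). osc_form nu eps b c)"
proof -
 have 1: "of_real eps - \<i> * of_real b \<notin> \<real>\<^sub>\<le>\<^sub>0" "of_real eps + \<i> * of_real b \<notin> \<real>\<^sub>\<le>\<^sub>0" for eps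
  using assms by (auto simp: complex_nonpos_Reals_iff)
 have 2: "- \<i> * of_real (snd x) \<notin> \<real>\<^sub>\<le>\<^sub>0" "\<i> * of_real (snd x) \<notin> \<real>\<^sub>\<le>\<^sub>0" if "x \<in> {0..1} \<times> {c1..c2}" for x
  using assms that by (auto simp: complex_nonpos_Reals_iff)
 show ?thesis
  unfolding osc_form_def case_prod_beta
  by (intro continuous_on_divide continuous_on_diff continuous_on_add continuous_on_mult continuous_on_bessel_E
     continuous_on_powr_const continuous_on_const continuous_on_of_real continuous_on_fst continuous_on_snd continuous_on_id 1 2) auto
qed

context smooth_bump
begin

text \<open>The limit is taken in the closed form. The support of \<open>phi\<close> keeps
  \<open>c\<close> in a compact interval away from 0, and joint continuity for eps in [0, 1]
  supplies both the pointwise limit and the constant that dominates.\<close>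

lemma osc_limit:
 assumes nu: "0 < Re nu" "Re nu < 1" and b: "b > 0" and k: "k > 0"
 shows "(%n. \<integral>t. phi t * osc_int nu (1 / real (Suc n)) b (2 * pi * k * t) \<partial>lborel) \<longlonglongrightarrow> (\<integral>t. phi t * voronoi_X nu b (2 * pi * k * t) \<partial>lborel)"
proof -
 define kap where "kap = sin (of_real pi * nu) / complex_of_real pi"
 have kap: "kap ~= 0" using rGamma_reflect_nz(2)[OF nu] by (simp add: kap_def)
 define c1 c2 where "c1 = 2 * pi * k * lo" and "c2 = 2 * pi * k * hi"
 have c1: "c1 > 0" using k lo by (simp add: c1_def)
 let ?Z = "{0..1} \<times> {c1..c2}"
 have cf: "continuous_on ?Z (%(eps, c). osc_form nu eps b c)" by (rule osc_form_continuous[OF b c1])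
 hence "compact ((%(eps, c). osc_form nu eps b c) ` ?Z)"
  by (rule compact_continuous_image) (intro compact_Times compact_Icc)
 then obtain K where K: "!!eps c. eps \<in> {0..1} ==> c \<in> {c1..c2} ==> norm (osc_form nu eps b c) <= K"
  by (force dest!: compact_imp_bounded simp: bounded_iff)
 have supp: "2 * pi * k * t \<in> {c1..c2}" if "phi t ~= 0" for t
 proof -
  have "lo < t" "t < hi" using that van by (auto simp: vanishes_off_def not_le intro: ccontr)
  thus ?thesis using k by (auto simp: c1_def c2_def intro!: mult_left_mono)
 qed
 have mphi[measurable]: "phi \<in> borel_measurable borel" using cont by (rule borel_measurable_continuous_onI)
 have iphi: "integrable lborel phi" by (rule integrable_vanishes_off[OF cont van])
 define g where "g = (%eps t. phi t * osc_form nu eps b (2 * pi * k * t))"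
 have mg: "g eps \<in> borel_measurable lborel" if "eps \<in> {0..1}" for eps
 proof -
  have "continuous_on {lo..hi} (%t. osc_form nu eps b (2 * pi * k * t))"
  proof -
   have 1: "continuous_on {lo..hi} (%t. (eps, 2 * pi * k * t))" by (intro continuous_intros)
   have 2: "(%t. (eps, 2 * pi * k * t)) ` {lo..hi} \<subseteq> ?Z" using that k by (auto simp: c1_def c2_def mult_left_mono)
   from continuous_on_compose2[OF cf 1 2] show ?thesis by simp
  qed
  hence "(%t. indicator {lo..hi} t *\<^sub>R osc_form nu eps b (2 * pi * k * t)) \<in> borel_measurable borel"
   by (intro borel_measurable_continuous_on_indicator) auto
  hence "(%t. phi t * (indicator {lo..hi} t *\<^sub>R osc_form nu eps b (2 * pi * k * t))) \<in> borel_measurable borel" by measurable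
  also have "(%t. phi t * (indicator {lo..hi} t *\<^sub>R osc_form nu eps b (2 * pi * k * t))) = g eps"
   using van by (auto simp: fun_eq_iff g_def indicator_def vanishes_off_def)
  finally show ?thesis by simp
 qed
 have e01: "1 / real (Suc n) \<in> {0..1}" for n by (simp add: divide_simps)
 have "(%n. \<integral>t. g (1 / real (Suc n)) t \<partial>lborel) \<longlonglongrightarrow> (\<integral>t. g 0 t \<partial>lborel)"
 proof (rule integral_dominated_convergence[where w = "%t. K * norm (phi t)"])
  show "g 0 \<in> borel_measurable lborel" by (rule mg) simp
  show "g (1 / real (Suc n)) \<in> borel_measurable lborel" for n by (rule mg[OF e01])
  show "integrable lborel (%t. K * norm (phi t))" using iphi by (intro integrable_mult_right integrable_norm)
  have "norm (g (1 / real (Suc n)) t) <= K * norm (phi t)" for n t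
  proof (cases "phi t = 0")
   case False
   show ?thesis unfolding g_def norm_mult by (subst mult.commute) (intro mult_right_mono K[OF e01 supp[OF False]] norm_ge_zero)
  qed (simp add: g_def)
  thus "AE t in lborel. norm (g (1 / real (Suc n)) t) <= K * norm (phi t)" for n by simp
  have "(%n. g (1 / real (Suc n)) t) \<longlonglongrightarrow> g 0 t" for t
  proof (cases "phi t = 0")
   case False
   define c where "c = 2 * pi * k * t"
   have c: "c \<in> {c1..c2}" unfolding c_def by (rule supp[OF False])
   have "continuous_on {0..1} (%eps. osc_form nu eps b c)"
   proof -
    have 1: "continuous_on {0..1} (%eps. (eps, c))" by (intro continuous_intros)
    have 2: "(%eps. (eps, c)) ` {0..1} \<subseteq> ?Z" using c by auto
    from continuous_on_compose2[OF cf 1 2] show ?thesis by simp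
   qed
   hence "(%n. osc_form nu (1 / real (Suc n)) b c) \<longlonglongrightarrow> osc_form nu 0 b c"
    using LIMSEQ_inverse_real_of_nat e01
    by (intro continuous_on_tendsto_compose[of "{0..1}" "%eps. osc_form nu eps b c"]) (auto simp: inverse_eq_divide simp del: of_nat_Suc)
   thus ?thesis unfolding g_def c_def by (intro tendsto_mult tendsto_const)
  qed (simp add: g_def)
  thus "AE t in lborel. (%n. g (1 / real (Suc n)) t) \<longlonglongrightarrow> g 0 t" by simp
 qed
 hence "(%n. inverse kap * (\<integral>t. g (1 / real (Suc n)) t \<partial>lborel)) \<longlonglongrightarrow> inverse kap * (\<integral>t. g 0 t \<partial>lborel)"
  by (intro tendsto_mult tendsto_const)
 moreover have "inverse kap * (\<integral>t. g (1 / real (Suc n)) t \<partial>lborel) = (\<integral>t. phi t * osc_int nu (1 / real (Suc n)) b (2 * pi * k * t) \<partial>lborel)" for n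
 proof -
  have "inverse kap * g (1 / real (Suc n)) t = phi t * osc_int nu (1 / real (Suc n)) b (2 * pi * k * t)" for t
  proof (cases "phi t = 0")
   case False
   have "2 * pi * k * t > 0" using supp[OF False] c1 by auto
   from osc_int_eq_form[OF nu _ this, of "1 / real (Suc n)" b] kap show ?thesis by (simp add: g_def kap_def[symmetric] del: of_nat_Suc) (simp add: field_simps)
  qed (simp add: g_def)
  thus ?thesis by (simp only: integral_mult_right_zero[symmetric])
 qed
 moreover have "inverse kap * (\<integral>t. g 0 t \<partial>lborel) = (\<integral>t. phi t * voronoi_X nu b (2 * pi * k * t) \<partial>lborel)"
 proof -
  have "inverse kap * g 0 t = phi t * voronoi_X nu b (2 * pi * k * t)" for t
  proof (cases "phi t = 0")
   case False
   have "2 * pi * k * t > 0" using supp[OF False] c1 by auto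
   from osc_form_0[OF b this nu] kap show ?thesis by (simp add: g_def kap_def[symmetric])
  qed (simp add: g_def)
  thus ?thesis by (simp only: integral_mult_right_zero[symmetric])
 qed
 ultimately show ?thesis by simp
qed

end

section \<open>Interchange of summations and Abel regularisation of the L-series\<close>

lemma infsum_eq_suminf:
 fixes g :: "nat => 'a :: banach"
 assumes "summable (%n. norm (g n))"
 shows "infsum g UNIV = suminf g"
 by (rule infsumI) (rule norm_summable_imp_has_sum[OF assms summable_sums[OF summable_norm_cancel[OF assms]]])

lemma product_bound_summable_on:
 fixes f :: "nat => nat => 'a :: banach"
 assumes u: "summable u" "!!m. u m >= 0" and v: "summable v" "!!k. v k >= 0"
  and f: "!!m k. norm (f m k) <= u m * v k"
 shows "(%p. norm (case p of (m, k) => f m k)) summable_on UNIV \<times> UNIV"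
proof -
 have us: "u summable_on UNIV" and vs: "v summable_on UNIV"
  using u v by (auto simp: summable_on_UNIV_nonneg_real_iff)
 have "(%p. norm (case p of (m, k) => u m * v k)) summable_on UNIV \<times> UNIV"
  unfolding Infinite_Sum.abs_summable_on_Sigma_iff
 proof (intro conjI ballI)
  show "(%k. norm (case (m, k) of (m, k) => u m * v k)) summable_on UNIV" for m
   using summable_on_cmult_right[OF vs, of "u m"] u v by (simp add: abs_mult)
  have e: "(\<Sum>\<^sub>\<infinity>k. norm (case (m, k) of (m, k) => u m * v k)) = u m * infsum v UNIV" for m
   using u v by (simp add: abs_mult infsum_cmult_right' abs_of_nonneg)
  have "infsum v UNIV >= 0" using v by (intro infsum_nonneg) auto
  thus "(%m. norm (\<Sum>\<^sub>\<infinity>k. norm (case (m, k) of (m, k) => u m * v k))) summable_on UNIV"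
   unfolding e using summable_on_cmult_left[OF us, of "infsum v UNIV"] u by (simp add: abs_mult abs_of_nonneg)
 qed
 thus ?thesis
  by (rule Infinite_Sum.abs_summable_on_comparison_test) (use f u v in \<open>auto simp: abs_mult abs_of_nonneg\<close>)
qed

text \<open>A product majorant gives unconditional summability over pairs, from which the
  interchange for ordered sums is read off.\<close>

lemma suminf_swap:
 fixes f :: "nat => nat => 'a :: banach"
 assumes u: "summable u" "!!m. u m >= 0" and v: "summable v" "!!k. v k >= 0"
  and f: "!!m k. norm (f m k) <= u m * v k"
 shows "(\<Sum>m. \<Sum>k. f m k) = (\<Sum>k. \<Sum>m. f m k)"
proof -
 have sk: "summable (%k. norm (f m k))" for m
  by (rule summable_comparison_test'[OF summable_mult[OF v(1), of "u m"]]) (use f in auto)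
 have sm: "summable (%m. norm (f m k))" for k
  by (rule summable_comparison_test'[OF summable_mult2[OF u(1), of "v k"]]) (use f in auto)
 have b1: "norm (\<Sum>k. f m k) <= u m * suminf v" for m
 proof -
  have "norm (\<Sum>k. f m k) <= (\<Sum>k. norm (f m k))" by (rule summable_norm[OF sk])
  also have "... <= (\<Sum>k. u m * v k)" by (rule suminf_le[OF f sk summable_mult[OF v(1)]])
  finally show ?thesis using v by (simp add: suminf_mult)
 qed
 have b2: "norm (\<Sum>m. f m k) <= suminf u * v k" for k
 proof -
  have "norm (\<Sum>m. f m k) <= (\<Sum>m. norm (f m k))" by (rule summable_norm[OF sm])
  also have "... <= (\<Sum>m. u m * v k)" by (rule suminf_le[OF f sm summable_mult2[OF u(1)]])
  finally show ?thesis using u by (simp add: suminf_mult2)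
 qed
 have s1: "summable (%m. norm (\<Sum>k. f m k))"
  by (rule summable_comparison_test'[OF summable_mult2[OF u(1), of "suminf v"]]) (use b1 in auto)
 have s2: "summable (%k. norm (\<Sum>m. f m k))"
  by (rule summable_comparison_test'[OF summable_mult[OF v(1), of "suminf u"]]) (use b2 in auto)
 have "(%(m, k). f m k) summable_on UNIV \<times> UNIV"
  by (rule abs_summable_summable[OF product_bound_summable_on[OF u v f]])
 from infsum_swap_banach[OF this]
 have "(\<Sum>\<^sub>\<infinity>m. \<Sum>\<^sub>\<infinity>k. f m k) = (\<Sum>\<^sub>\<infinity>k. \<Sum>\<^sub>\<infinity>m. f m k)" .
 thus ?thesis by (simp add: infsum_eq_suminf sk sm s1 s2)
qed

context odd_primitive_char
begin

definition char_sum :: "nat => complex" where "char_sum N = (\<Sum>m<N. chi m)"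

text \<open>A full period sums to 0, so only an incomplete one counts.\<close>

lemma norm_char_sum_le: "norm (char_sum N) <= real q"
proof -
 have per: "char_sum (q + N) = char_sum N" for N
 proof -
  have "(\<Sum>m\<in>{0..<q}. chi m) + (\<Sum>m\<in>{q..<q + N}. chi m) = (\<Sum>m\<in>{0..<q + N}. chi m)"
   by (rule sum.atLeastLessThan_concat) auto
  hence "char_sum (q + N) = (\<Sum>m<q. chi m) + (\<Sum>m\<in>{q..<q + N}. chi m)"
   by (simp add: char_sum_def atLeast0LessThan)
  also have "(\<Sum>m\<in>{q..<q + N}. chi m) = (\<Sum>m<N. chi (m + q))"
   using sum.shift_bounds_nat_ivl[of chi 0 q N] by (simp add: atLeast0LessThan add.commute)
  also have "... = char_sum N"
   unfolding char_sum_def by (intro sum.cong refl chi_cong) (simp add: cong_def)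
  finally show ?thesis by (simp add: sum_chi)
 qed
 show ?thesis
 proof (induction N rule: less_induct)
  case (less N)
  show ?case
  proof (cases "N < q")
   case True
   have "norm (char_sum N) <= (\<Sum>m<N. norm (chi m))" unfolding char_sum_def by (rule norm_sum)
   also have "... <= (\<Sum>m<N. 1)" by (intro sum_mono norm_dirichlet_char_le[OF char])
   finally show ?thesis using True by simp
  next
   case False
   thus ?thesis using less[of "N - q"] per[of "N - q"] q_pos by simp
  qed
 qed
qed

lemma summation_by_parts:
 "(\<Sum>m<N. chi m * u m) = (\<Sum>m<N. char_sum (Suc m) * (u m - u (Suc m))) + char_sum N * u N"
 by (induction N) (auto simp: char_sum_def algebra_simps)

definition abel_term :: "complex => real => nat => complex" where
 "abel_term nu eps m = of_nat m powr (nu - 1) * of_real (exp (- eps * real m))"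

text \<open>The mean value inequality is combined with eps x * exp (- eps x) <= 1, which removes eps
  from the bound on the derivative.\<close>

lemma abel_term_diff_bound:
 assumes nu: "0 < Re nu" "Re nu < 1" and e: "eps >= 0" and m: "m >= 1"
 shows "norm (abel_term nu eps m - abel_term nu eps (Suc m)) <= (norm (nu - 1) + 1) * real m powr (Re nu - 2)"
proof -
 define f where "f = (%x. of_real x powr (nu - 1) * complex_of_real (exp (- eps * x)))"
 define f' where "f' = (%x. of_real x powr (nu - 1) * complex_of_real (- eps * exp (- eps * x)) + (nu - 1) * of_real x powr (nu - 1 - 1) * complex_of_real (exp (- eps * x)))"
 define B where "B = (norm (nu - 1) + 1) * real m powr (Re nu - 2)"
 have der: "(f has_vector_derivative f' x) (at x)" if "x > 0" for x
 proof -
  have 1: "((%x. complex_of_real x powr (nu - 1)) has_vector_derivative (nu - 1) * of_real x powr (nu - 1 - 1)) (at x)"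
   by (rule has_vector_derivative_real_field, rule has_field_derivative_powr) (use that in \<open>auto simp: complex_nonpos_Reals_iff\<close>)
  have 3: "((%x. complex_of_real (exp (- eps * x))) has_vector_derivative of_real (- eps * exp (- eps * x))) (at x)"
   by (rule has_vector_derivative_of_real) (auto intro!: derivative_eq_intros simp flip: has_real_derivative_iff_has_vector_derivative)
  show ?thesis unfolding f_def f'_def by (rule has_vector_derivative_mult[OF 1 3])
 qed
 have bd: "norm (f' x) <= B" if "x >= real m" for x
 proof -
  have x: "x > 0" "x >= 1" using that m by auto
  have y: "eps * x * exp (- (eps * x)) <= 1" using power_exp_neg_le[of "eps * x" 1] e x by simp
  have "x powr (Re nu - 1) = x powr (Re nu - 2) * x"
   using x powr_add[of x "Re nu - 2" 1] by simp
  hence "x powr (Re nu - 1) * (eps * exp (- eps * x)) = x powr (Re nu - 2) * (eps * x * exp (- (eps * x)))" by simp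
  also have "... <= x powr (Re nu - 2) * 1" by (intro mult_left_mono y) auto
  finally have a: "x powr (Re nu - 1) * (eps * exp (- eps * x)) <= x powr (Re nu - 2)" by simp
  have "exp (- eps * x) <= 1" using e x by simp
  hence b: "norm (nu - 1) * x powr (Re nu - 2) * exp (- eps * x) <= norm (nu - 1) * x powr (Re nu - 2)"
   by (intro mult_left_le) auto
  have "norm (f' x) <= x powr (Re nu - 1) * (eps * exp (- eps * x)) + norm (nu - 1) * x powr (Re nu - 2) * exp (- eps * x)"
   unfolding f'_def by (rule order_trans[OF norm_triangle_ineq]) (use x e in \<open>simp add: norm_mult norm_powr_real_powr abs_mult\<close>)
  also have "... <= x powr (Re nu - 2) + norm (nu - 1) * x powr (Re nu - 2)" using a b by linarith
  also have "... = (norm (nu - 1) + 1) * x powr (Re nu - 2)" by (simp add: algebra_simps)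
  also have "... <= B" unfolding B_def
  proof (intro mult_left_mono)
   show "x powr (Re nu - 2) <= real m powr (Re nu - 2)" using that m nu by (intro powr_mono2') auto
  qed auto
  finally show ?thesis .
 qed
 have "norm (f (real (Suc m)) - f (real m)) <= B * real (Suc m) - B * real m"
 proof (rule differentiable_bound_general[of "real m" "real (Suc m)" f "%x. B * x" f' "%x. B"])
  show "continuous_on {real m..real (Suc m)} f"
   using m by (intro continuous_at_imp_continuous_on ballI has_vector_derivative_continuous[OF der]) auto
  show "((%x. B * x) has_vector_derivative B) (at x)" for x
   by (auto intro!: derivative_eq_intros simp flip: has_real_derivative_iff_has_vector_derivative)
 qed (use der bd m in \<open>auto intro!: continuous_intros\<close>)
 also have "B * real (Suc m) - B * real m = B" by (simp add: algebra_simps)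
 finally show ?thesis by (simp add: f_def abel_term_def B_def norm_minus_commute)
qed

lemma abel_summable_bound:
 assumes "0 < Re nu" "Re nu < 1"
 shows "summable (%m. real q * ((norm (nu - 1) + 1) * real m powr (Re nu - 2)))"
 using assms by (intro summable_mult) (simp add: summable_real_powr_iff)

lemma abel_term_bound:
 assumes nu: "0 < Re nu" "Re nu < 1" and e: "eps >= 0"
 shows "norm (char_sum (Suc m) * (abel_term nu eps m - abel_term nu eps (Suc m))) <= real q * ((norm (nu - 1) + 1) * real m powr (Re nu - 2))"
proof (cases "m = 0")
 case True
 thus ?thesis by (simp add: char_sum_def chi_0)
next
 case False
 thus ?thesis unfolding norm_mult
  using abel_term_diff_bound[OF nu e, of m] by (intro mult_mono norm_char_sum_le) auto
qed

lemma abel_sums: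
 assumes nu: "0 < Re nu" "Re nu < 1" and e: "eps >= 0"
 shows "(%m. chi m * abel_term nu eps m) sums (\<Sum>m. char_sum (Suc m) * (abel_term nu eps m - abel_term nu eps (Suc m)))"
proof -
 have "summable (%m. char_sum (Suc m) * (abel_term nu eps m - abel_term nu eps (Suc m)))"
  by (rule summable_comparison_test'[OF abel_summable_bound[OF nu]]) (rule abel_term_bound[OF nu e])
 hence "(%N. \<Sum>m<N. char_sum (Suc m) * (abel_term nu eps m - abel_term nu eps (Suc m))) \<longlonglongrightarrow> (\<Sum>m. char_sum (Suc m) * (abel_term nu eps m - abel_term nu eps (Suc m)))"
  by (rule summable_LIMSEQ)
 moreover have "(%N. char_sum N * abel_term nu eps N) \<longlonglongrightarrow> 0"
 proof (rule Lim_null_comparison)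
  show "\<forall>\<^sub>F N in sequentially. norm (char_sum N * abel_term nu eps N) <= real q * real N powr (Re nu - 1)"
   using eventually_gt_at_top[of 0]
  proof eventually_elim
   case (elim N)
   have "norm (abel_term nu eps N) = real N powr (Re nu - 1) * exp (- eps * real N)"
    using norm_powr_real_powr[of "of_nat N" "nu - 1"] by (simp add: abel_term_def norm_mult)
   also have "... <= real N powr (Re nu - 1)" using e by (intro mult_left_le) auto
   finally show ?case unfolding norm_mult by (intro mult_mono norm_char_sum_le) auto
  qed
  show "(%N. real q * real N powr (Re nu - 1)) \<longlonglongrightarrow> 0" using nu by real_asymp
 qed
 ultimately have "(%N. (\<Sum>m<N. char_sum (Suc m) * (abel_term nu eps m - abel_term nu eps (Suc m))) + char_sum N * abel_term nu eps N)
  \<longlonglongrightarrow> (\<Sum>m. char_sum (Suc m) * (abel_term nu eps m - abel_term nu eps (Suc m))) + 0" by (rule tendsto_add)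
 thus ?thesis unfolding sums_def summation_by_parts by simp
qed

text \<open>The series for L (1 - nu) converges only conditionally. Summation by parts gives the
  damped and the undamped series a common summable majorant, so that the damping can be removed
  termwise.\<close>

lemma abel_limit:
 assumes nu: "0 < Re nu" "Re nu < 1"
 shows "(%n. \<Sum>m. chi m * abel_term nu (1 / real (Suc n)) m) \<longlonglongrightarrow> dirichlet_L chi (1 - nu)"
proof -
 have z: "(%n. 1 / real (Suc n)) \<longlonglongrightarrow> 0"
  using LIMSEQ_inverse_real_of_nat by (simp add: inverse_eq_divide del: of_nat_Suc)
 have t: "(%n. abel_term nu (1 / real (Suc n)) m) \<longlonglongrightarrow> abel_term nu 0 m" for m
 proof -
  have "(%n. abel_term nu (1 / real (Suc n)) m) \<longlonglongrightarrow> of_nat m powr (nu - 1) * of_real (exp (- 0 * real m))"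
   unfolding abel_term_def by (intro tendsto_intros z)
  thus ?thesis by (simp add: abel_term_def)
 qed
 have "((%n. \<Sum>m. char_sum (Suc m) * (abel_term nu (1 / real (Suc n)) m - abel_term nu (1 / real (Suc n)) (Suc m)))
  \<longlongrightarrow> (\<Sum>m. char_sum (Suc m) * (abel_term nu 0 m - abel_term nu 0 (Suc m)))) sequentially"
 proof (rule tannery[OF _ _ abel_summable_bound[OF nu]])
  show "(%n. char_sum (Suc m) * (abel_term nu (1 / real (Suc n)) m - abel_term nu (1 / real (Suc n)) (Suc m)))
   \<longlonglongrightarrow> char_sum (Suc m) * (abel_term nu 0 m - abel_term nu 0 (Suc m))" for m
   by (intro tendsto_mult tendsto_diff tendsto_const t)
 qed (auto intro!: abel_term_bound[OF nu])
 moreover have "(\<Sum>m. char_sum (Suc m) * (abel_term nu (1 / real (Suc n)) m - abel_term nu (1 / real (Suc n)) (Suc m)))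
   = (\<Sum>m. chi m * abel_term nu (1 / real (Suc n)) m)" for n
  using abel_sums[OF nu, of "1 / real (Suc n)"] by (simp add: sums_iff)
 moreover have "(\<Sum>m. char_sum (Suc m) * (abel_term nu 0 m - abel_term nu 0 (Suc m))) = dirichlet_L chi (1 - nu)"
 proof -
  have s: "(%m. chi m * abel_term nu 0 m) sums (\<Sum>m. char_sum (Suc m) * (abel_term nu 0 m - abel_term nu 0 (Suc m)))"
   using abel_sums[OF nu, of 0] by simp
  hence "(%m. chi (Suc m) * abel_term nu 0 (Suc m)) sums (\<Sum>m. char_sum (Suc m) * (abel_term nu 0 m - abel_term nu 0 (Suc m)))"
   by (subst sums_Suc_iff) (simp add: chi_0)
  moreover have "chi (Suc m) * abel_term nu 0 (Suc m) = chi (Suc m) / of_nat (Suc m) powr (1 - nu)" for m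
   using powr_minus[of "of_nat (Suc m)" "1 - nu"] by (simp add: abel_term_def divide_inverse del: of_nat_Suc)
  ultimately show ?thesis by (simp add: dirichlet_L_def sums_iff)
 qed
 ultimately show ?thesis by simp
qed

end

section \<open>The formula for smooth test functions, with an absolutely convergent double
  series\<close>

context smooth_bump
begin

lemma bump_derivs:
 obtains phi' phi'' C where "quadratic_decay_C2 phi phi' phi'' C" "vanishes_off lo hi phi'" "continuous_on UNIV phi'" "continuous_on UNIV phi''"
proof -
 have "ck_on (Suc (Suc 0)) UNIV phi" using ck_on_le[OF open_UNIV _ ck, of 2] by (simp add: numeral_2_eq_2)
 from ck_on_SucD[OF this] obtain phi' where 1: "!!x. (phi has_vector_derivative phi' x) (at x)" "ck_on (Suc 0) UNIV phi'" by auto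
 from ck_on_SucD[OF 1(2)] obtain phi'' where 2: "!!x. (phi' has_vector_derivative phi'' x) (at x)" "continuous_on UNIV phi''" by auto
 have c1: "continuous_on UNIV phi'" using ck_on_continuous[OF open_UNIV 1(2)] .
 have v1: "vanishes_off lo hi phi'" by (rule vanishes_off_deriv[OF van 1(1) c1])
 have v2: "vanishes_off lo hi phi''" by (rule vanishes_off_deriv[OF v1 2])
 have bounded: "\<exists>B. \<forall>x. norm (f x) <= B / (1 + x^2)" if f: "continuous_on UNIV f" "vanishes_off lo hi f" for f :: "real => complex"
 proof -
  have "compact ((%x. of_real (1 + x^2) * f x) ` {lo..hi})"
   by (rule compact_continuous_image) (intro continuous_intros continuous_on_subset[OF f(1)], auto)
  then obtain B where B: "!!x. x \<in> {lo..hi} ==> norm (of_real (1 + x^2) * f x) <= B"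
   by (force dest!: compact_imp_bounded simp: bounded_iff)
  have "norm (f x) <= \<bar>B\<bar> / (1 + x^2)" for x
  proof (cases "x \<in> {lo..hi}")
   case True
   have "norm (complex_of_real (1 + x^2)) = 1 + x^2" by (subst norm_of_real) simp
   hence "(1 + x^2) * norm (f x) <= \<bar>B\<bar>" using B[OF True] unfolding norm_mult by simp
   thus ?thesis by (simp add: pos_le_divide_eq add_pos_nonneg mult.commute)
  next
   case False
   hence "f x = 0" using f(2) by (auto simp: vanishes_off_def)
   thus ?thesis by simp
  qed
  thus ?thesis by blast
 qed
 obtain B0 where B0: "!!x. norm (phi x) <= B0 / (1 + x^2)" using bounded[OF cont van] by blast
 obtain B1 where B1: "!!x. norm (phi' x) <= B1 / (1 + x^2)" using bounded[OF c1 v1] by blast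
 obtain B2 where B2: "!!x. norm (phi'' x) <= B2 / (1 + x^2)" using bounded[OF 2(2) v2] by blast
 define C where "C = max B0 (max B1 B2)"
 have le: "B / (1 + x^2) <= C / (1 + x^2)" if "B <= C" for B x using that by (intro divide_right_mono) auto
 have z: "f x = 0" if "vanishes_off lo hi f" "x <= 0" for f and x :: real
 proof -
  have "x <= lo" using that(2) lo by linarith
  thus ?thesis using that(1) by (simp add: vanishes_off_def)
 qed
 have "quadratic_decay_C2 phi phi' phi'' C"
  by unfold_locales
   (use 1 2 z[OF van] z[OF v1] z[OF v2] order_trans[OF B0 le] order_trans[OF B1 le] order_trans[OF B2 le] in \<open>auto simp: C_def\<close>)
 thus ?thesis using that v1 c1 2(2) by blast
qed

lemma integral_cos_eq_fourier:
 assumes "continuous_on UNIV f" "vanishes_off a b' f"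
 shows "(\<integral>t. f t * of_real (cos (b * t)) \<partial>lborel) = (fourier f (of_real b) + fourier f (of_real (- b))) / 2"
proof -
 have int: "integrable lborel (%t. f t * exp (\<i> * of_real z * of_real t))" for z :: real
  by (rule integrable_vanishes_off[of _ a b']) (use assms in \<open>auto simp: vanishes_off_def intro!: continuous_intros\<close>)
 have "(fourier f (of_real b) + fourier f (of_real (- b))) / 2 =
  (\<integral>t. (f t * exp (\<i> * of_real b * of_real t) + f t * exp (\<i> * of_real (- b) * of_real t)) / 2 \<partial>lborel)"
  unfolding fourier_def using int[of b] int[of "- b"] by (simp add: Bochner_Integration.integral_add del: of_real_minus)
 also have "... = (\<integral>t. f t * of_real (cos (b * t)) \<partial>lborel)"
  by (intro Bochner_Integration.integral_cong refl) (simp add: cos_exp_eq algebra_simps flip: cos_of_real)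
 finally show ?thesis by simp
qed

lemma summable_P0: "m > 0 ==> summable (%k. norm (P0 (real (Suc k) / m)))"
proof -
 assume m: "m > 0"
 obtain B where B: "B >= 0" "!!y. y > 0 ==> norm (P0 y) <= B / y ^ 7"
  using P_bounds by blast
 show ?thesis
 proof (rule summable_comparison_test'[OF summable_mult[OF summable_inverse_Suc_squares, of "B * m ^ 7"], of 0])
  fix k :: nat
  have "norm (P0 (real (Suc k) / m)) <= B * m ^ 7 / real (Suc k) ^ 7" using B(2)[of "real (Suc k) / m"] m by (simp add: power_divide)
  also have "... <= B * m ^ 7 / (real (Suc k))^2"
   using B(1) m by (intro divide_left_mono power_increasing) auto
  finally show "norm (norm (P0 (real (Suc k) / m))) <= B * m ^ 7 * (1 / (real (Suc k))^2)" by simp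
 qed
qed

text \<open>Euler-Maclaurin summation with step and first node both equal to \<open>m\<close>, the
  cosine series being integrated termwise. The shift by \<open>m\<close> amounts to full periods of
  the cosines, and the two derivatives on \<open>phi\<close> cancel the weights 1 / l^2.\<close>

lemma bump_poisson:
 assumes m: "m > 0"
 shows "(%j. phi (m + m * real j)) sums ((P0 0 + 2 * (\<Sum>k. P0 (real (Suc k) / m))) / of_real m)"
proof -
 obtain phi' phi'' C where D: "quadratic_decay_C2 phi phi' phi'' C" "vanishes_off lo hi phi'" "continuous_on UNIV phi'" "continuous_on UNIV phi''"
  by (rule bump_derivs)
 interpret quadratic_decay_C2 phi phi' phi'' C by fact
 have v2: "vanishes_off lo hi phi''" by (rule vanishes_off_deriv[OF D(2) d1 D(4)])
 have F: "fourier phi'' (of_real y) = - (of_real y)\<^sup>2 * fourier phi (of_real y)" for y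
  unfolding fourier_of_deriv[OF D(2) d1 D(4)] fourier_of_deriv[OF van d0 D(3)] by (simp add: power2_eq_square mult_ac)
 have I: "(\<integral>x. phi'' x * of_real (cos (2 * pi * real (Suc l) * ((x - m) / m))) \<partial>lborel) / (of_nat (Suc l))^2
  = - (4 * of_real pi ^ 2 / of_real m ^ 2) * P0 (real (Suc l) / m)" for l
 proof -
  define b where "b = 2 * pi * real (Suc l) / m"
  have "cos (2 * pi * real (Suc l) * ((x - m) / m)) = cos (b * x)" for x
  proof -
   have "2 * pi * real (Suc l) * ((x - m) / m) = b * x - 2 * pi * real (Suc l)"
    using m by (simp add: b_def field_simps)
   thus ?thesis using cos_int_2pin[of "int (Suc l)"] sin_int_2pin[of "int (Suc l)"]
    by (simp only: cos_diff of_int_of_nat_eq)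
  qed
  hence "(\<integral>x. phi'' x * of_real (cos (2 * pi * real (Suc l) * ((x - m) / m))) \<partial>lborel) = (fourier phi'' (of_real b) + fourier phi'' (of_real (- b))) / 2"
   using integral_cos_eq_fourier[OF D(4) v2, of b] by simp
  also have "... = - (of_real b)\<^sup>2 * ((fourier phi (of_real b) + fourier phi (of_real (- b))) / 2)"
   unfolding F by (simp add: field_simps)
  also have "(fourier phi (of_real b) + fourier phi (of_real (- b))) / 2 = P0 (real (Suc l) / m)"
   by (simp add: P0_def b_def del: of_nat_Suc)
  finally have i1: "(\<integral>x. phi'' x * of_real (cos (2 * pi * real (Suc l) * ((x - m) / m))) \<partial>lborel) = - (of_real b)\<^sup>2 * P0 (real (Suc l) / m)" .
  have i2: "(complex_of_real b)^2 / (of_nat (Suc l))^2 = 4 * of_real pi ^ 2 / of_real m ^ 2"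
   by (simp add: b_def power_mult_distrib power_divide del: of_nat_Suc)
  show ?thesis unfolding i1 i2[symmetric] by (simp only: times_divide_eq_left minus_divide_left)
 qed
 have "(%l. - (4 * of_real pi ^ 2 / of_real m ^ 2) * P0 (real (Suc l) / m)) sums (\<integral>x. phi'' x * of_real (cos_series ((x - m) / m)) \<partial>lborel)"
  using g2_cos_series_sums[of m m] unfolding I .
 moreover have "(%l. - (4 * of_real pi ^ 2 / of_real m ^ 2) * P0 (real (Suc l) / m)) sums (- (4 * of_real pi ^ 2 / of_real m ^ 2) * (\<Sum>l. P0 (real (Suc l) / m)))"
  by (rule sums_mult[OF summable_sums[OF summable_norm_cancel[OF summable_P0[OF m]]]])
 ultimately have J: "(\<integral>x. phi'' x * of_real (cos_series ((x - m) / m)) \<partial>lborel) = - (4 * of_real pi ^ 2 / of_real m ^ 2) * (\<Sum>l. P0 (real (Suc l) / m))"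
  by (rule sums_unique2)
 have "P0 0 = (\<integral>x. phi x \<partial>lborel)" unfolding P0_eq by simp
 moreover have "of_real (m^2 / (2 * pi^2)) * (- (4 * of_real pi ^ 2 / of_real m ^ 2) * S) = - 2 * S" for S :: complex
  using m by (simp add: power2_eq_square)
 ultimately show ?thesis using euler_maclaurin_half_line[of m m] m unfolding J by simp
qed

lemma bump_zero: "x >= hi ==> phi x = 0" using van by (simp add: vanishes_off_def)

end

locale voronoi = odd_primitive_char q chi + smooth_bump phi lo hi for q chi phi lo hi +
 fixes nu :: complex
 assumes nu0: "0 < Re nu" and nu1: "Re nu < 1"
begin

text \<open>\<open>k\<close> is dual to d and \<open>l\<close> is dual to m. Both count from 0, so
  the frequencies are \<open>Suc k\<close> and \<open>Suc l\<close>.\<close>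

definition dual_term :: "nat => nat => complex" where
 "dual_term k l = cnj (chi (Suc l)) * (\<integral>t. phi t * voronoi_X nu (2 * pi * real (Suc l) / real q) (2 * pi * real (Suc k) * t) \<partial>lborel)"

text \<open>The integral that \<open>twisted_poisson\<close> produces for the mode
  \<open>Suc k\<close>; \<open>n\<close> encodes the damping eps = 1 / Suc n.\<close>

definition Wint :: "nat => nat => nat => complex" where
 "Wint n k l = (\<integral>x. (if x > 0 then Q2 nu (real (Suc k)) (1 / real (Suc n)) x else 0) * of_real (sin (2 * pi * real (Suc l) * x / real q)) \<partial>lborel)"

text \<open>Integrating the bound of \<open>Q2_uniform\<close> over x turns the exponent Re nu - 3
  into Re nu - 2. Independence of \<open>n\<close> and \<open>l\<close> is the point: it provides
  the majorants for the limit eps -> 0.\<close>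

lemma Wint_bound: "\<exists>C\<ge>0. \<forall>n k l. norm (Wint n k l) <= C * real (Suc k) powr (Re nu - 2)"
proof -
 obtain C where C: "C >= 0" "!!k eps x. k > 0 ==> eps > 0 ==> x > 0 ==> norm (Q2 nu k eps x) <= C * k powr (Re nu - 3) / (1 + (x / k)^2)"
  using Q2_uniform[OF nu0 nu1] by blast
 define I where "I = (\<integral>x. 1 / (1 + (x::real)^2) \<partial>lborel)"
 have "norm (Wint n k l) <= C * I * real (Suc k) powr (Re nu - 2)" for n k l
 proof -
  define K where "K = real (Suc k)"
  define eps where "eps = 1 / real (Suc n)"
  have pos: "K > 0" "eps > 0" "K >= 1" by (auto simp: K_def eps_def)
  obtain D where "quadratic_decay_C2 (%x. if x > 0 then Q0 nu K eps x else 0) (%x. if x > 0 then Q1 nu K eps x else 0) (%x. if x > 0 then Q2 nu K eps x else 0) D"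
   using Q_decay[OF nu0 nu1 pos(3,2)] by blast
  then interpret Q: quadratic_decay_C2 "%x. if x > 0 then Q0 nu K eps x else 0" "%x. if x > 0 then Q1 nu K eps x else 0" "%x. if x > 0 then Q2 nu K eps x else 0" D .
  have "norm (Wint n k l) <= (\<integral>x. (C * K powr (Re nu - 3)) * (1 / (1 + (x / K)^2)) \<partial>lborel)"
   unfolding Wint_def K_def[symmetric] eps_def[symmetric]
  proof (rule order_trans[OF integral_norm_bound integral_mono])
   show "integrable lborel (%x. norm ((if x > 0 then Q2 nu K eps x else 0) * of_real (sin (2 * pi * real (Suc l) * x / real q))))"
    by (intro integrable_norm Q.integrable_g2_bounded[where B = 1]) auto
   show "integrable lborel (%x. (C * K powr (Re nu - 3)) * (1 / (1 + (x / K)^2)))"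
    by (intro integrable_mult_right integral_rescaled_quadratic pos)
   fix x
   have "norm ((if x > 0 then Q2 nu K eps x else 0) * of_real (sin (2 * pi * real (Suc l) * x / real q))) <= norm (if x > 0 then Q2 nu K eps x else 0) * 1"
    unfolding norm_mult by (intro mult_left_mono) auto
   also have "... <= (C * K powr (Re nu - 3)) * (1 / (1 + (x / K)^2))" using C(2)[OF pos(1,2), of x] C(1) by auto
   finally show "norm ((if x > 0 then Q2 nu K eps x else 0) * of_real (sin (2 * pi * real (Suc l) * x / real q))) <= (C * K powr (Re nu - 3)) * (1 / (1 + (x / K)^2))" .
  qed
  also have "... = (C * K powr (Re nu - 3)) * (K * I)"
   unfolding I_def integral_rescaled_quadratic(2)[OF pos(1), symmetric] by (rule integral_mult_right_zero)
  also have "... = C * I * K powr (Re nu - 2)" using powr_add[of K "Re nu - 3" 1] pos by simp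
  finally show ?thesis by (simp add: K_def)
 qed
 moreover have "I >= 0" unfolding I_def by (rule Bochner_Integration.integral_nonneg) simp
 ultimately show ?thesis using C(1) by (intro exI[of _ "C * I"]) auto
qed

text \<open>Undoing the two derivatives by \<open>integral_g2_sin\<close> yields - b^2, whose factor
  l^2 cancels the weight; \<open>osc_limit\<close> evaluates what remains.\<close>

lemma Wint_limit:
 "(%n. cnj (chi (Suc l)) / (of_nat (Suc l))^2 * Wint n k l) \<longlonglongrightarrow> - (4 * of_real pi ^ 2 / of_nat q ^ 2) * dual_term k l"
proof -
 define b where "b = 2 * pi * real (Suc l) / real q"
 have b: "b > 0" using q_pos by (simp add: b_def)
 have W: "Wint n k l = - (of_real b)\<^sup>2 * (\<integral>t. phi t * osc_int nu (1 / real (Suc n)) b (2 * pi * real (Suc k) * t) \<partial>lborel)" for n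
 proof -
  define eps where "eps = 1 / real (Suc n)"
  define K where "K = real (Suc k)"
  have pos: "eps > 0" "K >= 1" by (auto simp: K_def eps_def)
  obtain D where "quadratic_decay_C2 (%x. if x > 0 then Q0 nu K eps x else 0) (%x. if x > 0 then Q1 nu K eps x else 0) (%x. if x > 0 then Q2 nu K eps x else 0) D"
   using Q_decay[OF nu0 nu1 pos(2,1)] by blast
  then interpret Q: quadratic_decay_C2 "%x. if x > 0 then Q0 nu K eps x else 0" "%x. if x > 0 then Q1 nu K eps x else 0" "%x. if x > 0 then Q2 nu K eps x else 0" D .
  have "Wint n k l = (\<integral>x. (if x > 0 then Q2 nu K eps x else 0) * of_real (sin (b * x)) \<partial>lborel)"
   unfolding Wint_def K_def eps_def b_def by (simp del: of_nat_Suc)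
  also have "... = - (of_real b)\<^sup>2 * (\<integral>x. (if x > 0 then Q0 nu K eps x else 0) * of_real (sin (b * x)) \<partial>lborel)"
   by (rule Q.integral_g2_sin)
  also have "(\<integral>x. (if x > 0 then Q0 nu K eps x else 0) * of_real (sin (b * x)) \<partial>lborel) = (\<integral>t. phi t * osc_int nu eps b (2 * pi * K * t) \<partial>lborel)"
   by (rule Q0_sin_integral[OF nu0 pos(1)])
  finally show ?thesis by (simp only: K_def eps_def)
 qed
 have "(%n. cnj (chi (Suc l)) / (of_nat (Suc l))^2 * Wint n k l) \<longlonglongrightarrow>
  cnj (chi (Suc l)) / (of_nat (Suc l))^2 * (- (of_real b)\<^sup>2 * (\<integral>t. phi t * voronoi_X nu b (2 * pi * real (Suc k) * t) \<partial>lborel))"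
  unfolding W by (intro tendsto_mult tendsto_const osc_limit nu0 nu1 b) simp
 moreover have "(complex_of_real b)^2 = 4 * of_real pi ^ 2 / of_nat q ^ 2 * (of_nat (Suc l))^2"
  by (simp add: b_def power_mult_distrib power_divide del: of_nat_Suc)
 moreover have "(of_nat (Suc l))^2 ~= (0::complex)" by (simp del: of_nat_Suc)
 ultimately show ?thesis unfolding dual_term_def b_def[symmetric]
  by (simp add: mult_ac del: of_nat_Suc)
qed

text \<open>The bound on the integrals of second derivatives is uniform in the damping and hence
  survives the limit. Absolute convergence of the dual double series is obtained without any
  information on the Bessel kernel.\<close>

lemma dual_term_bound: "\<exists>C\<ge>0. \<forall>k l. norm (dual_term k l) <= C * real (Suc k) powr (Re nu - 2) * (1 / (real (Suc l))^2)"
proof -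
 obtain C where C: "C >= 0" "!!n k l. norm (Wint n k l) <= C * real (Suc k) powr (Re nu - 2)" using Wint_bound by blast
 define c where "c = (real q)^2 / (4 * pi^2)"
 have "norm (dual_term k l) <= (c * C) * real (Suc k) powr (Re nu - 2) * (1 / (real (Suc l))^2)" for k l
 proof -
  have "norm (- (4 * of_real pi ^ 2 / of_nat q ^ 2) * dual_term k l) <= C * real (Suc k) powr (Re nu - 2) * (1 / (real (Suc l))^2)"
  proof (rule LIMSEQ_le_const2[OF tendsto_norm[OF Wint_limit[of l k]]], intro exI allI impI)
   fix n
   have "norm (cnj (chi (Suc l)) / (of_nat (Suc l))^2) <= 1 / (real (Suc l))^2"
    unfolding norm_divide norm_power using norm_dirichlet_char_le[OF char] by (simp add: divide_right_mono del: of_nat_Suc)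
   hence "norm (cnj (chi (Suc l)) / (of_nat (Suc l))^2 * Wint n k l) <= (1 / (real (Suc l))^2) * (C * real (Suc k) powr (Re nu - 2))"
    unfolding norm_mult using C(2) by (intro mult_mono) auto
   thus "norm (cnj (chi (Suc l)) / (of_nat (Suc l))^2 * Wint n k l) <= C * real (Suc k) powr (Re nu - 2) * (1 / (real (Suc l))^2)"
    by (simp only: mult.commute)
  qed
  moreover have "norm (- (4 * complex_of_real pi ^ 2 / of_nat q ^ 2)) = 1 / c"
   by (simp add: c_def norm_divide norm_mult norm_power)
  moreover have "c > 0" using q_pos by (simp add: c_def)
  ultimately have "1 / c * norm (dual_term k l) <= C * real (Suc k) powr (Re nu - 2) * (1 / (real (Suc l))^2)" and "c > 0"
   by (simp_all only: norm_mult)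
  moreover have "x <= c * y" if "1 / c * x <= y" "c > 0" for x y :: real
   using that by (simp add: pos_divide_le_eq mult.commute)
  ultimately have "norm (dual_term k l) <= c * (C * real (Suc k) powr (Re nu - 2) * (1 / (real (Suc l))^2))" by blast
  thus ?thesis by (simp only: mult.assoc)
 qed
 moreover have "c * C >= 0" using C(1) by (simp add: c_def)
 ultimately show ?thesis by blast
qed

lemma summable_Suc_powr: "summable (%k. real (Suc k) powr (Re nu - 2))"
 using nu1 by (subst summable_Suc_iff) (simp add: summable_real_powr_iff)

definition inner_sum :: "nat => complex" where
 "inner_sum m = (\<Sum>j. phi (real m + real m * real j))"

lemma inner_sum_zero: "real m >= hi ==> inner_sum m = 0"
proof -
 assume "real m >= hi"
 hence "phi (real m + real m * real j) = 0" for j by (intro bump_zero) (simp add: add_increasing2)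
 thus ?thesis by (simp add: inner_sum_def)
qed

text \<open>For each m the sum over d is replaced by its Poisson dual. The zero frequency produces
  the damped L-series; for the other frequencies the sum over m is carried out first and transformed
  by \<open>twisted_poisson\<close>.\<close>

lemma regularized_identity:
 fixes n :: nat
 defines "eps \<equiv> 1 / real (Suc n)"
 shows "(\<Sum>m. chi m * (of_nat m powr nu * of_real (exp (- eps * real m)) * inner_sum m)) =
  P0 0 * (\<Sum>m. chi m * abel_term nu eps m) +
  \<i> * gauss_sum q chi * of_nat q / of_real pi ^ 2 * (\<Sum>k. \<Sum>l. cnj (chi (Suc l)) / (of_nat (Suc l))^2 * Wint n k l)"
proof -
 have e: "eps > 0" by (simp add: eps_def)
 obtain B where B: "B >= 0" "!!y. y > 0 ==> norm (P0 y) <= B / y ^ 7" using P_bounds by blast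
 define q0 where "q0 = (%k (m::nat). (if real m > 0 then Q0 nu (real (Suc k)) eps (real m) else 0))"
 have q0: "q0 k m = abel_term nu eps m * P0 (real (Suc k) / real m)" if "m > 0" for k m
  using that by (simp add: q0_def Q0_def tau_def abel_term_def mult_ac)
 have t: "chi m * (of_nat m powr nu * of_real (exp (- eps * real m)) * inner_sum m) =
   P0 0 * (chi m * abel_term nu eps m) + 2 * (\<Sum>k. chi m * q0 k m)" for m
 proof (cases "m = 0")
  case False
  hence m: "m > 0" by simp
  have i: "inner_sum m = (P0 0 + 2 * (\<Sum>k. P0 (real (Suc k) / real m))) / of_nat m"
   using bump_poisson[of "real m"] m by (simp add: inner_sum_def sums_iff)
  have p: "of_nat m powr nu * of_real (exp (- eps * real m)) / of_nat m = abel_term nu eps m"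
   using m by (simp add: abel_term_def powr_diff)
  have sm: "summable (%k. P0 (real (Suc k) / real m))" using m by (intro summable_norm_cancel[OF summable_P0]) auto
  have "(\<Sum>k. chi m * q0 k m) = chi m * abel_term nu eps m * (\<Sum>k. P0 (real (Suc k) / real m))"
   unfolding q0[OF m] mult.assoc[symmetric] by (rule suminf_mult[OF sm])
  moreover have "chi m * (of_nat m powr nu * of_real (exp (- eps * real m)) * inner_sum m)
   = chi m * (of_nat m powr nu * of_real (exp (- eps * real m)) / of_nat m) * (P0 0 + 2 * (\<Sum>k. P0 (real (Suc k) / real m)))"
   unfolding i by simp
  ultimately show ?thesis unfolding p by (simp add: algebra_simps)
 qed (simp add: chi_0)
 \<comment> \<open>The decay of order 7 of \<open>P0\<close> in k / m costs a factor m^7, so the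
   exponential has to supply nine powers in order to leave 1 / m^2.\<close>
 define u where "u = (%m::nat. (if m = 0 then 0 else B * fact 9 / eps ^ 9 * (1 / (real m)^2)))"
 define v where "v = (%k::nat. 1 / (real (Suc k))^2)"
 have su: "summable u"
 proof (rule summable_comparison_test'[of "%m. B * fact 9 / eps ^ 9 * (1 / (real m)^2)" 1])
  show "summable (%m. B * fact 9 / eps ^ 9 * (1 / (real m)^2))"
   using inverse_power_summable[of 2, where ?'a = real] by (intro summable_mult) (simp add: inverse_eq_divide)
 qed (use B e in \<open>auto simp: u_def\<close>)
 have sv: "summable v" unfolding v_def by (rule summable_inverse_Suc_squares)
 have bound: "norm (chi m * q0 k m) <= u m * v k" for m k
 proof (cases "m = 0")
  case False
  hence m: "m > 0" "real m >= 1" by auto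
  have "norm (abel_term nu eps m) = real m powr (Re nu - 1) * exp (- eps * real m)"
   using norm_powr_real_powr[of "of_nat m" "nu - 1"] by (simp add: abel_term_def norm_mult)
  also have "... <= real m powr 0 * exp (- eps * real m)" using m nu1 by (intro mult_right_mono powr_mono) auto
  also have "... <= fact 9 / (eps * real m) ^ 9"
   using power_exp_neg_le[of "eps * real m" 9] e m by (simp add: pos_le_divide_eq mult.commute)
  finally have a: "norm (abel_term nu eps m) <= fact 9 / (eps * real m) ^ 9" .
  have b: "norm (P0 (real (Suc k) / real m)) <= B * real m ^ 7 * v k"
  proof -
   have "norm (P0 (real (Suc k) / real m)) <= B * real m ^ 7 / real (Suc k) ^ 7" using B(2)[of "real (Suc k) / real m"] m by (simp add: power_divide)
   also have "... <= B * real m ^ 7 / (real (Suc k))^2" using B(1) m by (intro divide_left_mono power_increasing) auto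
   finally show ?thesis by (simp add: v_def)
  qed
  have "norm (chi m * q0 k m) <= 1 * ((fact 9 / (eps * real m) ^ 9) * (B * real m ^ 7 * v k))"
   unfolding q0[OF m(1)] norm_mult using a b norm_dirichlet_char_le[OF char] e m by (intro mult_mono) auto
  also have "... = u m * v k"
  proof -
   have m9: "real m ^ 9 = real m ^ 7 * (real m)^2" by (simp flip: power_add)
   have c: "1 * (F / (E * (M7 * M2)) * (B * M7 * V)) = B * F / E * (1 / M2) * V" if "M7 ~= 0" for E F M7 M2 V :: real
    using that by simp
   have "u m = B * fact 9 / eps ^ 9 * (1 / (real m)^2)" using m by (simp add: u_def)
   thus ?thesis unfolding power_mult_distrib m9 using m by (subst c) auto
  qed
  finally show ?thesis .
 qed (simp add: chi_0 u_def)
 have sq: "summable (%k. norm (chi m * q0 k m))" for m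
  by (rule summable_comparison_test'[OF summable_mult[OF summable_inverse_Suc_squares, of "u m"], of 0]) (use bound in \<open>auto simp: v_def\<close>)
 have sS: "summable (%m. \<Sum>k. chi m * q0 k m)"
 proof (rule summable_comparison_test'[OF summable_mult2[OF su, of "suminf v"], of 0])
  fix m
  have "norm (\<Sum>k. chi m * q0 k m) <= (\<Sum>k. norm (chi m * q0 k m))" by (rule summable_norm[OF sq])
  also have "... <= (\<Sum>k. u m * v k)"
   by (rule suminf_le[OF bound sq summable_mult[OF sv]])
  also have "... = u m * suminf v" by (rule suminf_mult[OF sv])
  finally show "norm (\<Sum>k. chi m * q0 k m) <= u m * suminf v" .
 qed
 have sA: "summable (%m. chi m * abel_term nu eps m)" using abel_sums[OF nu0 nu1, of eps] e by (simp add: sums_iff)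
 have "(\<Sum>m. chi m * (of_nat m powr nu * of_real (exp (- eps * real m)) * inner_sum m)) = P0 0 * (\<Sum>m. chi m * abel_term nu eps m) + 2 * (\<Sum>m. \<Sum>k. chi m * q0 k m)"
  unfolding t using sA sS by (subst suminf_add[symmetric]) (auto intro: summable_mult simp: suminf_mult)
 also have "(\<Sum>m. \<Sum>k. chi m * q0 k m) = (\<Sum>k. \<Sum>m. chi m * q0 k m)"
  by (rule suminf_swap[OF su _ _ _ bound]) (use B e summable_inverse_Suc_squares in \<open>auto simp: u_def v_def\<close>)
 also have "(%k. \<Sum>m. chi m * q0 k m) = (%k. \<i> * gauss_sum q chi * of_nat q / (2 * of_real pi ^ 2) * (\<Sum>l. cnj (chi (Suc l)) / (of_nat (Suc l))^2 * Wint n k l))"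
 proof
  fix k
  have "real (Suc k) >= 1" by simp
  from Q_decay[OF nu0 nu1 this e] obtain D where
   D: "quadratic_decay_C2 (%x. if x > 0 then Q0 nu (real (Suc k)) eps x else 0) (%x. if x > 0 then Q1 nu (real (Suc k)) eps x else 0) (%x. if x > 0 then Q2 nu (real (Suc k)) eps x else 0) D"
   by blast
  from sums_unique[OF twisted_poisson[OF D]]
  show "(\<Sum>m. chi m * q0 k m) = \<i> * gauss_sum q chi * of_nat q / (2 * of_real pi ^ 2) * (\<Sum>l. cnj (chi (Suc l)) / (of_nat (Suc l))^2 * Wint n k l)"
   unfolding Wint_def q0_def eps_def by simp
 qed
 also have "(\<Sum>k. \<i> * gauss_sum q chi * of_nat q / (2 * of_real pi ^ 2) * (\<Sum>l. cnj (chi (Suc l)) / (of_nat (Suc l))^2 * Wint n k l)) =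
  \<i> * gauss_sum q chi * of_nat q / (2 * of_real pi ^ 2) * (\<Sum>k. \<Sum>l. cnj (chi (Suc l)) / (of_nat (Suc l))^2 * Wint n k l)"
 proof (rule suminf_mult)
  obtain C where C: "C >= 0" "!!n k l. norm (Wint n k l) <= C * real (Suc k) powr (Re nu - 2)" using Wint_bound by blast
  have b: "norm (cnj (chi (Suc l)) / (of_nat (Suc l))^2 * Wint n k l) <= (C * real (Suc k) powr (Re nu - 2)) * v l" for k l
  proof -
   have "norm (cnj (chi (Suc l)) / (of_nat (Suc l))^2) <= v l"
    unfolding norm_divide norm_power v_def using norm_dirichlet_char_le[OF char] by (simp add: divide_right_mono del: of_nat_Suc)
   hence "norm (cnj (chi (Suc l)) / (of_nat (Suc l))^2 * Wint n k l) <= v l * (C * real (Suc k) powr (Re nu - 2))"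
    unfolding norm_mult using C(2) by (intro mult_mono) (auto simp: v_def)
   thus ?thesis by (simp only: mult.commute)
  qed
  have sl: "summable (%l. norm (cnj (chi (Suc l)) / (of_nat (Suc l))^2 * Wint n k l))" for k
   by (rule summable_comparison_test'[OF summable_mult[OF sv, of "C * real (Suc k) powr (Re nu - 2)"], of 0]) (use b in auto)
  show "summable (%k. \<Sum>l. cnj (chi (Suc l)) / (of_nat (Suc l))^2 * Wint n k l)"
  proof (rule summable_comparison_test'[OF summable_mult2[OF summable_mult[OF summable_Suc_powr, of C], of "suminf v"], of 0])
   fix k
   have "norm (\<Sum>l. cnj (chi (Suc l)) / (of_nat (Suc l))^2 * Wint n k l) <= (\<Sum>l. norm (cnj (chi (Suc l)) / (of_nat (Suc l))^2 * Wint n k l))"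
    by (rule summable_norm[OF sl])
   also have "... <= (\<Sum>l. (C * real (Suc k) powr (Re nu - 2)) * v l)" by (rule suminf_le[OF b sl summable_mult[OF sv]])
   also have "... = (C * real (Suc k) powr (Re nu - 2)) * suminf v" by (rule suminf_mult[OF sv])
   finally show "norm (\<Sum>l. cnj (chi (Suc l)) / (of_nat (Suc l))^2 * Wint n k l) <= (C * real (Suc k) powr (Re nu - 2)) * suminf v" .
  qed
 qed
 finally show ?thesis by simp
qed

text \<open>As eps -> 0 the left side is a finite sum, because \<open>phi\<close> has bounded
  support. On the right the L-series is handled by \<open>abel_limit\<close> and the double series
  by \<open>tannery\<close> twice, once for each dual index.\<close>

theorem voronoi_double_sum:
 "(\<Sum>m. chi m * (of_nat m powr nu * inner_sum m)) = P0 0 * dirichlet_L chi (1 - nu) - 4 * \<i> * gauss_sum q chi / of_nat q * (\<Sum>k. \<Sum>l. dual_term k l)"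
proof -
 define eps where "eps = (%n::nat. 1 / real (Suc n))"
 have z: "eps \<longlonglongrightarrow> 0"
  unfolding eps_def using LIMSEQ_inverse_real_of_nat by (simp add: inverse_eq_divide del: of_nat_Suc)
 obtain M :: nat where M: "real M > hi" using reals_Archimedean2 by blast
 have zero: "inner_sum m = 0" if "m \<notin> {..<M}" for m
  using that M by (intro inner_sum_zero) auto
 have lhs: "(%n. \<Sum>m. chi m * (of_nat m powr nu * of_real (exp (- eps n * real m)) * inner_sum m)) \<longlonglongrightarrow> (\<Sum>m. chi m * (of_nat m powr nu * inner_sum m))"
 proof -
  have "(%n. \<Sum>m<M. chi m * (of_nat m powr nu * of_real (exp (- eps n * real m)) * inner_sum m)) \<longlonglongrightarrow>
   (\<Sum>m<M. chi m * (of_nat m powr nu * of_real (exp (- 0 * real m)) * inner_sum m))"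
   by (intro tendsto_intros z)
  moreover have "(\<Sum>m. chi m * (of_nat m powr nu * of_real (exp (- eps n * real m)) * inner_sum m)) =
   (\<Sum>m<M. chi m * (of_nat m powr nu * of_real (exp (- eps n * real m)) * inner_sum m))" for n
   by (rule suminf_finite) (use zero in auto)
  moreover have "(\<Sum>m. chi m * (of_nat m powr nu * inner_sum m)) = (\<Sum>m<M. chi m * (of_nat m powr nu * inner_sum m))"
   by (rule suminf_finite) (use zero in auto)
  ultimately show ?thesis by simp
 qed
 obtain C where C: "C >= 0" "!!n k l. norm (Wint n k l) <= C * real (Suc k) powr (Re nu - 2)" using Wint_bound by blast
 define v where "v = (%k::nat. 1 / (real (Suc k))^2)"
 have sv: "summable v" unfolding v_def by (rule summable_inverse_Suc_squares)
 have b: "norm (cnj (chi (Suc l)) / (of_nat (Suc l))^2 * Wint n k l) <= (C * real (Suc k) powr (Re nu - 2)) * v l" for n k l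
 proof -
  have "norm (cnj (chi (Suc l)) / (of_nat (Suc l))^2) <= v l"
   unfolding norm_divide norm_power v_def using norm_dirichlet_char_le[OF char] by (simp add: divide_right_mono del: of_nat_Suc)
  hence "norm (cnj (chi (Suc l)) / (of_nat (Suc l))^2 * Wint n k l) <= v l * (C * real (Suc k) powr (Re nu - 2))"
   unfolding norm_mult using C(2) by (intro mult_mono) (auto simp: v_def)
  thus ?thesis by (simp only: mult.commute)
 qed
 have sl: "summable (%l. norm (cnj (chi (Suc l)) / (of_nat (Suc l))^2 * Wint n k l))" for n k
  by (rule summable_comparison_test'[OF summable_mult[OF sv, of "C * real (Suc k) powr (Re nu - 2)"], of 0]) (use b in auto)
 have inner: "(%n. \<Sum>l. cnj (chi (Suc l)) / (of_nat (Suc l))^2 * Wint n k l) \<longlonglongrightarrow> (\<Sum>l. - (4 * of_real pi ^ 2 / of_nat q ^ 2) * dual_term k l)" for k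
  by (rule tannery[OF Wint_limit b summable_mult[OF sv]]) simp
 have outer: "(%n. \<Sum>k. \<Sum>l. cnj (chi (Suc l)) / (of_nat (Suc l))^2 * Wint n k l) \<longlonglongrightarrow> (\<Sum>k. \<Sum>l. - (4 * of_real pi ^ 2 / of_nat q ^ 2) * dual_term k l)"
 proof (rule tannery[OF inner])
  show "summable (%k. (C * real (Suc k) powr (Re nu - 2)) * suminf v)"
   by (intro summable_mult2 summable_mult summable_Suc_powr)
  fix k n
  have "norm (\<Sum>l. cnj (chi (Suc l)) / (of_nat (Suc l))^2 * Wint n k l) <= (\<Sum>l. norm (cnj (chi (Suc l)) / (of_nat (Suc l))^2 * Wint n k l))"
   by (rule summable_norm[OF sl])
  also have "... <= (\<Sum>l. (C * real (Suc k) powr (Re nu - 2)) * v l)" by (rule suminf_le[OF b sl summable_mult[OF sv]])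
  also have "... = (C * real (Suc k) powr (Re nu - 2)) * suminf v" by (rule suminf_mult[OF sv])
  finally show "norm (\<Sum>l. cnj (chi (Suc l)) / (of_nat (Suc l))^2 * Wint n k l) <= (C * real (Suc k) powr (Re nu - 2)) * suminf v" .
 qed simp
 have "(%n. P0 0 * (\<Sum>m. chi m * abel_term nu (eps n) m) + \<i> * gauss_sum q chi * of_nat q / of_real pi ^ 2 * (\<Sum>k. \<Sum>l. cnj (chi (Suc l)) / (of_nat (Suc l))^2 * Wint n k l))
  \<longlonglongrightarrow> P0 0 * dirichlet_L chi (1 - nu) + \<i> * gauss_sum q chi * of_nat q / of_real pi ^ 2 * (\<Sum>k. \<Sum>l. - (4 * of_real pi ^ 2 / of_nat q ^ 2) * dual_term k l)"
  unfolding eps_def by (intro tendsto_add tendsto_mult tendsto_const abel_limit outer nu0 nu1)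
 hence "(%n. \<Sum>m. chi m * (of_nat m powr nu * of_real (exp (- eps n * real m)) * inner_sum m))
  \<longlonglongrightarrow> P0 0 * dirichlet_L chi (1 - nu) + \<i> * gauss_sum q chi * of_nat q / of_real pi ^ 2 * (\<Sum>k. \<Sum>l. - (4 * of_real pi ^ 2 / of_nat q ^ 2) * dual_term k l)"
  unfolding eps_def regularized_identity .
 with lhs have eq: "(\<Sum>m. chi m * (of_nat m powr nu * inner_sum m)) = P0 0 * dirichlet_L chi (1 - nu) + \<i> * gauss_sum q chi * of_nat q / of_real pi ^ 2 * (\<Sum>k. \<Sum>l. - (4 * of_real pi ^ 2 / of_nat q ^ 2) * dual_term k l)"
  by (rule LIMSEQ_unique)
 obtain C' where C': "C' >= 0" "!!k l. norm (dual_term k l) <= C' * real (Suc k) powr (Re nu - 2) * v l" using dual_term_bound unfolding v_def by blast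
 have sl': "summable (%l. norm (dual_term k l))" for k
  by (rule summable_comparison_test'[OF summable_mult[OF sv, of "C' * real (Suc k) powr (Re nu - 2)"], of 0]) (use C' in auto)
 have sk': "summable (%k. \<Sum>l. dual_term k l)"
 proof (rule summable_comparison_test'[OF summable_mult2[OF summable_mult[OF summable_Suc_powr, of C'], of "suminf v"], of 0])
  fix k
  have "norm (\<Sum>l. dual_term k l) <= (\<Sum>l. norm (dual_term k l))" by (rule summable_norm[OF sl'])
  also have "... <= (\<Sum>l. (C' * real (Suc k) powr (Re nu - 2)) * v l)" by (rule suminf_le[OF C'(2) sl' summable_mult[OF sv]])
  also have "... = (C' * real (Suc k) powr (Re nu - 2)) * suminf v" by (rule suminf_mult[OF sv])
  finally show "norm (\<Sum>l. dual_term k l) <= (C' * real (Suc k) powr (Re nu - 2)) * suminf v" .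
 qed
 have "(\<Sum>k. \<Sum>l. - (4 * of_real pi ^ 2 / of_nat q ^ 2) * dual_term k l) = - (4 * of_real pi ^ 2 / of_nat q ^ 2) * (\<Sum>k. \<Sum>l. dual_term k l)"
  unfolding suminf_mult[OF summable_norm_cancel[OF sl']] by (rule suminf_mult[OF sk'])
 moreover have "\<i> * gauss_sum q chi * of_nat q / of_real pi ^ 2 * (- (4 * of_real pi ^ 2 / of_nat q ^ 2) * S) = - (4 * \<i> * gauss_sum q chi / of_nat q * S)" for S :: complex
  using q_pos by (simp add: power2_eq_square)
 ultimately show ?thesis unfolding eq by simp
qed

end

section \<open>Identification of the Bessel kernel and of the divisor functions\<close>

lemma bessel_J_eq: "bessel_J mu x = of_real (x / 2) powr mu * bessel_E mu (- of_real ((x / 2)^2))"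
proof -
 define z where "z = complex_of_real (x / 2)"
 have "bessel_J mu x = (\<Sum>k. z powr mu * (rGamma (of_nat k + mu + 1) / of_nat (fact k) * (- (z^2)) ^ k))"
  unfolding bessel_J_def z_def[symmetric]
  by (intro suminf_cong) (simp add: power_mult[symmetric] power_minus[of "z^2"] mult_ac)
 also have "... = z powr mu * bessel_E mu (- (z^2))"
  unfolding bessel_E_def by (rule suminf_mult[OF summable_norm_cancel[OF summable_bessel_E]])
 finally show ?thesis by (simp only: z_def of_real_power)
qed

lemma bessel_I_eq: "bessel_I mu x = of_real (x / 2) powr mu * bessel_E mu (of_real ((x / 2)^2))"
proof -
 define z where "z = complex_of_real (x / 2)"
 have "bessel_I mu x = (\<Sum>k. z powr mu * (rGamma (of_nat k + mu + 1) / of_nat (fact k) * (z^2) ^ k))"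
  unfolding bessel_I_def z_def[symmetric]
  by (intro suminf_cong) (simp add: power_mult[symmetric] mult_ac)
 also have "... = z powr mu * bessel_E mu (z^2)"
  unfolding bessel_E_def by (rule suminf_mult[OF summable_norm_cancel[OF summable_bessel_E]])
 finally show ?thesis by (simp only: z_def of_real_power)
qed

definition bessel_G :: "complex => real => complex" where
 "bessel_G nu x = (2 / of_real pi * bessel_K nu x - bessel_Y nu x) * sin (of_real pi * nu / 2) + bessel_J nu x * cos (of_real pi * nu / 2)"

text \<open>K and Y share the denominator sin (pi nu), a double-angle product whose sine cancels the
  sine in front; the explicit J term then completes the rest to a symmetric sum. In this form the
  kernel matches \<open>voronoi_X\<close>, and its decaying part, the difference of the I functions,
  is separated from the oscillating one.\<close>

lemma bessel_G_eq:
 assumes "0 < Re nu" "Re nu < 1"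
 shows "bessel_G nu x = (bessel_I (- nu) x - bessel_I nu x + bessel_J (- nu) x + bessel_J nu x) / (2 * cos (of_real pi * nu / 2))"
proof -
 have "nu \<notin> \<int>"
 proof
  assume "nu \<in> \<int>"
  then obtain n where "nu = of_int n" by (auto elim: Ints_cases)
  hence "0 < n" "n < 1" using assms by auto
  thus False by simp
 qed
 define s c where "s = sin (of_real pi * nu / 2)" and "c = cos (of_real pi * nu / 2)"
 have S: "sin (nu * of_real pi) = 2 * s * c" using sin_double[of "of_real pi * nu / 2"] by (simp add: s_def c_def mult.commute)
 have "sin (nu * of_real pi) ~= 0" using rGamma_reflect_nz(2)[OF assms] by (simp add: mult.commute)
 hence nz: "s ~= 0" "c ~= 0" using S by auto
 have C: "cos (nu * of_real pi) = 2 * c^2 - 1" using cos_double_cos[of "of_real pi * nu / 2"] by (simp add: c_def mult.commute)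
 have K: "bessel_K nu x = of_real pi / 2 * (bessel_I (-nu) x - bessel_I nu x) / (2 * s * c)"
  using \<open>nu \<notin> \<int>\<close> S by (simp add: bessel_K_def bessel_K_aux_def)
 have Y: "bessel_Y nu x = (bessel_J nu x * (2 * c^2 - 1) - bessel_J (-nu) x) / (2 * s * c)"
  using \<open>nu \<notin> \<int>\<close> S C by (simp add: bessel_Y_def bessel_Y_aux_def)
 show ?thesis unfolding bessel_G_def K Y s_def[symmetric] c_def[symmetric]
  using nz by (simp add: field_simps power2_eq_square)
qed

text \<open>\<open>voronoi_U\<close> is \<open>voronoi_X\<close> stripped of its dependence on the factorisation of \<open>n\<close>.\<close>

definition voronoi_U :: "complex => nat => nat => real => complex" where
 "voronoi_U nu q n t = of_real pi / (4 * cos (of_real pi * nu / 2)) *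
  (of_real (2 * pi / real q) powr (- nu) * (bessel_E (- nu) (of_real (4 * pi^2 * real n * t / real q)) + bessel_E (- nu) (- of_real (4 * pi^2 * real n * t / real q)))
   - of_real (2 * pi * real n * t) powr nu * (bessel_E nu (of_real (4 * pi^2 * real n * t / real q)) - bessel_E nu (- of_real (4 * pi^2 * real n * t / real q))))"

lemma powr_of_real_mult:
 assumes "x > 0" "y > 0"
 shows "complex_of_real (x * y) powr s = of_real x powr s * of_real y powr s"
 using assms by (simp add: powr_def Ln_of_real[of "x * y"] Ln_of_real ln_mult exp_add[symmetric] algebra_simps del: of_real_mult)

lemma mult_inverse_cancel: "x = c * b ==> a * b = 1 ==> a * x = c" for a b c x :: complex
 by (simp add: mult.left_commute)

text \<open>The arguments of \<open>bessel_E\<close> involve only the product k * d, and both powers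
  shed the same factor d powr (- nu). Hence all dual terms with k * d = n share one integral, and
  the factors assemble the divisor function.\<close>

lemma voronoi_X_eq_U:
 assumes "d > 0" "k > 0" "q > 0" "t > 0"
 shows "voronoi_X nu (2 * pi * real d / real q) (2 * pi * real k * t) = of_nat d powr (- nu) * voronoi_U nu q (k * d) t"
proof -
 have y: "2 * pi * real d / real q * (2 * pi * real k * t) = 4 * pi^2 * real (k * d) * t / real q"
  by (simp add: power2_eq_square)
 have b: "complex_of_real (2 * pi * real d / real q) powr (- nu) = of_nat d powr (- nu) * of_real (2 * pi / real q) powr (- nu)"
  using powr_of_real_mult[of "real d" "2 * pi / real q" "- nu"] assms by (simp add: mult_ac)
 have "complex_of_real (2 * pi * real (k * d) * t) powr nu = of_real (2 * pi * real k * t) powr nu * of_nat d powr nu"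
  using powr_of_real_mult[of "2 * pi * real k * t" "real d" nu] assms by (simp add: mult_ac)
 moreover have "of_nat d powr (- nu) * of_nat d powr nu = (1 :: complex)" using assms by (simp add: powr_minus)
 ultimately have c: "of_nat d powr (- nu) * complex_of_real (2 * pi * real (k * d) * t) powr nu = of_real (2 * pi * real k * t) powr nu"
  by (rule mult_inverse_cancel)
 show ?thesis
  unfolding voronoi_X_def voronoi_U_def y b c[symmetric]
  by (simp only: right_diff_distrib mult_ac)
qed

text \<open>With (x / 2)^2 = 4 pi^2 n t / q both sides contain the same Bessel-Clifford
  combinations, so only the powers in front have to be compared. Written as exponentials of
  logarithms, this is linear algebra in the exponents.\<close>

lemma voronoi_U_eq_G:
 assumes nu: "0 < Re nu" "Re nu < 1" and pos: "n > 0" "q > 0" "t > 0"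
 shows "of_real t powr (- nu) * voronoi_U nu q n t =
  of_real pi / 2 * of_nat q powr (nu / 2) * (of_nat n powr (nu / 2) * of_real t powr (- nu / 2) * bessel_G nu (4 * pi * sqrt (real n * t / real q)))"
proof -
 define x where "x = 4 * pi * sqrt (real n * t / real q)"
 define L where "L = (%y. complex_of_real (ln y))"
 have x2: "(x / 2)^2 = 4 * pi^2 * real n * t / real q"
  using pos by (simp add: x_def power_mult_distrib power_divide)
 have xpos: "x / 2 > 0" using pos by (simp add: x_def)
 have lx: "ln (x / 2) = ln (2 * pi) + (ln (real n) + ln t - ln (real q)) / 2"
 proof -
  have "ln (x / 2) = ln ((2 * pi) * sqrt (real n * t / real q))" by (simp add: x_def mult.assoc)
  thus ?thesis using pos by (simp add: ln_mult ln_sqrt ln_div)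
 qed
 have px: "of_real (x / 2) powr s = exp (s * (L (2 * pi) + (L (real n) + L t - L (real q)) / 2))" for s
 proof -
  have "of_real (x / 2) powr s = exp (s * of_real (ln (x / 2)))" using xpos by (simp add: powr_def Ln_of_real del: of_real_divide)
  moreover have "complex_of_real (ln (x / 2)) = L (2 * pi) + (L (real n) + L t - L (real q)) / 2" unfolding lx L_def by simp
  ultimately show ?thesis by simp
 qed
 have pq: "of_nat q powr s = exp (s * L (real q))" "of_nat n powr s = exp (s * L (real n))" "of_real t powr s = exp (s * L t)" for s
  using pos by (simp_all add: powr_def L_def Ln_of_real)
 have p2: "of_real (2 * pi / real q) powr s = exp (s * (L (2 * pi) - L (real q)))" for s
  using pos by (simp add: powr_def L_def Ln_of_real ln_div del: of_real_divide of_real_mult)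
 have p3: "of_real (2 * pi * real n * t) powr s = exp (s * (L (2 * pi) + L (real n) + L t))" for s
  using pos by (simp add: powr_def L_def Ln_of_real ln_mult del: of_real_mult)
 define u v where "u = bessel_E (- nu) (of_real ((x / 2)^2)) + bessel_E (- nu) (- of_real ((x / 2)^2))"
  and "v = bessel_E nu (of_real ((x / 2)^2)) - bessel_E nu (- of_real ((x / 2)^2))"
 define c where "c = cos (of_real pi * nu / 2)"
 have G: "bessel_G nu x = (of_real (x / 2) powr (- nu) * u - of_real (x / 2) powr nu * v) / (2 * c)"
  unfolding bessel_G_eq[OF nu] bessel_I_eq bessel_J_eq u_def v_def c_def by (simp add: algebra_simps)
 have A: "of_nat q powr (nu / 2) * (of_nat n powr (nu / 2) * of_real t powr (- nu / 2)) * of_real (x / 2) powr (- nu) = of_real t powr (- nu) * of_real (2 * pi / real q) powr (- nu)"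
  unfolding pq p2 px exp_add[symmetric] by (rule arg_cong[of _ _ exp]) (simp add: field_simps)
 have B: "of_nat q powr (nu / 2) * (of_nat n powr (nu / 2) * of_real t powr (- nu / 2)) * of_real (x / 2) powr nu = of_real t powr (- nu) * of_real (2 * pi * real n * t) powr nu"
  unfolding pq p3 px exp_add[symmetric] by (rule arg_cong[of _ _ exp]) (simp add: field_simps)
 have "of_real pi / 2 * of_nat q powr (nu / 2) * (of_nat n powr (nu / 2) * of_real t powr (- nu / 2) * bessel_G nu x)
  = of_real pi / (4 * c) * ((of_nat q powr (nu / 2) * (of_nat n powr (nu / 2) * of_real t powr (- nu / 2)) * of_real (x / 2) powr (- nu)) * u
    - (of_nat q powr (nu / 2) * (of_nat n powr (nu / 2) * of_real t powr (- nu / 2)) * of_real (x / 2) powr nu) * v)"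
  unfolding G by (simp add: algebra_simps diff_divide_distrib)
 also have "... = of_real t powr (- nu) * voronoi_U nu q n t"
  unfolding A B voronoi_U_def x2[symmetric] u_def[symmetric] v_def[symmetric] c_def[symmetric]
  by (simp only: right_diff_distrib mult_ac)
 finally show ?thesis by (simp only: x_def)
qed

lemma dvd_div_pos: "(d::nat) dvd N ==> N > 0 ==> d > 0 \<and> N div d > 0"
 by (metis dvd_div_eq_0_iff dvd_pos_nat gr0I less_irrefl)

lemma sum_divisor_rearrange:
 fixes F :: "nat => nat => complex"
 assumes "!!m d. m * d > J ==> F m d = 0"
 shows "(\<Sum>m\<in>{1..J}. \<Sum>d\<in>{1..J}. F m d) = (\<Sum>N\<in>{1..J}. \<Sum>d | d dvd N. F (N div d) d)"
proof -
 define A where "A = {(m, d). m \<in> {1..J} \<and> d \<in> {1..J} \<and> m * d <= J}"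
 have "(\<Sum>m\<in>{1..J}. \<Sum>d\<in>{1..J}. F m d) = (\<Sum>(m, d)\<in>{1..J} \<times> {1..J}. F m d)"
  by (rule sum.cartesian_product)
 also have "... = (\<Sum>(m, d)\<in>A. F m d)"
  by (rule sum.mono_neutral_right) (auto simp: A_def intro!: assms)
 also have "... = (\<Sum>(N, d)\<in>(SIGMA N:{1..J}. {d. d dvd N}). F (N div d) d)"
 proof (rule sum.reindex_bij_witness[where i = "%(N, d). (N div d, d)" and j = "%(m, d). (m * d, d)"])
  fix p assume "p \<in> (SIGMA N:{1..J}. {d. d dvd N})"
  then obtain N d where p: "p = (N, d)" "N >= 1" "N <= J" "d dvd N" by auto
  have "d >= 1" "N div d >= 1" using dvd_div_pos[OF p(4)] p(2) by auto
  moreover have "d <= J" using p dvd_imp_le[OF p(4)] by auto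
  moreover have "N div d <= J" using p(3) by (meson div_le_dividend le_trans)
  ultimately show "(case p of (N, d) => (N div d, d)) \<in> A" using p by (auto simp: A_def)
  show "(case case p of (N, d) => (N div d, d) of (m, d) => (m * d, d)) = p" using p by simp
 qed (auto simp: A_def)
 also have "... = (\<Sum>N\<in>{1..J}. \<Sum>d | d dvd N. F (N div d) d)"
  by (subst sum.Sigma) auto
 finally show ?thesis .
qed

context voronoi
begin

lemma dual_term_eq:
 assumes "d dvd Suc n"
 shows "dual_term (Suc n div d - 1) (d - 1) = of_nat d powr (- nu) * cnj (chi d) * (\<integral>t. phi t * voronoi_U nu q (Suc n) t \<partial>lborel)"
proof -
 have d: "d > 0" "Suc n div d > 0" using dvd_div_pos[OF assms] by auto
 have "(\<integral>t. phi t * voronoi_X nu (2 * pi * real d / real q) (2 * pi * real (Suc n div d) * t) \<partial>lborel)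
   = (\<integral>t. of_nat d powr (- nu) * (phi t * voronoi_U nu q (Suc n) t) \<partial>lborel)"
 proof (intro Bochner_Integration.integral_cong refl)
  fix t
  show "phi t * voronoi_X nu (2 * pi * real d / real q) (2 * pi * real (Suc n div d) * t) = of_nat d powr (- nu) * (phi t * voronoi_U nu q (Suc n) t)"
  proof (cases "t > lo")
   case True
   hence "t > 0" using lo by simp
   thus ?thesis using voronoi_X_eq_U[OF d q_pos, of t nu] assms by simp
  next
   case False
   hence "phi t = 0" using van by (simp add: vanishes_off_def)
   thus ?thesis by simp
  qed
 qed
 also have "... = of_nat d powr (- nu) * (\<integral>t. phi t * voronoi_U nu q (Suc n) t \<partial>lborel)" by (rule integral_mult_right_zero)
 finally show ?thesis using d by (simp add: dual_term_def)
qed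

text \<open>Absolute convergence permits regrouping the double series by the product of the two
  frequencies, Suc n = Suc k * Suc l; the shifts by one in the bijection come from counting all
  indices from 0.\<close>

lemma dual_sums:
 "(%n. sigma_char (- nu) (%m. cnj (chi m)) (Suc n) * (\<integral>t. phi t * voronoi_U nu q (Suc n) t \<partial>lborel)) sums (\<Sum>k. \<Sum>l. dual_term k l)"
proof -
 obtain C where C: "C >= 0" "!!k l. norm (dual_term k l) <= C * real (Suc k) powr (Re nu - 2) * (1 / (real (Suc l))^2)" using dual_term_bound by blast
 define u where "u = (%k. C * real (Suc k) powr (Re nu - 2))"
 define v where "v = (%l. 1 / (real (Suc l))^2)"
 have uv: "summable u" "!!k. u k >= 0" "summable v" "!!l. v l >= 0"
  using C summable_Suc_powr summable_inverse_Suc_squares by (auto simp: u_def v_def intro!: summable_mult)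
 have b: "norm (dual_term k l) <= u k * v l" for k l unfolding u_def v_def by (rule C(2))
 have S: "(%(k, l). dual_term k l) summable_on UNIV \<times> UNIV"
  by (rule abs_summable_summable[OF product_bound_summable_on[OF uv b]])
 have sl: "summable (%l. norm (dual_term k l))" for k
  by (rule summable_comparison_test'[OF summable_mult[OF uv(3), of "u k"], of 0]) (use b in auto)
 have sk: "summable (%k. norm (\<Sum>l. dual_term k l))"
 proof (rule summable_comparison_test'[OF summable_mult2[OF uv(1), of "suminf v"], of 0])
  fix k
  have "norm (\<Sum>l. dual_term k l) <= (\<Sum>l. norm (dual_term k l))" by (rule summable_norm[OF sl])
  also have "... <= (\<Sum>l. u k * v l)" by (rule suminf_le[OF b sl summable_mult[OF uv(3)]])
  also have "... = u k * suminf v" by (rule suminf_mult[OF uv(3)])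
  finally show "norm (norm (\<Sum>l. dual_term k l)) <= u k * suminf v" by simp
 qed
 have tot: "infsum (%(k, l). dual_term k l) (UNIV \<times> UNIV) = (\<Sum>k. \<Sum>l. dual_term k l)"
  using infsum_Sigma'_banach[OF S] by (simp add: infsum_eq_suminf sl sk)
 let ?B = "SIGMA n:UNIV. {d. d dvd Suc n}"
 define g where "g = (%n d. dual_term (Suc n div d - 1) (d - 1))"
 have bij: "bij_betw (%(n, d). (Suc n div d - 1, d - 1)) ?B (UNIV \<times> UNIV)"
 proof (rule bij_betw_byWitness[where f' = "%(k, l). (Suc k * Suc l - 1, Suc l)"])
  show "\<forall>a\<in>?B. (case case a of (n, d) => (Suc n div d - 1, d - 1) of (k, l) => (Suc k * Suc l - 1, Suc l)) = a"
  proof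
   fix a assume "a \<in> ?B"
   then obtain n d where a: "a = (n, d)" "d dvd Suc n" by auto
   have d: "d > 0" "Suc n div d > 0" using dvd_div_pos[OF a(2)] by auto
   hence e: "Suc (Suc n div d - 1) * Suc (d - 1) = Suc n" using a(2) by simp
   show "(case case a of (n, d) => (Suc n div d - 1, d - 1) of (k, l) => (Suc k * Suc l - 1, Suc l)) = a"
    by (simp only: a(1) prod.case e) (use d in simp)
  qed
  show "\<forall>a'\<in>UNIV \<times> UNIV. (case case a' of (k, l) => (Suc k * Suc l - 1, Suc l) of (n, d) => (Suc n div d - 1, d - 1)) = a'"
  proof
   fix a' :: "nat \<times> nat"
   obtain k l where a: "a' = (k, l)" by (cases a')
   have "Suc (Suc k * Suc l - 1) = Suc k * Suc l" by simp
   hence "Suc (Suc k * Suc l - 1) div Suc l = Suc k" by (simp only: nonzero_mult_div_cancel_right)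
   thus "(case case a' of (k, l) => (Suc k * Suc l - 1, Suc l) of (n, d) => (Suc n div d - 1, d - 1)) = a'"
    by (simp only: a prod.case) simp
  qed
  show "(%(k, l). (Suc k * Suc l - 1, Suc l)) ` (UNIV \<times> UNIV) \<subseteq> ?B"
  proof
   fix p assume "p \<in> (%(k, l). (Suc k * Suc l - 1, Suc l)) ` (UNIV \<times> UNIV)"
   then obtain k l where p: "p = (Suc k * Suc l - 1, Suc l)" by auto
   have "Suc (Suc k * Suc l - 1) = Suc k * Suc l" by simp
   hence "Suc l dvd Suc (Suc k * Suc l - 1)" by (metis dvd_triv_right)
   thus "p \<in> ?B" unfolding p by (simp only: mem_Sigma_iff mem_Collect_eq UNIV_I simp_thms)
  qed
 qed auto
 have g_eq: "(%(n, d). g n d) = (%p. case (case p of (n, d) => (Suc n div d - 1, d - 1)) of (k, l) => dual_term k l)"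
  by (simp add: g_def fun_eq_iff)
 have gS: "(%(n, d). g n d) summable_on ?B"
  unfolding g_eq by (rule summable_on_reindex_bij_betw[OF bij, THEN iffD2]) (rule S)
 have gI: "infsum (%(n, d). g n d) ?B = (\<Sum>k. \<Sum>l. dual_term k l)"
  unfolding g_eq tot[symmetric] by (rule infsum_reindex_bij_betw[OF bij])
 have inner: "infsum (g n) {d. d dvd Suc n} = sigma_char (- nu) (%m. cnj (chi m)) (Suc n) * (\<integral>t. phi t * voronoi_U nu q (Suc n) t \<partial>lborel)" for n
 proof -
  have "infsum (g n) {d. d dvd Suc n} = (\<Sum>d | d dvd Suc n. g n d)" by (rule infsum_finite) simp
  also have "... = (\<Sum>d | d dvd Suc n. of_nat d powr (- nu) * cnj (chi d) * (\<integral>t. phi t * voronoi_U nu q (Suc n) t \<partial>lborel))"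
   unfolding g_def by (intro sum.cong refl dual_term_eq) simp
  finally show ?thesis by (simp add: sigma_char_def sum_distrib_right)
 qed
 have "(%n. infsum (g n) {d. d dvd Suc n}) summable_on UNIV" by (rule summable_on_Sigma_banach[OF gS])
 moreover have "infsum (%n. infsum (g n) {d. d dvd Suc n}) UNIV = (\<Sum>k. \<Sum>l. dual_term k l)"
  using infsum_Sigma'_banach[OF gS] gI by simp
 ultimately have "((%n. infsum (g n) {d. d dvd Suc n}) has_sum (\<Sum>k. \<Sum>l. dual_term k l)) UNIV"
  using has_sum_infsum by metis
 hence "(%n. infsum (g n) {d. d dvd Suc n}) sums (\<Sum>k. \<Sum>l. dual_term k l)" by (rule has_sum_imp_sums)
 thus ?thesis by (simp only: inner)
qed

text \<open>For N = m d one has m powr nu = N powr nu * d powr (- nu), which turns the finite double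
  sum of \<open>voronoi_double_sum\<close> into \<open>sigma_bar_char\<close>. The bound
  \<open>J\<close> lies beyond the support of \<open>phi\<close>, so it truncates nothing.\<close>

theorem smoothed_voronoi:
 assumes J: "real J >= hi"
 shows "(%n. sigma_char (- nu) (%m. cnj (chi m)) (Suc n) * (\<integral>t. phi t * voronoi_U nu q (Suc n) t \<partial>lborel)) sums
  (of_nat q / (4 * \<i> * gauss_sum q chi) *
   (dirichlet_L chi (1 - nu) * (\<integral>t. phi t \<partial>lborel) - (\<Sum>N\<in>{1..J}. sigma_bar_char (- nu) chi N * (of_nat N powr nu * phi (real N)))))"
proof -
 have z: "phi (real m * real d) = 0" if "m * d > J" for m d
 proof -
  have "real m * real d >= hi" using that J by (metis less_imp_le of_nat_less_iff of_nat_mult order_le_less_trans)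
  thus ?thesis by (rule bump_zero)
 qed
 have inner: "inner_sum m = (\<Sum>d\<in>{1..J}. phi (real m * real d))" if "m >= 1" for m
 proof -
  have "inner_sum m = (\<Sum>j<J. phi (real m + real m * real j))"
   unfolding inner_sum_def
  proof (rule suminf_finite)
   fix j assume "j \<notin> {..<J}"
   hence "m * Suc j > J" using that by (metis Suc_le_eq le_trans lessThan_iff linorder_not_less mult_le_mono1 nat_mult_1 not_less_eq)
   from z[OF this] show "phi (real m + real m * real j) = 0" by (simp add: algebra_simps)
  qed simp
  also have "... = (\<Sum>d\<in>{1..J}. phi (real m * real d))"
   by (rule sum.reindex_bij_witness[where i = "%d. d - 1" and j = Suc]) (auto simp: algebra_simps)
  finally show ?thesis .
 qed
 have "(\<Sum>m. chi m * (of_nat m powr nu * inner_sum m)) = (\<Sum>m\<in>{1..J}. chi m * (of_nat m powr nu * inner_sum m))"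
 proof (rule suminf_finite)
  fix m assume m: "m \<notin> {1..J}"
  show "chi m * (of_nat m powr nu * inner_sum m) = 0"
  proof (cases "m = 0")
   case False
   hence "real m >= hi" using m J by auto
   thus ?thesis by (simp add: inner_sum_zero)
  qed (simp add: chi_0)
 qed simp
 also have "... = (\<Sum>m\<in>{1..J}. \<Sum>d\<in>{1..J}. chi m * (of_nat m powr nu * phi (real m * real d)))"
  by (intro sum.cong refl) (simp add: inner sum_distrib_left)
 also have "... = (\<Sum>N\<in>{1..J}. \<Sum>d | d dvd N. chi (N div d) * (of_nat (N div d) powr nu * phi (real (N div d) * real d)))"
  by (rule sum_divisor_rearrange) (simp add: z)
 also have "... = (\<Sum>N\<in>{1..J}. sigma_bar_char (- nu) chi N * (of_nat N powr nu * phi (real N)))"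
 proof (intro sum.cong refl)
  fix N assume N: "N \<in> {1..J}"
  have "chi (N div d) * (of_nat (N div d) powr nu * phi (real (N div d) * real d)) = of_nat d powr (- nu) * chi (N div d) * (of_nat N powr nu * phi (real N))" if "d dvd N" for d
  proof -
   have d: "d > 0" "N div d > 0" using dvd_div_pos[OF that] N by auto
   have Nd: "N = N div d * d" using that by simp
   have "(of_nat N :: complex) powr nu = of_nat (N div d) powr nu * of_nat d powr nu"
    by (subst Nd) (use powr_of_real_mult[of "real (N div d)" "real d" nu] d in simp)
   moreover have "of_nat d powr (- nu) * of_nat d powr nu = (1 :: complex)" using d by (simp add: powr_minus)
   ultimately have "of_nat d powr (- nu) * of_nat N powr nu = (of_nat (N div d) :: complex) powr nu"
    by (rule mult_inverse_cancel)
   moreover have "real (N div d) * real d = real N" using Nd by (metis of_nat_mult)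
   ultimately show ?thesis by (simp add: mult_ac)
  qed
  hence "(\<Sum>d | d dvd N. chi (N div d) * (of_nat (N div d) powr nu * phi (real (N div d) * real d))) = (\<Sum>d | d dvd N. of_nat d powr (- nu) * chi (N div d) * (of_nat N powr nu * phi (real N)))"
   by (intro sum.cong) auto
  thus "(\<Sum>d | d dvd N. chi (N div d) * (of_nat (N div d) powr nu * phi (real (N div d) * real d))) = sigma_bar_char (- nu) chi N * (of_nat N powr nu * phi (real N))"
   by (simp add: sigma_bar_char_def sum_distrib_right)
 qed
 finally have L: "(\<Sum>N\<in>{1..J}. sigma_bar_char (- nu) chi N * (of_nat N powr nu * phi (real N))) = P0 0 * dirichlet_L chi (1 - nu) - 4 * \<i> * gauss_sum q chi / of_nat q * (\<Sum>k. \<Sum>l. dual_term k l)"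
  using voronoi_double_sum by simp
 have P: "P0 0 = (\<integral>t. phi t \<partial>lborel)" unfolding P0_eq by simp
 have "X = of_nat q / (4 * \<i> * gauss_sum q chi) * (A - (A - 4 * \<i> * gauss_sum q chi / of_nat q * X))" for X A
  using gauss_sum_nonzero q_pos by simp
 hence "(\<Sum>k. \<Sum>l. dual_term k l) = of_nat q / (4 * \<i> * gauss_sum q chi) *
   (dirichlet_L chi (1 - nu) * (\<integral>t. phi t \<partial>lborel) - (\<Sum>N\<in>{1..J}. sigma_bar_char (- nu) chi N * (of_nat N powr nu * phi (real N))))"
  unfolding L P mult.commute[of "dirichlet_L chi (1 - nu)"] by blast
 thus ?thesis using dual_sums by (simp only:)
qed

end

section \<open>Asymptotic expansion of the kernel at infinity\<close>

text \<open>Comparison with the primitive - K / (m x^m) bounds all increments beyond x by K / x^m.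
  This gives a Cauchy sequence along x0 + n, and the same estimate gives the rate.\<close>

lemma convergence_at_top_of_deriv_bound:
 fixes f f' :: "real => complex"
 assumes x0: "x0 > 0" and m: "m >= 1"
  and d: "!!x. x >= x0 ==> (f has_vector_derivative f' x) (at x)"
  and b: "!!x. x >= x0 ==> norm (f' x) <= K / x ^ Suc m"
 shows "\<exists>L. \<forall>x\<ge>x0. norm (f x - L) <= K / x ^ m"
proof -
 have K: "K >= 0"
 proof -
  have "0 <= K / x0 ^ Suc m" using b[of x0] norm_ge_zero[of "f' x0"] by linarith
  moreover have p: "x0 ^ Suc m > 0" using x0 by (rule zero_less_power)
  ultimately have "0 <= K / x0 ^ Suc m * x0 ^ Suc m" by (intro mult_nonneg_nonneg) auto
  also have "... = K" using p by (metis less_irrefl nonzero_eq_divide_eq)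
  finally show ?thesis .
 qed
 have step: "norm (f y - f x) <= K / x ^ m" if "x >= x0" "y >= x" for x y
 proof (cases "x = y")
  case True
  have "K / x ^ m >= 0" using K that x0 by (intro divide_nonneg_nonneg) auto
  thus ?thesis using True by simp
 next
  case False
  define \<psi> where "\<psi> = (%x. - (K / (real m * x ^ m)))"
  have xp: "x > 0" using that x0 by linarith
  have "norm (f y - f x) <= \<psi> y - \<psi> x"
  proof (rule differentiable_bound_general[where f' = f' and \<phi>' = "%x. K / x ^ Suc m"])
   show "x < y" using False that by simp
   show "continuous_on {x..y} f"
    using that by (intro continuous_at_imp_continuous_on ballI has_vector_derivative_continuous[OF d]) auto
   show "continuous_on {x..y} \<psi>" unfolding \<psi>_def using xp m by (intro continuous_intros) auto
   fix z assume z: "x < z" "z < y"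
   show "(f has_vector_derivative f' z) (at z)" using z that by (intro d) auto
   show "norm (f' z) <= K / z ^ Suc m" using z that by (intro b) auto
   have zp: "z > 0" using z xp by simp
   have "(\<psi> has_real_derivative K / z ^ Suc m) (at z)"
   proof -
    have mm: "z ^ m = z ^ (m - 1) * z" using m by (metis One_nat_def Suc_pred le_imp_less_Suc less_Suc_eq_le not_less_eq power_Suc2 less_eq_Suc_le)
    have "((%z. - (K / (real m * z ^ m))) has_real_derivative K * (real m * (real m * z ^ (m - 1))) / (real m * z ^ m)^2) (at z)"
     using zp m by (auto intro!: derivative_eq_intros simp: power2_eq_square)
    also have "K * (real m * (real m * z ^ (m - 1))) / (real m * z ^ m)^2 = K / z ^ Suc m"
     using zp m by (simp add: mm power2_eq_square)
    finally show ?thesis by (simp add: \<psi>_def)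
   qed
   thus "(\<psi> has_vector_derivative K / z ^ Suc m) (at z)" by (simp add: has_real_derivative_iff_has_vector_derivative)
  qed
  also have "... <= K / (real m * x ^ m)" using K xp that by (simp add: \<psi>_def)
  also have "... <= K / (1 * x ^ m)" using K xp m by (intro divide_left_mono mult_right_mono) auto
  finally show ?thesis by simp
 qed
 have "Cauchy (%n. f (x0 + real n))"
 proof (rule CauchyI)
  fix e :: real assume e: "e > 0"
  have "(%n. K / (x0 + real n) ^ m) \<longlonglongrightarrow> 0"
  proof -
   have "filterlim (%n. (x0 + real n) ^ m) at_top sequentially"
    using m by (intro filterlim_pow_at_top filterlim_tendsto_add_at_top[OF tendsto_const] filterlim_real_sequentially) auto
   thus ?thesis by (intro tendsto_divide_0[OF tendsto_const] filterlim_at_top_imp_at_infinity)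
  qed
  hence "\<forall>\<^sub>F n in sequentially. K / (x0 + real n) ^ m < e / 2" using e by (intro order_tendstoD(2)) auto
  then obtain N where N: "K / (x0 + real N) ^ m < e / 2" by (auto simp: eventually_sequentially)
  have "norm (f (x0 + real n) - f (x0 + real N)) < e / 2" if "n >= N" for n
  proof -
   have "norm (f (x0 + real n) - f (x0 + real N)) <= K / (x0 + real N) ^ m" by (rule step) (use that in auto)
   thus ?thesis using N by linarith
  qed
  hence "norm (f (x0 + real n) - f (x0 + real m')) < e" if "n >= N" "m' >= N" for n m'
   using that norm_triangle_half_l[of "f (x0 + real n)" "f (x0 + real N)" e "f (x0 + real m')"] by blast
  thus "\<exists>M. \<forall>m\<ge>M. \<forall>n\<ge>M. norm (f (x0 + real m) - f (x0 + real n)) < e" by blast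
 qed
 then obtain L where L: "(%n. f (x0 + real n)) \<longlonglongrightarrow> L" using Cauchy_convergent convergent_def by blast
 have "norm (f x - L) <= K / x ^ m" if "x >= x0" for x
 proof -
  obtain N :: nat where N: "real N > x - x0" using reals_Archimedean2 by blast
  have "(%n. norm (f (x0 + real n) - f x)) \<longlonglongrightarrow> norm (L - f x)" by (intro tendsto_intros L)
  moreover have "\<forall>n\<ge>N. norm (f (x0 + real n) - f x) <= K / x ^ m"
  proof (intro allI impI)
   fix n assume "n >= N"
   hence "real n >= real N" by simp
   thus "norm (f (x0 + real n) - f x) <= K / x ^ m" using that N by (intro step) auto
  qed
  ultimately have "norm (L - f x) <= K / x ^ m" by (intro LIMSEQ_le_const2) auto
  thus ?thesis by (simp add: norm_minus_commute)
 qed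
 thus ?thesis by blast
qed

text \<open>The equation w'' = - w + kap / x^2 * w as a first-order system. Bessel functions times
  sqrt x satisfy it, and since 1 / x^2 is integrable at infinity its solutions behave like free
  waves.\<close>

locale perturbed_oscillator =
 fixes w w1 :: "real => complex" and kap :: complex and x0 :: real
 assumes x0: "x0 > 0"
  and dw: "!!x. x >= x0 ==> (w has_vector_derivative w1 x) (at x)"
  and dw1: "!!x. x >= x0 ==> (w1 has_vector_derivative (- w x + kap / (of_real x)^2 * w x)) (at x)"
begin

text \<open>In the energy formed from w and w' the free terms cancel, which leaves E' <= k / x^2 *
  E. The factor exp (k / x) absorbs this growth and makes \<open>G\<close> nonincreasing. The real
  inner product of complex numbers is used, so \<open>kap\<close> may be complex.\<close>

lemma solution_bounded: "\<exists>M\<ge>0. \<forall>x\<ge>x0. norm (w x) <= M"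
proof -
 define k where "k = norm kap"
 define E where "E = (%x. w x \<bullet> w x + w1 x \<bullet> w1 x)"
 define E' where "E' = (%x. 2 * (w1 x \<bullet> (kap / (of_real x)^2 * w x)))"
 have dE: "(E has_real_derivative E' x) (at x)" if "x >= x0" for x
 proof -
  have "(E has_vector_derivative ((w x \<bullet> w1 x + w1 x \<bullet> w x) + (w1 x \<bullet> (- w x + kap / (of_real x)^2 * w x) + (- w x + kap / (of_real x)^2 * w x) \<bullet> w1 x))) (at x)"
   unfolding E_def by (intro has_vector_derivative_add bounded_bilinear.has_vector_derivative[OF bounded_bilinear_inner] dw dw1 that)
  moreover have "((w x \<bullet> w1 x + w1 x \<bullet> w x) + (w1 x \<bullet> (- w x + kap / (of_real x)^2 * w x) + (- w x + kap / (of_real x)^2 * w x) \<bullet> w1 x)) = E' x"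
   unfolding E'_def by (simp add: inner_add_right inner_add_left inner_diff_right inner_diff_left inner_commute)
  ultimately show ?thesis by (simp add: has_real_derivative_iff_has_vector_derivative)
 qed
 have E'_le: "E' x <= k / x^2 * E x" if "x >= x0" for x
 proof -
  have xp: "x > 0" using that x0 by simp
  have "w1 x \<bullet> (kap / (of_real x)^2 * w x) <= norm (w1 x) * norm (kap / (of_real x)^2 * w x)" by (rule norm_cauchy_schwarz)
  also have "norm (kap / (of_real x)^2 * w x) = k / x^2 * norm (w x)" by (simp add: norm_mult norm_divide norm_power k_def)
  also have "norm (w1 x) * (k / x^2 * norm (w x)) = k / x^2 * (norm (w1 x) * norm (w x))" by simp
  also have "... <= k / x^2 * (E x / 2)"
  proof (intro mult_left_mono)
   have "0 <= (norm (w1 x) - norm (w x))^2" by simp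
   hence "2 * (norm (w1 x) * norm (w x)) <= (norm (w x))^2 + (norm (w1 x))^2" by (simp add: power2_diff mult_ac)
   thus "norm (w1 x) * norm (w x) <= E x / 2" by (simp add: E_def dot_square_norm)
  qed (auto simp: k_def)
  also have "k / x^2 * (E x / 2) = (k / x^2 * E x) / 2" by simp
  finally have "w1 x \<bullet> (kap / (of_real x)^2 * w x) <= (k / x^2 * E x) / 2" .
  moreover have "2 * a <= b" if "a <= b / 2" for a b :: real using that by simp
  ultimately show ?thesis unfolding E'_def by blast
 qed
 define G where "G = (%x. E x * exp (k / x))"
 have dG: "(G has_real_derivative (E' x - k / x^2 * E x) * exp (k / x)) (at x)" if "x >= x0" for x
 proof -
  have xp: "x > 0" using that x0 by simp
  have "((%x. exp (k / x)) has_real_derivative (- k / x^2) * exp (k / x)) (at x)"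
   using xp by (auto intro!: derivative_eq_intros simp: power2_eq_square)
  from DERIV_mult[OF dE[OF that] this] show ?thesis
   unfolding G_def by (simp add: algebra_simps)
 qed
 have mono: "G x <= G x0" if "x >= x0" for x
 proof (rule DERIV_nonpos_imp_nonincreasing[OF that])
  fix y assume y: "x0 <= y" "y <= x"
  have "(E' y - k / y^2 * E y) * exp (k / y) <= 0" using E'_le[OF y(1)] by (intro mult_nonpos_nonneg) auto
  thus "\<exists>z. (G has_real_derivative z) (at y) \<and> z <= 0" using dG[OF y(1)] by blast
 qed
 have "norm (w x) <= sqrt (G x0)" if "x >= x0" for x
 proof -
  have xp: "x > 0" using that x0 by simp
  have "(norm (w x))^2 <= E x" by (simp add: E_def dot_square_norm)
  also have "E x * 1 <= E x * exp (k / x)" using xp by (intro mult_left_mono) (auto simp: E_def k_def)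
  also have "... <= G x0" using mono[OF that] by (simp add: G_def)
  finally show ?thesis by (simp add: real_le_rsqrt)
 qed
 moreover have "sqrt (G x0) >= 0" by (simp add: G_def E_def)
 ultimately show ?thesis by blast
qed

text \<open>Variation of constants: for u = i and u = - i these are, up to the factor 2 u, the
  amplitudes of the two free waves; they would be constant for kap = 0.\<close>

definition amp :: "complex => real => complex" where
 "amp u x = exp (- (u * of_real x)) * (w1 x + u * w x)"

lemma amp_deriv:
 assumes u: "u^2 = -1" and x: "x >= x0"
 shows "(amp u has_vector_derivative kap / (of_real x)^2 * exp (- (u * of_real x)) * w x) (at x)"
proof -
 have e: "((%x. exp (- (u * of_real x))) has_vector_derivative - u * exp (- (u * of_real x))) (at x)"
  by (rule has_vector_derivative_real_field) (auto intro!: derivative_eq_intros)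
 have s: "((%x. w1 x + u * w x) has_vector_derivative (- w x + kap / (of_real x)^2 * w x) + u * w1 x) (at x)"
  by (intro has_vector_derivative_add has_vector_derivative_mult_right dw dw1 x)
 have uu: "u * u = -1" using u by (simp add: power2_eq_square)
 show ?thesis
  unfolding amp_def
 proof (rule has_vector_derivative_eq_rhs[OF has_vector_derivative_mult[OF e s]])
  have alg: "E * ((- W + K * W) + u * W1) + (- u * E) * (W1 + u * W) = K * E * W + (- 1 - u * u) * E * W" for E W W1 K
   by (simp add: algebra_simps)
  show "exp (- (u * of_real x)) * (- w x + kap / (of_real x)^2 * w x + u * w1 x) + - u * exp (- (u * of_real x)) * (w1 x + u * w x)
   = kap / (of_real x)^2 * exp (- (u * of_real x)) * w x"
   unfolding alg uu by simp
 qed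
qed

lemma norm_exp_unit:
 assumes "u = \<i> \<or> u = - \<i>"
 shows "norm (exp (u * of_real x)) = 1" "norm (exp (- (u * of_real x))) = 1"
 using assms by auto

lemma w_eq_amp:
 assumes "u^2 = -1"
 shows "w x = (exp (u * of_real x) * amp u x - exp (- (u * of_real x)) * amp (- u) x) / (2 * u)"
proof -
 have "u ~= 0" using assms by auto
 have "exp (u * of_real x) * amp u x = w1 x + u * w x" "exp (- (u * of_real x)) * amp (- u) x = w1 x - u * w x"
  by (simp_all add: amp_def mult.assoc[symmetric] exp_add[symmetric])
 thus ?thesis using \<open>u ~= 0\<close> by simp
qed

lemma amp_limit: "\<exists>K\<ge>0. \<forall>u\<in>{\<i>, - \<i>}. \<exists>L. \<forall>x\<ge>x0. norm (amp u x - L) <= K / x"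
proof -
 obtain M where M: "M >= 0" "!!x. x >= x0 ==> norm (w x) <= M" using solution_bounded by blast
 have "\<exists>L. \<forall>x\<ge>x0. norm (amp u x - L) <= (norm kap * M) / x ^ 1" if "u \<in> {\<i>, - \<i>}" for u
 proof (rule convergence_at_top_of_deriv_bound[OF x0, of 1 "amp u" "%x. kap / (of_real x)^2 * exp (- (u * of_real x)) * w x"])
  fix x assume x: "x >= x0"
  show "(amp u has_vector_derivative kap / (of_real x)^2 * exp (- (u * of_real x)) * w x) (at x)"
   by (rule amp_deriv[OF _ x]) (use that in auto)
  have "norm (kap / (of_real x)^2 * exp (- (u * of_real x)) * w x) = norm kap / x^2 * norm (w x)"
   using norm_exp_unit(2)[of u x] that by (simp add: norm_mult norm_divide norm_power)
  also have "... <= norm kap / x^2 * M" using M(2)[OF x] by (intro mult_left_mono) auto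
  finally show "norm (kap / (of_real x)^2 * exp (- (u * of_real x)) * w x) <= norm kap * M / x ^ Suc 1"
   by (simp add: power2_eq_square)
 qed simp
 thus ?thesis using M(1) by (intro exI[of _ "norm kap * M"]) auto
qed

text \<open>To leading order the derivative of \<open>amp u\<close> is kap / (2 u x^2) times a - b *
  exp (- 2 u x). The constant part integrates to the term in 1 / x. The oscillating part is
  integrated by parts: the explicit function \<open>c\<close>, of size x powr (-2), removes it and
  leaves an error of size x powr (-3). The corrected function \<open>h\<close> therefore converges
  at the rate x powr (-2).\<close>

lemma amp_expansion:
 assumes u: "u \<in> {\<i>, - \<i>}" and K: "K >= 0" "!!x. x >= x0 ==> norm (amp u x - a) <= K / x" "!!x. x >= x0 ==> norm (amp (- u) x - b) <= K / x"
 shows "\<exists>D\<ge>0. \<forall>x\<ge>x0. norm (amp u x - (a - kap * a / (2 * u) / of_real x)) <= D / x^2"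
proof -
 have u2: "u^2 = -1" "u ~= 0" "u * u = -1" "norm u = 1" using u by auto
 define c where "c = (%x. - (kap * b / 4) * (exp (- (2 * u * of_real x)) * of_real (1 / x^2)))"
 define h where "h = (%x. amp u x + kap * a / (2 * u) * of_real (1 / x) - c x)"
 define h' where "h' = (%x. kap / (2 * u) * of_real (1 / x^2) * ((amp u x - a) - exp (- (2 * u * of_real x)) * (amp (- u) x - b))
    - kap * b / 2 * (exp (- (2 * u * of_real x)) * of_real (1 / x ^ 3)))"
 have dh: "(h has_vector_derivative h' x) (at x)" if x: "x >= x0" for x
 proof -
  have xp: "x > 0" using x x0 by simp
  have d1: "((%x. complex_of_real (1 / x)) has_vector_derivative of_real (- 1 / x^2)) (at x)"
   using xp by (intro has_vector_derivative_of_real) (auto intro!: derivative_eq_intros simp flip: has_real_derivative_iff_has_vector_derivative simp: power2_eq_square)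
  have d2: "((%x. complex_of_real (1 / x^2)) has_vector_derivative of_real (- 2 / x ^ 3)) (at x)"
   using xp by (intro has_vector_derivative_of_real) (auto intro!: derivative_eq_intros simp flip: has_real_derivative_iff_has_vector_derivative simp: power2_eq_square power3_eq_cube field_simps)
  have e: "((%x. exp (- (2 * u * of_real x))) has_vector_derivative - (2 * u) * exp (- (2 * u * of_real x))) (at x)"
   by (rule has_vector_derivative_real_field) (auto intro!: derivative_eq_intros)
  have dc: "(c has_vector_derivative - (kap * b / 4) * (exp (- (2 * u * of_real x)) * of_real (- 2 / x ^ 3) + (- (2 * u) * exp (- (2 * u * of_real x))) * of_real (1 / x^2))) (at x)"
   unfolding c_def by (intro has_vector_derivative_mult_right has_vector_derivative_mult e d2)
  have "(h has_vector_derivative (kap / (of_real x)^2 * exp (- (u * of_real x)) * w x + kap * a / (2 * u) * of_real (- 1 / x^2)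
   - (- (kap * b / 4) * (exp (- (2 * u * of_real x)) * of_real (- 2 / x ^ 3) + (- (2 * u) * exp (- (2 * u * of_real x))) * of_real (1 / x^2))))) (at x)"
   unfolding h_def by (intro has_vector_derivative_diff has_vector_derivative_add has_vector_derivative_mult_right amp_deriv u2 x d1 dc)
  moreover have "kap / (of_real x)^2 * exp (- (u * of_real x)) * w x + kap * a / (2 * u) * of_real (- 1 / x^2)
   - (- (kap * b / 4) * (exp (- (2 * u * of_real x)) * of_real (- 2 / x ^ 3) + (- (2 * u) * exp (- (2 * u * of_real x))) * of_real (1 / x^2))) = h' x"
  proof -
   define E where "E = exp (- (2 * u * of_real x))"
   define i2 where "i2 = complex_of_real (1 / x^2)"
   define i3 where "i3 = complex_of_real (1 / x ^ 3)"
   have ew: "exp (- (u * of_real x)) * w x = (amp u x - E * amp (- u) x) / (2 * u)"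
   proof -
    have "exp (- (u * of_real x)) * exp (u * of_real x) = 1" by (simp add: exp_add[symmetric])
    moreover have "exp (- (u * of_real x)) * exp (- (u * of_real x)) = E" by (simp add: E_def exp_add[symmetric] mult.assoc)
    ultimately show ?thesis
     unfolding w_eq_amp[OF u2(1), of x] times_divide_eq_right right_diff_distrib mult.assoc[symmetric] by simp
   qed
   have iu: "1 / (2 * u) = - u / 2" using u2(2,3) by (simp add: field_simps)
   have "kap / (of_real x)^2 * exp (- (u * of_real x)) * w x = kap * i2 * (exp (- (u * of_real x)) * w x)"
    by (simp add: i2_def)
   also have "... = kap * i2 * ((amp u x - E * amp (- u) x) * (- u / 2))" unfolding ew iu[symmetric] by simp
   finally have t1: "kap / (of_real x)^2 * exp (- (u * of_real x)) * w x = kap * i2 * ((amp u x - E * amp (- u) x) * (- u / 2))" .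
   have t2: "of_real (- 1 / x^2) = - i2" "of_real (- 2 / x ^ 3) = - 2 * i3" by (simp_all add: i2_def i3_def)
   have t3: "kap * a / (2 * u) = kap * a * (- u / 2)" "kap / (2 * u) = kap * (- u / 2)" unfolding iu[symmetric] by simp_all
   show ?thesis
    unfolding h'_def t1 t2 t3 E_def[symmetric] i2_def[symmetric] i3_def[symmetric] by (simp add: algebra_simps)
  qed
  ultimately show ?thesis by simp
 qed
 define D1 where "D1 = norm kap * K + norm kap * norm b / 2"
 have bh: "norm (h' x) <= D1 / x ^ Suc 2" if x: "x >= x0" for x
 proof -
  have xp: "x > 0" using x x0 by simp
  have ne: "norm (exp (- (2 * u * of_real x))) = 1" using u by auto
  have "norm ((amp u x - a) - exp (- (2 * u * of_real x)) * (amp (- u) x - b)) <= K / x + 1 * (K / x)"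
  proof -
   have "norm (exp (- (2 * u * of_real x)) * (amp (- u) x - b)) <= K / x"
    using K(3)[OF x] by (simp only: norm_mult ne mult_1_left)
   thus ?thesis using norm_triangle_ineq4[of "amp u x - a" "exp (- (2 * u * of_real x)) * (amp (- u) x - b)"] K(2)[OF x] by linarith
  qed
  hence 1: "norm (kap / (2 * u) * of_real (1 / x^2) * ((amp u x - a) - exp (- (2 * u * of_real x)) * (amp (- u) x - b))) <= norm kap / 2 * (1 / x^2) * (K / x + 1 * (K / x))"
   unfolding norm_mult by (intro mult_mono) (auto simp: norm_divide u2 norm_mult norm_power)
  have 2: "norm (kap * b / 2 * (exp (- (2 * u * of_real x)) * of_real (1 / x ^ 3))) = norm kap * norm b / 2 * (1 / x ^ 3)"
   using ne xp by (simp add: norm_mult norm_divide norm_power)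
  have "norm (h' x) <= norm kap / 2 * (1 / x^2) * (K / x + 1 * (K / x)) + norm kap * norm b / 2 * (1 / x ^ 3)"
   unfolding h'_def by (rule order_trans[OF norm_triangle_ineq4]) (use 1 2 in linarith)
  also have "... = D1 / x ^ Suc 2" using xp by (simp add: D1_def field_simps power2_eq_square eval_nat_numeral)
  finally show ?thesis .
 qed
 obtain L where L: "!!x. x >= x0 ==> norm (h x - L) <= D1 / x ^ 2"
  using convergence_at_top_of_deriv_bound[OF x0, of 2 h h' D1] dh bh by auto
 have nc: "norm (c x) = norm kap * norm b / 4 * (1 / x^2)" for x
  unfolding c_def using u by (auto simp: norm_mult norm_divide norm_power)
 \<comment> \<open>The limit of \<open>h\<close> is identified through \<open>amp u\<close>, since
   both corrections contained in \<open>h\<close> tend to 0.\<close>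
 have "L = a"
 proof -
  have lim0: "((%x::real. C / x) \<longlongrightarrow> 0) at_top" "((%x::real. C / x^2) \<longlongrightarrow> 0) at_top" for C by real_asymp+
  have "((%x. h x - amp u x) \<longlongrightarrow> 0) at_top"
  proof (rule Lim_null_comparison)
   show "\<forall>\<^sub>F x in at_top. norm (h x - amp u x) <= norm (kap * a / (2 * u)) / x + norm kap * norm b / 4 / x^2"
    using eventually_gt_at_top[of 0]
   proof eventually_elim
    case (elim x)
    have "norm (h x - amp u x) <= norm (kap * a / (2 * u) * of_real (1 / x)) + norm (c x)"
     unfolding h_def by (rule order_trans[OF _ norm_triangle_ineq4]) simp
    thus ?case using elim unfolding nc norm_mult by (simp add: norm_divide)
   qed
   show "((%x. norm (kap * a / (2 * u)) / x + norm kap * norm b / 4 / x^2) \<longlongrightarrow> 0) at_top"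
    using tendsto_add[OF lim0(1)[of "norm (kap * a / (2 * u))"] lim0(2)[of "norm kap * norm b / 4"]] by (simp only: add_0_right)
  qed
  moreover have "((%x. h x - L) \<longlongrightarrow> 0) at_top"
   by (rule Lim_null_comparison[OF eventually_mono[OF eventually_ge_at_top[of x0] L] lim0(2)[of D1]])
  moreover have "((%x. amp u x - a) \<longlongrightarrow> 0) at_top"
   by (rule Lim_null_comparison[OF eventually_mono[OF eventually_ge_at_top[of x0] K(2)] lim0(1)[of K]])
  ultimately have "((%x. (h x - amp u x) + (amp u x - a) - (h x - L)) \<longlongrightarrow> 0 + 0 - 0) at_top"
   by (intro tendsto_diff tendsto_add)
  hence "((%x::real. L - a) \<longlongrightarrow> 0) at_top" by simp
  hence "L - a = 0" by (simp add: tendsto_const_iff)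
  thus ?thesis by simp
 qed
 have "norm (amp u x - (a - kap * a / (2 * u) / of_real x)) <= (D1 + norm kap * norm b / 4) / x^2" if x: "x >= x0" for x
 proof -
  have "amp u x - (a - kap * a / (2 * u) / of_real x) = (h x - L) + c x"
   unfolding h_def \<open>L = a\<close> by simp
  hence "norm (amp u x - (a - kap * a / (2 * u) / of_real x)) <= norm (h x - L) + norm (c x)" by (simp add: norm_triangle_ineq)
  also have "... <= D1 / x^2 + norm kap * norm b / 4 * (1 / x^2)" unfolding nc using L[OF x] by simp
  finally show ?thesis by (simp add: add_divide_distrib)
 qed
 moreover have "D1 + norm kap * norm b / 4 >= 0" using K(1) by (simp add: D1_def)
 ultimately show ?thesis by blast
qed

theorem oscillator_expansion:
 "\<exists>A0 A1 B0 B1 D. D >= 0 \<and> (\<forall>x\<ge>x0. norm (w x - (exp (\<i> * of_real x) * (A0 + A1 / of_real x) + exp (- (\<i> * of_real x)) * (B0 + B1 / of_real x))) <= D / x^2)"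
proof -
 obtain K where K: "K >= 0" "!!u. u \<in> {\<i>, - \<i>} ==> \<exists>L. \<forall>x\<ge>x0. norm (amp u x - L) <= K / x" using amp_limit by blast
 obtain a where a: "!!x. x >= x0 ==> norm (amp \<i> x - a) <= K / x" using K(2)[of \<i>] by auto
 obtain b where b: "!!x. x >= x0 ==> norm (amp (- \<i>) x - b) <= K / x" using K(2)[of "- \<i>"] by auto
 obtain D1 where D1: "D1 >= 0" "!!x. x >= x0 ==> norm (amp \<i> x - (a - kap * a / (2 * \<i>) / of_real x)) <= D1 / x^2"
  using amp_expansion[of \<i> K a b] K(1) a b by auto
 obtain D2 where D2: "D2 >= 0" "!!x. x >= x0 ==> norm (amp (- \<i>) x - (b - kap * b / (2 * (- \<i>)) / of_real x)) <= D2 / x^2"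
  using amp_expansion[of "- \<i>" K b a] K(1) a b by auto
 define A0 A1 B0 B1 where "A0 = a / (2 * \<i>)" and "A1 = - (kap * a / (2 * \<i>)) / (2 * \<i>)"
  and "B0 = - b / (2 * \<i>)" and "B1 = (kap * b / (2 * (- \<i>))) / (2 * \<i>)"
 have "norm (w x - (exp (\<i> * of_real x) * (A0 + A1 / of_real x) + exp (- (\<i> * of_real x)) * (B0 + B1 / of_real x))) <= (D1 + D2) / x^2" if x: "x >= x0" for x
 proof -
  have xp: "x > 0" using x x0 by simp
  define \<alpha> where "\<alpha> = amp \<i> x - (a - kap * a / (2 * \<i>) / of_real x)"
  define \<beta> where "\<beta> = amp (- \<i>) x - (b - kap * b / (2 * (- \<i>)) / of_real x)"
  have am: "amp \<i> x = \<alpha> + (a - kap * a / (2 * \<i>) / of_real x)" "amp (- \<i>) x = \<beta> + (b - kap * b / (2 * (- \<i>)) / of_real x)"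
   by (simp_all add: \<alpha>_def \<beta>_def)
  have i2: "\<i>\<^sup>2 = -1" by simp
  have alg: "(E * (\<alpha> + (a - p / X)) - F * (\<beta> + (b - r / X))) / (2 * \<i>) - (E * (a / (2 * \<i>) + - p / (2 * \<i>) / X) + F * (- b / (2 * \<i>) + r / (2 * \<i>) / X)) = (E * \<alpha> - F * \<beta>) / (2 * \<i>)" for E F p r X
   by (simp add: algebra_simps diff_divide_distrib add_divide_distrib)
  have "w x - (exp (\<i> * of_real x) * (A0 + A1 / of_real x) + exp (- (\<i> * of_real x)) * (B0 + B1 / of_real x)) = (exp (\<i> * of_real x) * \<alpha> - exp (- (\<i> * of_real x)) * \<beta>) / (2 * \<i>)"
   unfolding w_eq_amp[OF i2, of x] am A0_def A1_def B0_def B1_def by (rule alg)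
  also have "norm ... <= (norm \<alpha> + norm \<beta>) / 2"
   unfolding norm_divide using norm_triangle_ineq4[of "exp (\<i> * of_real x) * \<alpha>" "exp (- (\<i> * of_real x)) * \<beta>"] by (simp add: norm_mult divide_right_mono)
  also have "... <= norm \<alpha> + norm \<beta>" by simp
  also have "... <= D1 / x^2 + D2 / x^2" using D1(2)[OF x] D2(2)[OF x] unfolding \<alpha>_def \<beta>_def by linarith
  finally show ?thesis by (simp add: add_divide_distrib)
 qed
 thus ?thesis using D1(1) D2(1) by (intro exI[of _ A0] exI[of _ A1] exI[of _ B0] exI[of _ B1] exI[of _ "D1 + D2"]) auto
qed

end

text \<open>The function is a constant multiple of sqrt x * J mu x, and kap = mu^2 - 1/4 is the
  coefficient in the Liouville normal form of Bessel's equation.\<close>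

lemma bessel_J_oscillator:
 assumes x0: "x0 > 0"
 shows "\<exists>w1. perturbed_oscillator (%x. of_real x powr (mu + 1/2) * bessel_E mu (- (of_real x)\<^sup>2 / 4)) w1 (mu\<^sup>2 - 1/4) x0"
proof -
 define p where "p = (%s x. complex_of_real x powr s)"
 define E where "E = (%j x. bessel_E (mu + j) (- (complex_of_real x)\<^sup>2 / 4))"
 have dp: "(p s has_vector_derivative s * p (s - 1) x) (at x)" if "x > 0" for s x
  unfolding p_def by (rule has_vector_derivative_real_field, rule has_field_derivative_powr) (use that in \<open>auto simp: complex_nonpos_Reals_iff\<close>)
 have dE: "(E j has_vector_derivative - (of_real x / 2) * E (j + 1) x) (at x)" for j x
 proof -
  have "((%z. - z\<^sup>2 / 4) has_field_derivative - (of_real x / 2)) (at (complex_of_real x))"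
   by (auto intro!: derivative_eq_intros)
  from DERIV_chain2[OF bessel_E_deriv this]
  have "((%z. bessel_E (mu + j) (- z\<^sup>2 / 4)) has_field_derivative bessel_E (mu + j + 1) (- (of_real x)\<^sup>2 / 4) * - (of_real x / 2)) (at (complex_of_real x))" .
  from has_vector_derivative_real_field[OF this] show ?thesis
   unfolding E_def by (simp add: mult_ac add.assoc)
 qed
 have dpE: "((%x. p s x * E j x) has_vector_derivative (s * p (s - 1) x * E j x - p (s + 1) x * E (j + 1) x / 2)) (at x)" if x: "x > 0" for s j x
 proof (rule has_vector_derivative_eq_rhs[OF has_vector_derivative_mult[OF dp[OF x] dE]])
  have "p (s + 1) x = of_real x * p s x" using x by (simp add: p_def powr_add)
  thus "p s x * (- (of_real x / 2) * E (j + 1) x) + s * p (s - 1) x * E j x = s * p (s - 1) x * E j x - p (s + 1) x * E (j + 1) x / 2" by simp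
 qed
 define m where "m = mu + 1/2"
 define w1 where "w1 = (%x. m * (p (m - 1) x * E 0 x) - (p (m + 1) x * E 1 x) / 2)"
 have "perturbed_oscillator (%x. p m x * E 0 x) w1 (mu\<^sup>2 - 1/4) x0"
 proof
  fix x assume "x >= x0"
  hence x: "x > 0" using x0 by simp
  show "((%x. p m x * E 0 x) has_vector_derivative w1 x) (at x)"
   using dpE[OF x, of m 0] by (simp add: w1_def mult_ac)
  have px: "p (s + 1) x = of_real x * p s x" for s using x by (simp add: p_def powr_add)
  have pm1: "p m x = of_real x * p (m - 1) x" "p (m - 1) x = of_real x * p (m - 2) x" using px[of "m - 1"] px[of "m - 2"] by simp_all
  have rec: "E 0 x = (mu + 1) * E 1 x + (- (of_real x)\<^sup>2 / 4) * E 2 x"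
   using bessel_E_rec[of "mu + 1" "- (of_real x)\<^sup>2 / 4"] by (simp add: E_def add.assoc)
  have "(w1 has_vector_derivative m * ((m - 1) * p (m - 1 - 1) x * E 0 x - p (m - 1 + 1) x * E (0 + 1) x / 2)
    - ((m + 1) * p (m + 1 - 1) x * E 1 x - p (m + 1 + 1) x * E (1 + 1) x / 2) / 2) (at x)"
   unfolding w1_def by (intro has_vector_derivative_diff has_vector_derivative_mult_right has_vector_derivative_divide dpE x)
  moreover have "m * ((m - 1) * p (m - 1 - 1) x * E 0 x - p (m - 1 + 1) x * E (0 + 1) x / 2)
    - ((m + 1) * p (m + 1 - 1) x * E 1 x - p (m + 1 + 1) x * E (1 + 1) x / 2) / 2
   = - (p m x * E 0 x) + (mu\<^sup>2 - 1/4) / (of_real x)^2 * (p m x * E 0 x)"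
  proof -
   define P where "P = p (m - 2) x"
   define X where "X = complex_of_real x"
   have X: "X ~= 0" using x by (simp add: X_def)
   have ps: "p (m - 1 - 1) x = P" "p (m - 1 + 1) x = X * X * P" "p (m + 1 - 1) x = X * X * P" "p (m + 1 + 1) x = X * X * X * X * P" "p m x = X * X * P"
    using pm1 px[of m] px[of "m + 1"] by (simp_all add: P_def X_def)
   have "E (0 + 1) x = E 1 x" "E (1 + 1) x = E 2 x" by simp_all
   define e1 e2 where "e1 = E 1 x" and "e2 = E 2 x"
   have e0: "E 0 x = (mu + 1) * e1 - X * X / 4 * e2" using rec by (simp add: e1_def e2_def X_def power2_eq_square)
   have k: "(mu\<^sup>2 - 1/4) / X^2 * (X * X * P * E 0 x) = m * (m - 1) * P * E 0 x"
    using X by (simp add: m_def power2_eq_square field_simps)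
   have "m * ((m - 1) * P * E 0 x - X * X * P * e1 / 2) - ((m + 1) * (X * X * P) * e1 - X * X * X * X * P * e2 / 2) / 2
     = m * (m - 1) * P * E 0 x - X * X * P * ((mu + 1) * e1 - X * X / 4 * e2)"
    by (simp add: m_def field_simps)
   thus ?thesis unfolding ps \<open>E (0 + 1) x = E 1 x\<close> \<open>E (1 + 1) x = E 2 x\<close> X_def[symmetric] k e1_def[symmetric] e2_def[symmetric] e0[symmetric] by simp
  qed
  ultimately show "(w1 has_vector_derivative - (p m x * E 0 x) + (mu\<^sup>2 - 1/4) / (of_real x)^2 * (p m x * E 0 x)) (at x)" by simp
 qed (rule x0)
 thus ?thesis unfolding p_def E_def m_def by auto
qed

lemma bessel_J_expansion:
 assumes x0: "x0 > 0"
 shows "\<exists>A0 A1 B0 B1 D. D >= 0 \<and> (\<forall>x\<ge>x0. norm (of_real (sqrt x) * bessel_J mu x - (exp (\<i> * of_real x) * (A0 + A1 / of_real x) + exp (- (\<i> * of_real x)) * (B0 + B1 / of_real x))) <= D / x^2)"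
proof -
 define w where "w = (%x. of_real x powr (mu + 1/2) * bessel_E mu (- (of_real x)\<^sup>2 / 4))"
 obtain w1 where "perturbed_oscillator w w1 (mu\<^sup>2 - 1/4) x0" using bessel_J_oscillator[OF x0] unfolding w_def by blast
 then interpret perturbed_oscillator w w1 "mu\<^sup>2 - 1/4" x0 .
 obtain A0 A1 B0 B1 D where D: "D >= 0" "!!x. x >= x0 ==> norm (w x - (exp (\<i> * of_real x) * (A0 + A1 / of_real x) + exp (- (\<i> * of_real x)) * (B0 + B1 / of_real x))) <= D / x^2"
  using oscillator_expansion by blast
 define c where "c = complex_of_real (1/2) powr mu"
 have eq: "of_real (sqrt x) * bessel_J mu x = c * w x" if "x >= x0" for x
 proof -
  have x: "x > 0" using that x0 by simp
  have "complex_of_real (1/2 * x) powr mu = c * of_real x powr mu"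
   unfolding c_def using powr_of_real_mult[of "1/2" x mu] x by simp
  moreover have "complex_of_real (sqrt x) = of_real x powr (1/2)"
   using x powr_of_real[of x "1/2"] by (simp add: powr_half_sqrt)
  moreover have "of_real x powr (mu + 1/2) = of_real x powr mu * complex_of_real x powr (1/2)" by (simp add: powr_add)
  moreover have "x / 2 = 1/2 * x" by simp
  moreover have "- complex_of_real ((1/2 * x)^2) = - (of_real x)\<^sup>2 / 4" by (simp add: power2_eq_square)
  ultimately show ?thesis unfolding bessel_J_eq w_def by (simp only: mult_ac)
 qed
 have "norm (of_real (sqrt x) * bessel_J mu x - (exp (\<i> * of_real x) * (c * A0 + c * A1 / of_real x) + exp (- (\<i> * of_real x)) * (c * B0 + c * B1 / of_real x))) <= norm c * D / x^2" if x: "x >= x0" for x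
 proof -
  have "of_real (sqrt x) * bessel_J mu x - (exp (\<i> * of_real x) * (c * A0 + c * A1 / of_real x) + exp (- (\<i> * of_real x)) * (c * B0 + c * B1 / of_real x))
   = c * (w x - (exp (\<i> * of_real x) * (A0 + A1 / of_real x) + exp (- (\<i> * of_real x)) * (B0 + B1 / of_real x)))"
   unfolding eq[OF x] by (simp add: algebra_simps)
  thus ?thesis using mult_left_mono[OF D(2)[OF x] norm_ge_zero[of c]] by (simp add: norm_mult)
 qed
 moreover have "norm c * D >= 0" using D(1) by simp
 ultimately show ?thesis by blast
qed

text \<open>The difference is a multiple of K nu, and \<open>bessel_int_one\<close> writes it as an
  integral with parameter c = (x / 2)^2. Trading the factor exp (- c / w) for two powers of w / c
  gives the decay x powr (-4).\<close>

lemma bessel_I_diff_bound: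
 assumes nu: "0 < Re nu" "Re nu < 1" and x0: "x0 > 0"
 shows "\<exists>D\<ge>0. \<forall>x\<ge>x0. norm (of_real (sqrt x) * (bessel_I (- nu) x - bessel_I nu x)) <= D / x^2"
proof -
 define I where "I = (\<integral>x. gamma_kern (Re nu + 2) 1 x \<partial>lborel)"
 define c where "c = norm (rGamma (1 - nu) * rGamma nu)"
 define D where "D = (x0 / 2) powr (- Re nu) * sqrt x0 / x0^2 * c * 32 * I"
 have I: "I >= 0" unfolding I_def by (rule Bochner_Integration.integral_nonneg) (rule gamma_kern_nonneg)
 have b: "norm (bessel_int nu 1 (of_real z)) <= 2 / z^2 * I" if z: "z > 0" for z
 proof -
  have "norm (bessel_int nu 1 (of_real z)) <= (\<integral>x. norm (bessel_kern nu 1 (of_real z) x) \<partial>lborel)"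
   unfolding bessel_int_def by (rule integral_norm_bound)
  also have "... <= (\<integral>x. fact 2 / z ^ 2 * gamma_kern (Re nu + real 2) 1 x \<partial>lborel)"
   using z nu by (intro integral_mono integrable_norm integrable_bessel_kern integrable_mult_right integrable_gamma_kern norm_bessel_kern_le') auto
  also have "... = 2 / z^2 * I" by (simp add: I_def)
  finally show ?thesis .
 qed
 have "norm (of_real (sqrt x) * (bessel_I (- nu) x - bessel_I nu x)) <= D / x^2" if x: "x >= x0" for x
 proof -
  have xp: "x > 0" using x x0 by simp
  define z where "z = (x / 2)^2"
  have z: "z > 0" using xp by (simp add: z_def)
  have pz: "complex_of_real (x / 2) powr nu = of_real (x / 2) powr (- nu) * of_real z powr nu"
  proof -
   have "complex_of_real z powr nu = of_real (x / 2) powr nu * of_real (x / 2) powr nu"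
    unfolding z_def power2_eq_square using xp by (intro powr_of_real_mult) auto
   moreover have "complex_of_real (x / 2) powr (- nu) * of_real (x / 2) powr nu = 1" using xp by (simp add: powr_minus)
   ultimately show ?thesis by (simp add: mult.assoc[symmetric])
  qed
  have "bessel_I (- nu) x - bessel_I nu x = of_real (x / 2) powr (- nu) * (bessel_E (- nu) (of_real z) - of_real z powr nu * bessel_E nu (of_real z))"
   unfolding bessel_I_eq z_def[symmetric] pz by (simp add: algebra_simps)
  also have "... = of_real (x / 2) powr (- nu) * (bessel_int nu 1 (of_real z) * (rGamma (1 - nu) * rGamma nu))"
   using bessel_int_one[OF nu, of "of_real z"] z by simp
  finally have "norm (of_real (sqrt x) * (bessel_I (- nu) x - bessel_I nu x)) = sqrt x * ((x / 2) powr (- Re nu) * (norm (bessel_int nu 1 (of_real z)) * c))"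
   using xp norm_powr_real_powr[of "of_real (x / 2)" "- nu"] by (simp add: norm_mult c_def)
  also have "... <= sqrt x * ((x0 / 2) powr (- Re nu) * ((2 / z^2 * I) * c))"
   using b[OF z] xp x x0 nu I by (intro mult_left_mono mult_mono powr_mono2') (auto simp: c_def)
  \<comment> \<open>Here 2 / z^2 = 32 / x^4. What exceeds x powr (-2) decreases in x and is bounded
    by its value at \<open>x0\<close>.\<close>
  also have "... = (x0 / 2) powr (- Re nu) * c * I * 32 * (sqrt x / x^2) / x^2"
   using xp by (simp add: z_def field_simps power2_eq_square)
  also have "... <= (x0 / 2) powr (- Re nu) * c * I * 32 * (sqrt x0 / x0^2) / x^2"
  proof (intro divide_right_mono mult_left_mono)
   have s: "sqrt y / y^2 = y powr (- 3/2)" if "y > 0" for y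
   proof -
    have "sqrt y / y^2 = y powr (1/2) / y powr 2" using that by (simp add: powr_half_sqrt)
    also have "... = y powr (1/2 - 2)" by (rule powr_diff[symmetric])
    finally show ?thesis by simp
   qed
   show "sqrt x / x^2 <= sqrt x0 / x0^2" unfolding s[OF xp] s[OF x0] using x x0 by (intro powr_mono2') auto
  qed (use I in \<open>auto simp: c_def\<close>)
  also have "... = D / x^2" by (simp add: D_def)
  finally show ?thesis .
 qed
 moreover have "D >= 0" using I x0 by (simp add: D_def c_def)
 ultimately show ?thesis by blast
qed

text \<open>The shape is what matters later: waves with exact powers of x in their amplitudes, to
  which Fourier localisation applies, and a remainder small enough to be summed absolutely against
  the divisor function.\<close>

theorem bessel_G_expansion:
 assumes nu: "0 < Re nu" "Re nu < 1" and x0: "x0 > 0"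
 shows "\<exists>A0 A1 B0 B1 D. D >= 0 \<and> (\<forall>x\<ge>x0. norm (of_real (sqrt x) * bessel_G nu x - (exp (\<i> * of_real x) * (A0 + A1 / of_real x) + exp (- (\<i> * of_real x)) * (B0 + B1 / of_real x))) <= D / x^2)"
proof -
 obtain A0 A1 B0 B1 D where 1: "D >= 0" "!!x. x >= x0 ==> norm (of_real (sqrt x) * bessel_J nu x - (exp (\<i> * of_real x) * (A0 + A1 / of_real x) + exp (- (\<i> * of_real x)) * (B0 + B1 / of_real x))) <= D / x^2"
  using bessel_J_expansion[OF x0, of nu] by blast
 obtain A0' A1' B0' B1' D' where 2: "D' >= 0" "!!x. x >= x0 ==> norm (of_real (sqrt x) * bessel_J (- nu) x - (exp (\<i> * of_real x) * (A0' + A1' / of_real x) + exp (- (\<i> * of_real x)) * (B0' + B1' / of_real x))) <= D' / x^2"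
  using bessel_J_expansion[OF x0, of "- nu"] by blast
 obtain D'' where 3: "D'' >= 0" "!!x. x >= x0 ==> norm (of_real (sqrt x) * (bessel_I (- nu) x - bessel_I nu x)) <= D'' / x^2"
  using bessel_I_diff_bound[OF nu x0] by blast
 define c where "c = 1 / (2 * cos (of_real pi * nu / 2))"
 have "norm (of_real (sqrt x) * bessel_G nu x - (exp (\<i> * of_real x) * (c * (A0 + A0') + c * (A1 + A1') / of_real x) + exp (- (\<i> * of_real x)) * (c * (B0 + B0') + c * (B1 + B1') / of_real x)))
  <= norm c * (D + D' + D'') / x^2" if x: "x >= x0" for x
 proof -
  define u where "u = of_real (sqrt x) * bessel_J nu x - (exp (\<i> * of_real x) * (A0 + A1 / of_real x) + exp (- (\<i> * of_real x)) * (B0 + B1 / of_real x))"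
  define v where "v = of_real (sqrt x) * bessel_J (- nu) x - (exp (\<i> * of_real x) * (A0' + A1' / of_real x) + exp (- (\<i> * of_real x)) * (B0' + B1' / of_real x))"
  define t where "t = of_real (sqrt x) * (bessel_I (- nu) x - bessel_I nu x)"
  have G: "bessel_G nu x = c * (bessel_I (- nu) x - bessel_I nu x + bessel_J (- nu) x + bessel_J nu x)"
   unfolding bessel_G_eq[OF nu] c_def by simp
  have "of_real (sqrt x) * bessel_G nu x - (exp (\<i> * of_real x) * (c * (A0 + A0') + c * (A1 + A1') / of_real x) + exp (- (\<i> * of_real x)) * (c * (B0 + B0') + c * (B1 + B1') / of_real x)) = c * (u + v + t)"
   unfolding G u_def v_def t_def by (simp add: algebra_simps add_divide_distrib)
  also have "norm ... <= norm c * (norm u + norm v + norm t)"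
   unfolding norm_mult by (intro mult_left_mono order_trans[OF norm_triangle_ineq] add_mono norm_triangle_ineq) auto
  also have "... <= norm c * (D / x^2 + D' / x^2 + D'' / x^2)"
   using 1(2)[OF x] 2(2)[OF x] 3(2)[OF x] unfolding u_def v_def t_def by (intro mult_left_mono add_mono) auto
  also have "... = norm c * (D + D' + D'') / x^2" by (simp add: add_divide_distrib distrib_left)
  finally show ?thesis .
 qed
 moreover have "norm c * (D + D' + D'') >= 0" using 1(1) 2(1) 3(1) by simp
 ultimately show ?thesis by blast
qed

section \<open>The sine integral as a frequency window\<close>

text \<open>sin z / z extends holomorphically over 0 and hence has an entire primitive. This gives
  windows of every finite smoothness and allows complex differentiation under the integral
  sign.\<close>

lemma Si_entire_extension:
 obtains F where "F holomorphic_on UNIV" "!!z. (F has_field_derivative (if z = 0 then 1 else sin z / z)) (at z)"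
  "!!x. F (of_real x) = of_real (Si x)"
proof -
 define s where "s = (%z::complex. if z = 0 then 1 else sin z / z)"
 have d: "s field_differentiable at z" if "z ~= 0" for z
 proof -
  have "(s has_field_derivative (cos z * z - sin z * 1) / (z * z)) (at z)"
  proof (rule has_field_derivative_transform_within_open[of "%z. sin z / z" _ _ "- {0}"])
   show "((%z. sin z / z) has_field_derivative (cos z * z - sin z * 1) / (z * z)) (at z)"
    using that by (auto intro!: derivative_eq_intros)
  qed (use that in \<open>auto simp: s_def\<close>)
  thus ?thesis by (auto simp: field_differentiable_def)
 qed
 have "isCont s z" for z
 proof (cases "z = 0")
  case True
  have "((%x::complex. sin x / x) \<longlongrightarrow> 1) (at 0)"
   using DERIV_sin[of "0 :: complex"] by (simp add: has_field_derivative_iff)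
  hence "(s \<longlongrightarrow> 1) (at 0)"
   by (rule Lim_transform_eventually) (auto simp: eventually_at_filter s_def)
  thus ?thesis by (simp add: True isCont_def s_def)
 qed (use d field_differentiable_imp_continuous_at in blast)
 hence cont: "continuous_on UNIV s" by (simp add: continuous_at_imp_continuous_on)
 obtain g where g: "!!z. (g has_field_derivative s z) (at z)"
  using holomorphic_convex_primitive[of UNIV "{0}" s] cont d by auto
 define F where "F = (%z. g z - g 0)"
 have F: "(F has_field_derivative s z) (at z)" for z
  unfolding F_def using DERIV_diff[OF g DERIV_const[of "g 0"], of z] by simp
 have "((%x. F (of_real x) - of_real (Si x)) has_vector_derivative 0) (at x within UNIV)" for x
 proof -
  have "((%x. F (of_real x)) has_vector_derivative s (of_real x)) (at x)"
   by (rule has_vector_derivative_real_field[OF F])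
  moreover have "((%x. complex_of_real (Si x)) has_vector_derivative s (of_real x)) (at x)"
   using has_vector_derivative_of_real[OF DERIV_Si[of x]]
   by (cases "x = 0") (auto simp: s_def sin_of_real intro: has_vector_derivative_eq_rhs)
  ultimately show ?thesis using has_vector_derivative_diff by fastforce
 qed
 then obtain c where c: "!!x. F (of_real x) - of_real (Si x) = c"
  using has_vector_derivative_zero_constant[of UNIV "%x. F (of_real x) - of_real (Si x)"] by auto
 have "c = 0" using c[of 0] by (simp add: F_def Si_def flip: zero_ereal_def)
 hence "F (of_real x) = of_real (Si x)" for x using c[of x] by simp
 thus ?thesis using that[of F] F unfolding s_def by (auto simp: holomorphic_on_open)
qed

lemma fourier_decay':
 assumes "ck_on k UNIV f" "vanishes_off a b f"
 shows "\<exists>C\<ge>0. \<forall>y::real. norm (fourier f (of_real y)) <= C / (1 + \<bar>y\<bar>) ^ k"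
proof -
 have "ck_on 0 UNIV f" using assms(1) by (rule ck_on_le[rotated 2]) auto
 from fourier_decay[OF this assms(2)] obtain C0 where C0: "C0 >= 0" "!!y::real. norm (fourier f (of_real y)) <= C0" by auto
 obtain C1 where C1: "C1 >= 0" "!!y. \<bar>y\<bar> ^ k * norm (fourier f (of_real y)) <= C1" using fourier_decay[OF assms] by blast
 have "norm (fourier f (of_real y)) <= (2 ^ k * (C0 + C1)) / (1 + \<bar>y\<bar>) ^ k" for y :: real
 proof -
  have "(1 + \<bar>y\<bar>) ^ k <= (2 * max 1 \<bar>y\<bar>) ^ k" by (intro power_mono) auto
  also have "... <= 2 ^ k * (1 + \<bar>y\<bar> ^ k)" by (auto simp: power_mult_distrib max_def)
  finally have "(1 + \<bar>y\<bar>) ^ k * norm (fourier f (of_real y)) <= 2 ^ k * (1 + \<bar>y\<bar> ^ k) * norm (fourier f (of_real y))"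
   by (rule mult_right_mono) simp
  also have "... = 2 ^ k * (norm (fourier f (of_real y)) + \<bar>y\<bar> ^ k * norm (fourier f (of_real y)))" by (simp add: algebra_simps)
  also have "... <= 2 ^ k * (C0 + C1)" using C0(2) C1(2) by (intro mult_left_mono add_mono) auto
  finally show ?thesis by (simp add: pos_le_divide_eq mult.commute)
 qed
 moreover have "2 ^ k * (C0 + C1) >= 0" using C0 C1 by simp
 ultimately show ?thesis by blast
qed

text \<open>Differentiation in the cut-off frequency x replaces Si (x u) by sin (x u) / x. Resolved
  into exponentials, this leaves a difference of two values of the Fourier transform of
  \<open>g\<close>.\<close>

lemma has_vector_derivative_Si_fourier:
 fixes xi x :: real
 assumes "continuous_on UNIV g" "vanishes_off a b g" "x > 0"
 shows "((%x. \<integral>u. g u * of_real (Si (x * u)) * exp (\<i> * of_real xi * of_real u) \<partial>lborel) has_vector_derivative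
  (fourier g (of_real (xi + x)) - fourier g (of_real (xi - x))) / (2 * \<i> * of_real x)) (at x)"
proof -
 obtain F where F: "F holomorphic_on UNIV" "!!z. (F has_field_derivative (if z = 0 then 1 else sin z / z)) (at z)"
  "!!x. F (of_real x) = of_real (Si x)" by (rule Si_entire_extension) blast
 define s where "s = (%z::complex. if z = 0 then 1 else sin z / z)"
 have Fs: "deriv F = s" using F(2) DERIV_imp_deriv s_def by blast
 have s_cont: "continuous_on UNIV s" unfolding Fs[symmetric]
  by (intro holomorphic_on_imp_continuous_on holomorphic_deriv F) auto
 have F_cont: "continuous_on UNIV F" by (rule holomorphic_on_imp_continuous_on[OF F(1)])
 define R where "R = max \<bar>a\<bar> \<bar>b\<bar>"
 have R: "\<bar>t\<bar> <= R" if "g t ~= 0" for t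
  using that assms(2) unfolding vanishes_off_def R_def by (cases "t <= a"; cases "t >= b") auto
 have "bounded (s ` cball 0 ((x + 1) * R))"
  by (intro compact_imp_bounded compact_continuous_image continuous_on_subset[OF s_cont]) auto
 then obtain M where M: "!!z. norm z <= (x + 1) * R ==> norm (s z) <= M" unfolding bounded_iff by (metis dist_0_norm image_eqI mem_cball)
 have van: "vanishes_off a b (%u. g u * h u)" for h using assms(2) by (simp add: vanishes_off_def)
 have "((%z. \<integral>u. g u * (F (z * of_real u) * exp (\<i> * of_real xi * of_real u)) \<partial>lborel) has_field_derivative
   (\<integral>u. g u * (of_real u * s (of_real x * of_real u) * exp (\<i> * of_real xi * of_real u)) \<partial>lborel)) (at (of_real x))"
 proof (rule has_field_derivative_lborel_integral[where e = 1 and w = "%u. R * M * norm (g u)"])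
  fix w u assume w: "w \<in> ball (complex_of_real x) 1"
  have "((%z. F (z * of_real u)) has_field_derivative s (w * of_real u) * of_real u) (at w)"
   unfolding s_def by (rule DERIV_chain2[where g = "%z. z * of_real u", OF F(2)]) (auto intro!: derivative_eq_intros)
  from DERIV_cmult[OF DERIV_cmult_right[OF this, of "exp (\<i> * of_real xi * of_real u)"], of "g u"]
  show "((%z. g u * (F (z * of_real u) * exp (\<i> * of_real xi * of_real u))) has_field_derivative
   g u * (of_real u * s (w * of_real u) * exp (\<i> * of_real xi * of_real u))) (at w)" by (simp add: mult_ac)
  show "norm (g u * (of_real u * s (w * of_real u) * exp (\<i> * of_real xi * of_real u))) <= R * M * norm (g u)"
  proof (cases "g u = 0")
   case False
   have "norm w <= x + 1" using w norm_triangle_ineq2[of w "of_real x"] assms(3) by (auto simp: dist_norm norm_minus_commute)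
   hence "norm (w * of_real u) <= (x + 1) * R"
    using R[OF False] assms(3) unfolding norm_mult by (simp add: mult_mono)
   hence "norm (s (w * of_real u)) <= M" by (rule M)
   hence "\<bar>u\<bar> * norm (s (w * of_real u)) <= R * M"
    using R[OF False] by (intro mult_mono) auto
   from mult_right_mono[OF this norm_ge_zero[of "g u"]] show ?thesis by (simp add: norm_mult mult_ac)
  qed simp
 next
  show "integrable lborel (%u. R * M * norm (g u))"
   by (intro integrable_mult_right integrable_norm integrable_vanishes_off[OF assms(1,2)])
  show "integrable lborel (%u. g u * (F (w * of_real u) * exp (\<i> * of_real xi * of_real u)))" for w
   by (intro integrable_vanishes_off[OF _ van] continuous_intros assms continuous_on_compose2[OF F_cont]) auto
  have "continuous_on UNIV (%u. g u * (of_real u * s (of_real x * of_real u) * exp (\<i> * of_real xi * of_real u)))"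
   by (intro continuous_intros assms continuous_on_compose2[OF s_cont]) auto
  thus "(%u. g u * (of_real u * s (of_real x * of_real u) * exp (\<i> * of_real xi * of_real u))) \<in> borel_measurable lborel"
   by (simp add: borel_measurable_continuous_onI)
 qed auto
 from has_vector_derivative_real_field[OF this]
 have "((%x. \<integral>u. g u * of_real (Si (x * u)) * exp (\<i> * of_real xi * of_real u) \<partial>lborel) has_vector_derivative
   (\<integral>u. g u * (of_real u * s (of_real x * of_real u) * exp (\<i> * of_real xi * of_real u)) \<partial>lborel)) (at x)"
  by (simp add: F(3) of_real_mult[symmetric] mult.assoc del: of_real_mult)
 moreover have "(\<integral>u. g u * (of_real u * s (of_real x * of_real u) * exp (\<i> * of_real xi * of_real u)) \<partial>lborel)
  = (\<integral>u. (g u * exp (\<i> * of_real (xi + x) * of_real u) - g u * exp (\<i> * of_real (xi - x) * of_real u)) / (2 * \<i> * of_real x) \<partial>lborel)"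
 proof (rule Bochner_Integration.integral_cong[OF refl])
  fix u :: real
  have e1: "of_real u * s (of_real x * of_real u) = (exp (\<i> * (of_real x * of_real u)) - exp (- (\<i> * (of_real x * of_real u)))) / (2 * \<i> * of_real x)"
   using assms(3) by (auto simp: s_def sin_exp_eq field_simps)
  have e2: "exp (\<i> * of_real (xi + x) * of_real u) = exp (\<i> * of_real xi * of_real u) * exp (\<i> * (of_real x * of_real u))"
   "exp (\<i> * of_real (xi - x) * of_real u) = exp (\<i> * of_real xi * of_real u) * exp (- (\<i> * (of_real x * of_real u)))"
   by (simp_all add: exp_add[symmetric] algebra_simps)
  show "g u * (of_real u * s (of_real x * of_real u) * exp (\<i> * of_real xi * of_real u))
   = (g u * exp (\<i> * of_real (xi + x) * of_real u) - g u * exp (\<i> * of_real (xi - x) * of_real u)) / (2 * \<i> * of_real x)"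
   unfolding e1 e2 by (simp only: diff_divide_distrib right_diff_distrib left_diff_distrib times_divide_eq_right times_divide_eq_left mult_ac)
 qed
 moreover have "integrable lborel (%u. g u * exp (\<i> * of_real y * of_real u))" for y
  by (intro integrable_vanishes_off[OF _ van] continuous_intros assms)
 ultimately show ?thesis unfolding fourier_def by (simp del: of_real_add of_real_diff)
qed

lemma Si_tendsto_sgn: "((%x. Si (x * u)) \<longlongrightarrow> pi / 2 * sgn u) at_top"
proof -
 consider "u = 0" | "u > 0" | "u < 0" by linarith
 thus ?thesis
 proof cases
  case 2
  have "filterlim (%x. x * u) at_top at_top"
   using filterlim_tendsto_pos_mult_at_top[OF tendsto_const 2 filterlim_ident] by (simp add: mult.commute)
  from filterlim_compose[OF Si_at_top this] show ?thesis using 2 by simp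
 next
  case 3
  have "filterlim (%x. - u * x) at_top at_top"
   using 3 by (intro filterlim_tendsto_pos_mult_at_top[OF tendsto_const _ filterlim_ident]) auto
  from tendsto_minus[OF filterlim_compose[OF Si_at_top this]] have "((%x. - Si (- u * x)) \<longlongrightarrow> - (pi / 2)) at_top" .
  moreover have "eventually (%x. - Si (- u * x) = Si (x * u)) at_top"
   using eventually_ge_at_top[of 0]
  proof eventually_elim
   case (elim x)
   hence "- u * x >= 0" using 3 by (simp add: mult_nonpos_nonneg)
   thus ?case using Si_neg[of "- u * x"] by (simp add: mult.commute)
  qed
  ultimately show ?thesis using 3 by (simp add: Lim_transform_eventually)
 qed (simp add: Si_def flip: zero_ereal_def)
qed

text \<open>The comparison function is - K / 2 / (c + \<sigma> t)^2. The sign \<sigma> lets one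
  statement cover cut-offs moving away from the critical frequency and cut-offs moving towards
  it.\<close>

lemma inverse_square_deriv_bound:
 fixes W :: "real => complex" and \<sigma> :: real
 assumes "x < y" "continuous_on {x..y} W" "!!t. x < t ==> t < y ==> (W has_vector_derivative W' t) (at t)"
  and "!!t. x < t ==> t < y ==> norm (W' t) <= \<sigma> * K / (c + \<sigma> * t) ^ 3"
  and "!!t. x <= t ==> t <= y ==> c + \<sigma> * t > 0"
 shows "norm (W y - W x) <= K / 2 / (c + \<sigma> * x)^2 - K / 2 / (c + \<sigma> * y)^2"
proof -
 have "norm (W y - W x) <= - (K / 2 / (c + \<sigma> * y)^2) - - (K / 2 / (c + \<sigma> * x)^2)"
 proof (rule differentiable_bound_general[OF assms(1,2), where f' = W' and \<phi>' = "%t. \<sigma> * K / (c + \<sigma> * t) ^ 3"])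
  have nz: "c + \<sigma> * t ~= 0" if "x <= t" "t <= y" for t using assms(5)[OF that] by simp
  show "continuous_on {x..y} (%t. - (K / 2 / (c + \<sigma> * t)^2))"
   by (intro continuous_intros) (use nz in auto)
  fix t assume t: "x < t" "t < y"
  have "((%t. - (K / 2 / (c + \<sigma> * t)^2)) has_real_derivative \<sigma> * K / (c + \<sigma> * t) ^ 3) (at t)"
  proof -
   define v where "v = c + \<sigma> * t"
   have v: "v ~= 0" using nz[of t] t by (simp add: v_def)
   have "((%t. c + \<sigma> * t) has_real_derivative \<sigma>) (at t)" by (auto intro!: derivative_eq_intros)
   from DERIV_minus[OF DERIV_divide[OF DERIV_const[of "K / 2"] DERIV_power[OF this, of 2]]] v
   have "((%t. - (K / 2 / (c + \<sigma> * t)^2)) has_real_derivative - ((0 * v^2 - K / 2 * (2 * v * \<sigma>)) / (v^2 * v^2))) (at t)"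
    by (simp add: v_def[symmetric] mult_ac)
   also have "- ((0 * v^2 - K / 2 * (2 * v * \<sigma>)) / (v^2 * v^2)) = \<sigma> * K / v ^ 3"
    using v by (simp add: field_simps power2_eq_square power3_eq_cube)
   finally show ?thesis unfolding v_def .
  qed
  thus "((%t. - (K / 2 / (c + \<sigma> * t)^2)) has_vector_derivative \<sigma> * K / (c + \<sigma> * t) ^ 3) (at t)"
   by (simp add: has_real_derivative_iff_has_vector_derivative)
 qed (use assms in auto)
 thus ?thesis by simp
qed

lemma dominated_convergence_Si:
 assumes g: "continuous_on UNIV g" "vanishes_off a b g"
 shows "((%x. \<integral>u. g u * of_real (Si (x * (u - s0))) \<partial>lborel) \<longlongrightarrow> (\<integral>u. g u * of_real (pi / 2 * sgn (u - s0)) \<partial>lborel)) at_top"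
proof -
 obtain B where B: "!!T. \<bar>Si T\<bar> <= B" using bounded_Si by blast
 have gm: "g \<in> borel_measurable borel" using g(1) by (rule borel_measurable_continuous_onI)
 show ?thesis
 proof (rule integral_dominated_convergence_at_top[where w = "%u. B * norm (g u)"])
  show "integrable lborel (%u. B * norm (g u))"
   by (intro integrable_mult_right integrable_norm integrable_vanishes_off[OF g])
  show "\<forall>\<^sub>F x in at_top. AE u in lborel. norm (g u * complex_of_real (Si (x * (u - s0)))) <= B * norm (g u)"
  proof (intro always_eventually allI AE_I2)
   fix x u :: real
   show "norm (g u * complex_of_real (Si (x * (u - s0)))) <= B * norm (g u)"
    using mult_left_mono[OF B[of "x * (u - s0)"] norm_ge_zero[of "g u"]] by (simp add: norm_mult mult.commute)
  qed
  show "AE u in lborel. ((%x. g u * complex_of_real (Si (x * (u - s0)))) \<longlongrightarrow> g u * complex_of_real (pi / 2 * sgn (u - s0))) at_top"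
   by (intro AE_I2 tendsto_intros Si_tendsto_sgn)
 qed (use gm in measurable)
qed

text \<open>As the cut-off x grows, the integral \<open>W\<close> changes appreciably only while x
  passes |xi|, because its derivative involves the Fourier transform of \<open>g\<close> at distance
  at least ||xi| - x| from 0. For |xi| <= L the change from L to infinity is estimated, where the
  limit is the integral with the sharp sign function; otherwise it is the change from 0 to L, with
  \<open>W\<close> = 0 at the start. Decay of order 3 of the derivative integrates to the square in
  the claim.\<close>

lemma Si_fourier_localization:
 assumes g: "ck_on 4 UNIV g" "vanishes_off a b g"
 shows "\<exists>C\<ge>0. \<forall>xi L. L > 0 --> xi ~= 0 -->
  norm ((\<integral>u. g u * of_real (Si (L * u)) * exp (\<i> * of_real xi * of_real u) \<partial>lborel)
   - (if \<bar>xi\<bar> <= L then (\<integral>u. g u * of_real (pi / 2 * sgn u) * exp (\<i> * of_real xi * of_real u) \<partial>lborel) else 0))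
  <= C / max \<bar>xi\<bar> L / (1 + \<bar>\<bar>xi\<bar> - L\<bar>)^2"
proof -
 have gc: "continuous_on UNIV g" using g(1) ck_on_continuous by blast
 obtain C0 where C0: "C0 >= 0" "!!y::real. norm (fourier g (of_real y)) <= C0 / (1 + \<bar>y\<bar>) ^ 4" using fourier_decay'[OF g] by blast
 define g1 where "g1 = (%t. \<i> * of_real t * g t)"
 have "ck_on 4 UNIV (%t. \<i> * complex_of_real t)"
  by (rule ck_on_holomorphic[of UNIV "%z. \<i> * z"]) (auto intro!: holomorphic_intros)
 hence g1: "ck_on 4 UNIV g1" unfolding g1_def by (rule ck_on_mult[OF open_UNIV _ g(1)])
 have v1: "vanishes_off a b g1" unfolding g1_def by (rule vanishes_off_mult[OF g(2)])
 obtain C1 where C1: "C1 >= 0" "!!y::real. norm (fourier g1 (of_real y)) <= C1 / (1 + \<bar>y\<bar>) ^ 4" using fourier_decay'[OF g1 v1] by blast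
 define K where "K = C0 + 16 * C1 + 2 * C0"
 define W where "W = (%xi x. \<integral>u. g u * of_real (Si (x * u)) * exp (\<i> * of_real xi * of_real u) \<partial>lborel)"
 define W' where "W' = (%xi x. (fourier g (of_real (xi + x)) - fourier g (of_real (xi - x))) / (2 * \<i> * of_real x))"
 have dW: "(W xi has_vector_derivative W' xi x) (at x)" if "x > 0" for xi x
  unfolding W_def W'_def by (rule has_vector_derivative_Si_fourier[OF gc g(2) that])
 have b1: "norm (W' xi x) <= C0 / (x * (1 + \<bar>\<bar>xi\<bar> - x\<bar>) ^ 4)" if "x > 0" for xi x
 proof -
  have "norm (fourier g (of_real (xi + x))) <= C0 / (1 + \<bar>\<bar>xi\<bar> - x\<bar>) ^ 4"
   by (rule order_trans[OF C0(2)]) (use C0(1) that in \<open>intro divide_left_mono power_mono; simp\<close>)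
  moreover have "norm (fourier g (of_real (xi - x))) <= C0 / (1 + \<bar>\<bar>xi\<bar> - x\<bar>) ^ 4"
   by (rule order_trans[OF C0(2)]) (use C0(1) that in \<open>intro divide_left_mono power_mono; simp\<close>)
  ultimately have "norm (fourier g (of_real (xi + x)) - fourier g (of_real (xi - x))) <= 2 * (C0 / (1 + \<bar>\<bar>xi\<bar> - x\<bar>) ^ 4)"
   using norm_triangle_ineq4[of "fourier g (of_real (xi + x))" "fourier g (of_real (xi - x))"] by linarith
  from divide_right_mono[OF this, of "2 * x"] that show ?thesis
   unfolding W'_def by (simp add: norm_divide norm_mult mult.commute)
 qed
 \<comment> \<open>For small x the factor 1 / x in \<open>W'\<close> is cancelled: the two
   frequencies are 2 x apart, so the mean value inequality with the derivative
   \<open>fourier g1\<close> yields a factor x.\<close>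
 have b2: "norm (W' xi x) <= C1 / (1 + \<bar>xi\<bar> / 2) ^ 4" if x: "x > 0" "x <= \<bar>xi\<bar> / 2" for xi x
 proof -
  have "norm (fourier g (of_real (xi + x)) - fourier g (of_real (xi - x))) <= C1 / (1 + \<bar>xi\<bar> / 2) ^ 4 * norm (complex_of_real (xi + x) - of_real (xi - x))"
  proof (rule field_differentiable_bound[where S = "complex_of_real ` {xi - x..xi + x}" and f' = "fourier g1"])
   show "convex (complex_of_real ` {xi - x..xi + x})" by (intro convex_linear_image bounded_linear.linear bounded_linear_of_real) auto
   show "(fourier g has_field_derivative fourier g1 z) (at z within complex_of_real ` {xi - x..xi + x})" for z
    unfolding g1_def by (rule has_field_derivative_at_within[OF fourier_deriv[OF gc g(2)]])
   fix z assume "z \<in> complex_of_real ` {xi - x..xi + x}"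
   then obtain y where y: "z = of_real y" "xi - x <= y" "y <= xi + x" by auto
   have "\<bar>xi\<bar> / 2 <= \<bar>y\<bar>" using y x by linarith
   hence "C1 / (1 + \<bar>y\<bar>) ^ 4 <= C1 / (1 + \<bar>xi\<bar> / 2) ^ 4" using C1(1) by (intro divide_left_mono power_mono) auto
   thus "norm (fourier g1 z) <= C1 / (1 + \<bar>xi\<bar> / 2) ^ 4" using C1(2)[of y] y(1) by simp
  qed (use x in \<open>auto simp del: of_real_add of_real_diff\<close>)
  also have "norm (complex_of_real (xi + x) - of_real (xi - x)) = 2 * x" unfolding of_real_diff[symmetric] norm_of_real using x by simp
  finally have "norm (fourier g (of_real (xi + x)) - fourier g (of_real (xi - x))) <= C1 / (1 + \<bar>xi\<bar> / 2) ^ 4 * (2 * x)" .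
  from divide_right_mono[OF this, of "2 * x"] x(1) show ?thesis
   unfolding W'_def by (simp add: norm_divide norm_mult mult.commute)
 qed
 \<comment> \<open>Up to |xi| / 2 one of the four powers of decay is spent on producing 1 / |xi|,
   the factor 16 coming from the doublings. Beyond that 1 / x is at most 2 / |xi|.\<close>
 have b3: "norm (W' xi x) <= K / \<bar>xi\<bar> / (1 + \<bar>xi\<bar> - x) ^ 3" if x: "x > 0" "x <= \<bar>xi\<bar>" for xi x
 proof (cases "x <= \<bar>xi\<bar> / 2")
  case True
  have xi: "\<bar>xi\<bar> > 0" using x by linarith
  have p4: "(2 * w) * (2 * w) ^ 3 = 16 * w ^ 4" for w :: real by (simp add: power_mult_distrib eval_nat_numeral)
  have "\<bar>xi\<bar> * (1 + \<bar>xi\<bar> - x) ^ 3 <= (2 * (1 + \<bar>xi\<bar> / 2)) * (2 * (1 + \<bar>xi\<bar> / 2)) ^ 3"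
   using x by (intro mult_mono power_mono) auto
  also have "... = 16 * (1 + \<bar>xi\<bar> / 2) ^ 4" by (rule p4)
  finally have "C1 / (1 + \<bar>xi\<bar> / 2) ^ 4 <= 16 * C1 / (\<bar>xi\<bar> * (1 + \<bar>xi\<bar> - x) ^ 3)"
   using divide_left_mono[of "\<bar>xi\<bar> * (1 + \<bar>xi\<bar> - x) ^ 3" "16 * (1 + \<bar>xi\<bar> / 2) ^ 4" "16 * C1"] C1(1) xi x
   by (simp add: zero_less_mult_iff)
  also have "... <= K / (\<bar>xi\<bar> * (1 + \<bar>xi\<bar> - x) ^ 3)" using C0 C1 x by (intro divide_right_mono) (auto simp: K_def)
  finally show ?thesis using b2[OF x(1) True] by simp
 next
  case False
  have "\<bar>xi\<bar> * (1 + \<bar>xi\<bar> - x) ^ 3 <= (2 * x) * (1 + \<bar>xi\<bar> - x) ^ 4"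
   using False x by (intro mult_mono power_increasing) auto
  hence "2 * C0 / (2 * x * (1 + \<bar>xi\<bar> - x) ^ 4) <= 2 * C0 / (\<bar>xi\<bar> * (1 + \<bar>xi\<bar> - x) ^ 3)"
   using C0(1) x by (intro divide_left_mono) auto
  also have "... <= K / (\<bar>xi\<bar> * (1 + \<bar>xi\<bar> - x) ^ 3)" using C0 C1 x by (intro divide_right_mono) (auto simp: K_def)
  finally show ?thesis using b1[OF x(1), of xi] x by (simp add: add_diff_eq)
 qed
 have b4: "norm (W' xi x) <= K / L / (1 + x - \<bar>xi\<bar>) ^ 3" if x: "L > 0" "L <= x" "\<bar>xi\<bar> <= x" for xi x L
 proof -
  have "L * (1 + x - \<bar>xi\<bar>) ^ 3 <= x * (1 + x - \<bar>xi\<bar>) ^ 4"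
   using x by (intro mult_mono power_increasing) auto
  hence "C0 / (x * (1 + x - \<bar>xi\<bar>) ^ 4) <= C0 / (L * (1 + x - \<bar>xi\<bar>) ^ 3)"
   using C0(1) x by (intro divide_left_mono) auto
  also have "... <= K / (L * (1 + x - \<bar>xi\<bar>) ^ 3)" using C0 C1 x by (intro divide_right_mono) (auto simp: K_def)
  finally show ?thesis using b1[of x xi] x by (simp add: abs_minus_commute add_diff_eq)
 qed
 have K: "K >= 0" using C0 C1 by (simp add: K_def)
 obtain B where B: "!!T. \<bar>Si T\<bar> <= B" using bounded_Si by blast
 have contW: "continuous_on {0..} (W xi)" for xi
 proof (rule continuous_on_subset[of UNIV])
  show "continuous_on UNIV (W xi)" unfolding continuous_on_sequentially o_def W_def
  proof (intro ballI allI impI; elim conjE)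
   fix X x assume "X \<longlonglongrightarrow> (x::real)"
   show "(%n. \<integral>u. g u * of_real (Si (X n * u)) * exp (\<i> * of_real xi * of_real u) \<partial>lborel) \<longlonglongrightarrow> (\<integral>u. g u * of_real (Si (x * u)) * exp (\<i> * of_real xi * of_real u) \<partial>lborel)"
   proof (rule integral_dominated_convergence[where w = "%u. B * norm (g u)"])
    show "integrable lborel (%u. B * norm (g u))"
     by (intro integrable_mult_right integrable_norm integrable_vanishes_off[OF gc g(2)])
    have gm: "g \<in> borel_measurable borel" using gc by (rule borel_measurable_continuous_onI)
    show "(%u. g u * of_real (Si (x * u)) * exp (\<i> * of_real xi * of_real u)) \<in> borel_measurable lborel" using gm by measurable
    show "(%u. g u * of_real (Si (X n * u)) * exp (\<i> * of_real xi * of_real u)) \<in> borel_measurable lborel" for n using gm by measurable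
    show "AE u in lborel. norm (g u * of_real (Si (X n * u)) * exp (\<i> * of_real xi * of_real u)) <= B * norm (g u)" for n
     using mult_left_mono[OF B norm_ge_zero] by (intro AE_I2) (simp add: norm_mult mult.commute)
    show "AE u in lborel. (%n. g u * of_real (Si (X n * u)) * exp (\<i> * of_real xi * of_real u)) \<longlonglongrightarrow> g u * of_real (Si (x * u)) * exp (\<i> * of_real xi * of_real u)"
     by (intro AE_I2 tendsto_intros isCont_tendsto_compose[OF isCont_Si] \<open>X \<longlonglongrightarrow> x\<close>)
   qed
  qed
 qed auto
 have W0: "W xi 0 = 0" for xi by (simp add: W_def Si_def flip: zero_ereal_def)
 have main: "norm (W xi L - (if \<bar>xi\<bar> <= L then (\<integral>u. g u * of_real (pi / 2 * sgn u) * exp (\<i> * of_real xi * of_real u) \<partial>lborel) else 0))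
  <= K / max \<bar>xi\<bar> L / (1 + \<bar>\<bar>xi\<bar> - L\<bar>)^2" if L: "L > 0" and xi: "xi ~= 0" for xi L
 proof (cases "\<bar>xi\<bar> <= L")
  case True
  have "norm (W xi x - W xi L) <= K / L / 2 / (1 + L - \<bar>xi\<bar>)^2" if x: "x > L" for x
  proof -
   have "norm (W xi x - W xi L) <= K / L / 2 / ((1 - \<bar>xi\<bar>) + 1 * L)^2 - K / L / 2 / ((1 - \<bar>xi\<bar>) + 1 * x)^2"
   proof (rule inverse_square_deriv_bound[OF x continuous_on_subset[OF contW]])
    fix t assume "L < t" "t < x"
    thus "(W xi has_vector_derivative W' xi t) (at t)" "norm (W' xi t) <= 1 * (K / L) / (1 - \<bar>xi\<bar> + 1 * t) ^ 3"
     using dW L b4[of L t xi] True by (auto simp: algebra_simps)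
   qed (use L True in auto)
   moreover have "K / L / 2 / ((1 - \<bar>xi\<bar>) + 1 * x)^2 >= 0" using K L by simp
   ultimately show ?thesis by (simp add: algebra_simps)
  qed
  hence "eventually (%x. norm (W xi x - W xi L) <= K / L / 2 / (1 + L - \<bar>xi\<bar>)^2) at_top"
   by (rule eventually_mono[OF eventually_gt_at_top[of L]])
  moreover have "((%x. norm (W xi x - W xi L)) \<longlongrightarrow> norm ((\<integral>u. g u * of_real (pi / 2 * sgn u) * exp (\<i> * of_real xi * of_real u) \<partial>lborel) - W xi L)) at_top"
  proof (intro tendsto_intros)
   have "((%x. \<integral>u. (g u * exp (\<i> * of_real xi * of_real u)) * of_real (Si (x * (u - 0))) \<partial>lborel) \<longlongrightarrow>
     (\<integral>u. (g u * exp (\<i> * of_real xi * of_real u)) * of_real (pi / 2 * sgn (u - 0)) \<partial>lborel)) at_top"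
    by (rule dominated_convergence_Si) (use gc g(2) in \<open>auto intro!: continuous_intros simp: vanishes_off_def\<close>)
   thus "(W xi \<longlongrightarrow> (\<integral>u. g u * of_real (pi / 2 * sgn u) * exp (\<i> * of_real xi * of_real u) \<partial>lborel)) at_top"
    unfolding W_def by (simp add: mult_ac)
  qed
  ultimately have "norm ((\<integral>u. g u * of_real (pi / 2 * sgn u) * exp (\<i> * of_real xi * of_real u) \<partial>lborel) - W xi L) <= K / L / 2 / (1 + L - \<bar>xi\<bar>)^2"
   by (intro tendsto_upperbound) auto
  also have "... <= K / L / (1 + L - \<bar>xi\<bar>)^2" using K L by (intro divide_right_mono) (auto simp: field_simps)
  also have "... = K / max \<bar>xi\<bar> L / (1 + \<bar>\<bar>xi\<bar> - L\<bar>)^2" using True by (simp add: max_def algebra_simps)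
  finally show ?thesis using True by (simp add: norm_minus_commute)
 next
  case False
  have "norm (W xi L - W xi 0) <= - (K / \<bar>xi\<bar>) / 2 / ((1 + \<bar>xi\<bar>) + (- 1) * 0)^2 - - (K / \<bar>xi\<bar>) / 2 / ((1 + \<bar>xi\<bar>) + (- 1) * L)^2"
  proof (rule inverse_square_deriv_bound[OF L continuous_on_subset[OF contW]])
   fix t assume t: "0 < t" "t < L"
   show "(W xi has_vector_derivative W' xi t) (at t)" by (rule dW[OF t(1)])
   show "norm (W' xi t) <= (- 1) * (- (K / \<bar>xi\<bar>)) / (1 + \<bar>xi\<bar> + (- 1) * t) ^ 3"
    using b3[of t xi] t False by (simp add: algebra_simps)
  qed (use L False in auto)
  hence "norm (W xi L) <= K / \<bar>xi\<bar> / 2 / (1 + \<bar>xi\<bar> - L)^2 - K / \<bar>xi\<bar> / 2 / (1 + \<bar>xi\<bar>)^2" using W0[of xi] by simp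
  also have "... <= K / \<bar>xi\<bar> / 2 / (1 + \<bar>xi\<bar> - L)^2" using K by simp
  also have "... <= K / \<bar>xi\<bar> / (1 + \<bar>xi\<bar> - L)^2" using K xi by (intro divide_right_mono) (auto simp: field_simps)
  also have "... = K / max \<bar>xi\<bar> L / (1 + \<bar>\<bar>xi\<bar> - L\<bar>)^2" using False by (simp add: max_def algebra_simps)
  finally show ?thesis using False by simp
 qed
 show ?thesis using main K unfolding W_def by blast
qed

lemma ck_on_shift:
 assumes "ck_on k UNIV g"
 shows "ck_on k UNIV (%u. g (u + s0))"
 by (rule ck_on_compose[of UNIV UNIV "%u. u + s0" k g "%_. 1"]) (use assms in \<open>auto intro!: derivative_eq_intros\<close>)

text \<open>Translating the jump to \<open>s0\<close> only introduces a phase of modulus 1.\<close>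

lemma Si_fourier_localization_at:
 assumes g: "ck_on 4 UNIV g" "vanishes_off a b g"
 shows "\<exists>C\<ge>0. \<forall>xi L. L > 0 --> xi ~= 0 -->
  norm ((\<integral>s. g s * of_real (Si (L * (s - s0))) * exp (\<i> * of_real xi * of_real s) \<partial>lborel)
   - (if \<bar>xi\<bar> <= L then (\<integral>s. g s * of_real (pi / 2 * sgn (s - s0)) * exp (\<i> * of_real xi * of_real s) \<partial>lborel) else 0))
  <= C / max \<bar>xi\<bar> L / (1 + \<bar>\<bar>xi\<bar> - L\<bar>)^2"
proof -
 have "vanishes_off (a - s0) (b - s0) (%u. g (u + s0))" using g(2) by (auto simp: vanishes_off_def)
 from Si_fourier_localization[OF ck_on_shift[OF g(1)] this] obtain C where C: "C >= 0"
  "!!xi L. L > 0 ==> xi ~= 0 ==>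
  norm ((\<integral>u. g (u + s0) * of_real (Si (L * u)) * exp (\<i> * of_real xi * of_real u) \<partial>lborel)
   - (if \<bar>xi\<bar> <= L then (\<integral>u. g (u + s0) * of_real (pi / 2 * sgn u) * exp (\<i> * of_real xi * of_real u) \<partial>lborel) else 0))
  <= C / max \<bar>xi\<bar> L / (1 + \<bar>\<bar>xi\<bar> - L\<bar>)^2" by blast
 have sh: "(\<integral>s. g s * of_real (k (s - s0)) * exp (\<i> * of_real xi * of_real s) \<partial>lborel)
  = exp (\<i> * of_real xi * of_real s0) * (\<integral>u. g (u + s0) * of_real (k u) * exp (\<i> * of_real xi * of_real u) \<partial>lborel)" for k xi
 proof -
  have "(\<integral>s. g s * of_real (k (s - s0)) * exp (\<i> * of_real xi * of_real s) \<partial>lborel)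
   = (\<integral>u. g (s0 + 1 * u) * of_real (k (s0 + 1 * u - s0)) * exp (\<i> * of_real xi * of_real (s0 + 1 * u)) \<partial>lborel)"
   using lborel_integral_real_affine[of 1 "%s. g s * of_real (k (s - s0)) * exp (\<i> * of_real xi * of_real s)" s0] by simp
  also have "... = (\<integral>u. exp (\<i> * of_real xi * of_real s0) * (g (u + s0) * of_real (k u) * exp (\<i> * of_real xi * of_real u)) \<partial>lborel)"
   by (intro Bochner_Integration.integral_cong) (simp_all add: distrib_left exp_add add.commute mult_ac)
  finally show ?thesis by simp
 qed
 have n1: "norm (exp (\<i> * of_real xi * of_real s0)) = 1" for xi :: real by simp
 show ?thesis
 proof (rule exI[of _ C], intro conjI allI impI)
  fix xi L :: real assume L: "L > 0" "xi ~= 0"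
  have "(\<integral>s. g s * of_real (Si (L * (s - s0))) * exp (\<i> * of_real xi * of_real s) \<partial>lborel)
   - (if \<bar>xi\<bar> <= L then (\<integral>s. g s * of_real (pi / 2 * sgn (s - s0)) * exp (\<i> * of_real xi * of_real s) \<partial>lborel) else 0)
  = exp (\<i> * of_real xi * of_real s0) * ((\<integral>u. g (u + s0) * of_real (Si (L * u)) * exp (\<i> * of_real xi * of_real u) \<partial>lborel)
   - (if \<bar>xi\<bar> <= L then (\<integral>u. g (u + s0) * of_real (pi / 2 * sgn u) * exp (\<i> * of_real xi * of_real u) \<partial>lborel) else 0))"
   using sh[of "%u. Si (L * u)" xi] sh[of "%u. pi / 2 * sgn u" xi] by (simp add: right_diff_distrib)
  thus "norm ((\<integral>s. g s * of_real (Si (L * (s - s0))) * exp (\<i> * of_real xi * of_real s) \<partial>lborel)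
   - (if \<bar>xi\<bar> <= L then (\<integral>s. g s * of_real (pi / 2 * sgn (s - s0)) * exp (\<i> * of_real xi * of_real s) \<partial>lborel) else 0))
   <= C / max \<bar>xi\<bar> L / (1 + \<bar>\<bar>xi\<bar> - L\<bar>)^2"
   using C(2)[OF L] unfolding norm_mult n1 by (simp only: norm_mult n1 mult_1)
 qed (rule C(1))
qed

lemma integral_sgn_diff:
 assumes g: "continuous_on UNIV g" "vanishes_off a b g" and s: "s1 < s2"
 shows "(\<integral>s. g s * of_real (pi / 2 * sgn (s - s1)) \<partial>lborel) - (\<integral>s. g s * of_real (pi / 2 * sgn (s - s2)) \<partial>lborel)
   = of_real pi * integral {s1..s2} g"
proof -
 have gm: "g \<in> borel_measurable borel" using g(1) by (rule borel_measurable_continuous_onI)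
 have int: "integrable lborel (%s. g s * of_real (pi / 2 * sgn (s - c)))" for c
 proof (rule Bochner_Integration.integrable_bound[of _ "%s. of_real (pi / 2) * g s"])
  show "integrable lborel (%s. of_real (pi / 2) * g s)" by (intro integrable_mult_right integrable_vanishes_off[OF g])
  show "(%s. g s * of_real (pi / 2 * sgn (s - c))) \<in> borel_measurable lborel" using gm by measurable
 qed (auto simp: norm_mult abs_mult sgn_if)
 have si: "set_integrable lborel {s1..s2} g" by (intro borel_integrable_atLeastAtMost' continuous_on_subset[OF g(1)]) auto
 have "(\<integral>s. g s * of_real (pi / 2 * sgn (s - s1)) \<partial>lborel) - (\<integral>s. g s * of_real (pi / 2 * sgn (s - s2)) \<partial>lborel)
  = (\<integral>s. g s * of_real (pi / 2 * sgn (s - s1)) - g s * of_real (pi / 2 * sgn (s - s2)) \<partial>lborel)"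
  by (rule Bochner_Integration.integral_diff[symmetric]) (rule int)+
 also have "... = (\<integral>s. of_real pi * (indicator {s1..s2} s *\<^sub>R g s) \<partial>lborel)"
 proof (rule integral_cong_AE)
  have "AE s in lborel. s ~= s1 \<and> s ~= s2" using AE_lborel_singleton[of s1] AE_lborel_singleton[of s2] by eventually_elim auto
  thus "AE s in lborel. g s * of_real (pi / 2 * sgn (s - s1)) - g s * of_real (pi / 2 * sgn (s - s2)) = of_real pi * (indicator {s1..s2} s *\<^sub>R g s)"
   by eventually_elim (use s in \<open>auto simp: indicator_def sgn_if\<close>)
 qed (use gm in measurable)
 also have "... = of_real pi * integral {s1..s2} g"
  using set_borel_integral_eq_integral(2)[OF si] by (simp add: set_lebesgue_integral_def del: mult_scaleR_right)
 finally show ?thesis .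
qed

definition window :: "real => real => real => real => real" where
 "window s1 s2 L s = (Si (L * (s - s1)) - Si (L * (s - s2))) / pi"

lemma continuous_on_Si_affine [continuous_intros]: "continuous_on A f ==> continuous_on A (%x. Si (f x))"
 using continuous_on_compose2[of UNIV Si A f] isCont_Si by (auto simp: continuous_at_imp_continuous_on)

lemma continuous_on_window [continuous_intros]: "continuous_on A (window s1 s2 L)"
 unfolding window_def[abs_def] by (intro continuous_intros) auto

lemma window_bounded: "\<exists>B\<ge>0. \<forall>s1 s2 L s. \<bar>window s1 s2 L s\<bar> <= B"
proof -
 obtain B where B: "!!T. \<bar>Si T\<bar> <= B" using bounded_Si by blast
 have "\<bar>window s1 s2 L s\<bar> <= 2 * B / pi" for s1 s2 L s
  using B[of "L * (s - s1)"] B[of "L * (s - s2)"] unfolding window_def abs_divide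
  by (simp add: divide_right_mono)
 moreover have "0 <= 2 * B / pi" using B[of 0] by (simp add: abs_le_iff)
 ultimately show ?thesis by blast
qed

lemma window_tendsto:
 assumes "s1 < s2" "s ~= s1" "s ~= s2"
 shows "((%L. window s1 s2 L s) \<longlongrightarrow> indicator {s1..s2} s) at_top"
proof -
 have "((%L. window s1 s2 L s) \<longlongrightarrow> (pi / 2 * sgn (s - s1) - pi / 2 * sgn (s - s2)) / pi) at_top"
  unfolding window_def by (intro tendsto_intros Si_tendsto_sgn) auto
 also have "(pi / 2 * sgn (s - s1) - pi / 2 * sgn (s - s2)) / pi = indicator {s1..s2} s"
  using assms by (auto simp: sgn_if indicator_def)
 finally show ?thesis .
qed

lemma window_integral_eq:
 assumes g: "continuous_on UNIV g" "vanishes_off a b g"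
 shows "(\<integral>s. g s * of_real (window s1 s2 L s) \<partial>lborel) =
  ((\<integral>s. g s * of_real (Si (L * (s - s1))) \<partial>lborel) - (\<integral>s. g s * of_real (Si (L * (s - s2))) \<partial>lborel)) / of_real pi"
proof -
 have int: "integrable lborel (%s. g s * of_real (Si (L * (s - c))))" for c
  by (rule integrable_vanishes_off[of _ a b]) (use g in \<open>auto intro!: continuous_intros simp: vanishes_off_def\<close>)
 have "(\<integral>s. g s * of_real (window s1 s2 L s) \<partial>lborel) = (\<integral>s. (g s * of_real (Si (L * (s - s1))) - g s * of_real (Si (L * (s - s2)))) / of_real pi \<partial>lborel)"
  by (intro Bochner_Integration.integral_cong) (auto simp: window_def right_diff_distrib)
 thus ?thesis using int by simp
qed

lemma window_integral_tendsto:
 assumes g: "continuous_on UNIV g" "vanishes_off a b g" and s: "s1 < s2"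
 shows "((%L. \<integral>s. g s * of_real (window s1 s2 L s) \<partial>lborel) \<longlongrightarrow> integral {s1..s2} g) at_top"
proof -
 have "((%L. \<integral>s. g s * of_real (window s1 s2 L s) \<partial>lborel) \<longlongrightarrow>
  ((\<integral>s. g s * of_real (pi / 2 * sgn (s - s1)) \<partial>lborel) - (\<integral>s. g s * of_real (pi / 2 * sgn (s - s2)) \<partial>lborel)) / of_real pi) at_top"
  unfolding window_integral_eq[OF g] by (intro tendsto_intros dominated_convergence_Si[OF g]) auto
 thus ?thesis unfolding integral_sgn_diff[OF g s] by simp
qed

lemma window_fourier_localization:
 assumes g: "ck_on 4 UNIV g" "vanishes_off a b g" and s: "s1 < s2"
 shows "\<exists>C\<ge>0. \<forall>xi L. L > 0 --> xi ~= 0 -->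
  norm ((\<integral>s. g s * exp (\<i> * of_real xi * of_real s) * of_real (window s1 s2 L s) \<partial>lborel)
   - (if \<bar>xi\<bar> <= L then integral {s1..s2} (%s. g s * exp (\<i> * of_real xi * of_real s)) else 0))
  <= C / max \<bar>xi\<bar> L / (1 + \<bar>\<bar>xi\<bar> - L\<bar>)^2"
proof -
 define A where "A = (%c xi L. \<integral>s. g s * of_real (Si (L * (s - c))) * exp (\<i> * of_real xi * of_real s) \<partial>lborel)"
 define S where "S = (%c xi. \<integral>s. g s * of_real (pi / 2 * sgn (s - c)) * exp (\<i> * of_real xi * of_real s) \<partial>lborel)"
 obtain C1 where C1: "C1 >= 0" "!!xi L. L > 0 ==> xi ~= 0 ==> norm (A s1 xi L - (if \<bar>xi\<bar> <= L then S s1 xi else 0)) <= C1 / max \<bar>xi\<bar> L / (1 + \<bar>\<bar>xi\<bar> - L\<bar>)^2"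
  using Si_fourier_localization_at[OF g, of s1] unfolding A_def S_def by blast
 obtain C2 where C2: "C2 >= 0" "!!xi L. L > 0 ==> xi ~= 0 ==> norm (A s2 xi L - (if \<bar>xi\<bar> <= L then S s2 xi else 0)) <= C2 / max \<bar>xi\<bar> L / (1 + \<bar>\<bar>xi\<bar> - L\<bar>)^2"
  using Si_fourier_localization_at[OF g, of s2] unfolding A_def S_def by blast
 have gc: "continuous_on UNIV g" using ck_on_continuous[OF open_UNIV g(1)] .
 have ge: "continuous_on UNIV (%s. g s * exp (\<i> * of_real xi * of_real s))" "vanishes_off a b (%s. g s * exp (\<i> * of_real xi * of_real s))" for xi :: real
  using gc g(2) by (auto intro!: continuous_intros simp: vanishes_off_def)
 show ?thesis
 proof (rule exI[of _ "(C1 + C2) / pi"], intro conjI allI impI)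
  fix xi L :: real assume L: "L > 0" "xi ~= 0"
  define D where "D = 1 / max \<bar>xi\<bar> L / (1 + \<bar>\<bar>xi\<bar> - L\<bar>)^2"
  have e1: "(\<integral>s. g s * exp (\<i> * of_real xi * of_real s) * of_real (window s1 s2 L s) \<partial>lborel) = (A s1 xi L - A s2 xi L) / of_real pi"
   unfolding window_integral_eq[OF ge] A_def by (simp add: mult_ac)
  have e2: "integral {s1..s2} (%s. g s * exp (\<i> * of_real xi * of_real s)) = (S s1 xi - S s2 xi) / of_real pi"
   using integral_sgn_diff[OF ge s, of xi] unfolding S_def by (simp add: mult_ac)
  have "norm ((A s1 xi L - A s2 xi L) / of_real pi - (if \<bar>xi\<bar> <= L then (S s1 xi - S s2 xi) / of_real pi else 0))
   = norm ((A s1 xi L - (if \<bar>xi\<bar> <= L then S s1 xi else 0)) - (A s2 xi L - (if \<bar>xi\<bar> <= L then S s2 xi else 0))) / pi"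
   by (simp add: diff_divide_distrib[symmetric] algebra_simps) (simp add: norm_divide)
  also have "... <= (C1 * D + C2 * D) / pi"
   using order_trans[OF norm_triangle_ineq4 add_mono[OF C1(2)[OF L] C2(2)[OF L]]] unfolding D_def by (intro divide_right_mono) auto
  finally show "norm ((\<integral>s. g s * exp (\<i> * of_real xi * of_real s) * of_real (window s1 s2 L s) \<partial>lborel)
   - (if \<bar>xi\<bar> <= L then integral {s1..s2} (%s. g s * exp (\<i> * of_real xi * of_real s)) else 0))
  <= (C1 + C2) / pi / max \<bar>xi\<bar> L / (1 + \<bar>\<bar>xi\<bar> - L\<bar>)^2"
   unfolding e1 e2 D_def by (simp add: add_divide_distrib mult_ac)
 qed (use C1(1) C2(1) in auto)
qed

section \<open>Divisor sums over blocks of frequencies\<close>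

lemma card_nat_interval_le:
 fixes x y :: real
 assumes "x <= y"
 shows "finite {m::nat. x <= real m \<and> real m < y} \<and> real (card {m::nat. x <= real m \<and> real m < y}) <= y - x + 1"
proof -
 let ?A = "{m::nat. x <= real m \<and> real m < y}"
 have fin: "finite ?A" by (rule finite_subset[of _ "{..nat \<lceil>y\<rceil>}"]) (auto, linarith)
 have "card ?A = card (int ` ?A)" by (simp add: card_image)
 also have "... <= card {\<lceil>x\<rceil>..<\<lceil>y\<rceil>}" by (intro card_mono) (auto simp: ceiling_le_iff less_ceiling_iff)
 also have "... = nat (\<lceil>y\<rceil> - \<lceil>x\<rceil>)" by simp
 finally have "real (card ?A) <= real (nat (\<lceil>y\<rceil> - \<lceil>x\<rceil>))" by linarith
 also have "... <= y - x + 1" using assms by linarith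
 finally show ?thesis using fin by blast
qed

lemma card_multiples_le:
 fixes X Y :: real
 assumes "X <= Y" "l > 0"
 shows "real (card {n::nat. l dvd n \<and> X <= real n \<and> real n < Y}) <= (Y - X) / real l + 1"
proof -
 let ?B = "{m::nat. X / real l <= real m \<and> real m < Y / real l}"
 have xy: "X / real l <= Y / real l" using assms by (simp add: divide_right_mono)
 have "{n::nat. l dvd n \<and> X <= real n \<and> real n < Y} \<subseteq> (%m. l * m) ` ?B"
  using assms by (auto elim!: dvdE simp: field_simps)
 hence "card {n::nat. l dvd n \<and> X <= real n \<and> real n < Y} <= card ?B"
  using card_nat_interval_le[OF xy] by (meson card_image_le card_mono finite_imageI order_trans)
 thus ?thesis using card_nat_interval_le[OF xy] by (simp add: diff_divide_distrib)
qed

text \<open>Of the divisors d and n / d the one beyond sqrt n carries the smaller weight. The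
  restriction to d <= sqrt n keeps the rounding errors under control when multiples of d are counted
  in a block.\<close>

lemma sum_divisors_le_small:
 fixes r :: real
 assumes "r >= 0" "n > 0"
 shows "(\<Sum>d | d dvd n. real d powr - r) <= 2 * (\<Sum>d | d dvd n \<and> d * d <= n. real d powr - r)"
proof -
 let ?D = "{d. d dvd n}" and ?S = "{d. d dvd n \<and> d * d <= n}" and ?T = "{d. d dvd n \<and> n < d * d}"
 have fin: "finite ?D" using assms by simp
 have "(\<Sum>d\<in>?T. real d powr - r) <= (\<Sum>d\<in>?T. real (n div d) powr - r)"
 proof (rule sum_mono)
  fix d assume "d \<in> ?T"
  then obtain e where e: "n = d * e" "n < d * d" by (auto elim: dvdE)
  hence "e < d" "e > 0" "d > 0" using assms by auto
  thus "real d powr - r <= real (n div d) powr - r" using e assms by (auto intro!: powr_mono2')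
 qed
 also have "... = (\<Sum>d\<in>(%d. n div d) ` ?T. real d powr - r)"
 proof (rule sum.reindex_cong[symmetric, of "%d. n div d", OF _ refl refl])
  show "inj_on ((div) n) ?T" by (rule inj_onI) (use assms in \<open>metis (no_types, lifting) dvd_div_eq_0_iff dvd_div_mult_self mem_Collect_eq mult_left_cancel not_gr0\<close>)
 qed
 also have "... <= (\<Sum>d\<in>?S. real d powr - r)"
 proof (rule sum_mono2)
  show "finite ?S" using fin by (rule rev_finite_subset) auto
  show "(%d. n div d) ` ?T \<subseteq> ?S"
  proof
   fix x assume "x \<in> (%d. n div d) ` ?T"
   then obtain d where d: "d dvd n" "n < d * d" "x = n div d" by auto
   then obtain e where e: "n = d * e" by (auto elim: dvdE)
   have "e < d" "x = e" using d e assms by auto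
   thus "x \<in> ?S" using e by (auto intro: mult_right_mono)
  qed
 qed simp
 finally have "(\<Sum>d\<in>?T. real d powr - r) <= (\<Sum>d\<in>?S. real d powr - r)" .
 moreover have "(\<Sum>d\<in>?D. real d powr - r) = (\<Sum>d\<in>?S. real d powr - r) + (\<Sum>d\<in>?T. real d powr - r)"
  by (subst sum.union_disjoint[symmetric]) (use fin in \<open>auto intro: sum.cong rev_finite_subset\<close>)
 ultimately show ?thesis by simp
qed

lemma norm_sigma_char_le:
 assumes "!!d. norm (c d) <= 1" "n > 0"
 shows "norm (sigma_char z c n) <= (\<Sum>d | d dvd n. real d powr Re z)"
 unfolding sigma_char_def
proof (rule sum_norm_le)
 fix d assume "d \<in> {d. d dvd n}"
 hence "d > 0" using assms by (auto intro: dvd_pos_nat)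
 hence "norm (of_nat d powr z) = real d powr Re z"
  using norm_powr_real_powr[of "of_nat d" z] by simp
 thus "norm (of_nat d powr z * c d) <= real d powr Re z"
  using assms(1)[of d] mult_left_mono[of "norm (c d)" 1 "real d powr Re z"] by (simp add: norm_mult)
qed

lemma sum_inverse_powr_bounded:
 fixes p :: real
 assumes "p > 1"
 shows "\<exists>Z\<ge>0. \<forall>A. finite A --> (\<Sum>l\<in>A. real l powr - p) <= Z"
proof -
 have s: "summable (%l. real l powr - p)" using assms by (simp add: summable_real_powr_iff)
 have "(\<Sum>l\<in>A. real l powr - p) <= (\<Sum>l. real l powr - p)" if "finite A" for A
  by (rule sum_le_suminf[OF s that]) simp
 moreover have "(\<Sum>l. real l powr - p) >= 0" by (rule suminf_nonneg[OF s]) simp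
 ultimately show ?thesis by blast
qed

text \<open>A block is an interval of integers of length O(j + 1), which contains at most length / d
  + 1 multiples of d. As only d up to (j + 1) / b occur after \<open>sum_divisors_le_small\<close>,
  the extra 1 is itself O((j + 1) / d), and the series of d powr (- (1 + r)) converges.\<close>

lemma sigma_char_block_bound:
 fixes b :: real
 assumes c: "!!d. norm (c d) <= 1" and z: "Re z < 0" and b: "b > 0"
 shows "\<exists>K\<ge>0. \<forall>j::nat. \<forall>A. finite A --> (\<forall>n\<in>A. n > 0 \<and> real j <= b * sqrt (real n) \<and> b * sqrt (real n) < real j + 1) -->
  (\<Sum>n\<in>A. norm (sigma_char z c n)) <= K * (real j + 1)"
proof -
 define r where "r = - Re z"
 have r: "r > 0" using z by (simp add: r_def)
 obtain Z where Z: "Z >= 0" "!!A. finite A ==> (\<Sum>l\<in>A. real l powr - (1 + r)) <= Z"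
  using sum_inverse_powr_bounded[of "1 + r"] r by auto
 define H where "H = 2 / b^2 + 1 / b"
 have H: "H > 0" using b by (simp add: H_def add_pos_pos)
 have main: "(\<Sum>n\<in>A. norm (sigma_char z c n)) <= 2 * H * Z * (real j + 1)"
  if fin: "finite A" and A: "!!n. n \<in> A ==> n > 0 \<and> real j <= b * sqrt (real n) \<and> b * sqrt (real n) < real j + 1" for j :: nat and A
 proof -
  define X Y where "X = (real j / b)^2" and "Y = ((real j + 1) / b)^2"
  define L where "L = {l::nat. 0 < l \<and> real l <= (real j + 1) / b}"
  have finL: "finite L" unfolding L_def by (rule finite_subset[of _ "{..nat \<lceil>(real j + 1) / b\<rceil>}"]) (auto, linarith)
  have AX: "X <= real n \<and> real n < Y" if "n \<in> A" for n
  proof -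
   have "real j / b <= sqrt (real n)" "sqrt (real n) < (real j + 1) / b" using A[OF that] b by (auto simp: field_simps)
   from power_mono[OF this(1), of 2] power_strict_mono[OF this(2), of 2] b show ?thesis by (simp add: X_def Y_def)
  qed
  have XY: "X <= Y" unfolding X_def Y_def using b by (intro power_mono divide_right_mono) auto
  have YX: "Y - X <= 2 / b^2 * (real j + 1)"
   using b unfolding X_def Y_def power_divide diff_divide_distrib[symmetric]
   by (simp add: power2_eq_square divide_right_mono algebra_simps)
  have "(\<Sum>n\<in>A. norm (sigma_char z c n)) <= (\<Sum>n\<in>A. 2 * (\<Sum>d | d dvd n \<and> d * d <= n. real d powr - r))"
  proof (rule sum_mono)
   fix n assume "n \<in> A"
   hence n: "n > 0" using A by blast
   show "norm (sigma_char z c n) <= 2 * (\<Sum>d | d dvd n \<and> d * d <= n. real d powr - r)"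
    using norm_sigma_char_le[where c = c and z = z, OF c n] sum_divisors_le_small[of r n] n r by (simp add: r_def)
  qed
  also have "... <= (\<Sum>n\<in>A. 2 * (\<Sum>d\<in>L. if d dvd n then real d powr - r else 0))"
  proof (intro sum_mono mult_left_mono)
   fix n assume n: "n \<in> A"
   have "{d. d dvd n \<and> d * d <= n} \<subseteq> L"
   proof
    fix d assume "d \<in> {d. d dvd n \<and> d * d <= n}"
    hence d: "d dvd n" "d * d <= n" by auto
    have "real d * real d <= real n" using d(2) by (metis of_nat_le_iff of_nat_mult)
    hence "real d <= sqrt (real n)" by (intro real_le_rsqrt) (simp add: power2_eq_square)
    also have "... <= (real j + 1) / b" using A[OF n] b by (simp add: field_simps)
    finally show "d \<in> L" using d A[OF n] by (auto simp: L_def intro: dvd_pos_nat)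
   qed
   hence "(\<Sum>d | d dvd n \<and> d * d <= n. real d powr - r) = (\<Sum>d\<in>{d. d dvd n \<and> d * d <= n}. if d dvd n then real d powr - r else 0)"
    by (intro sum.cong) auto
   also have "... <= (\<Sum>d\<in>L. if d dvd n then real d powr - r else 0)"
    by (rule sum_mono2[OF finL \<open>_ \<subseteq> L\<close>]) auto
   finally show "(\<Sum>d | d dvd n \<and> d * d <= n. real d powr - r) <= (\<Sum>d\<in>L. if d dvd n then real d powr - r else 0)" .
  qed auto
  also have "... = 2 * (\<Sum>d\<in>L. \<Sum>n\<in>A. if d dvd n then real d powr - r else 0)"
   by (simp add: sum_distrib_left[symmetric]) (rule sum.swap)
  also have "(\<Sum>d\<in>L. \<Sum>n\<in>A. if d dvd n then real d powr - r else 0) <= (\<Sum>d\<in>L. H * (real j + 1) * real d powr - (1 + r))"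
  proof (rule sum_mono)
   fix d assume "d \<in> L"
   hence d: "d > 0" "real d <= (real j + 1) / b" by (auto simp: L_def)
   have fB: "finite {n::nat. d dvd n \<and> X <= real n \<and> real n < Y}"
    using card_nat_interval_le[OF XY] by (rule_tac finite_subset[of _ "{n::nat. X <= real n \<and> real n < Y}"]) auto
   have "(\<Sum>n\<in>A. if d dvd n then real d powr - r else 0) = real (card {n\<in>A. d dvd n}) * real d powr - r"
    using fin by (simp add: sum.If_cases Int_def)
   also have "... <= ((Y - X) / real d + 1) * real d powr - r"
   proof (rule mult_right_mono)
    have "card {n\<in>A. d dvd n} <= card {n::nat. d dvd n \<and> X <= real n \<and> real n < Y}"
     by (rule card_mono[OF fB]) (use AX in auto)
    thus "real (card {n\<in>A. d dvd n}) <= (Y - X) / real d + 1" using card_multiples_le[OF XY d(1)] by linarith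
   qed simp
   also have "... <= (2 / b^2 * (real j + 1) / real d + (real j + 1) / b / real d) * real d powr - r"
   proof (intro mult_right_mono add_mono divide_right_mono YX)
    show "1 <= (real j + 1) / b / real d" using d by (subst pos_le_divide_eq) auto
   qed auto
   also have "... = H * (real j + 1) * (real d powr - r / real d)" by (simp add: H_def field_simps add_divide_distrib)
   also have "real d powr - r / real d = real d powr - (1 + r)" using d by (simp add: powr_diff powr_minus powr_add divide_simps)
   finally show "(\<Sum>n\<in>A. if d dvd n then real d powr - r else 0) <= H * (real j + 1) * real d powr - (1 + r)" .
  qed
  also have "(\<Sum>d\<in>L. H * (real j + 1) * real d powr - (1 + r)) = H * (real j + 1) * (\<Sum>d\<in>L. real d powr - (1 + r))" by (simp add: sum_distrib_left)
  also have "... <= H * (real j + 1) * Z" using Z(2)[OF finL] H by (intro mult_left_mono) auto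
  finally show ?thesis by (simp add: mult_ac)
 qed
 show ?thesis
 proof (intro exI[of _ "2 * H * Z"] conjI allI impI)
  show "2 * H * Z >= 0" using H Z by simp
 qed (rule main, auto)
qed

text \<open>The majorant \<open>F\<close> depends only on the block of n. It is left arbitrary so
  that one block decomposition serves pure power weights as well as weights concentrated at the
  cut-off.\<close>

lemma sigma_char_weighted_sum:
 fixes b :: real
 assumes c: "!!d. norm (c d) <= 1" and z: "Re z < 0" and b: "b > 0"
 obtains K where "K >= 0" "\<forall>A w F. finite A --> 0 \<notin> A --> (\<forall>j::nat. F j >= 0) --> (\<forall>n\<in>A. w n <= F (nat \<lfloor>b * sqrt (real n)\<rfloor>)) -->
  (\<Sum>n\<in>A. norm (sigma_char z c n) * w n) <= K * (\<Sum>j\<in>(%n. nat \<lfloor>b * sqrt (real n)\<rfloor>) ` A. (real j + 1) * F j)"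
proof -
 obtain K where K: "K >= 0" "!!j A. finite A ==> (\<forall>n\<in>A. n > 0 \<and> real j <= b * sqrt (real n) \<and> b * sqrt (real n) < real j + 1) ==>
  (\<Sum>n\<in>A. norm (sigma_char z c n)) <= K * (real j + 1)"
  using sigma_char_block_bound[where c = c, OF c z b] by blast
 have main: "(\<Sum>n\<in>A. norm (sigma_char z c n) * w n) <= K * (\<Sum>j\<in>(%n. nat \<lfloor>b * sqrt (real n)\<rfloor>) ` A. (real j + 1) * F j)"
  if fin: "finite A" and A: "0 \<notin> A" and F: "!!j. F j >= 0" and w: "!!n. n \<in> A ==> w n <= F (nat \<lfloor>b * sqrt (real n)\<rfloor>)" for A w F
 proof -
  define J where "J = (%n. nat \<lfloor>b * sqrt (real n)\<rfloor>)"
  have "(\<Sum>n\<in>A. norm (sigma_char z c n) * w n) <= (\<Sum>n\<in>A. norm (sigma_char z c n) * F (J n))"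
   using w by (intro sum_mono mult_left_mono) (auto simp: J_def)
  also have "... = (\<Sum>j\<in>J ` A. \<Sum>n\<in>{n\<in>A. J n = j}. norm (sigma_char z c n) * F (J n))"
   by (rule sum.image_gen[OF fin])
  also have "... <= (\<Sum>j\<in>J ` A. K * (real j + 1) * F j)"
  proof (rule sum_mono)
   fix j
   have "(\<Sum>n\<in>{n\<in>A. J n = j}. norm (sigma_char z c n) * F (J n)) = (\<Sum>n\<in>{n\<in>A. J n = j}. norm (sigma_char z c n)) * F j"
    unfolding sum_distrib_right by (intro sum.cong) auto
   also have "... <= K * (real j + 1) * F j"
   proof (intro mult_right_mono K(2) F ballI)
    fix n assume n: "n \<in> {n\<in>A. J n = j}"
    have nn: "b * sqrt (real n) >= 0" using b by simp
    hence "real j = of_int \<lfloor>b * sqrt (real n)\<rfloor>" using n by (auto simp: J_def)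
    thus "n > 0 \<and> real j <= b * sqrt (real n) \<and> b * sqrt (real n) < real j + 1"
     using n A by (auto intro: gr0I)
   qed (use fin in auto)
   finally show "(\<Sum>n\<in>{n\<in>A. J n = j}. norm (sigma_char z c n) * F (J n)) <= K * (real j + 1) * F j" .
  qed
  finally show ?thesis by (simp add: J_def sum_distrib_left mult.assoc)
 qed
 show thesis by (rule that[OF K(1)]) (intro allI impI main, auto)
qed

text \<open>Comparison with j + 1 instead of j keeps negative powers finite in the block j = 0; sqrt
  n >= 1 is what makes it possible.\<close>

lemma floor_scale:
 fixes b :: real
 assumes "b > 0" "n > 0"
 shows "b / (1 + b) * (real (nat \<lfloor>b * sqrt (real n)\<rfloor>) + 1) <= b * sqrt (real n)"
proof -
 have s: "sqrt (real n) >= 1" using assms by simp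
 have "real (nat \<lfloor>b * sqrt (real n)\<rfloor>) <= b * sqrt (real n)" using assms by simp
 hence "real (nat \<lfloor>b * sqrt (real n)\<rfloor>) + 1 <= (1 + b) * sqrt (real n)" unfolding distrib_right using s by linarith
 from mult_left_mono[OF this, of "b / (1 + b)"] show ?thesis using assms by simp
qed

text \<open>Of the threshold 2, one power pays for the block sum O(j + 1) and the other for
  convergence over the blocks.\<close>

lemma sigma_char_summable:
 fixes b p :: real
 assumes c: "!!d. norm (c d) <= 1" and z: "Re z < 0" and b: "b > 0" and p: "p > 2"
 shows "summable (%n. norm (sigma_char z c (Suc n)) * (b * sqrt (real (Suc n))) powr - p)"
proof -
 obtain K where K: "K >= 0" "\<forall>A w F. finite A --> 0 \<notin> A --> (\<forall>j::nat. F j >= 0) --> (\<forall>n\<in>A. w n <= F (nat \<lfloor>b * sqrt (real n)\<rfloor>)) -->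
  (\<Sum>n\<in>A. norm (sigma_char z c n) * w n) <= K * (\<Sum>j\<in>(%n. nat \<lfloor>b * sqrt (real n)\<rfloor>) ` A. (real j + 1) * F j)"
  by (rule sigma_char_weighted_sum[where c = c, OF c z b]) (rule that)
 obtain Z where Z: "Z >= 0" "!!A. finite A ==> (\<Sum>l\<in>A. real l powr - (p - 1)) <= Z"
  using sum_inverse_powr_bounded[of "p - 1"] p by auto
 define kap where "kap = b / (1 + b)"
 have kap: "kap > 0" using b by (simp add: kap_def)
 show ?thesis
 proof (rule summableI_nonneg_bounded)
  fix N
  have "(\<Sum>n<N. norm (sigma_char z c (Suc n)) * (b * sqrt (real (Suc n))) powr - p) = (\<Sum>n\<in>Suc ` {..<N}. norm (sigma_char z c n) * (b * sqrt (real n)) powr - p)"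
   by (subst sum.reindex) auto
  also have "... <= K * (\<Sum>j\<in>(%n. nat \<lfloor>b * sqrt (real n)\<rfloor>) ` Suc ` {..<N}. (real j + 1) * (kap * (real j + 1)) powr - p)"
  proof (rule K(2)[rule_format])
   fix n assume "n \<in> Suc ` {..<N}"
   hence "n > 0" by auto
   thus "(b * sqrt (real n)) powr - p <= (kap * (real (nat \<lfloor>b * sqrt (real n)\<rfloor>) + 1)) powr - p"
    using floor_scale[OF b, of n] kap p unfolding kap_def[symmetric] by (intro powr_mono2') auto
  qed auto
  also have "(\<Sum>j\<in>(%n. nat \<lfloor>b * sqrt (real n)\<rfloor>) ` Suc ` {..<N}. (real j + 1) * (kap * (real j + 1)) powr - p)
   = kap powr - p * (\<Sum>j\<in>(%n. nat \<lfloor>b * sqrt (real n)\<rfloor>) ` Suc ` {..<N}. real (Suc j) powr - (p - 1))"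
   unfolding sum_distrib_left
  proof (rule sum.cong[OF refl])
   fix j :: nat
   have "(real j + 1) * (real j + 1) powr - p = (real j + 1) powr (1 + - p)" unfolding powr_add by simp
   thus "(real j + 1) * (kap * (real j + 1)) powr - p = kap powr - p * real (Suc j) powr - (p - 1)"
    using kap by (simp add: powr_mult mult_ac add.commute)
  qed
  also have "(\<Sum>j\<in>(%n. nat \<lfloor>b * sqrt (real n)\<rfloor>) ` Suc ` {..<N}. real (Suc j) powr - (p - 1)) <= Z"
   using Z(2)[of "Suc ` (%n. nat \<lfloor>b * sqrt (real n)\<rfloor>) ` Suc ` {..<N}"] by (simp add: sum.reindex del: of_nat_Suc)
  finally show "(\<Sum>n<N. norm (sigma_char z c (Suc n)) * (b * sqrt (real (Suc n))) powr - p) <= K * (kap powr - p * Z)"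
   using K(1) by (simp add: mult_left_mono)
 qed simp
qed

text \<open>The indices on either side of \<open>k\<close> are mapped injectively to positive
  integers, so the bound does not see the centre.\<close>

lemma sum_inverse_square_centred:
 "\<exists>Z\<ge>0. \<forall>A (k::nat). finite A --> (\<Sum>j\<in>A. 1 / (1 + \<bar>real j - real k\<bar>)^2) <= Z"
proof -
 obtain Z where Z: "Z >= 0" "!!A. finite A ==> (\<Sum>l\<in>A. real l powr - 2) <= Z"
  using sum_inverse_powr_bounded[of 2] by auto
 have "(\<Sum>j\<in>A. 1 / (1 + \<bar>real j - real k\<bar>)^2) <= 2 * Z" if fin: "finite A" for A and k :: nat
 proof -
  have b: "(\<Sum>j\<in>B. 1 / (1 + \<bar>real j - real k\<bar>)^2) <= Z" if B: "finite B" "inj_on phi B" "!!j. j \<in> B ==> real (phi j) = 1 + \<bar>real j - real k\<bar>" for B and phi :: "nat => nat"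
  proof -
   have "(\<Sum>j\<in>B. 1 / (1 + \<bar>real j - real k\<bar>)^2) = (\<Sum>j\<in>B. real (phi j) powr - 2)"
    by (intro sum.cong refl) (simp add: B(3) powr_minus_divide powr_numeral)
   also have "... = (\<Sum>l\<in>phi ` B. real l powr - 2)" by (simp add: sum.reindex[OF B(2)])
   finally show ?thesis using Z(2) B(1) by simp
  qed
  have "(\<Sum>j\<in>A. 1 / (1 + \<bar>real j - real k\<bar>)^2) = (\<Sum>j\<in>{j\<in>A. j >= k}. 1 / (1 + \<bar>real j - real k\<bar>)^2) + (\<Sum>j\<in>{j\<in>A. j < k}. 1 / (1 + \<bar>real j - real k\<bar>)^2)"
   by (subst sum.union_disjoint[symmetric]) (use fin in \<open>auto intro: sum.cong\<close>)
  also have "... <= Z + Z"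
   by (intro add_mono b[of _ "%j. 1 + j - k"] b[of _ "%j. 1 + k - j"]) (use fin in \<open>auto simp: inj_on_def of_nat_diff\<close>)
  finally show ?thesis by simp
 qed
 thus ?thesis using Z(1) by (intro exI[of _ "2 * Z"]) auto
qed

text \<open>The key inequality is x powr e / max x L <= L powr e / x: for x <= L it uses e + 1 > 0,
  for x > L it uses e < 0. The resulting 1 / x cancels the size j + 1 of the block sum, and the
  inverse squares about L add up to a bounded amount.\<close>

lemma sigma_char_localized_sum:
 fixes b e :: real
 assumes c: "!!d. norm (c d) <= 1" and z: "Re z < 0" and b: "b > 0" and e: "-1 < e" "e < 0"
 shows "\<exists>K\<ge>0. \<forall>L>0. \<forall>A. finite A --> 0 \<notin> A -->
  (\<Sum>n\<in>A. norm (sigma_char z c n) * ((b * sqrt (real n)) powr e / max (b * sqrt (real n)) L / (1 + \<bar>b * sqrt (real n) - L\<bar>)^2)) <= K * L powr e"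
proof -
 obtain K where K: "K >= 0" "\<forall>A w F. finite A --> 0 \<notin> A --> (\<forall>j::nat. F j >= 0) --> (\<forall>n\<in>A. w n <= F (nat \<lfloor>b * sqrt (real n)\<rfloor>)) -->
  (\<Sum>n\<in>A. norm (sigma_char z c n) * w n) <= K * (\<Sum>j\<in>(%n. nat \<lfloor>b * sqrt (real n)\<rfloor>) ` A. (real j + 1) * F j)"
  by (rule sigma_char_weighted_sum[where c = c, OF c z b]) (rule that)
 obtain Z where Z: "Z >= 0" "!!A (k::nat). finite A ==> (\<Sum>j\<in>A. 1 / (1 + \<bar>real j - real k\<bar>)^2) <= Z"
  using sum_inverse_square_centred by blast
 define kap where "kap = b / (1 + b)"
 have kap: "kap > 0" using b by (simp add: kap_def)
 have "(\<Sum>n\<in>A. norm (sigma_char z c n) * ((b * sqrt (real n)) powr e / max (b * sqrt (real n)) L / (1 + \<bar>b * sqrt (real n) - L\<bar>)^2)) <= K * (4 / kap * Z) * L powr e"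
  if L: "L > 0" and fin: "finite A" and A: "0 \<notin> A" for L A
 proof -
  define k where "k = nat \<lfloor>L\<rfloor>"
  define J where "J = (%n. nat \<lfloor>b * sqrt (real n)\<rfloor>)"
  have "(\<Sum>n\<in>A. norm (sigma_char z c n) * ((b * sqrt (real n)) powr e / max (b * sqrt (real n)) L / (1 + \<bar>b * sqrt (real n) - L\<bar>)^2))
   <= K * (\<Sum>j\<in>J ` A. (real j + 1) * (L powr e / (kap * (real j + 1)) * (4 / (1 + \<bar>real j - real k\<bar>)^2)))"
   unfolding J_def
  proof (rule K(2)[rule_format, OF fin A])
   fix n assume n: "n \<in> A"
   define j x where "j = nat \<lfloor>b * sqrt (real n)\<rfloor>" and "x = b * sqrt (real n)"
   have np: "n > 0" using n A by (auto intro: gr0I)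
   have x: "x > 0" using np b by (simp add: x_def)
   have jx: "kap * (real j + 1) <= x" using floor_scale[OF b np] by (simp add: kap_def j_def x_def)
   have "x powr e / max x L <= L powr e / x"
   proof (cases "x <= L")
    case True
    have "x powr (e + 1) <= L powr (e + 1)" using True x e by (intro powr_mono2) auto
    hence "x * x powr e <= L * L powr e" using x L by (simp add: powr_add mult.commute)
    thus ?thesis using True x L by (simp add: max_def field_simps)
   next
    case False
    have "x powr e <= L powr e" using False L e by (intro powr_mono2') auto
    thus ?thesis using False x by (simp add: max_def divide_right_mono)
   qed
   also have "... <= L powr e / (kap * (real j + 1))" using jx x kap by (intro divide_left_mono) auto
   finally have 1: "x powr e / max x L <= L powr e / (kap * (real j + 1))" .
   \<comment> \<open>Rounding both x and L down changes their distance by at most 1, which costs the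
     factor 4 below.\<close>
   have jk: "\<bar>real j - real k\<bar> <= \<bar>x - L\<bar> + 1" unfolding j_def k_def x_def[symmetric] using x L by linarith
   have g: "a <= y + 1 ==> 0 <= y ==> 1 + a <= 2 * (1 + y)" for a y :: real by simp
   have "(1 + \<bar>real j - real k\<bar>)^2 <= (2 * (1 + \<bar>x - L\<bar>))^2"
    by (rule power_mono[OF g[OF jk abs_ge_zero]]) simp
   hence "(1 + \<bar>real j - real k\<bar>)^2 <= 4 * (1 + \<bar>x - L\<bar>)^2" by (simp only: power_mult_distrib) simp
   moreover have "(1 + \<bar>x - L\<bar>)^2 > 0" "(1 + \<bar>real j - real k\<bar>)^2 > 0" by (simp_all add: add_pos_nonneg)
   ultimately have 2: "1 / (1 + \<bar>x - L\<bar>)^2 <= 4 / (1 + \<bar>real j - real k\<bar>)^2" by (simp add: divide_simps)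
   have "x powr e / max x L * (1 / (1 + \<bar>x - L\<bar>)^2) <= L powr e / (kap * (real j + 1)) * (4 / (1 + \<bar>real j - real k\<bar>)^2)"
    using kap x L by (intro mult_mono 1 2) auto
   thus "(b * sqrt (real n)) powr e / max (b * sqrt (real n)) L / (1 + \<bar>b * sqrt (real n) - L\<bar>)^2
    <= L powr e / (kap * (real (nat \<lfloor>b * sqrt (real n)\<rfloor>) + 1)) * (4 / (1 + \<bar>real (nat \<lfloor>b * sqrt (real n)\<rfloor>) - real k\<bar>)^2)"
    by (simp add: j_def x_def)
  qed (use kap in auto)
  also have "(\<Sum>j\<in>J ` A. (real j + 1) * (L powr e / (kap * (real j + 1)) * (4 / (1 + \<bar>real j - real k\<bar>)^2))) = L powr e / kap * 4 * (\<Sum>j\<in>J ` A. 1 / (1 + \<bar>real j - real k\<bar>)^2)"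
   unfolding sum_distrib_left
  proof (rule sum.cong[OF refl])
   fix j :: nat
   have "real j + 1 ~= 0" by linarith
   thus "(real j + 1) * (L powr e / (kap * (real j + 1)) * (4 / (1 + \<bar>real j - real k\<bar>)^2)) = L powr e / kap * 4 * (1 / (1 + \<bar>real j - real k\<bar>)^2)"
    by simp
  qed
  also have "K * (L powr e / kap * 4 * (\<Sum>j\<in>J ` A. 1 / (1 + \<bar>real j - real k\<bar>)^2)) <= K * (L powr e / kap * 4 * Z)"
   using Z(2)[of "J ` A" k] fin kap K(1) by (intro mult_left_mono) auto
  finally show ?thesis by (simp add: mult_ac)
 qed
 moreover have "K * (4 / kap * Z) >= 0" using K(1) Z(1) kap by simp
 ultimately show ?thesis by blast
qed

section \<open>Comparison of the windowed and the sharp dual series\<close>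

lemma ck_on_mult_extend:
 assumes h: "ck_on k UNIV h" "vanishes_off a b h" "0 < a" and m: "ck_on k {0<..} m"
 shows "ck_on k UNIV (%s. h s * m s)"
proof (rule ck_on_extend_zero[of "{0<..}" k _ "{a..b}"])
 show "ck_on k {0<..} (%s. h s * m s)" using ck_on_subset[of "{0<..}" UNIV k h] h m by (intro ck_on_mult) auto
qed (use h in \<open>auto simp: vanishes_off_def\<close>)

lemma ck_on_of_real_powr: "ck_on k {0<..} (%s. of_real s powr w)"
 by (rule ck_on_holomorphic[of "- \<real>\<^sub>\<le>\<^sub>0" "%z. z powr w"]) (auto intro!: holomorphic_intros simp: closed_nonpos_Reals_complex open_Compl complex_nonpos_Reals_iff)

lemma continuous_on_bessel_G:
 assumes nu: "0 < Re nu" "Re nu < 1"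
 shows "continuous_on {0<..} (bessel_G nu)"
proof -
 have E: "continuous_on UNIV (bessel_E mu)" for mu by (rule holomorphic_on_imp_continuous_on[OF holomorphic_bessel_E])
 have "continuous_on {0<..} (%x. complex_of_real (x / 2) powr mu)" for mu
  by (intro continuous_on_powr_complex continuous_intros) auto
 hence "continuous_on {0<..} (bessel_J mu)" "continuous_on {0<..} (bessel_I mu)" for mu
  unfolding bessel_J_eq[abs_def] bessel_I_eq[abs_def]
  by (intro continuous_intros continuous_on_compose2[OF E]; auto)+
 thus ?thesis unfolding bessel_G_eq[OF nu, abs_def] divide_inverse by (intro continuous_intros) auto
qed

text \<open>The flag \<open>c\<close> is kept apart from \<open>L\<close> so that the defect is
  linear in \<open>g\<close> for a fixed flag. It will be x <= L, the case in which the window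
  should let the frequency x pass.\<close>

definition window_defect :: "real => real => bool => real => (real => complex) => complex" where
 "window_defect s1 s2 c L g = (\<integral>s. g s * of_real (window s1 s2 L s) \<partial>lborel) - (if c then integral {s1..s2} g else 0)"

lemma integrable_window:
 assumes "continuous_on UNIV g" "vanishes_off a b g"
 shows "integrable lborel (%s. g s * of_real (window s1 s2 L s))"
 by (rule integrable_vanishes_off[of _ a b]) (use assms in \<open>auto intro!: continuous_intros simp: vanishes_off_def\<close>)

lemma window_defect_add:
 assumes "continuous_on UNIV f" "vanishes_off a b f" "continuous_on UNIV g" "vanishes_off a b g"
 shows "window_defect s1 s2 c L (%s. f s + g s) = window_defect s1 s2 c L f + window_defect s1 s2 c L g"
proof -
 have "f integrable_on {s1..s2}" "g integrable_on {s1..s2}"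
  using assms by (auto intro!: integrable_continuous_interval continuous_on_subset[of UNIV])
 thus ?thesis using integrable_window[OF assms(1,2)] integrable_window[OF assms(3,4)]
  by (simp add: window_defect_def distrib_right Henstock_Kurzweil_Integration.integral_add)
qed

lemma window_defect_cmult: "window_defect s1 s2 c L (%s. k * g s) = k * window_defect s1 s2 c L g"
 by (simp add: window_defect_def mult.assoc right_diff_distrib)

lemma window_defect_bound:
 assumes s: "s1 < s2"
 shows "\<exists>B\<ge>0. \<forall>a b c L g. continuous_on UNIV g --> vanishes_off a b g --> norm (window_defect s1 s2 c L g) <= B * (\<integral>s. norm (g s) \<partial>lborel)"
proof -
 obtain B where B: "B >= 0" "!!L s. \<bar>window s1 s2 L s\<bar> <= B" using window_bounded by blast
 show ?thesis
 proof (intro exI[of _ "2 * B"] conjI allI impI)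
  fix a b L :: real and c g assume g: "continuous_on UNIV g" "vanishes_off a b g"
  have w: "norm (\<integral>s. g s * of_real (window s1 s2 L s) \<partial>lborel) <= B * (\<integral>s. norm (g s) \<partial>lborel)" for L
  proof -
   have "norm (\<integral>s. g s * of_real (window s1 s2 L s) \<partial>lborel) <= (\<integral>s. B * norm (g s) \<partial>lborel)"
   proof (rule order_trans[OF integral_norm_bound integral_mono])
    show "norm (g s * of_real (window s1 s2 L s)) <= B * norm (g s)" for s
     using mult_left_mono[OF B(2)[of L s] norm_ge_zero[of "g s"]] by (simp add: norm_mult mult.commute)
   qed (use integrable_vanishes_off[OF g] integrable_window[OF g] in auto)
   thus ?thesis by simp
  qed
  \<comment> \<open>The sharp integral inherits the bound as a limit of windowed ones.\<close>
  have "norm (integral {s1..s2} g) <= B * (\<integral>s. norm (g s) \<partial>lborel)"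
   by (rule tendsto_upperbound[OF tendsto_norm[OF window_integral_tendsto[OF g s]]]) (auto intro!: always_eventually w)
  moreover have "0 <= B * (\<integral>s. norm (g s) \<partial>lborel)" using B(1) by simp
  ultimately have "norm (if c then integral {s1..s2} g else 0) <= B * (\<integral>s. norm (g s) \<partial>lborel)" by simp
  thus "norm (window_defect s1 s2 c L g) <= 2 * B * (\<integral>s. norm (g s) \<partial>lborel)"
   using w[of L] unfolding window_defect_def
   by (smt (verit) norm_triangle_ineq4 distrib_right mult_2 mult.assoc)
 qed (use B in auto)
qed

lemma window_defect_tendsto:
 assumes "continuous_on UNIV g" "vanishes_off a b g" "s1 < s2"
 shows "((%L. window_defect s1 s2 (x <= L) L g) \<longlongrightarrow> 0) at_top"
proof -
 have "((%L. (\<integral>s. g s * of_real (window s1 s2 L s) \<partial>lborel) - integral {s1..s2} g) \<longlongrightarrow> integral {s1..s2} g - integral {s1..s2} g) at_top"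
  by (intro tendsto_intros window_integral_tendsto[OF assms])
 moreover have "eventually (%L. (\<integral>s. g s * of_real (window s1 s2 L s) \<partial>lborel) - integral {s1..s2} g = window_defect s1 s2 (x <= L) L g) at_top"
  using eventually_ge_at_top[of x] by eventually_elim (simp add: window_defect_def)
 ultimately show ?thesis by (simp add: Lim_transform_eventually)
qed

text \<open>The expansion of the kernel splits the integrand into waves of frequency x, to which
  \<open>window_fourier_localization\<close> applies, and a remainder. The remainder has no usable
  frequency, so its defect is kept as \<open>E\<close>: O(x powr (- 5/2)) uniformly in L, and
  tending to 0 for each x, as dominated convergence requires.\<close>

lemma kernel_localization:
 fixes b :: real
 assumes h: "ck_on 4 UNIV h" "vanishes_off slo shi h" "0 < slo" and s: "s1 < s2"
  and nu: "0 < Re nu" "Re nu < 1" and b: "b > 0"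
 shows "\<exists>C\<ge>0. \<exists>E. (\<forall>x\<ge>b. \<forall>L>0. norm (window_defect s1 s2 (x <= L) L (%s. h s * bessel_G nu (x * s)) - E x L) <= C * (x powr (- 1/2) / max x L / (1 + \<bar>x - L\<bar>)^2)) \<and>
  (\<forall>x\<ge>b. \<forall>L. norm (E x L) <= C * x powr (- 5/2)) \<and> (\<forall>x\<ge>b. (E x \<longlongrightarrow> 0) at_top)"
proof -
 have x0: "b * slo > 0" using b h by simp
 obtain A0 A1 B0 B1 D where D: "D >= 0" "!!x. x >= b * slo ==> norm (of_real (sqrt x) * bessel_G nu x - (exp (\<i> * of_real x) * (A0 + A1 / of_real x) + exp (- (\<i> * of_real x)) * (B0 + B1 / of_real x))) <= D / x^2"
  using bessel_G_expansion[OF nu x0] by blast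
 \<comment> \<open>At the argument x * s the two terms of the expansion leave the powers - 1/2 and -
   3/2 of s; they are absorbed into the test functions \<open>g 0\<close> and
   \<open>g 1\<close>.\<close>
 define g where "g = (%(k::nat) s. h s * of_real s powr (- 1/2 - of_nat k))"
 have gck: "ck_on 4 UNIV (g k)" for k unfolding g_def by (rule ck_on_mult_extend[OF h ck_on_of_real_powr])
 have gv: "vanishes_off slo shi (g k)" for k using h(2) by (simp add: g_def vanishes_off_def)
 have gc: "continuous_on UNIV (g k)" for k using ck_on_continuous[OF open_UNIV gck] .
 have "\<exists>C\<ge>0. \<forall>xi L. L > 0 --> xi ~= 0 --> norm (window_defect s1 s2 (\<bar>xi\<bar> <= L) L (%s. g k s * exp (\<i> * of_real xi * of_real s)))
  <= C / max \<bar>xi\<bar> L / (1 + \<bar>\<bar>xi\<bar> - L\<bar>)^2" for k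
  using window_fourier_localization[OF gck gv s, of k] unfolding window_defect_def .
 then obtain C where C: "!!k. C k >= 0" "!!k xi L. L > 0 ==> xi ~= 0 ==> norm (window_defect s1 s2 (\<bar>xi\<bar> <= L) L (%s. g k s * exp (\<i> * of_real xi * of_real s)))
  <= C k / max \<bar>xi\<bar> L / (1 + \<bar>\<bar>xi\<bar> - L\<bar>)^2" by metis
 obtain B where B: "B >= 0" "!!c L g. continuous_on UNIV g ==> vanishes_off slo shi g ==> norm (window_defect s1 s2 c L g) <= B * (\<integral>s. norm (g s) \<partial>lborel)"
  using window_defect_bound[OF s] by blast
 define e where "e = (%k (\<sigma>::real) x s. g k s * exp (\<i> * of_real (\<sigma> * x) * of_real s))"
 have ev: "vanishes_off slo shi (e k \<sigma> x)" for k \<sigma> x using gv by (simp add: e_def vanishes_off_def)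
 have ec: "continuous_on UNIV (e k \<sigma> x)" for k \<sigma> x unfolding e_def by (intro continuous_intros gc)
 define P where "P = (%x s. of_real (1 / sqrt x) * ((A0 * e 0 1 x s + A1 / of_real x * e 1 1 x s) + (B0 * e 0 (-1) x s + B1 / of_real x * e 1 (-1) x s)))"
 define R where "R = (%x s. h s * bessel_G nu (x * s) - P x s)"
 have hc: "continuous_on UNIV h" using ck_on_continuous[OF open_UNIV h(1)] .
 have Pv: "vanishes_off slo shi (P x)" for x using ev by (auto simp: P_def vanishes_off_def)
 have Pc: "continuous_on UNIV (P x)" for x unfolding P_def by (intro continuous_intros ec)
 have Gc: "continuous_on UNIV (%s. h s * bessel_G nu (x * s))" if "x >= b" for x
 proof -
  have "continuous_on {0<..} (%s. bessel_G nu (x * s))"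
   by (intro continuous_on_compose2[OF continuous_on_bessel_G[OF nu]] continuous_intros) (use that b in auto)
  thus ?thesis using ck_on_mult_extend[of 0 h slo shi "%s. bessel_G nu (x * s)"] hc h by simp
 qed
 have Rc: "continuous_on UNIV (R x)" if "x >= b" for x unfolding R_def by (intro continuous_intros Gc Pc that)
 have Rv: "vanishes_off slo shi (R x)" for x using Pv h(2) by (simp add: R_def vanishes_off_def)
 have DR: "window_defect s1 s2 c L (%s. h s * bessel_G nu (x * s)) = window_defect s1 s2 c L (P x) + window_defect s1 s2 c L (R x)" if "x >= b" for c L x
  using window_defect_add[OF Pc Pv Rc Rv, OF that, of s1 s2 c L x] by (simp add: R_def)
 have Rb: "norm (R x s) <= D * slo powr (- 5/2) * x powr (- 5/2) * norm (h s)" if x: "x >= b" for x s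
 proof (cases "h s = 0")
  case False
  hence s0: "s > slo" "s > 0" using h(2,3) by (auto simp: vanishes_off_def not_le[symmetric])
  have xp: "x > 0" using x b by simp
  define y where "y = x * s"
  have y: "y >= b * slo" "y > 0" unfolding y_def using x s0 b h by (auto intro!: mult_mono)
  define Q where "Q = exp (\<i> * of_real y) * (A0 + A1 / of_real y) + exp (- (\<i> * of_real y)) * (B0 + B1 / of_real y)"
  have p0: "complex_of_real s powr (- 1/2) = of_real (1 / sqrt s)"
   using powr_of_real[of s "- 1/2"] s0 by (simp add: powr_minus_divide powr_half_sqrt)
  have p1: "complex_of_real s powr (- 1/2 - 1) = complex_of_real (1 / sqrt s) / of_real s"
   unfolding powr_diff p0 using s0 by simp
  define u v where "u = complex_of_real (1 / sqrt s)" and "v = complex_of_real (1 / sqrt x)"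
  have gs: "g 0 s = h s * u" "g 1 s = h s * (u / of_real s)" unfolding g_def u_def using p0 p1 by simp_all
  have ex: "exp (\<i> * complex_of_real (1 * x) * of_real s) = exp (\<i> * of_real y)" "exp (\<i> * complex_of_real ((-1) * x) * of_real s) = exp (- (\<i> * of_real y))"
   by (simp_all add: y_def mult.assoc)
  have "of_real (1 / sqrt y) = v * u" by (simp add: y_def u_def v_def real_sqrt_mult)
  moreover have "z / of_real y = z / of_real x / of_real s" for z :: complex by (simp add: y_def)
  ultimately have "P x s = h s * of_real (1 / sqrt y) * Q"
   unfolding P_def e_def Q_def gs ex v_def[symmetric] by (simp only: algebra_simps times_divide_eq_left times_divide_eq_right)
  moreover have "bessel_G nu y = of_real (1 / sqrt y) * (of_real (sqrt y) * bessel_G nu y)" using y by simp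
  ultimately have "R x s = h s * of_real (1 / sqrt y) * (of_real (sqrt y) * bessel_G nu y - Q)"
   unfolding R_def y_def[symmetric] using y by (simp add: right_diff_distrib)
  hence "norm (R x s) = norm (h s) * (1 / sqrt y) * norm (of_real (sqrt y) * bessel_G nu y - Q)" using y by (simp add: norm_mult norm_divide)
  also have "... <= norm (h s) * (1 / sqrt y) * (D / y^2)" using D(2)[OF y(1)] y unfolding Q_def by (intro mult_left_mono) auto
  also have "... = norm (h s) * D * y powr (- 5/2)"
  proof -
   have "y powr (- 5/2) = y powr (- (1/2) - 2)" by simp
   also have "... = 1 / sqrt y / y^2" unfolding powr_diff using y by (simp add: powr_minus_divide powr_half_sqrt powr_numeral)
   finally show ?thesis by simp
  qed
  also have "... <= norm (h s) * D * (slo powr (- 5/2) * x powr (- 5/2))"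
  proof (intro mult_left_mono)
   have "s powr (- 5/2) <= slo powr (- 5/2)" using s0 h by (intro powr_mono2') auto
   thus "y powr (- 5/2) <= slo powr (- 5/2) * x powr (- 5/2)" unfolding y_def using xp s0 by (simp add: powr_mult mult.commute mult_left_mono)
  qed (use D in auto)
  finally show ?thesis by (simp add: mult_ac)
 next
  case True
  thus ?thesis by (simp add: R_def P_def e_def g_def)
 qed
 define K1 where "K1 = norm A0 * C 0 + norm A1 / b * C 1 + (norm B0 * C 0 + norm B1 / b * C 1)"
 define K2 where "K2 = B * (D * slo powr (- 5/2) * (\<integral>s. norm (h s) \<partial>lborel))"
 have K1: "K1 >= 0" using C(1) b by (simp add: K1_def)
 have K2: "K2 >= 0" using B D by (simp add: K2_def)
 have 1: "norm (window_defect s1 s2 (x <= L) L (P x)) <= K1 * (x powr (- 1/2) / max x L / (1 + \<bar>x - L\<bar>)^2)" if x: "x >= b" and L: "L > 0" for x L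
 proof -
  have xp: "x > 0" using x b by simp
  define W where "W = (%k \<sigma>. window_defect s1 s2 (x <= L) L (e k \<sigma> x))"
  define M where "M = 1 / max x L / (1 + \<bar>x - L\<bar>)^2"
  have M: "M >= 0" using xp by (simp add: M_def)
  have Wb: "norm (W k \<sigma>) <= C k * M" if "\<sigma> = 1 \<or> \<sigma> = -1" for k \<sigma>
   using C(2)[OF L, of "\<sigma> * x" k] that xp by (auto simp: W_def e_def M_def abs_mult)
  have Q: "continuous_on UNIV (%s. c * e k \<sigma> x s)" "vanishes_off slo shi (%s. c * e k \<sigma> x s)" for c k \<sigma>
   using ec ev by (auto intro!: continuous_intros simp: vanishes_off_def)
  have Q2: "continuous_on UNIV (%s. c * e k \<sigma> x s + c' * e k' \<sigma>' x s)" "vanishes_off slo shi (%s. c * e k \<sigma> x s + c' * e k' \<sigma>' x s)" for c k \<sigma> c' k' \<sigma>'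
   using ec ev by (auto intro!: continuous_intros simp: vanishes_off_def)
  have eq: "window_defect s1 s2 (x <= L) L (P x) = of_real (1 / sqrt x) * ((A0 * W 0 1 + A1 / of_real x * W 1 1) + (B0 * W 0 (-1) + B1 / of_real x * W 1 (-1)))"
   unfolding P_def window_defect_cmult window_defect_add[OF Q2 Q2] window_defect_add[OF Q Q] W_def by (rule refl)
  have xb: "norm (z / of_real x) <= norm z / b" for z :: complex using x b xp by (simp add: norm_divide divide_left_mono)
  have "norm ((A0 * W 0 1 + A1 / of_real x * W 1 1) + (B0 * W 0 (-1) + B1 / of_real x * W 1 (-1)))
   <= (norm A0 * (C 0 * M) + norm A1 / b * (C 1 * M)) + (norm B0 * (C 0 * M) + norm B1 / b * (C 1 * M))"
   using b by (intro order_trans[OF norm_triangle_ineq] add_mono; unfold norm_mult; intro mult_mono xb Wb order_refl) auto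
  also have "... = K1 * M" by (simp add: K1_def algebra_simps)
  finally have "norm (window_defect s1 s2 (x <= L) L (P x)) <= 1 / sqrt x * (K1 * M)"
   unfolding eq norm_mult using xp by (intro mult_mono) (auto simp: norm_divide)
  also have "1 / sqrt x = x powr (- 1/2)" using xp by (simp add: powr_minus_divide powr_half_sqrt)
  finally show ?thesis by (simp add: M_def mult_ac)
 qed
 have 2: "norm (window_defect s1 s2 c L (R x)) <= K2 * x powr (- 5/2)" if x: "x >= b" for x L c
 proof -
  have "norm (window_defect s1 s2 c L (R x)) <= B * (\<integral>s. norm (R x s) \<partial>lborel)" by (rule B(2)[OF Rc[OF x] Rv])
  also have "... <= B * (\<integral>s. D * slo powr (- 5/2) * x powr (- 5/2) * norm (h s) \<partial>lborel)"
   by (intro mult_left_mono[OF _ B(1)] integral_mono integrable_norm integrable_mult_right Rb[OF x] integrable_vanishes_off[OF Rc[OF x] Rv] integrable_vanishes_off[OF hc h(2)])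
  finally show ?thesis by (simp add: K2_def mult_ac)
 qed
 show ?thesis
 proof (intro exI[of _ "K1 + K2"] exI[of _ "%x L. window_defect s1 s2 (x <= L) L (R x)"] conjI allI impI)
  fix x L assume x: "b <= x" and L: "0 < (L::real)"
  have "x > 0" using x b by simp
  hence "0 <= x powr (- 1/2) / max x L / (1 + \<bar>x - L\<bar>)^2" by simp
  from mult_right_mono[OF _ this, of K1 "K1 + K2"] show "norm (window_defect s1 s2 (x <= L) L (%s. h s * bessel_G nu (x * s)) - window_defect s1 s2 (x <= L) L (R x)) <= (K1 + K2) * (x powr (- 1/2) / max x L / (1 + \<bar>x - L\<bar>)^2)"
   using 1[OF x L] K2 DR[OF x] by simp
 next
  fix x L assume x: "b <= x"
  show "norm (window_defect s1 s2 (x <= L) L (R x)) <= (K1 + K2) * x powr (- 5/2)"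
   using 2[OF x, of "x <= L" L] K1 mult_right_mono[of K2 "K1 + K2" "x powr (- 5/2)"] by simp
 next
  fix x assume x: "b <= x"
  show "((%L. window_defect s1 s2 (x <= L) L (R x)) \<longlongrightarrow> 0) at_top" by (rule window_defect_tendsto[OF Rc[OF x] Rv s])
 qed (use K1 K2 in auto)
qed

text \<open>With the cut-off L = x N the condition x n <= L means n <= N, so the windowed series
  minus the N-th partial sum of the sharp one is the sum of the defects \<open>d N\<close>. The part
  \<open>d N n - e N n\<close> adds up to O(x N powr (r - 1/2)) by
  \<open>sigma_char_localized_sum\<close>; the part \<open>e N n\<close> has a summable majorant and
  tends to 0 for each n.\<close>

lemma dual_series_localization:
 fixes b :: real
 assumes h: "ck_on 4 UNIV h" "vanishes_off slo shi h" "0 < slo" and s: "s1 < s2"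
  and nu: "0 < Re nu" "Re nu < 1/2" and b: "b > 0" and c: "!!d. norm (c d) <= 1"
  and S: "!!L. L > 0 ==> (%n. sigma_char (- nu) c (Suc n) * of_nat (Suc n) powr (nu / 2) *
    (\<integral>s. h s * bessel_G nu (b * sqrt (real (Suc n)) * s) * of_real (window s1 s2 L s) \<partial>lborel)) sums S L"
  and S0: "(S \<longlongrightarrow> S0) at_top"
 shows "(%n. sigma_char (- nu) c (Suc n) * of_nat (Suc n) powr (nu / 2) *
    integral {s1..s2} (%s. h s * bessel_G nu (b * sqrt (real (Suc n)) * s))) sums S0"
proof -
 define r where "r = Re nu"
 have r: "0 < r" "r < 1/2" using nu by (auto simp: r_def)
 have nu1: "Re nu < 1" using nu by simp
 obtain C E where C: "C >= 0"
  "!!x L. x >= b ==> L > 0 ==> norm (window_defect s1 s2 (x <= L) L (%s. h s * bessel_G nu (x * s)) - E x L) <= C * (x powr (- 1/2) / max x L / (1 + \<bar>x - L\<bar>)^2)"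
  "!!x L. x >= b ==> norm (E x L) <= C * x powr (- 5/2)" "!!x. x >= b ==> (E x \<longlongrightarrow> 0) at_top"
  using kernel_localization[OF h s nu(1) nu1 b] by blast
 have z: "Re (- nu) < 0" using nu by simp
 obtain K where K: "K >= 0" "!!L A. L > 0 ==> finite A ==> 0 \<notin> A ==>
  (\<Sum>n\<in>A. norm (sigma_char (- nu) c n) * ((b * sqrt (real n)) powr (r - 1/2) / max (b * sqrt (real n)) L / (1 + \<bar>b * sqrt (real n) - L\<bar>)^2)) <= K * L powr (r - 1/2)"
  using sigma_char_localized_sum[where c = c, OF c z b, of "r - 1/2"] r by auto
 define x where "x = (%n. b * sqrt (real (Suc n)))"
 define a where "a = (%n. norm (sigma_char (- nu) c (Suc n)))"
 define w where "w = (%n. sigma_char (- nu) c (Suc n) * of_nat (Suc n) powr (nu / 2))"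
 define T where "T = (%n. w n * integral {s1..s2} (%s. h s * bessel_G nu (x n * s)))"
 define U where "U = (%L n. w n * (\<integral>s. h s * bessel_G nu (x n * s) * of_real (window s1 s2 L s) \<partial>lborel))"
 define d where "d = (%N n. w n * window_defect s1 s2 (x n <= x N) (x N) (%s. h s * bessel_G nu (x n * s)))"
 have xb: "x n >= b" for n using b by (simp add: x_def)
 have xp: "x n > 0" for n using xb[of n] b by simp
 have xx: "x n <= x N \<longleftrightarrow> n <= N" for n N using b by (simp add: x_def)
 have "filterlim (%n. sqrt (real (Suc n))) at_top sequentially"
  by (intro filterlim_compose[OF sqrt_at_top] filterlim_compose[OF filterlim_real_sequentially] filterlim_Suc)
 hence xt: "filterlim x at_top sequentially"
  unfolding x_def by (intro filterlim_tendsto_pos_mult_at_top[OF tendsto_const b])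
 have wn: "norm (w n) = b powr - r * (a n * x n powr r)" for n
 proof -
  have "norm (complex_of_nat (Suc n) powr (nu / 2)) = real (Suc n) powr (r / 2)"
   using norm_powr_real_powr[of "complex_of_nat (Suc n)" "nu / 2"] by (simp add: r_def)
  also have "... = sqrt (real (Suc n)) powr r" by (simp add: powr_half_sqrt[symmetric] powr_powr)
  also have "... = b powr - r * x n powr r" unfolding x_def using b by (simp add: powr_mult powr_minus)
  finally show ?thesis by (simp add: w_def a_def norm_mult)
 qed
 have a0: "a n >= 0" for n by (simp add: a_def)
 define e where "e = (%N n. w n * E (x n) (x N))"
 define y where "y = (%N n. a n * (x n powr (r - 1/2) / max (x n) (x N) / (1 + \<bar>x n - x N\<bar>)^2))"
 have y0: "y N n >= 0" for N n unfolding y_def using a0 xp[of n] by (intro mult_nonneg_nonneg divide_nonneg_nonneg) auto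
 have ysum: "(\<Sum>n<M. y N n) <= K * x N powr (r - 1/2)" for N M
 proof -
  have "(\<Sum>n<M. y N n) = (\<Sum>n\<in>Suc ` {..<M}. norm (sigma_char (- nu) c n) * ((b * sqrt (real n)) powr (r - 1/2) / max (b * sqrt (real n)) (x N) / (1 + \<bar>b * sqrt (real n) - x N\<bar>)^2))"
   by (subst sum.reindex) (auto simp: y_def a_def x_def)
  also have "... <= K * x N powr (r - 1/2)" by (rule K(2)[OF xp]) auto
  finally show ?thesis .
 qed
 have ys: "summable (y N)" for N using summableI_nonneg_bounded[of "y N", OF y0 ysum] .
 have yle: "suminf (y N) <= K * x N powr (r - 1/2)" for N by (rule suminf_le_const[OF ys ysum])
 have pb: "norm (d N n - e N n) <= C * b powr - r * y N n" for N n
 proof -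
  have "norm (d N n - e N n) = norm (w n) * norm (window_defect s1 s2 (x n <= x N) (x N) (%s. h s * bessel_G nu (x n * s)) - E (x n) (x N))"
   by (simp add: d_def e_def norm_mult right_diff_distrib[symmetric])
  also have "... <= norm (w n) * (C * (x n powr (- 1/2) / max (x n) (x N) / (1 + \<bar>x n - x N\<bar>)^2))"
   by (intro mult_left_mono C xb xp) simp
  also have "... = C * b powr - r * (a n * ((x n powr r * x n powr (- 1/2)) / max (x n) (x N) / (1 + \<bar>x n - x N\<bar>)^2))" by (simp add: wn)
  also have "x n powr r * x n powr (- 1/2) = x n powr (r - 1/2)" by (simp add: powr_add[symmetric])
  finally show ?thesis unfolding y_def .
 qed
 define m where "m = (%n. a n * x n powr - (5/2 - r))"
 \<comment> \<open>The exponent 5/2 - r exceeds the threshold 2 of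
   \<open>sigma_char_summable\<close> because r < 1/2.\<close>
 have ms: "summable m" unfolding m_def a_def x_def using sigma_char_summable[where c = c, OF c z b, of "5/2 - r"] r by simp
 have eb: "norm (e N n) <= C * b powr - r * m n" for N n
 proof -
  have "norm (e N n) <= norm (w n) * (C * x n powr (- 5/2))" unfolding e_def norm_mult by (intro mult_left_mono C xb) simp
  also have "... = C * b powr - r * (a n * (x n powr r * x n powr (- 5/2)))" by (simp add: wn)
  also have "x n powr r * x n powr (- 5/2) = x n powr - (5/2 - r)" by (simp add: powr_add[symmetric])
  finally show ?thesis unfolding m_def .
 qed
 have es: "summable (e N)" for N by (rule summable_comparison_test'[of "%n. C * b powr - r * m n" 0]) (use eb ms in \<open>auto intro: summable_mult\<close>)
 have ps: "summable (%n. norm (d N n - e N n))" for N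
  by (rule summable_comparison_test'[of "%n. C * b powr - r * y N n" 0]) (use pb ys in \<open>auto intro: summable_mult\<close>)
 have elim: "(%N. suminf (e N)) \<longlonglongrightarrow> suminf (%n. 0 :: complex)"
 proof (rule tannery[where M = "%n. C * b powr - r * m n"])
  show "(%N. e N k) \<longlonglongrightarrow> 0" for k
   unfolding e_def using tendsto_mult[OF tendsto_const filterlim_compose[OF C(4)[OF xb] xt], of "w k" k] by simp
 qed (use eb ms in \<open>auto intro: summable_mult\<close>)
 have plim: "(%N. suminf (%n. d N n - e N n)) \<longlonglongrightarrow> 0"
 proof (rule tendsto_norm_zero_cancel, rule tendsto_sandwich[OF _ _ tendsto_const])
  show "\<forall>\<^sub>F N in sequentially. norm (suminf (%n. d N n - e N n)) <= C * b powr - r * (K * x N powr (r - 1/2))"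
  proof (intro always_eventually allI)
   fix N
   have "norm (suminf (%n. d N n - e N n)) <= (\<Sum>n. norm (d N n - e N n))" by (rule summable_norm[OF ps])
   also have "... <= (\<Sum>n. C * b powr - r * y N n)" by (intro suminf_le pb ps summable_mult ys)
   also have "... = C * b powr - r * suminf (y N)" by (rule suminf_mult[OF ys])
   also have "... <= C * b powr - r * (K * x N powr (r - 1/2))" using yle[of N] C(1) by (intro mult_left_mono) auto
   finally show "norm (suminf (%n. d N n - e N n)) <= C * b powr - r * (K * x N powr (r - 1/2))" .
  qed
  have "((%t::real. t powr (r - 1/2)) \<longlongrightarrow> 0) at_top" using r by (intro tendsto_neg_powr filterlim_ident) auto
  from tendsto_mult[OF tendsto_const tendsto_mult[OF tendsto_const filterlim_compose[OF this xt]]]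
  show "(%N. C * b powr - r * (K * x N powr (r - 1/2))) \<longlonglongrightarrow> 0" by simp
 qed auto
 have "(\<Sum>n\<le>N. T n) = S (x N) - (suminf (%n. d N n - e N n) + suminf (e N))" for N
 proof -
  have "(%n. U (x N) n) sums S (x N)" using S[OF xp] by (simp add: U_def w_def x_def)
  moreover have "(%n. if n \<in> {..N} then T n else 0) sums (\<Sum>n\<le>N. T n)" by (rule sums_If_finite_set) simp
  ultimately have "(%n. U (x N) n - (if n \<in> {..N} then T n else 0)) sums (S (x N) - (\<Sum>n\<le>N. T n))" by (rule sums_diff)
  also have "(%n. U (x N) n - (if n \<in> {..N} then T n else 0)) = d N"
   by (auto simp: fun_eq_iff U_def T_def d_def window_defect_def xx right_diff_distrib)
  finally have "suminf (d N) = S (x N) - (\<Sum>n\<le>N. T n)" by (rule sums_unique[symmetric])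
  moreover have "suminf (%n. (d N n - e N n) + e N n) = suminf (%n. d N n - e N n) + suminf (e N)"
   by (rule suminf_add[symmetric, OF summable_norm_cancel[OF ps] es])
  ultimately show ?thesis by (simp add: algebra_simps)
 qed
 moreover have "(%N. S (x N) - (suminf (%n. d N n - e N n) + suminf (e N))) \<longlonglongrightarrow> S0 - (0 + suminf (%n. 0 :: complex))"
  by (intro tendsto_diff tendsto_add plim elim filterlim_compose[OF S0 xt])
 ultimately have "(%N. \<Sum>n\<le>N. T n) \<longlonglongrightarrow> S0" by simp
 hence "T sums S0" by (simp add: sums_def_le)
 thus ?thesis by (simp add: T_def[abs_def] w_def x_def)
qed

section \<open>Cut-off functions, the substitution t = s^2 and the final assembly\<close>

text \<open>The profile \<rho> composes two truncated powers: the outer eighth power is C^7, and the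
  inner function has a derivative that is a multiple of such a power. It is 1 left of 0 and 0 right
  of 1, and the plateau is a product of two rescaled copies, one for each end.\<close>

lemma plateau_function_exists:
 assumes "s1 < s2" "eps > 0"
 obtains \<eta> where "ck_on 7 UNIV \<eta>" "vanishes_off (s1 - eps) (s2 + eps) \<eta>" "!!x. x \<in> {s1..s2} ==> \<eta> x = 1"
proof -
 define \<rho> where "\<rho> = (%x. complex_of_real (max 0 (1 - max 0 x ^ 9) ^ 8))"
 have e: "Suc 7 = (8::nat)" "Suc 8 = (9::nat)" by simp_all
 have c1: "ck_on 7 UNIV (%x. complex_of_real (max 0 x ^ 8))" using ck_on_max_power[of 7] unfolding e .
 have c2: "ck_on 7 UNIV (%x. complex_of_real (- (9 * max 0 x ^ 8)))"
  using ck_on_mult[OF open_UNIV ck_on_const[of 7 UNIV "- 9"] c1] by (simp del: ck_on.simps)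
 have c3: "((%x. 1 - max 0 x ^ 9) has_real_derivative - (9 * max 0 x ^ 8)) (at x)" for x :: real
  using DERIV_diff[OF DERIV_const[of 1] has_real_derivative_max_power[of 7 x, unfolded e]] by simp
 have \<rho>: "ck_on 7 UNIV \<rho>" unfolding \<rho>_def
  by (rule ck_on_compose[OF open_UNIV open_UNIV subset_UNIV c1 c3 c2])
 have \<rho>1: "\<rho> x = 1" if "x <= 0" for x using that by (simp add: \<rho>_def max_def)
 have \<rho>0: "\<rho> x = 0" if "x >= 1" for x
 proof -
  have "max 0 x ^ 9 >= 1" using that by (simp add: one_le_power)
  hence "max 0 (1 - max 0 x ^ 9) = 0" by simp
  thus ?thesis unfolding \<rho>_def by simp
 qed
 have aff: "ck_on 7 UNIV (%x. \<rho> ((c + \<sigma> * x) / eps))" for c \<sigma>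
  by (rule ck_on_compose[where f = \<rho> and T = UNIV and h' = "%_. \<sigma> / eps"]) (use \<rho> assms in \<open>auto intro!: derivative_eq_intros\<close>)
 define \<eta> where "\<eta> = (%x. \<rho> ((s1 + (-1) * x) / eps) * \<rho> ((- s2 + 1 * x) / eps))"
 have ge1: "y / eps >= 1" if "y >= eps" for y using that assms by simp
 show ?thesis
 proof (rule that[of \<eta>])
  show "ck_on 7 UNIV \<eta>" unfolding \<eta>_def by (intro ck_on_mult aff open_UNIV)
  show "vanishes_off (s1 - eps) (s2 + eps) \<eta>"
   unfolding vanishes_off_def \<eta>_def by (auto intro!: \<rho>0 ge1)
  show "\<eta> x = 1" if "x \<in> {s1..s2}" for x
   using that assms unfolding \<eta>_def by (subst (1 2) \<rho>1) (auto simp: divide_nonpos_pos)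
 qed
qed

lemma lborel_integral_vanishes_off:
 assumes "continuous_on {a..b} f" "vanishes_off a b f"
 shows "(\<integral>x. f x \<partial>lborel) = integral {a..b} f"
proof -
 have "(\<integral>x. f x \<partial>lborel) = (LINT x:{a..b}|lborel. f x)"
  unfolding set_lebesgue_integral_def using assms(2) by (intro Bochner_Integration.integral_cong) (auto simp: indicator_def vanishes_off_def)
 also have "... = integral {a..b} f" by (intro set_borel_integral_eq_integral borel_integrable_atLeastAtMost' assms)
 finally show ?thesis .
qed

lemma has_integral_sqrt_substitution:
 fixes k :: "real => complex"
 assumes "0 < a" "a <= b" "continuous_on {a..b} k"
 shows "((%t. k (sqrt t) / of_real (2 * sqrt t)) has_integral integral {a..b} k) {a^2..b\<^sup>2}"
proof -
 have ab: "a^2 <= b^2" using assms by (intro power_mono) auto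
 have "((%t. (inverse (sqrt t) / 2) *\<^sub>R k (sqrt t)) has_integral integral {sqrt (a^2)..sqrt (b^2)} k) {a^2..b\<^sup>2}"
 proof (rule has_integral_substitution[where g = sqrt and g' = "%t. inverse (sqrt t) / 2" and f = k and c = a and d = b])
  show "sqrt ` {a^2..b\<^sup>2} \<subseteq> {a..b}" using assms by (auto intro!: real_le_rsqrt real_le_lsqrt)
  fix t assume "t \<in> {a^2..b\<^sup>2}"
  hence "t > 0" using zero_less_power[OF assms(1), of 2] by (simp only: atLeastAtMost_iff) linarith
  thus "(sqrt has_real_derivative inverse (sqrt t) / 2) (at t within {a^2..b\<^sup>2})"
   by (rule has_field_derivative_at_within[OF DERIV_real_sqrt])
 next
  show "a^2 <= b^2" by (rule ab)
  show "sqrt (a^2) <= sqrt (b^2)" by (rule real_sqrt_le_mono[OF ab])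
 qed (rule assms)
 also have "(%t. (inverse (sqrt t) / 2) *\<^sub>R k (sqrt t)) = (%t. k (sqrt t) / of_real (2 * sqrt t))"
  by (simp add: fun_eq_iff scaleR_conv_of_real inverse_eq_divide)
 finally show ?thesis using assms by (simp only: real_sqrt_abs) simp
qed

lemma lborel_integral_sqrt_substitution:
 assumes k: "continuous_on UNIV k" "vanishes_off a b k" "0 < a" "a <= b"
 shows "(\<integral>t. k (sqrt t) / of_real (2 * sqrt t) \<partial>lborel) = (\<integral>s. k s \<partial>lborel)"
proof -
 have v: "vanishes_off (a^2) (b^2) (%t. k (sqrt t) / of_real (2 * sqrt t))"
  unfolding vanishes_off_def
 proof (intro allI impI)
  fix t assume "t <= a^2 \<or> b^2 <= t"
  hence "sqrt t <= a \<or> b <= sqrt t" using k(3,4) by (auto intro: real_le_rsqrt real_le_lsqrt simp: sqrt_le_D)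
  thus "k (sqrt t) / of_real (2 * sqrt t) = 0" using k(2) by (auto simp: vanishes_off_def)
 qed
 have "continuous_on {a^2..b\<^sup>2} (%t. k (sqrt t) / of_real (2 * sqrt t))"
 proof (intro continuous_intros continuous_on_compose2[OF k(1)])
  show "\<forall>t\<in>{a^2..b\<^sup>2}. complex_of_real (2 * sqrt t) ~= 0"
  proof
   fix t assume "t \<in> {a^2..b\<^sup>2}"
   hence "t >= a^2" by simp
   hence "t > 0" using zero_less_power[OF k(3), of 2] by linarith
   thus "complex_of_real (2 * sqrt t) ~= 0" by simp
  qed
 qed auto
 from lborel_integral_vanishes_off[OF this v] lborel_integral_vanishes_off[OF continuous_on_subset[OF k(1)] k(2)]
  integral_unique[OF has_integral_sqrt_substitution[OF k(3,4) continuous_on_subset[OF k(1)]]]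
 show ?thesis by simp
qed

text \<open>The entire extension of Si settles all orders of differentiability at once.\<close>

lemma ck_on_window: "ck_on k UNIV (%s. of_real (window s1 s2 L s))"
proof -
 obtain F where F: "F holomorphic_on UNIV" "!!x. F (of_real x) = of_real (Si x)" using Si_entire_extension by metis
 have "ck_on k UNIV (%s. (%z. (F (of_real L * (z - of_real s1)) - F (of_real L * (z - of_real s2))) / of_real pi) (of_real s))"
  by (rule ck_on_holomorphic[of UNIV])
   (auto intro!: holomorphic_intros holomorphic_on_compose_gen[where f = "%z. of_real L * (z - of_real _)" and g = F, unfolded o_def] F(1))
 thus ?thesis unfolding of_real_diff[symmetric] of_real_mult[symmetric] F(2) window_def by simp
qed

lemma ck_on_sqrt_compose:
 assumes "ck_on k UNIV g"
 shows "ck_on k {0<..} (%t. g (sqrt t))"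
proof (rule ck_on_compose[where T = UNIV and h' = "%t. inverse (sqrt t) / 2"])
 show "(sqrt has_real_derivative inverse (sqrt t) / 2) (at t)" if "t \<in> {0<..}" for t using that by (intro DERIV_real_sqrt) auto
 show "ck_on k {0<..} (%t. complex_of_real (inverse (sqrt t) / 2))"
 proof (rule ck_on_cong[OF _ _ ck_on_mult[OF _ ck_on_const[of k _ "1/2"] ck_on_of_real_powr[of k "- 1/2"]]])
  fix t :: real assume "t \<in> {0<..}"
  thus "1/2 * complex_of_real t powr (- 1/2) = of_real (inverse (sqrt t) / 2)"
   using powr_of_real[of t "- 1/2"] by (simp add: powr_minus powr_half_sqrt)
 qed auto
qed (use assms in auto)

lemma of_real_sqrt_powr: "t > 0 ==> complex_of_real (sqrt t) powr w = of_real t powr (w / 2)"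
 using powr_of_real_mult[of "sqrt t" "sqrt t" "w / 2"] by (simp add: powr_add[symmetric] flip: of_real_mult)

lemma of_real_powr_minus_half: "t > 0 ==> complex_of_real t powr (w - 1/2) = of_real t powr w / of_real (sqrt t)"
 using of_real_sqrt_powr[of t 1] by (simp add: powr_diff)

context odd_primitive_char
begin

text \<open>For each L the function \<open>h\<close> times the window, transported to t = s^2, is an
  admissible test function for \<open>smoothed_voronoi\<close>. As L tends to infinity the right
  sides converge, the finite sum because by \<open>nz\<close> no integer sits at a jump of the
  limiting indicator; \<open>dual_series_localization\<close> then carries the limit over to the
  sharp dual series.\<close>

theorem windowed_voronoi:
 assumes h: "ck_on 7 UNIV h" "vanishes_off slo shi h" "0 < slo" "slo <= shi" and s: "s1 < s2"
  and nu: "0 < Re nu" "Re nu < 1/2" and J: "shi^2 <= real J" and nz: "!!N::nat. sqrt (real N) ~= s1 \<and> sqrt (real N) ~= s2"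
 shows "(%n. sigma_char (- nu) (%m. cnj (chi m)) (Suc n) * of_nat (Suc n) powr (nu / 2) *
    integral {s1..s2} (%s. h s * bessel_G nu (4 * pi / sqrt (real q) * sqrt (real (Suc n)) * s))) sums
  (of_nat q / (4 * \<i> * gauss_sum q chi) / (of_real pi / 2 * of_nat q powr (nu / 2)) *
   (dirichlet_L chi (1 - nu) * integral {s1..s2} (%s. h s * of_real s powr (- nu))
    - (\<Sum>N\<in>{1..J}. sigma_bar_char (- nu) chi N * (of_nat N powr nu * (h (sqrt (real N)) * of_real (indicator {s1..s2} (sqrt (real N))) * (of_real (real N) powr (- nu / 2 - 1/2) / 2))))))"
proof -
 have nu1: "Re nu < 1" using nu by simp
 define b where "b = 4 * pi / sqrt (real q)"
 have b: "b > 0" using q_pos by (simp add: b_def)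
 define c where "c = of_real pi / 2 * of_nat q powr (nu / 2)"
 have c: "c ~= 0" using q_pos by (simp add: c_def)
 \<comment> \<open>The power t powr (- nu / 2) is what turns \<open>voronoi_U\<close> into a pure
   \<open>bessel_G\<close>; 1 / (2 sqrt t) is the Jacobian of t = s^2, which accounts for the extra
   exponent - 1/2 and the division by 2.\<close>
 define phi where "phi = (%L t. h (sqrt t) * of_real (window s1 s2 L (sqrt t)) * (of_real t powr (- nu / 2 - 1/2) / 2))"
 have hc: "continuous_on UNIV h" using ck_on_continuous[OF open_UNIV h(1)] .
 have h0: "h (sqrt t) = 0" if "t <= 0" for t
 proof -
  have "sqrt t <= slo" using that h(3) real_sqrt_le_0_iff[of t] by linarith
  thus ?thesis using h(2) by (simp add: vanishes_off_def)
 qed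
 have phieq: "phi L t = h (sqrt t) * of_real (window s1 s2 L (sqrt t)) * of_real t powr (- nu / 2) / of_real (2 * sqrt t)" if "t > 0" for L t
  unfolding phi_def of_real_powr_minus_half[OF that] by simp
 have van: "vanishes_off (slo^2) (shi^2) (phi L)" for L
  unfolding vanishes_off_def
 proof (intro allI impI)
  fix t assume "t <= slo^2 \<or> shi^2 <= t"
  hence "sqrt t <= slo \<or> shi <= sqrt t" using h(3,4) by (auto intro!: real_le_rsqrt real_le_lsqrt)
  thus "phi L t = 0" using h(2) by (auto simp: vanishes_off_def phi_def)
 qed
 have ck: "ck_on 7 UNIV (phi L)" for L
 proof (rule ck_on_extend_zero[of "{0<..}" _ _ "{slo^2..shi\<^sup>2}"])
  have p1: "ck_on 7 {0<..} (%t. 1/2 * complex_of_real t powr (- nu / 2 - 1/2))" by (intro ck_on_mult ck_on_of_real_powr ck_on_const) auto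
  have p2: "ck_on 7 UNIV (%s. h s * of_real (window s1 s2 L s))" by (intro ck_on_mult h ck_on_window open_UNIV)
  have "ck_on 7 {0<..} (%t. h (sqrt t) * of_real (window s1 s2 L (sqrt t)) * (1/2 * of_real t powr (- nu / 2 - 1/2)))"
   by (rule ck_on_mult[OF open_greaterThan ck_on_sqrt_compose[OF p2] p1])
  thus "ck_on 7 {0<..} (phi L)" by (simp add: phi_def del: ck_on.simps)
  show "{slo^2..shi\<^sup>2} \<subseteq> {0<..}" using zero_less_power[OF h(3), of 2] by (intro subsetI) (simp only: atLeastAtMost_iff greaterThan_iff, linarith)
 qed (use van in \<open>auto simp: vanishes_off_def\<close>)
 define w where "w = (%s. h s * of_real s powr (- nu))"
 have wc: "continuous_on UNIV w" using ck_on_continuous[OF open_UNIV ck_on_mult_extend[OF h(1-3) ck_on_of_real_powr]] unfolding w_def .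
 have wv: "vanishes_off slo shi w" using h(2) by (simp add: w_def vanishes_off_def)
 have int1: "(\<integral>t. phi L t \<partial>lborel) = (\<integral>s. w s * of_real (window s1 s2 L s) \<partial>lborel)" for L
 proof -
  have "phi L t = w (sqrt t) * of_real (window s1 s2 L (sqrt t)) / of_real (2 * sqrt t)" for t
  proof (cases "t > 0")
   case True thus ?thesis unfolding phieq[OF True] w_def of_real_sqrt_powr[OF True] by simp
  qed (simp add: phi_def w_def h0)
  thus ?thesis using lborel_integral_sqrt_substitution[of "%s. w s * of_real (window s1 s2 L s)" slo shi] wc wv h
   by (simp add: continuous_intros vanishes_off_def)
 qed
 have int2: "(\<integral>t. phi L t * voronoi_U nu q (Suc n) t \<partial>lborel) = c * (of_nat (Suc n) powr (nu / 2) * (\<integral>s. h s * bessel_G nu (b * sqrt (real (Suc n)) * s) * of_real (window s1 s2 L s) \<partial>lborel))" for L n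
 proof -
  define k where "k = (%s. h s * bessel_G nu (b * sqrt (real (Suc n)) * s) * of_real (window s1 s2 L s))"
  have "continuous_on {0<..} (%s. bessel_G nu (b * sqrt (real (Suc n)) * s))"
   by (intro continuous_on_compose2[OF continuous_on_bessel_G[OF nu(1) nu1]] continuous_intros) (use b in auto)
  hence "continuous_on UNIV (%s. h s * bessel_G nu (b * sqrt (real (Suc n)) * s))"
   using ck_on_mult_extend[of 0 h slo shi "%s. bessel_G nu (b * sqrt (real (Suc n)) * s)"] hc h by simp
  hence kc: "continuous_on UNIV k" unfolding k_def by (rule continuous_on_mult) (intro continuous_intros)
  have kv: "vanishes_off slo shi k" using h(2) by (simp add: k_def vanishes_off_def)
  have "phi L t * voronoi_U nu q (Suc n) t = (c * of_nat (Suc n) powr (nu / 2)) * (k (sqrt t) / of_real (2 * sqrt t))" for t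
  proof (cases "t > 0")
   case True
   have "of_real t powr (- nu / 2) * voronoi_U nu q (Suc n) t = of_real t powr (nu / 2) * (of_real t powr (- nu) * voronoi_U nu q (Suc n) t)"
    by (simp add: mult.assoc[symmetric] powr_add[symmetric])
   also have "... = of_real t powr (nu / 2) * (c * (of_nat (Suc n) powr (nu / 2) * of_real t powr (- nu / 2) * bessel_G nu (4 * pi * sqrt (real (Suc n) * t / real q))))"
    unfolding c_def by (subst voronoi_U_eq_G[OF nu(1) nu1 _ q_pos True]) auto
   also have "... = (of_real t powr (nu / 2) * of_real t powr (- nu / 2)) * (c * (of_nat (Suc n) powr (nu / 2) * bessel_G nu (4 * pi * sqrt (real (Suc n) * t / real q))))"
    by (simp only: mult_ac)
   also have "of_real t powr (nu / 2) * of_real t powr (- nu / 2) = (1::complex)" using True by (simp add: powr_add[symmetric])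
   also have "4 * pi * sqrt (real (Suc n) * t / real q) = b * sqrt (real (Suc n)) * sqrt t"
    by (simp add: b_def real_sqrt_mult real_sqrt_divide)
   finally have "of_real t powr (- nu / 2) * voronoi_U nu q (Suc n) t = c * (of_nat (Suc n) powr (nu / 2) * bessel_G nu (b * sqrt (real (Suc n)) * sqrt t))" by (simp only: mult_1)
   hence "phi L t * voronoi_U nu q (Suc n) t = h (sqrt t) * of_real (window s1 s2 L (sqrt t)) * (c * (of_nat (Suc n) powr (nu / 2) * bessel_G nu (b * sqrt (real (Suc n)) * sqrt t))) / of_real (2 * sqrt t)"
    unfolding phieq[OF True] by (simp only: times_divide_eq_left mult.assoc)
   thus ?thesis unfolding k_def by (simp only: times_divide_eq_left times_divide_eq_right mult_ac)
  qed (simp add: phi_def k_def h0)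
  hence "(\<integral>t. phi L t * voronoi_U nu q (Suc n) t \<partial>lborel) = (c * of_nat (Suc n) powr (nu / 2)) * (\<integral>t. k (sqrt t) / of_real (2 * sqrt t) \<partial>lborel)"
   by (simp only: integral_mult_right_zero)
  thus ?thesis unfolding lborel_integral_sqrt_substitution[OF kc kv h(3,4)] by (simp only: k_def mult.assoc)
 qed
 define S where "S = (%L. of_nat q / (4 * \<i> * gauss_sum q chi) / c *
   (dirichlet_L chi (1 - nu) * (\<integral>s. w s * of_real (window s1 s2 L s) \<partial>lborel) - (\<Sum>N\<in>{1..J}. sigma_bar_char (- nu) chi N * (of_nat N powr nu * phi L (real N)))))"
 have "(%n. sigma_char (- nu) (%m. cnj (chi m)) (Suc n) * of_nat (Suc n) powr (nu / 2) *
    integral {s1..s2} (%s. h s * bessel_G nu (b * sqrt (real (Suc n)) * s))) sums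
  (of_nat q / (4 * \<i> * gauss_sum q chi) / c * (dirichlet_L chi (1 - nu) * integral {s1..s2} w
    - (\<Sum>N\<in>{1..J}. sigma_bar_char (- nu) chi N * (of_nat N powr nu * (h (sqrt (real N)) * of_real (indicator {s1..s2} (sqrt (real N))) * (of_real (real N) powr (- nu / 2 - 1/2) / 2))))))"
 proof (rule dual_series_localization[OF _ h(2,3) s nu b, where S = S])
  show "ck_on 4 UNIV h" by (rule ck_on_le[OF open_UNIV _ h(1)]) simp
  show "norm (cnj (chi d)) <= 1" for d using norm_dirichlet_char_le[OF char] by simp
  show "(%n. sigma_char (- nu) (%m. cnj (chi m)) (Suc n) * of_nat (Suc n) powr (nu / 2) *
    (\<integral>s. h s * bessel_G nu (b * sqrt (real (Suc n)) * s) * of_real (window s1 s2 L s) \<partial>lborel)) sums S L" for L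
  proof -
   interpret V: voronoi q chi "phi L" "slo^2" "shi^2" nu
    by unfold_locales (use ck van h nu nu1 in \<open>auto simp del: ck_on.simps\<close>)
   from sums_divide[OF V.smoothed_voronoi[OF J], of c] show ?thesis
    unfolding int1 int2 S_def using c by (simp add: mult_ac del: of_nat_Suc)
  qed
  show "(S \<longlongrightarrow> of_nat q / (4 * \<i> * gauss_sum q chi) / c * (dirichlet_L chi (1 - nu) * integral {s1..s2} w
    - (\<Sum>N\<in>{1..J}. sigma_bar_char (- nu) chi N * (of_nat N powr nu * (h (sqrt (real N)) * of_real (indicator {s1..s2} (sqrt (real N))) * (of_real (real N) powr (- nu / 2 - 1/2) / 2)))))) at_top"
   unfolding S_def phi_def
   by (intro tendsto_mult tendsto_diff tendsto_sum tendsto_const tendsto_of_real window_integral_tendsto[OF wc wv s] window_tendsto[OF s]) (use nz in auto)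
 qed
 thus ?thesis by (simp only: b_def c_def w_def)
qed

end

theorem theorem4p3:
  fixes \<alpha> \<beta> :: real and f :: "complex \<Rightarrow> complex" and q :: nat
    and chi :: "nat \<Rightarrow> complex" and \<nu> :: complex
  assumes "0 < \<alpha>" "\<alpha> < \<beta>" "\<alpha> \<notin> \<int>" "\<beta> \<notin> \<int>"
    and "f analytic_on (complex_of_real ` {\<alpha>..\<beta>})"
    and "primitive_dirichlet_char q chi" and "odd_char q chi"
    and "0 < Re \<nu>" and "Re \<nu> < 1 / 2"
  shows "\<exists>S. (\<lambda>n. sigma_char (-\<nu>) (\<lambda>m. cnj (chi m)) (Suc n)
                  * of_nat (Suc n) powr (\<nu> / 2)
                  * integral {\<alpha>..\<beta>} (\<lambda>t. f (of_real t) * of_real t powr (- \<nu> / 2 - 1)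
                      * ((2 / of_real pi * bessel_K \<nu> (4 * pi * sqrt (real (Suc n) * t / real q))
                           - bessel_Y \<nu> (4 * pi * sqrt (real (Suc n) * t / real q)))
                           * sin (of_real pi * \<nu> / 2)
                         + bessel_J \<nu> (4 * pi * sqrt (real (Suc n) * t / real q))
                           * cos (of_real pi * \<nu> / 2)))) sums S
      \<and> of_nat q powr (1 - \<nu> / 2) / gauss_sum q chi
          * (\<Sum>j \<in> {j::nat. \<alpha> < real j \<and> real j < \<beta>}.
               sigma_bar_char (-\<nu>) chi j / of_nat j * f (of_nat j))
        = of_nat q powr (1 - \<nu> / 2) / gauss_sum q chi * dirichlet_L chi (1 - \<nu>)
            * integral {\<alpha>..\<beta>} (\<lambda>t. f (of_real t) / of_real t powr (\<nu> + 1))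
          - 2 * of_real pi * \<i> * S"
proof -
  interpret odd_primitive_char q chi by unfold_locales (use assms in auto)
  have nu1: "Re \<nu> < 1" using assms by simp
  define s1 s2 where "s1 = sqrt \<alpha>" and "s2 = sqrt \<beta>"
  have s: "0 < s1" "s1 < s2" "s1\<^sup>2 = \<alpha>" "s2\<^sup>2 = \<beta>" using assms by (auto simp: s1_def s2_def)
  obtain U where U: "open U" "complex_of_real ` {\<alpha>..\<beta>} \<subseteq> U" "f holomorphic_on U"
    using assms(5) analytic_on_holomorphic by metis
  \<comment> \<open>Analyticity near the segment is pulled back along s -> s^2. Compactness then
    leaves a positive margin around [s1, s2], inside which a plateau function fits.\<close>
  define V where "V = (\<lambda>s. complex_of_real (s\<^sup>2)) -` U \<inter> {0<..}"
  have V: "open V" unfolding V_def by (intro open_Int open_vimage[OF U(1)] continuous_intros)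
  have sV: "{s1..s2} \<subseteq> V"
  proof
    fix x assume x: "x \<in> {s1..s2}"
    have "s1\<^sup>2 \<le> x\<^sup>2" "x\<^sup>2 \<le> s2\<^sup>2" using x s by (auto intro!: power_mono)
    hence "x\<^sup>2 \<in> {\<alpha>..\<beta>}" using s(3,4) by simp
    hence "complex_of_real (x\<^sup>2) \<in> U" using U(2) by blast
    thus "x \<in> V" using x s by (simp add: V_def)
  qed
  obtain e where e: "e > 0" "(\<Union>x\<in>{s1..s2}. ball x e) \<subseteq> V"
    using compact_subset_open_imp_ball_epsilon_subset[OF compact_Icc V sV] by blast
  define \<epsilon> where "\<epsilon> = e / 2"
  have \<epsilon>: "\<epsilon> > 0" using e by (simp add: \<epsilon>_def)
  have eV: "{s1 - \<epsilon>..s2 + \<epsilon>} \<subseteq> V"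
  proof
    fix x assume x: "x \<in> {s1 - \<epsilon>..s2 + \<epsilon>}"
    have "max s1 (min x s2) \<in> {s1..s2}" "x \<in> ball (max s1 (min x s2)) e"
      using x s e by (auto simp: dist_real_def max_def min_def \<epsilon>_def)
    thus "x \<in> V" using e(2) by blast
  qed
  \<comment> \<open>\<open>V\<close> lies in the positive half line, so the margin stays to the
    right of 0.\<close>
  have lo: "0 < s1 - \<epsilon>"
  proof -
    have "s1 - \<epsilon> \<in> V" using eV \<epsilon> s by auto
    thus ?thesis by (simp add: V_def)
  qed
  obtain \<eta> where \<eta>: "ck_on 7 UNIV \<eta>" "vanishes_off (s1 - \<epsilon>) (s2 + \<epsilon>) \<eta>" "\<And>x. x \<in> {s1..s2} \<Longrightarrow> \<eta> x = 1"
    using plateau_function_exists[OF s(2) \<epsilon>] by metis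
  \<comment> \<open>Under t = s^2 the measure t powr (- nu / 2 - 1) dt becomes 2 s powr (- nu - 1)
    ds.\<close>
  define g where "g = (\<lambda>s. 2 * of_real s powr (- \<nu> - 1) * f (of_real (s\<^sup>2)))"
  define h where "h = (\<lambda>s. \<eta> s * g s)"
  have gck: "ck_on 7 V g"
  proof -
    define W where "W = {z. z \<in> - \<real>\<^sub>\<le>\<^sub>0 \<and> z\<^sup>2 \<in> U}"
    have W: "open W"
    proof -
      have "W = - \<real>\<^sub>\<le>\<^sub>0 \<inter> (\<lambda>z. z\<^sup>2) -` U" by (auto simp: W_def)
      thus ?thesis using U(1) by (auto intro!: open_Int open_vimage continuous_intros simp: open_Compl closed_nonpos_Reals_complex)
    qed
    have "(\<lambda>z. f (z\<^sup>2)) holomorphic_on W"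
      by (rule holomorphic_on_compose_gen[of "\<lambda>z. z\<^sup>2" W f U, unfolded o_def]) (auto intro!: holomorphic_intros U simp: W_def)
    hence "(\<lambda>z. 2 * z powr (- \<nu> - 1) * f (z\<^sup>2)) holomorphic_on W" by (intro holomorphic_intros) (auto simp: W_def)
    moreover have "complex_of_real ` V \<subseteq> W" by (auto simp: W_def V_def complex_nonpos_Reals_iff)
    ultimately have "ck_on 7 V (\<lambda>x. 2 * complex_of_real x powr (- \<nu> - 1) * f ((complex_of_real x)\<^sup>2))"
      by (rule ck_on_holomorphic[OF W _ V])
    thus ?thesis unfolding g_def by (simp only: of_real_power)
  qed
  have hck: "ck_on 7 UNIV h"
  proof (rule ck_on_extend_zero[OF V])
    show "ck_on 7 V h" unfolding h_def by (rule ck_on_mult[OF V ck_on_subset[OF subset_UNIV \<eta>(1)] gck])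
    show "h x = 0" if "x \<notin> {s1 - \<epsilon>..s2 + \<epsilon>}" for x using that \<eta>(2) by (auto simp: h_def vanishes_off_def)
  qed (use eV in auto)
  have hv: "vanishes_off (s1 - \<epsilon>) (s2 + \<epsilon>) h" using \<eta>(2) by (simp add: h_def vanishes_off_def)
  have hc: "continuous_on A h" for A using continuous_on_subset[OF ck_on_continuous[OF open_UNIV hck]] by auto
  have hs: "h (sqrt t) = 2 * of_real t powr (- \<nu> / 2) * f (of_real t) / of_real (sqrt t)" if t: "t \<in> {\<alpha>..\<beta>}" for t
  proof -
    have "t > 0" using t assms by simp
    hence "complex_of_real (sqrt t) powr (- \<nu> - 1) = of_real t powr (- \<nu> / 2) / of_real (sqrt t)"
      by (simp add: powr_diff of_real_sqrt_powr)
    moreover have "sqrt t \<in> {s1..s2}" using t by (simp add: s1_def s2_def)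
    ultimately show ?thesis using \<eta>(3)[of "sqrt t"] \<open>t > 0\<close> by (simp add: h_def g_def del: of_real_power)
  qed
  have sub: "integral {\<alpha>..\<beta>} F = integral {s1..s2} k" if "continuous_on {s1..s2} k" "\<And>t. t \<in> {\<alpha>..\<beta>} \<Longrightarrow> F t = k (sqrt t) / of_real (2 * sqrt t)" for F k :: "real \<Rightarrow> complex"
  proof -
    have "integral {\<alpha>..\<beta>} F = integral {s1\<^sup>2..s2\<^sup>2} (\<lambda>t. k (sqrt t) / of_real (2 * sqrt t))"
      unfolding s by (rule Henstock_Kurzweil_Integration.integral_cong) (rule that)
    also have "\<dots> = integral {s1..s2} k" by (rule integral_unique[OF has_integral_sqrt_substitution[OF s(1) less_imp_le[OF s(2)] that(1)]])
    finally show ?thesis .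
  qed
  have kc: "continuous_on {s1..s2} (\<lambda>s. h s * bessel_G \<nu> (c * s))" if "c > 0" for c :: real
  proof -
    have "(\<lambda>s. c * s) ` {s1..s2} \<subseteq> {0<..}" using that s(1) by (intro image_subsetI) (simp add: zero_less_mult_iff)
    thus ?thesis by (intro continuous_on_mult hc continuous_on_compose2[OF continuous_on_bessel_G[OF assms(8) nu1]]) (auto intro!: continuous_intros)
  qed
  have int1: "integral {\<alpha>..\<beta>} (\<lambda>t. f (of_real t) * of_real t powr (- \<nu> / 2 - 1) * bessel_G \<nu> (4 * pi * sqrt (real (Suc n) * t / real q)))
      = integral {s1..s2} (\<lambda>s. h s * bessel_G \<nu> (4 * pi / sqrt (real q) * sqrt (real (Suc n)) * s))" for n
  proof (rule sub[OF kc])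
    show "4 * pi / sqrt (real q) * sqrt (real (Suc n)) > 0" using q_pos by simp
    fix t assume t: "t \<in> {\<alpha>..\<beta>}"
    have tp: "t > 0" using t assms by simp
    have 1: "4 * pi * sqrt (real (Suc n) * t / real q) = 4 * pi / sqrt (real q) * sqrt (real (Suc n)) * sqrt t"
      by (simp add: real_sqrt_mult real_sqrt_divide)
    have "complex_of_real t = of_real (sqrt t) * of_real (sqrt t)" using tp by (simp flip: of_real_mult)
    hence 2: "of_real t powr (- \<nu> / 2 - 1) = of_real t powr (- \<nu> / 2) / (complex_of_real (sqrt t) * of_real (sqrt t))"
      using tp by (simp add: powr_diff)
    show "f (of_real t) * of_real t powr (- \<nu> / 2 - 1) * bessel_G \<nu> (4 * pi * sqrt (real (Suc n) * t / real q))
       = h (sqrt t) * bessel_G \<nu> (4 * pi / sqrt (real q) * sqrt (real (Suc n)) * sqrt t) / of_real (2 * sqrt t)"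
      unfolding 1 2 hs[OF t] using tp by (simp add: field_simps)
  qed
  have int2: "integral {\<alpha>..\<beta>} (\<lambda>t. f (of_real t) / of_real t powr (\<nu> + 1)) = integral {s1..s2} (\<lambda>s. h s * of_real s powr (- \<nu>))"
  proof (rule sub)
    show "continuous_on {s1..s2} (\<lambda>s. h s * of_real s powr (- \<nu>))"
      by (intro continuous_intros hc continuous_on_powr_complex) (use s in auto)
    fix t assume t: "t \<in> {\<alpha>..\<beta>}"
    have tp: "t > 0" using t assms by simp
    have 1: "complex_of_real t = of_real (sqrt t) * of_real (sqrt t)" using tp by (simp flip: of_real_mult)
    have 2: "of_real t powr (\<nu> + 1) = of_real t powr \<nu> * (complex_of_real (sqrt t) * of_real (sqrt t))"
      using 1 tp by (simp add: powr_add)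
    have 3: "of_real t powr (- \<nu> / 2) * of_real t powr (- \<nu> / 2) * of_real t powr \<nu> = (1 :: complex)" using tp by (simp add: powr_add[symmetric])
    have "f (of_real t) / of_real t powr (\<nu> + 1) = (of_real t powr (- \<nu> / 2) * of_real t powr (- \<nu> / 2) * of_real t powr \<nu>) * f (of_real t) / of_real t powr (\<nu> + 1)"
      unfolding 3 by simp
    also have "\<dots> = h (sqrt t) * of_real (sqrt t) powr (- \<nu>) / of_real (2 * sqrt t)"
      unfolding 2 hs[OF t] of_real_sqrt_powr[OF tp] using tp by (simp add: field_simps)
    finally show "f (of_real t) / of_real t powr (\<nu> + 1) = h (sqrt t) * of_real (sqrt t) powr (- \<nu>) / of_real (2 * sqrt t)" .
  qed
  obtain J :: nat where J: "(s2 + \<epsilon>)\<^sup>2 \<le> real J" using real_arch_simple by blast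
  have nz: "sqrt (real N) \<noteq> s1 \<and> sqrt (real N) \<noteq> s2" for N :: nat
    using assms(3,4) by (auto simp: s1_def s2_def)
  define A where "A = {j::nat. \<alpha> < real j \<and> real j < \<beta>}"
  have AJ: "A \<subseteq> {1..J}"
  proof
    fix j assume "j \<in> A"
    hence j: "\<alpha> < real j" "real j < s2\<^sup>2" using s by (auto simp: A_def)
    have "s2\<^sup>2 \<le> (s2 + \<epsilon>)\<^sup>2" using s \<epsilon> by (intro power_mono) auto
    hence "real j < real J" using j J by linarith
    moreover have "real j > 0" using j assms by linarith
    ultimately show "j \<in> {1..J}" by auto
  qed
  define b where "b = (\<lambda>N. sigma_bar_char (- \<nu>) chi N * (of_nat N powr \<nu> * (h (sqrt (real N)) * of_real (indicator {s1..s2} (sqrt (real N))) * (of_real (real N) powr (- \<nu> / 2 - 1/2) / 2))))"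
  \<comment> \<open>Since the endpoints are not integers, the closed interval of the indicator and
    the open range of the sum contain the same integers.\<close>
  have b0: "b N = 0" if "N \<notin> A" for N
  proof -
    have "\<not> (\<alpha> \<le> real N \<and> real N \<le> \<beta>)" using that nz[of N] by (auto simp: A_def s1_def s2_def less_le)
    hence "sqrt (real N) \<notin> {s1..s2}" by (auto simp: s1_def s2_def)
    thus ?thesis by (simp add: b_def)
  qed
  have bA: "b N = sigma_bar_char (- \<nu>) chi N / of_nat N * f (of_nat N)" if "N \<in> A" for N
  proof -
    have N: "real N \<in> {\<alpha>..\<beta>}" "real N > 0" using that assms by (auto simp: A_def)
    define n where "n = complex_of_real (real N)"
    define r where "r = complex_of_real (sqrt (real N))"
    have r: "r \<noteq> 0" using N by (simp add: r_def)
    have n: "n = r * r" using N by (simp add: n_def r_def flip: of_real_mult)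
    have i: "indicator {s1..s2} (sqrt (real N)) = (1::real)" using N by (auto simp: s1_def s2_def indicator_def)
    \<comment> \<open>The power N powr nu cancels against the two powers N powr (- nu / 2), one from
      \<open>h\<close> and one from the test function. What survives of the rest is 1 / N from two
      square roots, while the 2 in \<open>g\<close> cancels the 1/2 of the Jacobian.\<close>
    have p: "n powr \<nu> * n powr (- \<nu> / 2) * n powr (- \<nu> / 2) = 1" using N by (simp add: n_def powr_add[symmetric])
    have "b N = sigma_bar_char (- \<nu>) chi N * (n powr \<nu> * (2 * n powr (- \<nu> / 2) * f n / r * 1 * (n powr (- \<nu> / 2) / r / 2)))"
      unfolding b_def hs[OF N(1)] i of_real_powr_minus_half[OF N(2)] n_def r_def by simp
    also have "\<dots> = sigma_bar_char (- \<nu>) chi N * (n powr \<nu> * n powr (- \<nu> / 2) * n powr (- \<nu> / 2)) * f n / n"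
      unfolding n using r by (simp add: field_simps)
    also have "\<dots> = sigma_bar_char (- \<nu>) chi N / n * f n" unfolding p by simp
    finally show ?thesis by (simp add: n_def)
  qed
  have bsum: "(\<Sum>N\<in>{1..J}. b N) = (\<Sum>j\<in>A. sigma_bar_char (- \<nu>) chi j / of_nat j * f (of_nat j))"
  proof -
    have "(\<Sum>N\<in>{1..J}. b N) = (\<Sum>N\<in>A. b N)" by (rule sum.mono_neutral_right[OF _ AJ]) (use b0 in auto)
    thus ?thesis using bA by simp
  qed
  define I where "I = integral {\<alpha>..\<beta>} (\<lambda>t. f (of_real t) / of_real t powr (\<nu> + 1))"
  define S where "S = of_nat q / (4 * \<i> * gauss_sum q chi) / (of_real pi / 2 * of_nat q powr (\<nu> / 2)) * (dirichlet_L chi (1 - \<nu>) * I - (\<Sum>N\<in>{1..J}. b N))"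
  have "s1 - \<epsilon> \<le> s2 + \<epsilon>" using s \<epsilon> by simp
  from windowed_voronoi[OF hck hv lo this s(2) assms(8,9) J nz]
  have sums: "(\<lambda>n. sigma_char (-\<nu>) (\<lambda>m. cnj (chi m)) (Suc n) * of_nat (Suc n) powr (\<nu> / 2)
       * integral {\<alpha>..\<beta>} (\<lambda>t. f (of_real t) * of_real t powr (- \<nu> / 2 - 1) * bessel_G \<nu> (4 * pi * sqrt (real (Suc n) * t / real q)))) sums S"
    unfolding S_def I_def int1 int2 b_def .
  \<comment> \<open>The constants agree because 2 pi i times q / (4 i tau) times 2 / (pi q powr (nu
    / 2)), with tau the Gauss sum, equals q powr (1 - nu / 2) / tau.\<close>
  have "of_nat q powr (1 - \<nu> / 2) / gauss_sum q chi * (\<Sum>N\<in>{1..J}. b N)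
      = of_nat q powr (1 - \<nu> / 2) / gauss_sum q chi * dirichlet_L chi (1 - \<nu>) * I - 2 * of_real pi * \<i> * S"
  proof -
    define Q where "Q = complex_of_nat q powr (\<nu> / 2)"
    have Q: "Q \<noteq> 0" "gauss_sum q chi \<noteq> 0" using q_pos gauss_sum_nonzero by (auto simp: Q_def)
    have P: "complex_of_nat q powr (1 - \<nu> / 2) = of_nat q / Q" using q_pos by (simp add: powr_diff Q_def)
    show ?thesis unfolding S_def Q_def[symmetric] P using Q by (simp add: field_simps)
  qed
  with sums show ?thesis unfolding bsum I_def A_def bessel_G_def by blast
qed

end
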